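(* Let $(\bar N,g_{FS})$ be a quaternionic Kähler manifold in the image of the q-map, defined by a homogeneous cubic polynomial $h$ in $n$ variables. The symmetric quartic tensor field $\Omega=(\Omega_{\Gamma\Delta\Lambda\Xi})$ of $\bar N$, in the frame indexed by $\Gamma\in\{0,\ldots,n,\tilde 0,\ldots,\tilde n\}$, has the following non-vanishing components, where $a,b,c,d=1,\ldots,n$: $$\Omega_{00\tilde0\tilde0}=\tfrac12,\qquad \Omega_{0b\tilde0\tilde d}=\tfrac14\delta_{bd},\qquad \Omega_{ab\tilde c\tilde d}=\tfrac14(\delta_{ac}\delta_{bd}+\delta_{ad}\delta_{bc})-\tfrac12e^{2\mathcal{K}}\sum_{f=1}^n\tilde h_{abf}\tilde h_{fcd},$$ $$\Omega_{\tilde0bcd}=\Omega_{0\tilde b\tilde c\tilde d}=-\tfrac i2e^{\mathcal{K}}\tilde h_{bcd},\qquad \Omega_{abcd}=\Omega_{\tilde a\tilde b\tilde c\tilde d}=S_{abcd},$$ together with the components obtained from these by permuting the four indices (all remaining components vanish).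
   Context: Products of one-forms: $\alpha\beta=\frac12(\alpha\otimes\beta+\beta\otimes\alpha)$; $(\alpha\wedge\beta)(X,Y)=\alpha(X)\beta(Y)-\alpha(Y)\beta(X)$. r-map data: $\mathcal{H}\subset\mathbb{R}^n$ is a projective special real manifold, i.e. a hypersurface contained in $\{h=1\}$ for a homogeneous cubic polynomial $h$ with $-\partial^2h|_{T\mathcal{H}\times T\mathcal{H}}>0$; $U=\mathbb{R}^{>0}\cdot\mathcal{H}$; $\bar M=\mathbb{R}^n+iU$ with holomorphic coordinates $X^\mu=y^\mu+ix^\mu$, $x\in U$; $\mathcal{K}=-\log8h(x)$, $\mathcal{K}_{\mu\bar\nu}=\partial^2\mathcal{K}/\partial X^\mu\partial\bar X^\nu$, $g_{\bar M}=\sum\mathcal{K}_{\mu\bar\nu}dX^\mu d\bar X^\nu$. Let $(e^a_\mu)$ be a (local) real $n\times n$ matrix-valued function with $\sum_ae^a_\mu e^a_\nu=\mathcal{K}_{\mu\bar\nu}$, $(e^\mu_a)$ its inverse, $\sigma^a=\sum_\mu e^a_\mu dX^\mu$. With $h_\mu,h_{\mu\nu},h_{\mu\nu\sigma}$ the partial derivatives of $h$ at $x=\mathrm{Im}X$, put $\tilde h_a=\sum e^\mu_ah_\mu$, $\tilde h_{ab}=\sum e^\mu_ae^\nu_bh_{\mu\nu}$, $\tilde h_{abc}=\sum e^\mu_ae^\nu_be^\sigma_ch_{\mu\nu\sigma}$, and (summing over $f=1,\ldots,n$) $$S_{abcd}=-\tfrac12e^{2\mathcal{K}}\big((\tilde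 h_{bcf}\tilde h_{fad}-4\tilde h_{bc}\tilde h_{ad})+(\tilde h_{acf}\tilde h_{fbd}-4\tilde h_{ac}\tilde h_{bd})+(\tilde h_{abf}\tilde h_{fcd}-4\tilde h_{ab}\tilde h_{cd})+4\tilde h_a\tilde h_{bcd}+4\tilde h_b\tilde h_{cda}+4\tilde h_c\tilde h_{dab}+4\tilde h_d\tilde h_{abc}\big).$$ c-map data: $F(z^0,\ldots,z^n)=h(z^1,\ldots,z^n)/z^0$, $F_{IJ}=\partial^2F/\partial z^I\partial z^J$, $N_{IJ}=2\,\mathrm{Im}F_{IJ}$, $(N^{IJ})=(N_{IJ})^{-1}$, evaluated at $X=(X^0,\ldots,X^n)$ with $X^0=1$. $\bar N=\bar M\times\mathbb{R}^{>0}\times\mathbb{R}^{2n+3}$ with coordinates $(\rho,\tilde\phi,\tilde\zeta_I,\zeta^I)_{I=0,\ldots,n}$ on the last factors. Put $A_I=d\tilde\zeta_I+\sum_JF_{IJ}(X)d\zeta^J$, $P^a_0=-\sum_\nu e^a_\nu X^\nu$, $P^a_\mu=e^a_\mu$, and $$\beta^0=ie^{\mathcal{K}/2}\tfrac{1}{\sqrt\rho}\sum_IX^IA_I,\quad\beta^a=\sigma^a,\quad \alpha^0=-\tfrac{1}{2\rho}\big(d\rho-i(d\tilde\phi+\sum_I(\zeta^Id\tilde\zeta_I-\tilde\zeta_Id\zeta^I))\big),\quad\alpha^a=\tfrac{i}{\sqrt\rho}e^{-\mathcal{K}/2}\sum_{I,J}\overline{P}^a_IN^{IJ}A_J.$$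 The q-map (Ferrara–Sabharwal) metric on $\bar N$ is $g_{FS}=\sum_{A=0}^n(\beta^A\bar\beta^A+\alpha^A\bar\alpha^A)$. Frame: indices $\Gamma\in\{1,\ldots,2n+2\}$ are written as $A$ or $\tilde A$ with $A=0,\ldots,n$. The coframe $(f^{\alpha\Gamma})_{\alpha=1,2}$ is $f^{1A}=\beta^A$, $f^{1\tilde A}=\alpha^A$, $f^{2A}=-\bar\alpha^A$, $f^{2\tilde A}=\bar\beta^A$, and $(f_{\alpha\Gamma})$ is the dual frame of $T^{\mathbb{C}}\bar N$. The Riemann curvature tensor $R(X,Y)=[\nabla_X,\nabla_Y]-\nabla_{[X,Y]}$ of $g_{FS}$ has the form $f^{\alpha\Gamma}(R(X,Y)f_{\beta\Delta})=\tilde R_H{}^\alpha{}_\beta(X,Y)\delta^\Gamma_\Delta+\delta^\alpha_\beta\tilde R_E{}^\Gamma{}_\Delta(X,Y)$ with $\tilde R_H$ taking values in $\mathfrak{sp}(1)$ and $\tilde R_E$ in $\mathfrak{sp}(n+1)$. Let $\epsilon_{12}=-\epsilon_{21}=1$, $\epsilon_{11}=\epsilon_{22}=0$; $C_{A\tilde B}=-C_{\tilde AB}=\delta_{AB}$, $C_{AB}=C_{\tilde A\tilde B}=0$; $C^{\Gamma\Delta}=-C_{\Gamma\Delta}$. The reduced scalar curvature is $\nu=\frac{scal}{4(n+1)(n+3)}=-2$. The functions $\Omega_{\Gamma\Delta\Lambda\Xi}$, symmetric in all four indices, are defined by $$\tilde R_E{}^\Lambda{}_\Xi=\sum_{\alpha,\beta,\Delta}\tfrac\nu4\epsilon_{\alpha\beta}C_{\Xi\Delta}f^{\alpha\Lambda}\wedge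 f^{\beta\Delta}+\sum_{\alpha,\beta}\sum_{\Lambda',\Gamma,\Delta}C^{\Lambda\Lambda'}\Omega_{\Lambda'\Xi\Gamma\Delta}\,\epsilon_{\alpha\beta}f^{\alpha\Gamma}\wedge f^{\beta\Delta}.$$ *)

theory Defs
  imports "HOL-Analysis.Analysis" "HOL-Library.Multiset"
begin

text \<open>Only used on open sets, where the Frechet derivative is unique.\<close>

primrec Ck_on ::
    "nat \<Rightarrow> 'a::real_normed_vector set \<Rightarrow> ('a \<Rightarrow> 'b::real_normed_vector) \<Rightarrow> bool" where
  "Ck_on 0 S f \<longleftrightarrow> continuous_on S f"
| "Ck_on (Suc k) S f \<longleftrightarrow>
     f differentiable_on S \<and> (\<forall>v. Ck_on k S (\<lambda>x. frechet_derivative f (at x) v))"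

definition smooth_on :: "'a::real_normed_vector set \<Rightarrow> ('a \<Rightarrow> 'b::real_normed_vector) \<Rightarrow> bool" where
  "smooth_on S f \<longleftrightarrow> (\<forall>k. Ck_on k S f)"

definition hypersurface :: "'a::euclidean_space set \<Rightarrow> bool" where
  "hypersurface H \<longleftrightarrow>
     (\<forall>p\<in>H. \<exists>W (f :: 'a \<Rightarrow> real).
        open W \<and> p \<in> W \<and> smooth_on W f \<and>
        (\<forall>x\<in>W. frechet_derivative f (at x) \<noteq> (\<lambda>v. 0)) \<and> H \<inter> W = {x \<in> W. f x = 0})"

definition tangent_space :: "'a::euclidean_space set \<Rightarrow> 'a \<Rightarrow> 'a set" where
  "tangent_space H p =
     {v. \<exists>\<gamma> \<delta>. \<delta> > 0 \<and> smooth_on {-\<delta><..<\<delta>} \<gamma> \<and> \<gamma> ` {-\<delta><..<\<delta>} \<subseteq> H \<and> \<gamma> (0::real) = p \<and>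
        (\<gamma> has_vector_derivative v) (at 0)}"

text \<open>Vector fields on an open subset of \<open>'a\<close> are maps \<open>'a \<Rightarrow> 'a\<close>. The field \<open>christoffel g p\<close>
  is the bilinear map \<open>(u, v) \<mapsto> \<Gamma>\<^sub>p(u, v)\<close>, i.e. the first-kind Christoffel symbols with the last
  index raised by the metric.\<close>

definition christoffel ::
    "('a::euclidean_space \<Rightarrow> 'a \<Rightarrow> 'a \<Rightarrow> real) \<Rightarrow> 'a \<Rightarrow> 'a \<Rightarrow> 'a \<Rightarrow> 'a" where
  "christoffel g p u v = (THE w. \<forall>z. g p w z =
      (frechet_derivative (\<lambda>q. g q v z) (at p) u
       + frechet_derivative (\<lambda>q. g q u z) (at p) v
       - frechet_derivative (\<lambda>q. g q u v) (at p) z) / 2)"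

definition levi_civita ::
    "('a::euclidean_space \<Rightarrow> 'a \<Rightarrow> 'a \<Rightarrow> real) \<Rightarrow> ('a \<Rightarrow> 'a) \<Rightarrow> ('a \<Rightarrow> 'a) \<Rightarrow> 'a \<Rightarrow> 'a" where
  "levi_civita g X Y p = frechet_derivative Y (at p) (X p) + christoffel g p (X p) (Y p)"

definition lie_bracket :: "('a::euclidean_space \<Rightarrow> 'a) \<Rightarrow> ('a \<Rightarrow> 'a) \<Rightarrow> 'a \<Rightarrow> 'a" where
  "lie_bracket X Y p = frechet_derivative Y (at p) (X p) - frechet_derivative X (at p) (Y p)"

definition riemann ::
    "('a::euclidean_space \<Rightarrow> 'a \<Rightarrow> 'a \<Rightarrow> real) \<Rightarrow> ('a \<Rightarrow> 'a) \<Rightarrow> ('a \<Rightarrow> 'a) \<Rightarrow> ('a \<Rightarrow> 'a) \<Rightarrow> 'a \<Rightarrow> 'a" where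
  "riemann g X Y Z p =
     levi_civita g X (levi_civita g Y Z) p - levi_civita g Y (levi_civita g X Z) p
     - levi_civita g (lie_bracket X Y) Z p"

text \<open>The curvature is tensorial, so its value on tangent vectors at \<open>p\<close> may be computed with
  their constant extensions.\<close>

definition curvature_at ::
    "('a::euclidean_space \<Rightarrow> 'a \<Rightarrow> 'a \<Rightarrow> real) \<Rightarrow> 'a \<Rightarrow> 'a \<Rightarrow> 'a \<Rightarrow> 'a \<Rightarrow> 'a" where
  "curvature_at g p u v w = riemann g (\<lambda>_. u) (\<lambda>_. v) (\<lambda>_. w) p"

definition sym_prod :: "('a \<Rightarrow> complex) \<Rightarrow> ('a \<Rightarrow> complex) \<Rightarrow> 'a \<Rightarrow> 'a \<Rightarrow> complex" where
  "sym_prod \<phi> \<psi> u v = (\<phi> u * \<psi> v + \<psi> u * \<phi> v) / 2"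

definition wedge :: "('a \<Rightarrow> complex) \<Rightarrow> ('a \<Rightarrow> complex) \<Rightarrow> 'a \<Rightarrow> 'a \<Rightarrow> complex" where
  "wedge \<phi> \<psi> u v = \<phi> u * \<psi> v - \<phi> v * \<psi> u"

text \<open>The complexified tangent space is \<open>'a \<times> 'a\<close>, where \<open>(u, v)\<close> stands for \<open>u + \<i>v\<close>.
  One-forms and endomorphisms are extended complex linearly.\<close>

definition cx_form :: "('a \<Rightarrow> complex) \<Rightarrow> 'a \<times> 'a \<Rightarrow> complex" where
  "cx_form \<phi> w = \<phi> (fst w) + \<i> * \<phi> (snd w)"

definition cx_endo :: "('a \<Rightarrow> 'a) \<Rightarrow> 'a \<times> 'a \<Rightarrow> 'a \<times> 'a" where
  "cx_endo L w = (L (fst w), L (snd w))"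

text \<open>A homogeneous cubic polynomial is given by real coefficients, so that it can be evaluated at
  real and at complex vectors. The coefficients need not be symmetric.\<close>

definition cubic :: "('n::finite \<Rightarrow> 'n \<Rightarrow> 'n \<Rightarrow> real) \<Rightarrow> 'k::real_normed_field ^ 'n \<Rightarrow> 'k" where
  "cubic c x = (\<Sum>i\<in>UNIV. \<Sum>j\<in>UNIV. \<Sum>k\<in>UNIV. of_real (c i j k) * x $ i * x $ j * x $ k)"

definition partial ::
    "'i::finite \<Rightarrow> ('k::real_normed_field ^ 'i \<Rightarrow> 'k) \<Rightarrow> 'k ^ 'i \<Rightarrow> 'k" where
  "partial i f x = deriv (\<lambda>t. f (x + axis i t)) 0"

definition projective_special_real ::
    "('n::finite \<Rightarrow> 'n \<Rightarrow> 'n \<Rightarrow> real) \<Rightarrow> (real ^ 'n) set \<Rightarrow> bool" where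
  "projective_special_real c H \<longleftrightarrow>
     hypersurface H \<and> H \<subseteq> {x. cubic c x = 1} \<and>
     (\<forall>x\<in>H. \<forall>v\<in>tangent_space H x. v \<noteq> 0 \<longrightarrow>
        - (\<Sum>\<mu>\<in>UNIV. \<Sum>\<nu>\<in>UNIV. partial \<mu> (partial \<nu> (cubic c)) x * v $ \<mu> * v $ \<nu>) > 0)"

definition cone :: "(real ^ 'n::finite) set \<Rightarrow> (real ^ 'n) set" where
  "cone H = {r *\<^sub>R x | r x. r > 0 \<and> x \<in> H}"

definition im_vec :: "complex ^ 'n::finite \<Rightarrow> real ^ 'n" where
  "im_vec X = (\<chi> \<mu>. Im (X $ \<mu>))"

definition rmap_domain :: "(real ^ 'n::finite) set \<Rightarrow> (complex ^ 'n) set" where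
  "rmap_domain H = {X. im_vec X \<in> cone H}"

definition kahler_pot :: "('n::finite \<Rightarrow> 'n \<Rightarrow> 'n \<Rightarrow> real) \<Rightarrow> complex ^ 'n \<Rightarrow> real" where
  "kahler_pot c X = - ln (8 * cubic c (im_vec X))"

text \<open>Wirtinger derivatives for \<open>X\<^sup>\<mu> = y\<^sup>\<mu> + \<i>x\<^sup>\<mu>\<close>: \<open>axis \<mu> 1\<close> is the \<open>y\<^sup>\<mu>\<close>-direction and
  \<open>axis \<mu> \<i>\<close> the \<open>x\<^sup>\<mu>\<close>-direction.\<close>

definition wirtinger :: "'n::finite \<Rightarrow> (complex ^ 'n \<Rightarrow> complex) \<Rightarrow> complex ^ 'n \<Rightarrow> complex" where
  "wirtinger \<mu> f X =
     (frechet_derivative f (at X) (axis \<mu> 1) - \<i> * frechet_derivative f (at X) (axis \<mu> \<i>)) / 2"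

definition wirtinger_bar :: "'n::finite \<Rightarrow> (complex ^ 'n \<Rightarrow> complex) \<Rightarrow> complex ^ 'n \<Rightarrow> complex" where
  "wirtinger_bar \<mu> f X =
     (frechet_derivative f (at X) (axis \<mu> 1) + \<i> * frechet_derivative f (at X) (axis \<mu> \<i>)) / 2"

definition kahler_metric ::
    "('n::finite \<Rightarrow> 'n \<Rightarrow> 'n \<Rightarrow> real) \<Rightarrow> 'n \<Rightarrow> 'n \<Rightarrow> complex ^ 'n \<Rightarrow> complex" where
  "kahler_metric c \<mu> \<nu> = wirtinger \<mu> (wirtinger_bar \<nu> (\<lambda>X. of_real (kahler_pot c X)))"

text \<open>Here \<open>e X $ a $ \<mu>\<close> is \<open>e\<^sup>a\<^sub>\<mu>\<close>, so \<open>matrix_inv (e X) $ \<mu> $ a\<close> is \<open>e\<^sup>\<mu>\<^sub>a\<close>.\<close>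

definition local_frame ::
    "('n::finite \<Rightarrow> 'n \<Rightarrow> 'n \<Rightarrow> real) \<Rightarrow> (real ^ 'n) set \<Rightarrow> (complex ^ 'n) set \<Rightarrow>
     (complex ^ 'n \<Rightarrow> real ^ 'n ^ 'n) \<Rightarrow> bool" where
  "local_frame c H V e \<longleftrightarrow>
     open V \<and> V \<subseteq> rmap_domain H \<and> smooth_on V e \<and>
     (\<forall>X\<in>V. invertible (e X) \<and>
        (\<forall>\<mu> \<nu>. of_real (\<Sum>a\<in>UNIV. e X $ a $ \<mu> * e X $ a $ \<nu>) = kahler_metric c \<mu> \<nu> X))"

context
  fixes c :: "'n::finite \<Rightarrow> 'n \<Rightarrow> 'n \<Rightarrow> real" and e :: "complex ^ 'n \<Rightarrow> real ^ 'n ^ 'n"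
begin

definition h1 :: "complex ^ 'n \<Rightarrow> 'n \<Rightarrow> real" where
  "h1 X a = (\<Sum>\<mu>\<in>UNIV. matrix_inv (e X) $ \<mu> $ a * partial \<mu> (cubic c) (im_vec X))"

definition h2 :: "complex ^ 'n \<Rightarrow> 'n \<Rightarrow> 'n \<Rightarrow> real" where
  "h2 X a b = (\<Sum>\<mu>\<in>UNIV. \<Sum>\<nu>\<in>UNIV. matrix_inv (e X) $ \<mu> $ a * matrix_inv (e X) $ \<nu> $ b *
     partial \<mu> (partial \<nu> (cubic c)) (im_vec X))"

definition h3 :: "complex ^ 'n \<Rightarrow> 'n \<Rightarrow> 'n \<Rightarrow> 'n \<Rightarrow> real" where
  "h3 X a b d = (\<Sum>\<mu>\<in>UNIV. \<Sum>\<nu>\<in>UNIV. \<Sum>\<sigma>\<in>UNIV.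
     matrix_inv (e X) $ \<mu> $ a * matrix_inv (e X) $ \<nu> $ b * matrix_inv (e X) $ \<sigma> $ d *
     partial \<mu> (partial \<nu> (partial \<sigma> (cubic c))) (im_vec X))"

definition S_tensor :: "complex ^ 'n \<Rightarrow> 'n \<Rightarrow> 'n \<Rightarrow> 'n \<Rightarrow> 'n \<Rightarrow> real" where
  "S_tensor X a b k d = - (1/2) * exp (2 * kahler_pot c X) *
     (((\<Sum>f\<in>UNIV. h3 X b k f * h3 X f a d) - 4 * h2 X b k * h2 X a d)
      + ((\<Sum>f\<in>UNIV. h3 X a k f * h3 X f b d) - 4 * h2 X a k * h2 X b d)
      + ((\<Sum>f\<in>UNIV. h3 X a b f * h3 X f k d) - 4 * h2 X a b * h2 X k d)
      + 4 * h1 X a * h3 X b k d + 4 * h1 X b * h3 X k d a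
      + 4 * h1 X k * h3 X d a b + 4 * h1 X d * h3 X a b k)"

end

text \<open>The index set \<open>{0,\<dots>,n}\<close> is \<open>'n option\<close> with \<open>None\<close> as \<open>0\<close>. Points are tuples
  \<open>(X, \<rho>, \<phi>~, \<zeta>~, \<zeta>)\<close>. The coordinate functions are linear, so their differentials are
  the same functions applied to tangent vectors.\<close>

type_synonym 'n qpoint =
  "(complex ^ 'n) \<times> real \<times> real \<times> (real ^ 'n option) \<times> (real ^ 'n option)"

definition base :: "'n::finite qpoint \<Rightarrow> complex ^ 'n" where
  "base p = fst p"

definition rho :: "'n::finite qpoint \<Rightarrow> real" where
  "rho p = fst (snd p)"

definition phit :: "'n::finite qpoint \<Rightarrow> real" where
  "phit p = fst (snd (snd p))"

definition zetat :: "'n::finite qpoint \<Rightarrow> 'n option \<Rightarrow> real" where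
  "zetat p I = fst (snd (snd (snd p))) $ I"

definition zeta :: "'n::finite qpoint \<Rightarrow> 'n option \<Rightarrow> real" where
  "zeta p I = snd (snd (snd (snd p))) $ I"

definition qmap_domain :: "(real ^ 'n::finite) set \<Rightarrow> 'n qpoint set" where
  "qmap_domain H = {p. base p \<in> rmap_domain H \<and> rho p > 0}"

definition hom_coords :: "complex ^ 'n::finite \<Rightarrow> complex ^ 'n option" where
  "hom_coords X = (\<chi> I. case I of None \<Rightarrow> 1 | Some \<mu> \<Rightarrow> X $ \<mu>)"

context
  fixes c :: "'n::finite \<Rightarrow> 'n \<Rightarrow> 'n \<Rightarrow> real"
begin

definition prepotential :: "complex ^ 'n option \<Rightarrow> complex" where
  "prepotential z = cubic c (\<chi> \<mu>. z $ Some \<mu>) / z $ None"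

definition F_mat :: "complex ^ 'n \<Rightarrow> 'n option \<Rightarrow> 'n option \<Rightarrow> complex" where
  "F_mat X I J = partial I (partial J prepotential) (hom_coords X)"

definition N_mat :: "complex ^ 'n \<Rightarrow> real ^ 'n option ^ 'n option" where
  "N_mat X = (\<chi> I J. 2 * Im (F_mat X I J))"

definition A_form :: "'n qpoint \<Rightarrow> 'n option \<Rightarrow> 'n qpoint \<Rightarrow> complex" where
  "A_form p I v = of_real (zetat v I) + (\<Sum>J\<in>UNIV. F_mat (base p) I J * of_real (zeta v J))"

end

context
  fixes c :: "'n::finite \<Rightarrow> 'n \<Rightarrow> 'n \<Rightarrow> real" and e :: "complex ^ 'n \<Rightarrow> real ^ 'n ^ 'n"
begin

definition P_mat :: "complex ^ 'n \<Rightarrow> 'n \<Rightarrow> 'n option \<Rightarrow> complex" where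
  "P_mat X a I = (case I of
      None \<Rightarrow> - (\<Sum>\<nu>\<in>UNIV. of_real (e X $ a $ \<nu>) * X $ \<nu>)
    | Some \<mu> \<Rightarrow> of_real (e X $ a $ \<mu>))"

definition beta :: "'n qpoint \<Rightarrow> 'n option \<Rightarrow> 'n qpoint \<Rightarrow> complex" where
  "beta p A v = (case A of
      None \<Rightarrow> \<i> * of_real (exp (kahler_pot c (base p) / 2) / sqrt (rho p)) *
        (\<Sum>I\<in>UNIV. hom_coords (base p) $ I * A_form c p I v)
    | Some a \<Rightarrow> (\<Sum>\<mu>\<in>UNIV. of_real (e (base p) $ a $ \<mu>) * base v $ \<mu>))"

definition alpha :: "'n qpoint \<Rightarrow> 'n option \<Rightarrow> 'n qpoint \<Rightarrow> complex" where
  "alpha p A v = (case A of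
      None \<Rightarrow> - of_real (1 / (2 * rho p)) * (of_real (rho v) - \<i> * of_real (phit v +
        (\<Sum>I\<in>UNIV. zeta p I * zetat v I - zetat p I * zeta v I)))
    | Some a \<Rightarrow> \<i> * of_real (1 / sqrt (rho p) * exp (- kahler_pot c (base p) / 2)) *
        (\<Sum>I\<in>UNIV. \<Sum>J\<in>UNIV. cnj (P_mat (base p) a I) *
          of_real (matrix_inv (N_mat c (base p)) $ I $ J) * A_form c p J v))"

text \<open>The sum is real valued, since \<open>\<beta>\<beta>\<^sup>*\<close> is real for any complex one-form \<open>\<beta>\<close>.\<close>

definition g_FS :: "'n qpoint \<Rightarrow> 'n qpoint \<Rightarrow> 'n qpoint \<Rightarrow> real" where
  "g_FS p u v = Re (\<Sum>A\<in>UNIV. sym_prod (beta p A) (\<lambda>w. cnj (beta p A w)) u v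
                        + sym_prod (alpha p A) (\<lambda>w. cnj (alpha p A w)) u v)"

end

text \<open>\<open>Inl A\<close> stands for the index \<open>A\<close> and \<open>Inr A\<close> for the index \<open>A\<close> with a tilde. The indices
  \<open>1\<close> and \<open>2\<close> of the other factor are the two elements of the type \<open>2\<close>.\<close>

type_synonym 'n fidx = "'n option + 'n option"

abbreviation un0 :: "'n fidx" where "un0 \<equiv> Inl None"
abbreviation un :: "'n \<Rightarrow> 'n fidx" where "un a \<equiv> Inl (Some a)"
abbreviation ti0 :: "'n fidx" where "ti0 \<equiv> Inr None"
abbreviation ti :: "'n \<Rightarrow> 'n fidx" where "ti a \<equiv> Inr (Some a)"

definition eps :: "2 \<Rightarrow> 2 \<Rightarrow> complex" where
  "eps \<alpha> \<beta> = (if \<alpha> = 1 \<and> \<beta> = 2 then 1 else if \<alpha> = 2 \<and> \<beta> = 1 then -1 else 0)"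

fun C_low :: "'n fidx \<Rightarrow> 'n fidx \<Rightarrow> complex" where
  "C_low (Inl A) (Inr B) = of_bool (A = B)"
| "C_low (Inr A) (Inl B) = - of_bool (A = B)"
| "C_low (Inl A) (Inl B) = 0"
| "C_low (Inr A) (Inr B) = 0"

definition C_up :: "'n fidx \<Rightarrow> 'n fidx \<Rightarrow> complex" where
  "C_up \<Gamma> \<Delta> = - C_low \<Gamma> \<Delta>"

text \<open>The compact symplectic Lie algebra of the form \<open>J\<close>: skew-Hermitian matrices that are
  infinitesimal symmetries of \<open>J\<close>. With \<open>J = eps\<close> this is \<open>sp(1)\<close>, with \<open>J = C_low\<close> it is
  \<open>sp(n+1)\<close>.\<close>

definition sp_algebra :: "('i::finite \<Rightarrow> 'i \<Rightarrow> complex) \<Rightarrow> ('i \<Rightarrow> 'i \<Rightarrow> complex) set" where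
  "sp_algebra J = {B. \<forall>i j. B i j = - cnj (B j i) \<and>
     (\<Sum>k\<in>UNIV. B k i * J k j + J i k * B k j) = 0}"

definition symmetric4 :: "('i \<Rightarrow> 'i \<Rightarrow> 'i \<Rightarrow> 'i \<Rightarrow> 'b) \<Rightarrow> bool" where
  "symmetric4 T \<longleftrightarrow> (\<forall>i j k l i' j' k' l'.
     {#i, j, k, l#} = {#i', j', k', l'#} \<longrightarrow> T i j k l = T i' j' k' l')"

text \<open>The value of \<open>scal / (4 (n+1) (n+3))\<close> for \<open>g_FS\<close>, which is independent of \<open>c\<close>.\<close>

definition reduced_scal :: complex where
  "reduced_scal = -2"

context
  fixes c :: "'n::finite \<Rightarrow> 'n \<Rightarrow> 'n \<Rightarrow> real" and e :: "complex ^ 'n \<Rightarrow> real ^ 'n ^ 'n"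
begin

definition coframe :: "'n qpoint \<Rightarrow> 2 \<Rightarrow> 'n fidx \<Rightarrow> 'n qpoint \<Rightarrow> complex" where
  "coframe p \<alpha> \<Gamma> v = (if \<alpha> = 1
     then (case \<Gamma> of Inl A \<Rightarrow> beta c e p A v | Inr A \<Rightarrow> alpha c e p A v)
     else (case \<Gamma> of Inl A \<Rightarrow> - cnj (alpha c e p A v) | Inr A \<Rightarrow> cnj (beta c e p A v)))"

definition dual_frame :: "'n qpoint \<Rightarrow> 2 \<Rightarrow> 'n fidx \<Rightarrow> 'n qpoint \<times> 'n qpoint" where
  "dual_frame p \<beta> \<Delta> =
     (THE w. \<forall>\<alpha> \<Gamma>. cx_form (coframe p \<alpha> \<Gamma>) w = of_bool (\<alpha> = \<beta> \<and> \<Gamma> = \<Delta>))"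

definition is_quartic_tensor ::
    "'n qpoint \<Rightarrow> ('n fidx \<Rightarrow> 'n fidx \<Rightarrow> 'n fidx \<Rightarrow> 'n fidx \<Rightarrow> complex) \<Rightarrow> bool" where
  "is_quartic_tensor p \<Omega> \<longleftrightarrow> symmetric4 \<Omega> \<and>
     (\<exists>R_H R_E.
        (\<forall>u v. R_H u v \<in> sp_algebra eps \<and> R_E u v \<in> sp_algebra C_low) \<and>
        (\<forall>u v \<alpha> \<Gamma> \<beta> \<Delta>.
           cx_form (coframe p \<alpha> \<Gamma>)
             (cx_endo (curvature_at (g_FS c e) p u v) (dual_frame p \<beta> \<Delta>))
           = R_H u v \<alpha> \<beta> * of_bool (\<Gamma> = \<Delta>) + of_bool (\<alpha> = \<beta>) * R_E u v \<Gamma> \<Delta>) \<and>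
        (\<forall>u v \<Lambda> \<Xi>. R_E u v \<Lambda> \<Xi> =
           (\<Sum>\<alpha>\<in>UNIV. \<Sum>\<beta>\<in>UNIV. \<Sum>\<Delta>\<in>UNIV. reduced_scal / 4 * eps \<alpha> \<beta> * C_low \<Xi> \<Delta> *
              wedge (coframe p \<alpha> \<Lambda>) (coframe p \<beta> \<Delta>) u v)
           + (\<Sum>\<alpha>\<in>UNIV. \<Sum>\<beta>\<in>UNIV. \<Sum>\<Lambda>'\<in>UNIV. \<Sum>\<Gamma>\<in>UNIV. \<Sum>\<Delta>\<in>UNIV.
              C_up \<Lambda> \<Lambda>' * \<Omega> \<Lambda>' \<Xi> \<Gamma> \<Delta> * eps \<alpha> \<beta> *
              wedge (coframe p \<alpha> \<Gamma>) (coframe p \<beta> \<Delta>) u v)))"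

end

definition listed_indices :: "'n fidx multiset set" where
  "listed_indices =
     {{#un0, un0, ti0, ti0#}}
     \<union> {{#un0, un b, ti0, ti d#} | b d. True}
     \<union> {{#un a, un b, ti k, ti d#} | a b k d. True}
     \<union> {{#ti0, un b, un k, un d#} | b k d. True}
     \<union> {{#un0, ti b, ti k, ti d#} | b k d. True}
     \<union> {{#un a, un b, un k, un d#} | a b k d. True}
     \<union> {{#ti a, ti b, ti k, ti d#} | a b k d. True}"

end

theory Submission
  imports Defs
begin

definition diff2 :: "('a::real_normed_vector \<Rightarrow> 'b::real_normed_vector) \<Rightarrow> 'a \<Rightarrow> bool" where
  "diff2 f p \<longleftrightarrow> (\<forall>\<^sub>F q in nhds p. f differentiable (at q)) \<and>
     (\<forall>v. (\<lambda>q. frechet_derivative f (at q) v) differentiable (at p))"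

lemma diff2I:
  assumes "open S" "p \<in> S"
    and "\<And>q. q \<in> S \<Longrightarrow> (f has_derivative f' q) (at q)"
    and "\<And>v. (\<lambda>q. f' q v) differentiable (at p)"
  shows "diff2 f p"
proof -
  have fd: "frechet_derivative f (at q) = f' q" if "q \<in> S" for q
    using frechet_derivative_at[OF assms(3)[OF that]] by simp
  have "\<forall>\<^sub>F q in nhds p. f differentiable (at q)"
    unfolding eventually_nhds using assms(1-3) by (auto intro: differentiableI)
  moreover have "(\<lambda>q. frechet_derivative f (at q) v) differentiable (at p)" for v
  proof -
    obtain D where D: "((\<lambda>q. f' q v) has_derivative D) (at p)"
      using assms(4)[of v] by (auto simp: differentiable_def)
    have "((\<lambda>q. frechet_derivative f (at q) v) has_derivative D) (at p)"
      by (rule has_derivative_transform_within_open[OF D assms(1,2)]) (simp add: fd)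
    then show ?thesis by (rule differentiableI)
  qed
  ultimately show ?thesis by (simp add: diff2_def)
qed

lemma diff2E:
  assumes "diff2 f p"
  obtains S f' where "open S" "p \<in> S"
    and "\<And>q. q \<in> S \<Longrightarrow> (f has_derivative f' q) (at q)"
    and "\<And>v. (\<lambda>q. f' q v) differentiable (at p)"
proof -
  obtain S where "open S" "p \<in> S" "\<forall>q\<in>S. f differentiable (at q)"
    using assms unfolding diff2_def eventually_nhds by auto
  moreover have "(f has_derivative frechet_derivative f (at q)) (at q)" if "f differentiable (at q)" for q
    using that frechet_derivative_works by blast
  ultimately show thesis
    using that[of S "\<lambda>q. frechet_derivative f (at q)"] assms
    unfolding diff2_def by simp
qed

lemma diff2_imp_differentiable: "diff2 f p \<Longrightarrow> f differentiable (at p)"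
  by (auto simp: diff2_def dest: eventually_nhds_x_imp_x)

lemma diff2_const: "diff2 (\<lambda>q. k) p"
  by (rule diff2I[where S=UNIV]) (auto intro!: derivative_eq_intros)

lemma diff2_compose_linear:
  assumes "bounded_linear L" "diff2 f p"
  shows "diff2 (\<lambda>q. L (f q)) p"
proof -
  obtain S f' where S: "open S" "p \<in> S" "\<And>q. q \<in> S \<Longrightarrow> (f has_derivative f' q) (at q)"
    "\<And>v. (\<lambda>q. f' q v) differentiable (at p)" using diff2E[OF assms(2)] by blast
  show ?thesis
  proof (rule diff2I[OF S(1,2)])
    show "((\<lambda>q. L (f q)) has_derivative (\<lambda>v. L (f' q v))) (at q)" if "q \<in> S" for q
      by (rule bounded_linear.has_derivative[OF assms(1) S(3)[OF that]])
    show "(\<lambda>q. L (f' q v)) differentiable (at p)" for v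
      using S(4)[of v] bounded_linear.has_derivative[OF assms(1)] unfolding differentiable_def by blast
  qed
qed

lemma diff2_linear: "bounded_linear L \<Longrightarrow> diff2 L p"
  by (rule diff2I[where S=UNIV and f'="\<lambda>q. L"]) (auto intro: bounded_linear_imp_has_derivative)

lemma diff2_add:
  assumes "diff2 f p" "diff2 g p"
  shows "diff2 (\<lambda>q. f q + g q) p"
proof -
  obtain S f' where S: "open S" "p \<in> S" "\<And>q. q \<in> S \<Longrightarrow> (f has_derivative f' q) (at q)"
    "\<And>v. (\<lambda>q. f' q v) differentiable (at p)" using diff2E[OF assms(1)] by blast
  obtain R g' where R: "open R" "p \<in> R" "\<And>q. q \<in> R \<Longrightarrow> (g has_derivative g' q) (at q)"
    "\<And>v. (\<lambda>q. g' q v) differentiable (at p)" using diff2E[OF assms(2)] by blast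
  show ?thesis
    by (rule diff2I[where S="S \<inter> R" and f'="\<lambda>q v. f' q v + g' q v"])
      (use S R in \<open>auto intro!: derivative_intros\<close>)
qed

lemma diff2_mult:
  fixes f g :: "'a::real_normed_vector \<Rightarrow> 'b::real_normed_algebra"
  assumes "diff2 f p" "diff2 g p"
  shows "diff2 (\<lambda>q. f q * g q) p"
proof -
  obtain S f' where S: "open S" "p \<in> S" "\<And>q. q \<in> S \<Longrightarrow> (f has_derivative f' q) (at q)"
    "\<And>v. (\<lambda>q. f' q v) differentiable (at p)" using diff2E[OF assms(1)] by blast
  obtain R g' where R: "open R" "p \<in> R" "\<And>q. q \<in> R \<Longrightarrow> (g has_derivative g' q) (at q)"
    "\<And>v. (\<lambda>q. g' q v) differentiable (at p)" using diff2E[OF assms(2)] by blast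
  have "f differentiable (at p)" "g differentiable (at p)"
    using assms by (auto intro: diff2_imp_differentiable)
  then show ?thesis
    by (intro diff2I[where S="S \<inter> R" and f'="\<lambda>q v. f q * g' q v + f' q v * g q"])
      (use S R in \<open>auto intro!: derivative_intros\<close>)
qed

lemma diff2_sum:
  assumes "\<And>i. i \<in> I \<Longrightarrow> diff2 (f i) p"
  shows "diff2 (\<lambda>q. \<Sum>i\<in>I. f i q) p"
  using assms
proof (induction I rule: infinite_finite_induct)
  case (insert i I)
  then show ?case by (simp add: diff2_add)
qed (simp_all add: diff2_const)

lemma diff2_chain_real:
  fixes f :: "'a::real_normed_vector \<Rightarrow> real"
  assumes f: "diff2 f p" and U: "open U" "f p \<in> U"
    and G: "\<And>t. t \<in> U \<Longrightarrow> (G has_real_derivative G' t) (at t)"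
    and G': "G' differentiable (at (f p))"
  shows "diff2 (\<lambda>q. G (f q)) p"
proof -
  obtain S f' where S: "open S" "p \<in> S" "\<And>q. q \<in> S \<Longrightarrow> (f has_derivative f' q) (at q)"
    "\<And>v. (\<lambda>q. f' q v) differentiable (at p)" using diff2E[OF f] by blast
  have "continuous_on S f"
    using S(1,3) by (auto intro!: continuous_at_imp_continuous_on dest: has_derivative_continuous)
  then have op: "open (S \<inter> f -` U)"
    using S(1) U(1) continuous_open_preimage by blast
  have fp: "f differentiable (at p)" using f by (rule diff2_imp_differentiable)
  have Gp: "(\<lambda>q. G' (f q)) differentiable (at p)"
    using differentiable_chain_at[OF fp G'] by (simp add: o_def)
  show ?thesis
  proof (rule diff2I[OF op])
    show "p \<in> S \<inter> f -` U" using S U by simp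
    show "((\<lambda>q. G (f q)) has_derivative (\<lambda>v. G' (f q) * f' q v)) (at q)" if "q \<in> S \<inter> f -` U" for q
      using has_derivative_compose[OF S(3), of q G "\<lambda>t. G' (f q) * t"] G[of "f q"] that
      by (simp add: has_field_derivative_def)
    show "(\<lambda>q. G' (f q) * f' q v) differentiable (at p)" for v
      using Gp S(4) by (intro derivative_intros) auto
  qed
qed

lemma diff2_inverse:
  fixes f :: "'a::real_normed_vector \<Rightarrow> real"
  assumes "diff2 f p" "f p \<noteq> 0"
  shows "diff2 (\<lambda>q. inverse (f q)) p"
proof (rule diff2_chain_real[OF assms(1), where U="- {0}"])
  show "(inverse has_real_derivative - (inverse t * inverse t)) (at t)" if "t \<in> - {0}" for t :: real
    using that by (auto intro!: derivative_eq_intros simp: power2_eq_square)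
  show "(\<lambda>t::real. - (inverse t * inverse t)) differentiable (at (f p))"
    using assms(2) by (intro derivative_intros) auto
qed (use assms in auto)

lemma diff2_sqrt:
  fixes f :: "'a::real_normed_vector \<Rightarrow> real"
  assumes "diff2 f p" "f p > 0"
  shows "diff2 (\<lambda>q. sqrt (f q)) p"
proof (rule diff2_chain_real[OF assms(1), where U="{0<..}"])
  show "(sqrt has_real_derivative inverse (sqrt t) / 2) (at t)" if "t \<in> {0<..}" for t :: real
    using that by (auto intro!: derivative_eq_intros)
  have "sqrt differentiable (at (f p))"
    using DERIV_real_sqrt[OF assms(2)] real_differentiable_def by blast
  then have "(\<lambda>t. inverse (sqrt t) * (1/2)) differentiable (at (f p))"
    using assms(2) by (intro derivative_intros) auto
  then show "(\<lambda>t. inverse (sqrt t) / 2) differentiable (at (f p))" by simp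
qed (use assms in auto)

text \<open>Symmetry of second derivatives.\<close>

lemma second_derivative_quotient:
  fixes f :: "'a::real_normed_vector \<Rightarrow> real"
  assumes S: "open S" "p \<in> S" "\<And>q. q \<in> S \<Longrightarrow> (f has_derivative f' q) (at q)"
    and B: "((\<lambda>q. f' q u) has_derivative B) (at p)"
  shows "((\<lambda>t. (f (p + t *\<^sub>R u + t *\<^sub>R v) - f (p + t *\<^sub>R u) - f (p + t *\<^sub>R v) + f p) / t\<^sup>2) \<longlongrightarrow> B v) (at_right 0)"
proof (rule tendstoI)
  fix e :: real assume e: "e > 0"
  define M where "M = norm u + norm v + 1"
  have M: "M > 0" "norm u \<le> M" "norm u + norm v \<le> M" unfolding M_def by (auto simp: add_nonneg_pos)
  have e': "e / (4 * M) > 0" using e M by simp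
  have linB: "bounded_linear B" using B has_derivative_bounded_linear by blast
  interpret B: bounded_linear B by (rule linB)
  obtain d where d: "d > 0" "\<And>y. norm (y - p) < d \<Longrightarrow>
      norm (f' y u - f' p u - B (y - p)) \<le> e / (4 * M) * norm (y - p)"
    using B e' unfolding has_derivative_at_alt by blast
  obtain r where r: "r > 0" "ball p r \<subseteq> S" using S openE by blast
  define k where "k = min d r / M"
  have k: "k > 0" using d r M by (simp add: k_def)
  have close: "norm (s *\<^sub>R u + t *\<^sub>R v) \<le> t * M" if "0 \<le> s" "s \<le> t" for s t
  proof -
    have "norm (s *\<^sub>R u + t *\<^sub>R v) \<le> s * norm u + t * norm v"
      using that norm_triangle_ineq[of "s *\<^sub>R u" "t *\<^sub>R v"] by auto
    also have "\<dots> \<le> t * norm u + t * norm v" using that by (intro add_mono mult_right_mono) auto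
    also have "\<dots> \<le> t * M" using M that by (simp add: mult_left_mono flip: distrib_left)
    finally show ?thesis .
  qed
  have close0: "norm (s *\<^sub>R u) \<le> t * M" if "0 \<le> s" "s \<le> t" for s t
    using mult_mono[OF that(2) M(2)] that by simp
  have "dist ((f (p + t *\<^sub>R u + t *\<^sub>R v) - f (p + t *\<^sub>R u) - f (p + t *\<^sub>R v) + f p) / t\<^sup>2) (B v) < e"
    if t: "0 < t" "t < k" for t
  proof -
    have tM: "t * M < d" "t * M < r" using t M d r by (auto simp: k_def field_simps)
    define \<phi> where "\<phi> s = f (p + s *\<^sub>R u + t *\<^sub>R v) - f (p + s *\<^sub>R u)" for s
    have mem: "p + s *\<^sub>R u + t *\<^sub>R v \<in> S" "p + s *\<^sub>R u \<in> S" if "0 \<le> s" "s \<le> t" for s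
    proof -
      have "dist p (p + s *\<^sub>R u + t *\<^sub>R v) = norm (s *\<^sub>R u + t *\<^sub>R v)"
        "dist p (p + s *\<^sub>R u) = norm (s *\<^sub>R u)"
        using norm_minus_cancel[of "s *\<^sub>R u + t *\<^sub>R v"] by (simp_all add: dist_norm algebra_simps)
      then show "p + s *\<^sub>R u + t *\<^sub>R v \<in> S" "p + s *\<^sub>R u \<in> S"
        using close[OF that] close0[OF that] tM r by (auto simp: subset_iff)
    qed
    have der: "(\<phi> has_real_derivative (f' (p + s *\<^sub>R u + t *\<^sub>R v) u - f' (p + s *\<^sub>R u) u)) (at s)"
      if "0 \<le> s" "s \<le> t" for s
    proof -
      interpret l1: bounded_linear "f' (p + s *\<^sub>R u + t *\<^sub>R v)" using S(3) mem that has_derivative_bounded_linear by blast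
      interpret l2: bounded_linear "f' (p + s *\<^sub>R u)" using S(3) mem that has_derivative_bounded_linear by blast
      have l: "((\<lambda>s. p + s *\<^sub>R u + w) has_derivative (\<lambda>h. h *\<^sub>R u)) (at s)" for w
        by (auto intro!: derivative_eq_intros)
      have "((\<lambda>s. f (p + s *\<^sub>R u + t *\<^sub>R v)) has_derivative (\<lambda>h. f' (p + s *\<^sub>R u + t *\<^sub>R v) (h *\<^sub>R u))) (at s)"
        by (rule has_derivative_compose[OF l S(3)]) (rule mem(1)[OF that])
      moreover have "((\<lambda>s. f (p + s *\<^sub>R u)) has_derivative (\<lambda>h. f' (p + s *\<^sub>R u) (h *\<^sub>R u))) (at s)"
        using has_derivative_compose[OF l[of 0] S(3)] mem(2)[OF that] by simp
      ultimately have "(\<phi> has_derivative (\<lambda>h. f' (p + s *\<^sub>R u + t *\<^sub>R v) (h *\<^sub>R u) - f' (p + s *\<^sub>R u) (h *\<^sub>R u))) (at s)"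
        unfolding \<phi>_def by (rule has_derivative_diff)
      moreover have "(\<lambda>h. f' (p + s *\<^sub>R u + t *\<^sub>R v) (h *\<^sub>R u) - f' (p + s *\<^sub>R u) (h *\<^sub>R u))
          = (*) (f' (p + s *\<^sub>R u + t *\<^sub>R v) u - f' (p + s *\<^sub>R u) u)"
        by (simp add: l1.scaleR l2.scaleR right_diff_distrib mult.commute fun_eq_iff)
      ultimately show ?thesis by (simp add: has_field_derivative_def)
    qed
    obtain s where s: "0 < s" "s < t" "\<phi> t - \<phi> 0 = (t - 0) * (f' (p + s *\<^sub>R u + t *\<^sub>R v) u - f' (p + s *\<^sub>R u) u)"
      using MVT2[OF t(1) der] by blast
    have "norm (f' (p + s *\<^sub>R u + t *\<^sub>R v) u - f' p u - B (s *\<^sub>R u + t *\<^sub>R v)) \<le> e / (4 * M) * norm (s *\<^sub>R u + t *\<^sub>R v)"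
      using d(2)[of "p + s *\<^sub>R u + t *\<^sub>R v"] close[of s t] s tM by (simp add: add.assoc)
    also have "\<dots> \<le> e / (4 * M) * (t * M)" using close[of s t] s e' by (intro mult_left_mono) auto
    finally have 1: "norm (f' (p + s *\<^sub>R u + t *\<^sub>R v) u - f' p u - B (s *\<^sub>R u + t *\<^sub>R v)) \<le> e / 4 * t" using M by simp
    have "norm (f' (p + s *\<^sub>R u) u - f' p u - B (s *\<^sub>R u)) \<le> e / (4 * M) * norm (s *\<^sub>R u)"
      using d(2)[of "p + s *\<^sub>R u"] close0[of s t] s tM by simp
    also have "\<dots> \<le> e / (4 * M) * (t * M)" using close0[of s t] s e' by (intro mult_left_mono) auto
    finally have 2: "norm (f' (p + s *\<^sub>R u) u - f' p u - B (s *\<^sub>R u)) \<le> e / 4 * t" using M by simp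
    have "\<bar>(f' (p + s *\<^sub>R u + t *\<^sub>R v) u - f' (p + s *\<^sub>R u) u) - t * B v\<bar> \<le> e / 2 * t"
      using 1 2 unfolding B.add B.scaleR real_norm_def real_scaleR_def by linarith
    moreover have "(f (p + t *\<^sub>R u + t *\<^sub>R v) - f (p + t *\<^sub>R u) - f (p + t *\<^sub>R v) + f p)
        = t * (f' (p + s *\<^sub>R u + t *\<^sub>R v) u - f' (p + s *\<^sub>R u) u)"
      using s(3) by (simp add: \<phi>_def)
    moreover have "\<bar>Z / t\<^sup>2 - b\<bar> \<le> e / 2" if "\<bar>Y - t * b\<bar> \<le> e / 2 * t" "Z = t * Y" for Y Z b
    proof -
      have "Z / t\<^sup>2 - b = (Y - t * b) / t" using that(2) t by (simp add: power2_eq_square field_simps)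
      then have "\<bar>Z / t\<^sup>2 - b\<bar> = \<bar>Y - t * b\<bar> / t" using t by simp
      also have "\<dots> \<le> e / 2" using that(1) t by (simp only: pos_divide_le_eq)
      finally show ?thesis .
    qed
    ultimately have "\<bar>(f (p + t *\<^sub>R u + t *\<^sub>R v) - f (p + t *\<^sub>R u) - f (p + t *\<^sub>R v) + f p) / t\<^sup>2 - B v\<bar> \<le> e / 2"
      by blast
    then show ?thesis using e by (simp add: dist_real_def)
  qed
  then show "\<forall>\<^sub>F t in at_right 0. dist ((f (p + t *\<^sub>R u + t *\<^sub>R v) - f (p + t *\<^sub>R u) - f (p + t *\<^sub>R v) + f p) / t\<^sup>2) (B v) < e"
    using k by (auto simp: eventually_at_right_field)
qed

lemma second_derivative_symmetric_real:
  fixes f :: "'a::real_normed_vector \<Rightarrow> real"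
  assumes S: "open S" "p \<in> S" "\<And>q. q \<in> S \<Longrightarrow> (f has_derivative f' q) (at q)"
    and B: "((\<lambda>q. f' q u) has_derivative B) (at p)"
    and A: "((\<lambda>q. f' q v) has_derivative A) (at p)"
  shows "A u = B v"
proof -
  have "((\<lambda>t. (f (p + t *\<^sub>R u + t *\<^sub>R v) - f (p + t *\<^sub>R u) - f (p + t *\<^sub>R v) + f p) / t\<^sup>2) \<longlongrightarrow> A u) (at_right 0)"
    using second_derivative_quotient[OF S(1,2) S(3) A, of u] by (simp add: algebra_simps)
  moreover have "((\<lambda>t. (f (p + t *\<^sub>R u + t *\<^sub>R v) - f (p + t *\<^sub>R u) - f (p + t *\<^sub>R v) + f p) / t\<^sup>2) \<longlongrightarrow> B v) (at_right 0)"
    by (rule second_derivative_quotient[OF S(1,2) S(3) B])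
  ultimately show ?thesis
    by (rule tendsto_unique[OF trivial_limit_at_right_real])
qed

lemma second_derivative_symmetric:
  fixes f :: "'a::real_normed_vector \<Rightarrow> complex"
  assumes "diff2 f p"
  shows "frechet_derivative (\<lambda>q. frechet_derivative f (at q) v) (at p) u
       = frechet_derivative (\<lambda>q. frechet_derivative f (at q) u) (at p) v"
proof -
  obtain S where S: "open S" "p \<in> S" "\<And>q. q \<in> S \<Longrightarrow> f differentiable (at q)"
    using assms unfolding diff2_def eventually_nhds by auto
  let ?D = "\<lambda>q. frechet_derivative f (at q)"
  have D: "((\<lambda>q. ?D q w) has_derivative frechet_derivative (\<lambda>q. ?D q w) (at p)) (at p)" for w
    by (rule frechet_derivative_works[THEN iffD1]) (use assms in \<open>simp add: diff2_def\<close>)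
  have f: "(f has_derivative ?D q) (at q)" if "q \<in> S" for q
    using S(3)[OF that] frechet_derivative_works by blast
  have "Re (frechet_derivative (\<lambda>q. ?D q v) (at p) u) = Re (frechet_derivative (\<lambda>q. ?D q u) (at p) v)"
    by (rule second_derivative_symmetric_real[OF S(1,2), of "\<lambda>q. Re (f q)" "\<lambda>q w. Re (?D q w)"])
      (auto intro!: has_derivative_Re D f)
  moreover have "Im (frechet_derivative (\<lambda>q. ?D q v) (at p) u) = Im (frechet_derivative (\<lambda>q. ?D q u) (at p) v)"
    by (rule second_derivative_symmetric_real[OF S(1,2), of "\<lambda>q. Im (f q)" "\<lambda>q w. Im (?D q w)"])
      (auto intro!: has_derivative_Im D f)
  ultimately show ?thesis by (rule complex_eqI)
qed

text \<open>Solutions of linear systems with differentiable coefficients.\<close>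

lemma differentiable_linear_solution:
  fixes A :: "'a::real_normed_vector \<Rightarrow> 'b::euclidean_space \<Rightarrow> 'b" and w :: "'a \<Rightarrow> 'b"
  assumes lin: "\<And>q. linear (A q)"
    and dA: "\<And>z. (\<lambda>q. A q z) differentiable (at p)"
    and inj: "\<And>z. A p z = 0 \<Longrightarrow> z = 0"
    and eq: "\<forall>\<^sub>F q in nhds p. A q (w q) = y q"
    and dy: "y differentiable (at p)"
  shows "w differentiable (at p)"
proof -
  have "inj (A p)" using lin[of p] inj by (simp add: linear_injective_0)
  then obtain C where C: "linear C" "\<And>z. C (A p z) = z"
    using linear_injective_left_inverse[OF lin[of p]] by (auto simp: fun_eq_iff)
  interpret C: bounded_linear C using C(1) linear_conv_bounded_linear by blast
  obtain y' where y': "(y has_derivative y') (at p)" using dy by (auto simp: differentiable_def)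
  define A' where "A' z = frechet_derivative (\<lambda>q. A q z) (at p)" for z
  have A': "((\<lambda>q. A q z) has_derivative A' z) (at p)" for z
    unfolding A'_def using dA[of z] by (rule frechet_derivative_works[THEN iffD1])
  have rep: "A q z = (\<Sum>i\<in>Basis. (z \<bullet> i) *\<^sub>R A q i)" for q z
  proof -
    have "A q z = A q (\<Sum>i\<in>Basis. (z \<bullet> i) *\<^sub>R i)" by (simp add: euclidean_representation)
    also have "\<dots> = (\<Sum>i\<in>Basis. (z \<bullet> i) *\<^sub>R A q i)"
      using lin[of q] by (simp add: linear_sum linear_scale)
    finally show ?thesis .
  qed
  define E where "E q = (\<Sum>i\<in>Basis. norm (A q i - A p i))" for q
  have Ebd: "norm (A q z - A p z) \<le> E q * norm z" for q z
  proof -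
    have "A q z - A p z = (\<Sum>i\<in>Basis. (z \<bullet> i) *\<^sub>R (A q i - A p i))"
      by (simp add: rep[of q z] rep[of p z] sum_subtractf algebra_simps)
    also have "norm \<dots> \<le> (\<Sum>i\<in>Basis. norm z * norm (A q i - A p i))"
      by (rule sum_norm_le) (auto intro!: mult_right_mono Basis_le_norm)
    finally show ?thesis by (simp add: E_def sum_distrib_left mult.commute)
  qed
  have "((\<lambda>q. A q i) \<longlongrightarrow> A p i) (at p)" for i
    using A'[of i] has_derivative_continuous continuous_within by blast
  then have E0: "(E \<longlongrightarrow> 0) (at p)"
    unfolding E_def by (auto intro!: tendsto_eq_intros)
  have y0: "(y \<longlongrightarrow> y p) (at p)"
    using y' has_derivative_continuous continuous_within by blast
  obtain N where N: "N > 0" "\<And>z. norm (C z) \<le> norm z * N" using C.pos_bounded by blast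
  have eqp: "A p (w p) = y p" using eq by (rule eventually_nhds_x_imp_x)
  have eq': "\<forall>\<^sub>F q in at p. A q (w q) = y q"
    using eq by (simp add: eventually_nhds_conv_at)
  have expand: "w q - w p = C (y q - y p - (A q (w p) - A p (w p)) - (A q (w q - w p) - A p (w q - w p)))"
    if "A q (w q) = y q" for q
  proof -
    interpret Aq: linear "A q" by (rule lin)
    interpret Ap: linear "A p" by (rule lin)
    have "y q - y p - (A q (w p) - A p (w p)) - (A q (w q - w p) - A p (w q - w p)) = A p (w q - w p)"
      using that eqp by (simp add: Aq.diff Ap.diff)
    then show ?thesis by (simp add: C(2))
  qed
  have small: "\<forall>\<^sub>F q in at p. E q * N < 1/2"
  proof -
    have "((\<lambda>q. E q * N) \<longlongrightarrow> 0) (at p)" using E0 by (auto intro!: tendsto_eq_intros)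
    then show ?thesis by (rule order_tendstoD) simp
  qed
  define G where "G q = norm (y q - y p) + E q * norm (w p)" for q
  have wbd: "\<forall>\<^sub>F q in at p. norm (w q - w p) \<le> 2 * N * G q"
    using eq' small
  proof eventually_elim
    case (elim q)
    have "norm (w q - w p) \<le> norm (y q - y p - (A q (w p) - A p (w p)) - (A q (w q - w p) - A p (w q - w p))) * N"
      using expand[OF elim(1)] N(2) by metis
    also have "\<dots> \<le> (norm (y q - y p) + E q * norm (w p) + E q * norm (w q - w p)) * N"
      using N(1) Ebd[of q "w p"] Ebd[of q "w q - w p"]
      by (intro mult_right_mono) (auto intro!: order_trans[OF norm_triangle_ineq4] add_mono)
    finally have "norm (w q - w p) \<le> G q * N + (E q * N) * norm (w q - w p)"
      by (simp add: G_def algebra_simps)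
    moreover have "(E q * N) * norm (w q - w p) \<le> (1/2) * norm (w q - w p)"
      using elim(2) by (intro mult_right_mono) auto
    ultimately have "norm (w q - w p) \<le> 2 * (G q * N)" by linarith
    then show ?case by (simp add: mult_ac)
  qed
  have "(G \<longlongrightarrow> 0) (at p)" unfolding G_def
    using E0 y0 by (auto intro!: tendsto_eq_intros)
  then have "((\<lambda>q. 2 * N * G q) \<longlongrightarrow> 0) (at p)" by (auto intro!: tendsto_eq_intros)
  then have w0: "((\<lambda>q. w q - w p) \<longlongrightarrow> 0) (at p)"
    by (rule Lim_null_comparison[OF wbd])
  define W where "W h = C (y' h - A' (w p) h)" for h
  have yA: "((\<lambda>q. y q - A q (w p)) has_derivative (\<lambda>h. y' h - A' (w p) h)) (at p)"
    by (intro derivative_intros y' A')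
  have linW: "bounded_linear W"
    unfolding W_def using has_derivative_bounded_linear[OF yA] C.bounded_linear_axioms bounded_linear_compose by blast
  have quot1: "((\<lambda>q. norm ((y q - A q (w p)) - (y p - A p (w p)) - (y' (q - p) - A' (w p) (q - p))) / norm (q - p)) \<longlongrightarrow> 0) (at p)"
    using yA unfolding has_derivative_iff_norm by blast
  have E1: "\<exists>K. \<forall>\<^sub>F q in at p. E q / norm (q - p) \<le> K"
  proof -
    have "\<exists>K. \<forall>\<^sub>F q in at p. norm (A q i - A p i) / norm (q - p) \<le> K" for i
    proof -
      interpret Ai: bounded_linear "A' i" using A' has_derivative_bounded_linear by blast
      obtain K where K: "\<And>h. norm (A' i h) \<le> norm h * K" using Ai.bounded by blast
      have q1: "((\<lambda>q. norm (A q i - A p i - A' i (q - p)) / norm (q - p)) \<longlongrightarrow> 0) (at p)"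
        using A'[of i] unfolding has_derivative_iff_norm by blast
      have "\<forall>\<^sub>F q in at p. norm (A q i - A p i - A' i (q - p)) / norm (q - p) < 1"
        by (rule order_tendstoD[OF q1]) simp
      moreover have "\<forall>\<^sub>F q in at p. q \<noteq> p" by (simp add: eventually_at_filter)
      ultimately have "\<forall>\<^sub>F q in at p. norm (A q i - A p i) / norm (q - p) \<le> K + 1"
      proof eventually_elim
        case (elim q)
        then have pos: "norm (q - p) > 0" by simp
        have "norm (A q i - A p i) \<le> norm (A q i - A p i - A' i (q - p)) + norm (A' i (q - p))"
          by (metis diff_add_cancel norm_triangle_ineq)
        also have "\<dots> \<le> norm (q - p) + norm (q - p) * K"
          using elim pos K[of "q - p"] by (intro add_mono) (auto simp: field_simps)
        finally show ?case using pos by (simp add: field_simps)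
      qed
      then show ?thesis by blast
    qed
    then obtain K where K: "\<And>i. \<forall>\<^sub>F q in at p. norm (A q i - A p i) / norm (q - p) \<le> K i" by metis
    have "\<forall>\<^sub>F q in at p. \<forall>i\<in>Basis. norm (A q i - A p i) / norm (q - p) \<le> K i"
      using K by (intro eventually_ball_finite) auto
    then have "\<forall>\<^sub>F q in at p. E q / norm (q - p) \<le> (\<Sum>i\<in>Basis. K i)"
      by eventually_elim (auto simp: E_def sum_divide_distrib intro!: sum_mono)
    then show ?thesis by blast
  qed
  then obtain K where K: "\<forall>\<^sub>F q in at p. E q / norm (q - p) \<le> K" by blast
  have "(w has_derivative W) (at p)"
    unfolding has_derivative_iff_norm
  proof (intro conjI linW)
    define R where "R q = (norm ((y q - A q (w p)) - (y p - A p (w p)) - (y' (q - p) - A' (w p) (q - p))) / norm (q - p)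
         + K * norm (w q - w p)) * N" for q
    have "(R \<longlongrightarrow> 0) (at p)" unfolding R_def
      using tendsto_mult[OF tendsto_add[OF quot1 tendsto_mult[OF tendsto_const[of K] tendsto_norm_zero[OF w0]]] tendsto_const[of N]]
      by simp
    moreover have "\<forall>\<^sub>F q in at p. norm (norm (w q - w p - W (q - p)) / norm (q - p)) \<le> R q"
      using eq' K
    proof eventually_elim
      case (elim q)
      define m where "m = norm ((y q - A q (w p)) - (y p - A p (w p)) - (y' (q - p) - A' (w p) (q - p)))"
      have "w q - w p - W (q - p) = C (((y q - A q (w p)) - (y p - A p (w p)) - (y' (q - p) - A' (w p) (q - p)))
           - (A q (w q - w p) - A p (w q - w p)))"
        unfolding W_def C.diff[symmetric]
        by (subst expand[OF elim(1)]) (simp add: C.diff[symmetric] algebra_simps)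
      then have "norm (w q - w p - W (q - p)) \<le> norm (((y q - A q (w p)) - (y p - A p (w p)) - (y' (q - p) - A' (w p) (q - p)))
           - (A q (w q - w p) - A p (w q - w p))) * N" using N(2) by metis
      also have "\<dots> \<le> (m + E q * norm (w q - w p)) * N"
        unfolding m_def using N(1) Ebd[of q "w q - w p"]
        by (intro mult_right_mono) (auto intro!: order_trans[OF norm_triangle_ineq4] add_mono)
      finally have "norm (w q - w p - W (q - p)) / norm (q - p) \<le> (m + E q * norm (w q - w p)) * N / norm (q - p)"
        by (simp add: divide_right_mono)
      also have "\<dots> = (m / norm (q - p) + (E q / norm (q - p)) * norm (w q - w p)) * N"
        by (simp add: add_divide_distrib distrib_right)
      also have "\<dots> \<le> R q"
        unfolding R_def m_def using elim(2) N(1) by (intro mult_right_mono add_mono) auto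
      finally show ?case by simp
    qed
    ultimately show "((\<lambda>q. norm (w q - w p - W (q - p)) / norm (q - p)) \<longlongrightarrow> 0) (at p)"
      by (rule Lim_null_comparison[rotated])
  qed
  then show ?thesis by (rule differentiableI)
qed

text \<open>Exterior derivatives of one-forms.\<close>

definition has_ext ::
    "('a::real_normed_vector \<Rightarrow> 'a \<Rightarrow> 'b::real_normed_vector) \<Rightarrow> 'a \<Rightarrow> ('a \<Rightarrow> 'a \<Rightarrow> 'b) \<Rightarrow> bool" where
  "has_ext \<phi> p \<Phi> \<longleftrightarrow> (\<exists>D. (\<forall>v. ((\<lambda>q. \<phi> q v) has_derivative (\<lambda>u. D u v)) (at p)) \<and>
     (\<forall>u v. \<Phi> u v = D u v - D v u))"

lemma has_extI:
  assumes "\<And>v. ((\<lambda>q. \<phi> q v) has_derivative (\<lambda>u. D u v)) (at p)"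
    and "\<And>u v. \<Phi> u v = D u v - D v u"
  shows "has_ext \<phi> p \<Phi>"
  using assms unfolding has_ext_def by blast

lemma has_ext_frechet:
  assumes "has_ext \<phi> p \<Phi>"
  shows "\<Phi> u v = frechet_derivative (\<lambda>q. \<phi> q v) (at p) u - frechet_derivative (\<lambda>q. \<phi> q u) (at p) v"
proof -
  obtain D where D: "\<And>v. ((\<lambda>q. \<phi> q v) has_derivative (\<lambda>u. D u v)) (at p)"
    "\<And>u v. \<Phi> u v = D u v - D v u" using assms unfolding has_ext_def by blast
  show ?thesis using frechet_derivative_at[OF D(1)[of v]] frechet_derivative_at[OF D(1)[of u]] D(2)
    by (metis (no_types))
qed

lemma has_ext_differentiable: "has_ext \<phi> p \<Phi> \<Longrightarrow> (\<lambda>q. \<phi> q v) differentiable (at p)"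
  unfolding has_ext_def differentiable_def by blast

lemma differentiable_has_ext:
  assumes "\<And>v. (\<lambda>q. \<phi> q v) differentiable (at p)"
  shows "has_ext \<phi> p (\<lambda>u v. frechet_derivative (\<lambda>q. \<phi> q v) (at p) u - frechet_derivative (\<lambda>q. \<phi> q u) (at p) v)"
  by (rule has_extI[where D="\<lambda>u v. frechet_derivative (\<lambda>q. \<phi> q v) (at p) u"])
    (use frechet_derivative_works assms in blast)+

lemma has_ext_eqI: "has_ext \<phi> p \<Phi> \<Longrightarrow> (\<And>u v. \<Phi> u v = \<Psi> u v) \<Longrightarrow> has_ext \<phi> p \<Psi>"
  unfolding has_ext_def by simp

lemma has_ext_const: "has_ext (\<lambda>q. \<phi>) p (\<lambda>u v. 0)"
  by (rule has_extI[where D="\<lambda>u v. 0"]) auto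

lemma has_ext_add:
  assumes "has_ext \<phi> p \<Phi>" "has_ext \<psi> p \<Psi>"
  shows "has_ext (\<lambda>q v. \<phi> q v + \<psi> q v) p (\<lambda>u v. \<Phi> u v + \<Psi> u v)"
proof -
  obtain D where "\<And>v. ((\<lambda>q. \<phi> q v) has_derivative (\<lambda>u. D u v)) (at p)"
    "\<And>u v. \<Phi> u v = D u v - D v u" using assms unfolding has_ext_def by blast
  moreover obtain E where "\<And>v. ((\<lambda>q. \<psi> q v) has_derivative (\<lambda>u. E u v)) (at p)"
    "\<And>u v. \<Psi> u v = E u v - E v u" using assms unfolding has_ext_def by blast
  ultimately show ?thesis
    by (intro has_extI[where D="\<lambda>u v. D u v + E u v"]) (auto intro!: derivative_eq_intros)
qed

lemma has_ext_linear:
  assumes "bounded_linear L" "has_ext \<phi> p \<Phi>"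
  shows "has_ext (\<lambda>q v. L (\<phi> q v)) p (\<lambda>u v. L (\<Phi> u v))"
proof -
  interpret bounded_linear L by fact
  obtain D where "\<And>v. ((\<lambda>q. \<phi> q v) has_derivative (\<lambda>u. D u v)) (at p)"
    "\<And>u v. \<Phi> u v = D u v - D v u" using assms unfolding has_ext_def by blast
  then show ?thesis
    by (intro has_extI[where D="\<lambda>u v. L (D u v)"]) (auto intro!: has_derivative simp: diff)
qed

lemma has_ext_sum:
  assumes "\<And>i. i \<in> I \<Longrightarrow> has_ext (\<phi> i) p (\<Phi> i)"
  shows "has_ext (\<lambda>q v. \<Sum>i\<in>I. \<phi> i q v) p (\<lambda>u v. \<Sum>i\<in>I. \<Phi> i u v)"
  using assms
proof (induction I rule: infinite_finite_induct)
  case (insert i I)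
  then show ?case by (simp add: has_ext_add)
qed (simp_all add: has_ext_const)

lemma has_ext_mult:
  fixes f :: "'a::real_normed_vector \<Rightarrow> 'b::real_normed_field"
  assumes "(f has_derivative f') (at p)" "has_ext \<phi> p \<Phi>"
  shows "has_ext (\<lambda>q v. f q * \<phi> q v) p (\<lambda>u v. f' u * \<phi> p v - f' v * \<phi> p u + f p * \<Phi> u v)"
proof -
  obtain D where "\<And>v. ((\<lambda>q. \<phi> q v) has_derivative (\<lambda>u. D u v)) (at p)"
    "\<And>u v. \<Phi> u v = D u v - D v u" using assms unfolding has_ext_def by blast
  then show ?thesis
    by (intro has_extI[where D="\<lambda>u v. f p * D u v + f' u * \<phi> p v"])
      (auto intro!: derivative_eq_intros assms(1) simp: right_diff_distrib mult.commute)
qed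

lemmas has_ext_cnj = has_ext_linear[OF bounded_linear_cnj]
lemmas has_ext_of_real = has_ext_linear[OF bounded_linear_of_real]
lemmas has_ext_cmult = has_ext_linear[OF bounded_linear_mult_right]
lemmas has_ext_minus = has_ext_linear[OF bounded_linear_minus[OF bounded_linear_ident]]

lemma has_ext_diff:
  assumes "has_ext \<phi> p \<Phi>" "has_ext \<psi> p \<Psi>"
  shows "has_ext (\<lambda>q v. \<phi> q v - \<psi> q v) p (\<lambda>u v. \<Phi> u v - \<Psi> u v)"
  using has_ext_add[OF assms(1) has_ext_minus[OF assms(2)]] by simp

text \<open>Cartan's structure equations.\<close>

locale cartan_frame =
  fixes g :: "'a::euclidean_space \<Rightarrow> 'a \<Rightarrow> 'a \<Rightarrow> real"
    and f :: "'a \<Rightarrow> 'i::finite \<Rightarrow> 'a \<Rightarrow> complex"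
    and B :: "'i \<Rightarrow> 'i \<Rightarrow> complex"
    and \<omega> :: "'a \<Rightarrow> 'a \<Rightarrow> 'i \<Rightarrow> 'i \<Rightarrow> complex"
    and S :: "'a set" and p :: 'a
  assumes S: "open S" "p \<in> S"
    and lin: "\<And>q i. q \<in> S \<Longrightarrow> linear (f q i)"
    and span: "\<And>q c i. q \<in> S \<Longrightarrow> (\<And>z. (\<Sum>i\<in>UNIV. c i * f q i z) = 0) \<Longrightarrow> c i = 0"
    and inj: "\<And>q w. q \<in> S \<Longrightarrow> (\<And>i. f q i w = 0) \<Longrightarrow> w = 0"
    and Bsym: "\<And>i j. B i j = B j i"
    and Bnondeg: "\<And>c i. (\<And>j. (\<Sum>i\<in>UNIV. c i * B i j) = 0) \<Longrightarrow> c i = 0"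
    and metric: "\<And>q u v. q \<in> S \<Longrightarrow> of_real (g q u v) = (\<Sum>i\<in>UNIV. \<Sum>j\<in>UNIV. B i j * f q i u * f q j v)"
    and torsion_free: "\<And>q i. q \<in> S \<Longrightarrow>
       has_ext (\<lambda>q. f q i) q (\<lambda>u v. - (\<Sum>j\<in>UNIV. \<omega> q u i j * f q j v - \<omega> q v i j * f q j u))"
    and skew: "\<And>q u i j. q \<in> S \<Longrightarrow> (\<Sum>k\<in>UNIV. B k j * \<omega> q u k i + B i k * \<omega> q u k j) = 0"
    and lin_\<omega>: "\<And>q i j. q \<in> S \<Longrightarrow> linear (\<lambda>u. \<omega> q u i j)"
    and D2: "\<And>i v. diff2 (\<lambda>q. f q i v) p"
    and d\<omega>: "\<And>u i j. (\<lambda>q. \<omega> q u i j) differentiable (at p)"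
begin

definition Df :: "'a \<Rightarrow> 'i \<Rightarrow> 'a \<Rightarrow> 'a \<Rightarrow> complex" where
  "Df q i u v = frechet_derivative (\<lambda>q. f q i v) (at q) u"

lemma has_derivative_frame:
  assumes "q \<in> S"
  shows "((\<lambda>q. f q i v) has_derivative (\<lambda>u. Df q i u v)) (at q)"
  unfolding Df_def
  by (rule frechet_derivative_works[THEN iffD1, OF has_ext_differentiable[OF torsion_free[OF assms]]])

lemma Df_antisym:
  assumes "q \<in> S"
  shows "Df q i u v - Df q i v u = - (\<Sum>j\<in>UNIV. \<omega> q u i j * f q j v - \<omega> q v i j * f q j u)"
  using has_ext_frechet[OF torsion_free[OF assms, of i], of u v] by (simp add: Df_def)

text \<open>The frame components of \<open>\<nabla>\<^sub>u v\<close>.\<close>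

definition cov :: "'a \<Rightarrow> 'i \<Rightarrow> 'a \<Rightarrow> 'a \<Rightarrow> complex" where
  "cov q i u v = Df q i u v + (\<Sum>j\<in>UNIV. \<omega> q u i j * f q j v)"

lemma cov_sym: "q \<in> S \<Longrightarrow> cov q i u v = cov q i v u"
  using Df_antisym[of q i u v] by (auto simp: cov_def sum_subtractf diff_eq_eq algebra_simps)

definition BB :: "('i \<Rightarrow> complex) \<Rightarrow> ('i \<Rightarrow> complex) \<Rightarrow> complex" where
  "BB s t = (\<Sum>i\<in>UNIV. \<Sum>j\<in>UNIV. B i j * s i * t j)"

lemma BB_sym: "BB s t = BB t s"
  unfolding BB_def by (subst sum.swap) (simp add: Bsym mult_ac)

lemma BB_add: "BB (\<lambda>i. s i + s' i) t = BB s t + BB s' t"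
  unfolding BB_def by (simp add: algebra_simps sum.distrib)

lemma BB_skew:
  assumes "q \<in> S"
  shows "BB (\<lambda>i. \<Sum>j\<in>UNIV. \<omega> q u i j * s j) t + BB s (\<lambda>i. \<Sum>j\<in>UNIV. \<omega> q u i j * t j) = 0"
proof -
  have "BB (\<lambda>i. \<Sum>j\<in>UNIV. \<omega> q u i j * s j) t = (\<Sum>k\<in>UNIV. \<Sum>j\<in>UNIV. \<Sum>i\<in>UNIV. B k j * \<omega> q u k i * (s i * t j))"
    unfolding BB_def by (simp add: sum_distrib_left sum_distrib_right mult_ac)
  also have "\<dots> = (\<Sum>k\<in>UNIV. \<Sum>i\<in>UNIV. \<Sum>j\<in>UNIV. B k j * \<omega> q u k i * (s i * t j))"
    by (rule sum.cong[OF refl], rule sum.swap)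
  also have "\<dots> = (\<Sum>i\<in>UNIV. \<Sum>k\<in>UNIV. \<Sum>j\<in>UNIV. B k j * \<omega> q u k i * (s i * t j))"
    by (rule sum.swap)
  also have "\<dots> = (\<Sum>i\<in>UNIV. \<Sum>j\<in>UNIV. \<Sum>k\<in>UNIV. B k j * \<omega> q u k i * (s i * t j))"
    by (rule sum.cong[OF refl], rule sum.swap)
  finally have 1: "BB (\<lambda>i. \<Sum>j\<in>UNIV. \<omega> q u i j * s j) t = (\<Sum>i\<in>UNIV. \<Sum>j\<in>UNIV. \<Sum>k\<in>UNIV. B k j * \<omega> q u k i * (s i * t j))" .
  have "BB s (\<lambda>i. \<Sum>j\<in>UNIV. \<omega> q u i j * t j) = (\<Sum>i\<in>UNIV. \<Sum>k\<in>UNIV. \<Sum>j\<in>UNIV. B i k * \<omega> q u k j * (s i * t j))"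
    unfolding BB_def by (simp add: sum_distrib_left sum_distrib_right mult_ac)
  also have "\<dots> = (\<Sum>i\<in>UNIV. \<Sum>j\<in>UNIV. \<Sum>k\<in>UNIV. B i k * \<omega> q u k j * (s i * t j))"
    by (rule sum.cong[OF refl], rule sum.swap)
  finally have "BB (\<lambda>i. \<Sum>j\<in>UNIV. \<omega> q u i j * s j) t + BB s (\<lambda>i. \<Sum>j\<in>UNIV. \<omega> q u i j * t j)
     = (\<Sum>i\<in>UNIV. \<Sum>j\<in>UNIV. (\<Sum>k\<in>UNIV. B k j * \<omega> q u k i + B i k * \<omega> q u k j) * (s i * t j))"
    unfolding 1 by (simp add: sum.distrib[symmetric] sum_distrib_right distrib_right)
  then show ?thesis by (simp add: skew[OF assms])
qed

lemma BB_nondeg: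
  assumes q: "q \<in> S" and z: "\<And>z. BB s (\<lambda>j. f q j z) = 0"
  shows "s i = 0"
proof (rule Bnondeg)
  fix j
  show "(\<Sum>i\<in>UNIV. s i * B i j) = 0"
  proof (rule span[OF q, of "\<lambda>j. \<Sum>i\<in>UNIV. s i * B i j"])
    fix z
    have "(\<Sum>j\<in>UNIV. (\<Sum>i\<in>UNIV. s i * B i j) * f q j z) = BB s (\<lambda>j. f q j z)"
      unfolding BB_def by (subst sum.swap) (simp add: sum_distrib_right sum_distrib_left mult_ac)
    then show "(\<Sum>j\<in>UNIV. (\<Sum>i\<in>UNIV. s i * B i j) * f q j z) = 0" using z by simp
  qed
qed

lemma metric_BB: "q \<in> S \<Longrightarrow> of_real (g q u v) = BB (\<lambda>i. f q i u) (\<lambda>i. f q i v)"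
  by (simp add: metric BB_def)

lemma g_linear:
  assumes q: "q \<in> S"
  shows "linear (g q w)" "linear (\<lambda>w. g q w z)"
proof -
  interpret l: linear "f q m" for m by (rule lin[OF q])
  have a: "of_real (g q w (x + y)) = complex_of_real (g q w x + g q w y)" for w x y
    by (simp add: metric[OF q] l.add algebra_simps sum.distrib)
  have b: "of_real (g q w (r *\<^sub>R y)) = complex_of_real (r * g q w y)" for w r y
    by (simp add: metric[OF q] l.scaleR sum_distrib_left scaleR_conv_of_real mult_ac)
  have c: "g q x y = g q y x" for x y
  proof -
    have "complex_of_real (g q x y) = complex_of_real (g q y x)"
      unfolding metric_BB[OF q] by (rule BB_sym)
    then show ?thesis by (simp only: of_real_eq_iff)
  qed
  have a': "g q w (x + y) = g q w x + g q w y" for w x y using a[of w x y] by (simp only: of_real_eq_iff)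
  have b': "g q w (r *\<^sub>R y) = r * g q w y" for w r y using b[of w r y] by (simp only: of_real_eq_iff)
  show "linear (g q w)" by (rule linearI) (simp_all add: a' b')
  show "linear (\<lambda>w. g q w z)" by (rule linearI) (simp_all add: c[of _ z] a' b')
qed

lemma g_nondeg:
  assumes q: "q \<in> S" and z: "\<And>z. g q w z = 0"
  shows "w = 0"
  by (rule inj[OF q], rule BB_nondeg[OF q]) (simp add: metric_BB[OF q, symmetric] z)

lemma riesz:
  assumes q: "q \<in> S" and l: "linear l"
  shows "\<exists>!w. \<forall>z. g q w z = l z"
proof -
  define L where "L w = (\<Sum>b\<in>Basis. g q w b *\<^sub>R b)" for w
  have "linear L" unfolding L_def
    by (intro linearI; simp add: linear_add[OF g_linear(2)[OF q]] linear_scale[OF g_linear(2)[OF q]]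
        sum.distrib scaleR_add_left scaleR_sum_right)
  have ext: "g q w z = k z" if "\<And>b. b \<in> Basis \<Longrightarrow> g q w b = k b" "linear k" for w k z
    using linear_eq_on_span[OF g_linear(1)[OF q] that(2), of Basis w z] that(1) by simp
  have "inj L"
  proof (subst linear_injective_0[OF \<open>linear L\<close>], intro allI impI)
    fix w assume "L w = 0"
    then have "L w \<bullet> b = 0" for b by simp
    then have "g q w b = 0" if "b \<in> Basis" for b
      using that unfolding L_def by (metis inner_sum_left_Basis)
    then have "g q w z = 0" for z using ext[of w "\<lambda>_. 0" z] linear_zero by simp
    then show "w = 0" by (rule g_nondeg[OF q])
  qed
  then obtain w where w: "L w = (\<Sum>b\<in>Basis. l b *\<^sub>R b)"
    using linear_injective_imp_surjective[OF \<open>linear L\<close>] by (metis surjD)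
  have "g q w b = l b" if "b \<in> Basis" for b
  proof -
    have "L w \<bullet> b = (\<Sum>b\<in>Basis. l b *\<^sub>R b) \<bullet> b" by (simp add: w)
    then show ?thesis using that unfolding L_def by (simp add: inner_sum_left_Basis)
  qed
  then have "g q w z = l z" for z using ext[of w l z] l by simp
  moreover have "w' = w''" if "\<forall>z. g q w' z = l z" "\<forall>z. g q w'' z = l z" for w' w''
  proof -
    have "g q (w' - w'') z = 0" for z using that by (simp add: linear_diff[OF g_linear(2)[OF q]])
    then show ?thesis using g_nondeg[OF q] by (metis eq_iff_diff_eq_0)
  qed
  ultimately show ?thesis by blast
qed


lemma BB_diff: "BB (\<lambda>i. s i - s' i) t = BB s t - BB s' t"
  unfolding BB_def by (simp add: algebra_simps sum_subtractf)

lemma BB_add_right: "BB s (\<lambda>i. t i + t' i) = BB s t + BB s t'"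
  by (metis BB_add BB_sym)

lemma has_derivative_metric:
  assumes q: "q \<in> S"
  shows "((\<lambda>q. complex_of_real (g q v z)) has_derivative
      (\<lambda>u. BB (\<lambda>i. cov q i u v) (\<lambda>i. f q i z) + BB (\<lambda>i. f q i v) (\<lambda>i. cov q i u z))) (at q)"
proof -
  have "((\<lambda>r. BB (\<lambda>i. f r i v) (\<lambda>i. f r i z)) has_derivative
      (\<lambda>u. BB (\<lambda>i. Df q i u v) (\<lambda>i. f q i z) + BB (\<lambda>i. f q i v) (\<lambda>i. Df q i u z))) (at q)"
    unfolding BB_def
    by (auto intro!: derivative_eq_intros has_derivative_frame[OF q] simp: sum.distrib[symmetric] algebra_simps)
  moreover have "BB (\<lambda>i. Df q i u v) (\<lambda>i. f q i z) + BB (\<lambda>i. f q i v) (\<lambda>i. Df q i u z)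
      = BB (\<lambda>i. cov q i u v) (\<lambda>i. f q i z) + BB (\<lambda>i. f q i v) (\<lambda>i. cov q i u z)" for u
    using BB_skew[OF q, of u "\<lambda>i. f q i v" "\<lambda>i. f q i z"] by (simp add: cov_def BB_add BB_add_right)
  ultimately have "((\<lambda>r. BB (\<lambda>i. f r i v) (\<lambda>i. f r i z)) has_derivative
      (\<lambda>u. BB (\<lambda>i. cov q i u v) (\<lambda>i. f q i z) + BB (\<lambda>i. f q i v) (\<lambda>i. cov q i u z))) (at q)"
    by simp
  then show ?thesis
    by (rule has_derivative_transform_within_open[OF _ S(1) q]) (simp add: metric_BB)
qed

lemma of_real_frechet_metric:
  assumes q: "q \<in> S"
  shows "complex_of_real (frechet_derivative (\<lambda>q. g q v z) (at q) u)
      = BB (\<lambda>i. cov q i u v) (\<lambda>i. f q i z) + BB (\<lambda>i. f q i v) (\<lambda>i. cov q i u z)"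
proof -
  let ?D = "\<lambda>u. BB (\<lambda>i. cov q i u v) (\<lambda>i. f q i z) + BB (\<lambda>i. f q i v) (\<lambda>i. cov q i u z)"
  have 1: "((\<lambda>q. g q v z) has_derivative (\<lambda>u. Re (?D u))) (at q)"
    using has_derivative_Re[OF has_derivative_metric[OF q, of v z]] by simp
  have "((\<lambda>q. complex_of_real (g q v z)) has_derivative (\<lambda>u. complex_of_real (Re (?D u)))) (at q)"
    using has_derivative_of_real[OF 1] .
  from fun_cong[OF has_derivative_unique[OF this has_derivative_metric[OF q]], of u]
  have "complex_of_real (Re (?D u)) = ?D u" .
  then show ?thesis unfolding frechet_derivative_at[OF 1, symmetric] .
qed

lemma frame_christoffel:
  assumes q: "q \<in> S"
  shows "f q i (christoffel g q u v) = cov q i u v"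
proof -
  let ?l = "\<lambda>z. (frechet_derivative (\<lambda>q. g q v z) (at q) u
       + frechet_derivative (\<lambda>q. g q u z) (at q) v
       - frechet_derivative (\<lambda>q. g q u v) (at q) z) / 2"
  interpret l: linear "f q m" for m by (rule lin[OF q])
  have l: "complex_of_real (?l z) = BB (\<lambda>i. cov q i u v) (\<lambda>i. f q i z)" for z
    using BB_sym by (simp add: of_real_frechet_metric[OF q] cov_sym[OF q, of _ _ z] cov_sym[OF q, of _ v u])
  have "linear ?l"
  proof (rule linearI)
    fix x y :: 'a and r :: real
    have "complex_of_real (?l (x + y)) = complex_of_real (?l x + ?l y)"
      unfolding of_real_add l by (simp add: l.add BB_add_right)
    then show "?l (x + y) = ?l x + ?l y" by (simp only: of_real_eq_iff)
    have "complex_of_real (?l (r *\<^sub>R x)) = complex_of_real (r * ?l x)"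
      unfolding of_real_mult l
      by (simp add: l.scaleR BB_def sum_distrib_left scaleR_conv_of_real mult_ac)
    then show "?l (r *\<^sub>R x) = r *\<^sub>R ?l x" by (simp only: of_real_eq_iff real_scaleR_def)
  qed
  from theI'[OF riesz[OF q this]]
  have c: "\<forall>z. g q (christoffel g q u v) z = ?l z" unfolding christoffel_def .
  have "BB (\<lambda>i. f q i (christoffel g q u v)) (\<lambda>i. f q i z) = BB (\<lambda>i. cov q i u v) (\<lambda>i. f q i z)" for z
    by (rule trans[OF metric_BB[OF q, symmetric] trans[OF arg_cong[where f=complex_of_real, OF spec[OF c]] l]])
  then have "BB (\<lambda>i. f q i (christoffel g q u v) - cov q i u v) (\<lambda>i. f q i z) = 0" for z
    by (simp add: BB_diff)
  from BB_nondeg[OF q this] have "f q i (christoffel g q u v) - cov q i u v = 0" .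
  then show ?thesis by simp
qed

lemma Df_diff: "(\<lambda>q. Df q i u v) differentiable (at p)"
  using D2[of i v] by (simp add: diff2_def Df_def)

lemma cov_diff: "(\<lambda>q. cov q i u v) differentiable (at p)"
  unfolding cov_def
  by (intro derivative_intros differentiable_sum ballI Df_diff d\<omega> diff2_imp_differentiable[OF D2]) auto

lemma christoffel_differentiable: "(\<lambda>q. christoffel g q u v) differentiable (at p)"
proof (rule differentiable_linear_solution)
  define A where "A q w = (if q \<in> S then \<Sum>b\<in>Basis. (\<Sum>i\<in>UNIV. Re (cnj (f p i b) * f q i w)) *\<^sub>R b else 0)" for q w
  show "linear (A q)" for q
  proof (cases "q \<in> S")
    case True
    interpret l: linear "f q m" for m by (rule lin[OF True])
    show ?thesis
      by (intro linearI) (simp_all add: A_def l.add l.scaleR algebra_simps sum.distrib scaleR_sum_right sum_distrib_left)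
  qed (auto simp: A_def intro: linearI)
  have fd: "(\<lambda>q. f q i w) differentiable (at p)" for i w by (rule diff2_imp_differentiable[OF D2])
  have Red: "(\<lambda>q. Re (k q)) differentiable (at p)" if "k differentiable (at p)" for k :: "'a \<Rightarrow> complex"
    using that has_derivative_Re unfolding differentiable_def by blast
  have sd: "(\<lambda>q. k q *\<^sub>R b) differentiable (at p)" if "k differentiable (at p)" for k :: "'a \<Rightarrow> real" and b :: 'a
    using that has_derivative_scaleR_left unfolding differentiable_def by blast
  show "(\<lambda>q. A q w) differentiable (at p)" for w
  proof -
    have "(\<lambda>q. \<Sum>b\<in>Basis. (\<Sum>i\<in>UNIV. Re (cnj (f p i b) * f q i w)) *\<^sub>R b) differentiable (at p)"
      by (intro differentiable_sum ballI sd Red derivative_intros fd finite_Basis finite)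
    then obtain D where "((\<lambda>q. \<Sum>b\<in>Basis. (\<Sum>i\<in>UNIV. Re (cnj (f p i b) * f q i w)) *\<^sub>R b) has_derivative D) (at p)"
      unfolding differentiable_def by blast
    then have "((\<lambda>q. A q w) has_derivative D) (at p)"
      by (rule has_derivative_transform_within_open[OF _ S]) (simp add: A_def)
    then show ?thesis by (rule differentiableI)
  qed
  interpret lp: linear "f p m" for m by (rule lin[OF S(2)])
  show "w = 0" if "A p w = 0" for w
  proof (rule inj[OF S(2)])
    have "(\<Sum>i\<in>UNIV. Re (cnj (f p i b) * f p i w)) = 0" if b: "b \<in> Basis" for b
    proof -
      have "A p w \<bullet> b = 0" using \<open>A p w = 0\<close> by simp
      then show ?thesis using b S(2) by (simp add: A_def inner_sum_left_Basis)
    qed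
    then have "0 = (\<Sum>b\<in>Basis. (w \<bullet> b) * (\<Sum>i\<in>UNIV. Re (cnj (f p i b) * f p i w)))" by simp
    also have "\<dots> = (\<Sum>i\<in>UNIV. Re (cnj (\<Sum>b\<in>Basis. (w \<bullet> b) *\<^sub>R f p i b) * f p i w))"
      by (subst sum_distrib_left, subst sum.swap)
        (simp add: sum_distrib_right sum_distrib_left algebra_simps scaleR_sum_right)
    also have "\<dots> = (\<Sum>i\<in>UNIV. Re (cnj (f p i w) * f p i w))"
    proof -
      have "(\<Sum>b\<in>Basis. (w \<bullet> b) *\<^sub>R f p i b) = f p i w" for i
      proof -
      have "(\<Sum>b\<in>Basis. (w \<bullet> b) *\<^sub>R f p i b) = f p i (\<Sum>b\<in>Basis. (w \<bullet> b) *\<^sub>R b)"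
        by (simp add: lp.sum lp.scaleR)
      then show ?thesis by (simp add: euclidean_representation)
      qed
      then show ?thesis by simp
    qed
    finally have "(\<Sum>i\<in>UNIV. (cmod (f p i w))\<^sup>2) = 0"
      unfolding cmod_power2 by (simp add: power2_eq_square)
    then show "f p i w = 0" for i
      by (subst (asm) sum_nonneg_eq_0_iff) auto
  qed
  have "\<forall>\<^sub>F q in nhds p. q \<in> S" using S by (simp add: eventually_nhds_in_open)
  then show "\<forall>\<^sub>F q in nhds p. A q (christoffel g q u v) =
      (\<Sum>b\<in>Basis. (\<Sum>i\<in>UNIV. Re (cnj (f p i b) * cov q i u v)) *\<^sub>R b)"
    by eventually_elim (simp add: A_def frame_christoffel)
  show "(\<lambda>q. \<Sum>b\<in>Basis. (\<Sum>i\<in>UNIV. Re (cnj (f p i b) * cov q i u v)) *\<^sub>R b) differentiable (at p)"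
    by (intro differentiable_sum ballI sd Red derivative_intros cov_diff finite_Basis finite)
qed

lemma christoffel_zero: "christoffel g p 0 w = 0"
proof (rule inj[OF S(2)])
  interpret l: linear "f p m" for m by (rule lin[OF S(2)])
  interpret lo: linear "\<lambda>u. \<omega> p u i j" for i j by (rule lin_\<omega>[OF S(2)])
  interpret ld: linear "\<lambda>u. Df p i u w" for i
    using has_derivative_linear[OF has_derivative_frame[OF S(2)]] .
  show "f p i (christoffel g p 0 w) = 0" for i
    by (simp add: frame_christoffel[OF S(2)] cov_def ld.zero lo.zero)
qed

definition curv_form :: "'i \<Rightarrow> 'i \<Rightarrow> 'a \<Rightarrow> 'a \<Rightarrow> complex" where
  "curv_form i j u v = frechet_derivative (\<lambda>q. \<omega> q v i j) (at p) u - frechet_derivative (\<lambda>q. \<omega> q u i j) (at p) v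
     + (\<Sum>k\<in>UNIV. \<omega> p u i k * \<omega> p v k j - \<omega> p v i k * \<omega> p u k j)"

theorem frame_curvature: "f p i (curvature_at g p u v w) = (\<Sum>j\<in>UNIV. curv_form i j u v * f p j w)"
proof -
  interpret l: linear "f p m" for m by (rule lin[OF S(2)])
  have curv: "curvature_at g p u v w =
      frechet_derivative (\<lambda>q. christoffel g q v w) (at p) u + christoffel g p u (christoffel g p v w)
    - (frechet_derivative (\<lambda>q. christoffel g q u w) (at p) v + christoffel g p v (christoffel g p u w))"
    by (simp add: curvature_at_def riemann_def levi_civita_def[abs_def] lie_bracket_def christoffel_zero)
  define D\<omega> where "D\<omega> u v i j = frechet_derivative (\<lambda>q. \<omega> q v i j) (at p) u" for u v i j
  define DD where "DD u v w = frechet_derivative (\<lambda>q. Df q i v w) (at p) u" for u v w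
  have DDsym: "DD u v w = DD v u w" for u v w
    unfolding DD_def Df_def by (rule second_derivative_symmetric[OF D2])
  have hd\<omega>: "((\<lambda>q. \<omega> q v i j) has_derivative (\<lambda>u. D\<omega> u v i j)) (at p)" for v i j
    unfolding D\<omega>_def by (rule frechet_derivative_works[THEN iffD1, OF d\<omega>])
  have hDD: "((\<lambda>q. Df q i v w) has_derivative (\<lambda>u. DD u v w)) (at p)" for v w
    unfolding DD_def by (rule frechet_derivative_works[THEN iffD1, OF Df_diff])
  have key: "f p i (frechet_derivative (\<lambda>q. christoffel g q v w) (at p) u)
      = DD u v w + (\<Sum>j\<in>UNIV. D\<omega> u v i j * f p j w + \<omega> p v i j * Df p j u w) - Df p i u (christoffel g p v w)" for u v
  proof -
    let ?G = "\<lambda>q. christoffel g q v w"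
    let ?G' = "frechet_derivative ?G (at p)"
    have G: "(?G has_derivative ?G') (at p)"
      by (rule frechet_derivative_works[THEN iffD1, OF christoffel_differentiable])
    have rep: "f q i x = (\<Sum>b\<in>Basis. of_real (x \<bullet> b) * f q i b)" if "q \<in> S" for q x
    proof -
      interpret lq: linear "f q i" by (rule lin[OF that])
      have "f q i x = f q i (\<Sum>b\<in>Basis. (x \<bullet> b) *\<^sub>R b)" by (simp add: euclidean_representation)
      also have "\<dots> = (\<Sum>b\<in>Basis. of_real (x \<bullet> b) * f q i b)"
        by (simp add: lq.sum lq.scaleR scaleR_conv_of_real)
      finally show ?thesis .
    qed
    have "((\<lambda>q. \<Sum>b\<in>Basis. of_real (?G q \<bullet> b) * f q i b) has_derivative
       (\<lambda>u. \<Sum>b\<in>Basis. of_real (?G p \<bullet> b) * Df p i u b + of_real (?G' u \<bullet> b) * f p i b)) (at p)"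
      by (auto intro!: derivative_eq_intros G has_derivative_frame[OF S(2)])
    moreover have "(\<Sum>b\<in>Basis. of_real (?G' u \<bullet> b) * f p i b) = f p i (?G' u)" for u
      by (rule rep[OF S(2), symmetric])
    moreover have "(\<Sum>b\<in>Basis. of_real (x \<bullet> b) * Df p i u b) = Df p i u x" for u x
    proof -
      have "((\<lambda>q. \<Sum>b\<in>Basis. of_real (x \<bullet> b) * f q i b) has_derivative
         (\<lambda>u. \<Sum>b\<in>Basis. of_real (x \<bullet> b) * Df p i u b)) (at p)"
        by (auto intro!: derivative_eq_intros has_derivative_frame[OF S(2)])
      then have "((\<lambda>q. f q i x) has_derivative (\<lambda>u. \<Sum>b\<in>Basis. of_real (x \<bullet> b) * Df p i u b)) (at p)"
        by (rule has_derivative_transform_within_open[OF _ S]) (simp add: rep)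
      from has_derivative_unique[OF this has_derivative_frame[OF S(2)]] show ?thesis by metis
    qed
    ultimately have "((\<lambda>q. \<Sum>b\<in>Basis. of_real (?G q \<bullet> b) * f q i b) has_derivative
        (\<lambda>u. Df p i u (?G p) + f p i (?G' u))) (at p)"
      by (simp add: sum.distrib)
    then have "((\<lambda>q. cov q i v w) has_derivative (\<lambda>u. Df p i u (?G p) + f p i (?G' u))) (at p)"
      by (rule has_derivative_transform_within_open[OF _ S]) (simp add: rep[symmetric] frame_christoffel)
    moreover have "((\<lambda>q. cov q i v w) has_derivative
        (\<lambda>u. DD u v w + (\<Sum>j\<in>UNIV. D\<omega> u v i j * f p j w + \<omega> p v i j * Df p j u w))) (at p)"
      unfolding cov_def
      by (auto intro!: derivative_eq_intros hd\<omega> hDD has_derivative_frame[OF S(2)] simp: algebra_simps)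
    ultimately have "Df p i u (?G p) + f p i (?G' u)
        = DD u v w + (\<Sum>j\<in>UNIV. D\<omega> u v i j * f p j w + \<omega> p v i j * Df p j u w)"
      using has_derivative_unique by (metis (no_types, lifting))
    then show ?thesis by (simp add: algebra_simps)
  qed
  have chr: "f p i (christoffel g p u (christoffel g p v w)) = Df p i u (christoffel g p v w)
       + (\<Sum>j\<in>UNIV. \<omega> p u i j * (Df p j v w + (\<Sum>k\<in>UNIV. \<omega> p v j k * f p k w)))" for u v
    unfolding frame_christoffel[OF S(2)] cov_def[of p i] unfolding frame_christoffel[OF S(2)] cov_def by simp
  have sw: "(\<Sum>j\<in>UNIV. \<omega> p u i j * (\<Sum>k\<in>UNIV. \<omega> p v j k * f p k w))
      = (\<Sum>j\<in>UNIV. (\<Sum>k\<in>UNIV. \<omega> p u i k * \<omega> p v k j) * f p j w)" for u v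
    by (simp add: sum_distrib_left sum_distrib_right mult_ac) (rule sum.swap)
  let ?M = "(\<Sum>j\<in>UNIV. D\<omega> u v i j * f p j w) - (\<Sum>j\<in>UNIV. D\<omega> v u i j * f p j w)
     + (\<Sum>j\<in>UNIV. (\<Sum>k\<in>UNIV. \<omega> p u i k * \<omega> p v k j) * f p j w)
     - (\<Sum>j\<in>UNIV. (\<Sum>k\<in>UNIV. \<omega> p v i k * \<omega> p u k j) * f p j w)"
  have 1: "f p i (curvature_at g p u v w) = ?M"
    unfolding curv l.diff l.add key chr
    by (simp add: DDsym[of v u] distrib_left sum.distrib sw)
  have 2: "?M = (\<Sum>j\<in>UNIV. curv_form i j u v * f p j w)"
    by (simp add: curv_form_def D\<omega>_def algebra_simps sum.distrib sum_subtractf sum_distrib_left)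
  show ?thesis by (rule trans[OF 1 2])
qed

end

definition dot :: "('n::finite \<Rightarrow> complex) \<Rightarrow> ('n \<Rightarrow> complex) \<Rightarrow> complex" where
  "dot v w = (\<Sum>a\<in>UNIV. v a * w a)"

definition TT :: "('n::finite \<Rightarrow> 'n \<Rightarrow> 'n \<Rightarrow> real) \<Rightarrow> ('n \<Rightarrow> complex) \<Rightarrow> ('n \<Rightarrow> complex) \<Rightarrow> 'n \<Rightarrow> complex" where
  "TT T v w a = (\<Sum>b\<in>UNIV. \<Sum>d\<in>UNIV. of_real (T a b d) * v b * w d)"

lemma dot_sym: "dot v w = dot w v"
  by (simp add: dot_def mult.commute)

lemma dot_add: "dot (\<lambda>a. v a + w a) z = dot v z + dot w z" "dot z (\<lambda>a. v a + w a) = dot z v + dot z w"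
  and dot_diff: "dot (\<lambda>a. v a - w a) z = dot v z - dot w z" "dot z (\<lambda>a. v a - w a) = dot z v - dot z w"
  and dot_minus: "dot (\<lambda>a. - v a) z = - dot v z" "dot z (\<lambda>a. - v a) = - dot z v"
  and dot_scale: "dot (\<lambda>a. k * v a) z = k * dot v z" "dot z (\<lambda>a. k * v a) = k * dot z v"
  and dot_scale': "dot (\<lambda>a. v a * k) z = dot v z * k" "dot z (\<lambda>a. v a * k) = dot z v * k"
  and dot_divide: "dot (\<lambda>a. v a / k) z = dot v z / k" "dot z (\<lambda>a. v a / k) = dot z v / k"
  by (simp_all add: dot_def algebra_simps sum.distrib sum_subtractf sum_negf sum_distrib_left sum_divide_distrib)

lemma TT_add: "TT T (\<lambda>a. v a + w a) z b = TT T v z b + TT T w z b" "TT T z (\<lambda>a. v a + w a) b = TT T z v b + TT T z w b"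
  and TT_diff: "TT T (\<lambda>a. v a - w a) z b = TT T v z b - TT T w z b" "TT T z (\<lambda>a. v a - w a) b = TT T z v b - TT T z w b"
  and TT_minus: "TT T (\<lambda>a. - v a) z b = - TT T v z b" "TT T z (\<lambda>a. - v a) b = - TT T z v b"
  and TT_scale: "TT T (\<lambda>a. k * v a) z b = k * TT T v z b" "TT T z (\<lambda>a. k * v a) b = k * TT T z v b"
  and TT_scale': "TT T (\<lambda>a. v a * k) z b = TT T v z b * k" "TT T z (\<lambda>a. v a * k) b = TT T z v b * k"
  and TT_divide: "TT T (\<lambda>a. v a / k) z b = TT T v z b / k" "TT T z (\<lambda>a. v a / k) b = TT T z v b / k"
  by (simp_all add: TT_def algebra_simps sum.distrib sum_subtractf sum_negf sum_distrib_left sum_divide_distrib)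

lemmas multilinear = dot_add dot_diff dot_minus dot_scale dot_scale' dot_divide
  TT_add TT_diff TT_minus TT_scale TT_scale' TT_divide

lemma cnj_dot: "cnj (dot v w) = dot (\<lambda>a. cnj (v a)) (\<lambda>a. cnj (w a))"
  by (simp add: dot_def)

lemma cnj_TT: "cnj (TT T v w b) = TT T (\<lambda>a. cnj (v a)) (\<lambda>a. cnj (w a)) b"
  by (simp add: TT_def)

lemma has_derivative_dot:
  assumes "\<And>a. ((\<lambda>q. f q a) has_derivative (\<lambda>u. f' u a)) F" "\<And>a. ((\<lambda>q. g q a) has_derivative (\<lambda>u. g' u a)) F"
    and F: "F = at p"
  shows "((\<lambda>q. dot (f q) (g q)) has_derivative (\<lambda>u. dot (f' u) (g p) + dot (f p) (g' u))) F"
  unfolding dot_def F sum.distrib[symmetric]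
  by (rule has_derivative_sum)
    (use has_derivative_mult[OF assms(1)[unfolded F] assms(2)[unfolded F]] in \<open>simp add: add.commute\<close>)

lemma has_derivative_TT:
  assumes "\<And>a. ((\<lambda>q. f q a) has_derivative (\<lambda>u. f' u a)) F" "\<And>a. ((\<lambda>q. g q a) has_derivative (\<lambda>u. g' u a)) F"
    and F: "F = at p"
  shows "((\<lambda>q. TT T (f q) (g q) b) has_derivative (\<lambda>u. TT T (f' u) (g p) b + TT T (f p) (g' u) b)) F"
  unfolding TT_def F sum.distrib[symmetric] mult.assoc
  by (intro has_derivative_sum)
    (use has_derivative_mult_right[OF has_derivative_mult[OF assms(1)[unfolded F] assms(2)[unfolded F]]]
      in \<open>simp add: add.commute distrib_left\<close>)

locale cubic_chart =
  fixes T :: "'n::finite \<Rightarrow> 'n \<Rightarrow> 'n \<Rightarrow> real"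
    and X :: "'n \<Rightarrow> 'a::euclidean_space \<Rightarrow> complex"
    and rh ph Zt0 Z0 :: "'a \<Rightarrow> real" and Zt Z :: "'n \<Rightarrow> 'a \<Rightarrow> real"
  assumes T_sym: "\<And>a b d. T a b d = T b a d" "\<And>a b d. T a b d = T a d b"
    and lin: "\<And>a. linear (X a)" "linear rh" "linear ph" "linear Zt0" "linear Z0"
      "\<And>a. linear (Zt a)" "\<And>a. linear (Z a)"
begin

abbreviation tt where "tt \<equiv> TT T"

lemma tt_sym: "tt v w b = tt w v b"
proof -
  have "tt v w b = (\<Sum>d\<in>UNIV. \<Sum>a\<in>UNIV. of_real (T b a d) * v a * w d)"
    unfolding TT_def by (rule sum.swap)
  then show ?thesis by (simp add: TT_def T_sym(2)[of b] mult_ac)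
qed

lemma tri_sym: "dot u (tt v w) = dot v (tt u w)"
proof -
  have "dot u (tt v w) = (\<Sum>b\<in>UNIV. \<Sum>a\<in>UNIV. \<Sum>d\<in>UNIV. u a * (of_real (T a b d) * v b * w d))"
    unfolding dot_def TT_def sum_distrib_left by (rule sum.swap)
  then show ?thesis
    unfolding dot_def TT_def sum_distrib_left by (simp add: T_sym(1) mult_ac)
qed

definition xc :: "'a \<Rightarrow> 'n \<Rightarrow> complex" where "xc q a = of_real (Im (X a q))"
definition yc :: "'a \<Rightarrow> 'n \<Rightarrow> complex" where "yc q a = of_real (Re (X a q))"
definition XX :: "'a \<Rightarrow> 'n \<Rightarrow> complex" where "XX q a = X a q"
definition XB :: "'a \<Rightarrow> 'n \<Rightarrow> complex" where "XB q a = cnj (X a q)"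
definition Zc :: "'a \<Rightarrow> 'n \<Rightarrow> complex" where "Zc q a = of_real (Z a q)"
definition Ztc :: "'a \<Rightarrow> 'n \<Rightarrow> complex" where "Ztc q a = of_real (Zt a q)"

lemma XX_eq: "XX q = (\<lambda>a. yc q a + \<i> * xc q a)" "XB q = (\<lambda>a. yc q a - \<i> * xc q a)"
  by (auto simp: XX_def XB_def xc_def yc_def fun_eq_iff complex_eq_iff)

lemma cnj_coords [simp]: "cnj (xc q a) = xc q a" "cnj (yc q a) = yc q a" "cnj (XX q a) = XB q a" "cnj (XB q a) = XX q a"
  "cnj (Zc q a) = Zc q a" "cnj (Ztc q a) = Ztc q a"
  by (simp_all add: xc_def yc_def XX_def XB_def Zc_def Ztc_def)

definition H1 :: "('n \<Rightarrow> complex) \<Rightarrow> 'n \<Rightarrow> complex" where "H1 w a = tt w w a / 2"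
definition H0 :: "('n \<Rightarrow> complex) \<Rightarrow> complex" where "H0 w = dot (H1 w) w / 3"

abbreviation hc where "hc q \<equiv> H0 (xc q)"
abbreviation hd where "hd q \<equiv> H1 (xc q)"

definition vol :: "'a \<Rightarrow> real" where "vol q = Re (hc q)"

lemma cnj_H1: "cnj (H1 w a) = H1 (\<lambda>a. cnj (w a)) a"
  by (simp add: H1_def cnj_TT)

lemma cnj_H0: "cnj (H0 w) = H0 (\<lambda>a. cnj (w a))"
  by (simp add: H0_def cnj_dot cnj_H1)

lemma cnj_h [simp]: "cnj (hc q) = hc q" "cnj (hd q a) = hd q a"
  by (simp_all add: cnj_H0 cnj_H1)

lemma hc_vol: "hc q = of_real (vol q)"
  unfolding vol_def by (rule of_real_Re[symmetric]) (simp add: Reals_cnj_iff)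

lemma dot_hd_x: "dot (hd q) (xc q) = 3 * hc q"
  by (simp add: H0_def)

lemma tt_x_x: "tt (xc q) (xc q) a = 2 * hd q a"
  by (simp add: H1_def)

lemma dot_x_tt: "dot (xc q) (tt (xc q) v) = 2 * dot (hd q) v"
proof -
  have "dot (xc q) (tt (xc q) v) = dot v (tt (xc q) (xc q))"
    by (metis tri_sym tt_sym dot_sym ext)
  also have "\<dots> = 2 * dot (hd q) v"
    by (simp add: tt_x_x[abs_def] dot_scale dot_sym)
  finally show ?thesis .
qed

lemma bounded_linear_coords: "bounded_linear (X a)" "bounded_linear rh" "bounded_linear ph" "bounded_linear Zt0"
  "bounded_linear Z0" "bounded_linear (Zt a)" "bounded_linear (Z a)"
  using lin by (simp_all add: linear_conv_bounded_linear)

lemma has_derivative_coords: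
  "((\<lambda>q. XX q a) has_derivative (\<lambda>u. XX u a)) F"
  "((\<lambda>q. XB q a) has_derivative (\<lambda>u. XB u a)) F"
  "((\<lambda>q. xc q a) has_derivative (\<lambda>u. xc u a)) F"
  "((\<lambda>q. yc q a) has_derivative (\<lambda>u. yc u a)) F"
  "((\<lambda>q. Zc q a) has_derivative (\<lambda>u. Zc u a)) F"
  "((\<lambda>q. Ztc q a) has_derivative (\<lambda>u. Ztc u a)) F"
  "(rh has_derivative rh) F"
  "(ph has_derivative ph) F"
  "(Zt0 has_derivative Zt0) F"
  "(Z0 has_derivative Z0) F"
  unfolding XX_def XB_def xc_def yc_def Zc_def Ztc_def
  by (intro has_derivative_of_real has_derivative_Re has_derivative_Im has_derivative_cnj
      bounded_linear_imp_has_derivative bounded_linear_coords)+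

lemma has_derivative_H1:
  assumes "\<And>a. ((\<lambda>q. w q a) has_derivative (\<lambda>u. w' u a)) (at q)"
  shows "((\<lambda>q. H1 (w q) a) has_derivative (\<lambda>u. tt (w q) (w' u) a)) (at q)"
proof -
  have "((\<lambda>q. tt (w q) (w q) a / 2) has_derivative (\<lambda>u. (tt (w' u) (w q) a + tt (w q) (w' u) a) / 2)) (at q)"
    by (intro bounded_linear.has_derivative[OF bounded_linear_divide] has_derivative_TT assms refl)
  then show ?thesis by (simp add: H1_def tt_sym[of _ "w q"])
qed

lemma has_derivative_H0:
  assumes "\<And>a. ((\<lambda>q. w q a) has_derivative (\<lambda>u. w' u a)) (at q)"
  shows "((\<lambda>q. H0 (w q)) has_derivative (\<lambda>u. dot (H1 (w q)) (w' u))) (at q)"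
proof -
  have "((\<lambda>q. dot (H1 (w q)) (w q) / 3) has_derivative
      (\<lambda>u. (dot (tt (w q) (w' u)) (w q) + dot (H1 (w q)) (w' u)) / 3)) (at q)"
    by (intro bounded_linear.has_derivative[OF bounded_linear_divide] has_derivative_dot has_derivative_H1 assms refl)
  moreover have "dot (tt (w q) (w' u)) (w q) = 2 * dot (H1 (w q)) (w' u)" for u
  proof -
    have "dot (tt (w q) (w' u)) (w q) = dot (w q) (tt (w' u) (w q))"
      by (metis dot_sym tt_sym ext)
    also have "\<dots> = dot (w' u) (tt (w q) (w q))" by (rule tri_sym)
    finally show ?thesis by (simp add: H1_def[abs_def] dot_divide dot_sym)
  qed
  ultimately show ?thesis by (simp add: H0_def)
qed

text \<open>The translation-invariant forms.\<close>

definition pf :: "'a \<Rightarrow> 'a \<Rightarrow> 'n \<Rightarrow> complex" where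
  "pf q v a = Zc v a - yc q a * of_real (Z0 v)"
definition qf :: "'a \<Rightarrow> 'a \<Rightarrow> 'n \<Rightarrow> complex" where
  "qf q v a = Ztc v a + tt (yc q) (Zc v) a - H1 (yc q) a * of_real (Z0 v)"
definition q0f :: "'a \<Rightarrow> 'a \<Rightarrow> complex" where
  "q0f q v = of_real (Zt0 v) + dot (yc q) (Ztc v) + dot (H1 (yc q)) (Zc v) - H0 (yc q) * of_real (Z0 v)"
abbreviation p0f :: "'a \<Rightarrow> complex" where "p0f v \<equiv> of_real (Z0 v)"

lemma cnj_forms [simp]: "cnj (pf q v a) = pf q v a" "cnj (qf q v a) = qf q v a" "cnj (q0f q v) = q0f q v"
  by (simp_all add: pf_def qf_def q0f_def cnj_TT cnj_dot cnj_H1 cnj_H0)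

lemma has_derivative_pf: "((\<lambda>q. pf q v a) has_derivative (\<lambda>u. - (yc u a * p0f v))) (at q)"
  unfolding pf_def by (auto intro!: derivative_eq_intros has_derivative_coords)

lemma has_derivative_qf: "((\<lambda>q. qf q v a) has_derivative (\<lambda>u. tt (yc u) (pf q v) a)) (at q)"
proof -
  have "((\<lambda>q. qf q v a) has_derivative
      (\<lambda>u. 0 + (tt (yc u) (Zc v) a + tt (yc q) (\<lambda>a. 0) a) - (tt (yc q) (yc u) a * p0f v))) (at q)"
    unfolding qf_def
    by (intro has_derivative_diff has_derivative_add has_derivative_const has_derivative_TT
        has_derivative_mult_left has_derivative_H1 has_derivative_coords refl)
  moreover have "tt (yc u) (pf q v) a = tt (yc u) (Zc v) a - tt (yc q) (yc u) a * p0f v" for u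
    unfolding pf_def by (simp add: TT_diff TT_scale' tt_sym)
  moreover have "tt w (\<lambda>a. 0) a = 0" for w by (simp add: TT_def)
  ultimately show ?thesis by simp
qed

lemma has_derivative_q0f: "((\<lambda>q. q0f q v) has_derivative (\<lambda>u. dot (yc u) (qf q v))) (at q)"
proof -
  have "((\<lambda>q. q0f q v) has_derivative
      (\<lambda>u. 0 + (dot (yc u) (Ztc v) + dot (yc q) (\<lambda>a. 0)) + (dot (tt (yc q) (yc u)) (Zc v) + dot (H1 (yc q)) (\<lambda>a. 0))
        - (dot (H1 (yc q)) (yc u) * p0f v))) (at q)"
    unfolding q0f_def
    by (intro has_derivative_diff has_derivative_add has_derivative_const has_derivative_dot
        has_derivative_mult_left has_derivative_H1 has_derivative_H0 has_derivative_coords refl)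
  moreover have "dot (yc u) (qf q v) = dot (yc u) (Ztc v) + dot (tt (yc q) (yc u)) (Zc v) - dot (H1 (yc q)) (yc u) * p0f v" for u
  proof -
    have "dot (tt (yc q) (yc u)) (Zc v) = dot (yc u) (tt (yc q) (Zc v))"
      by (metis dot_sym tri_sym tt_sym ext)
    then show ?thesis
      unfolding qf_def by (simp add: multilinear dot_sym[of "yc u" "H1 (yc q)"])
  qed
  moreover have "dot w (\<lambda>a. 0) = 0" for w :: "'n \<Rightarrow> complex" by (simp add: dot_def)
  ultimately show ?thesis by simp
qed

text \<open>The Kaehler metric.\<close>

definition Kv :: "'a \<Rightarrow> ('n \<Rightarrow> complex) \<Rightarrow> 'n \<Rightarrow> complex" where
  "Kv q w a = (hd q a * dot (hd q) w / (hc q)\<^sup>2 - tt (xc q) w a / hc q) / 4"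

definition K3 :: "'a \<Rightarrow> ('n \<Rightarrow> complex) \<Rightarrow> ('n \<Rightarrow> complex) \<Rightarrow> 'n \<Rightarrow> complex" where
  "K3 q s w a = (- tt s w a / hc q
     + (tt (xc q) s a * dot (hd q) w + dot (hd q) s * tt (xc q) w a + hd q a * dot s (tt (xc q) w)) / (hc q)\<^sup>2
     - 2 * hd q a * dot (hd q) s * dot (hd q) w / (hc q)^3) / 4"

lemma K3_sym: "K3 q s w a = K3 q w s a"
proof -
  have "dot s (tt (xc q) w) = dot w (tt (xc q) s)"
    by (metis dot_sym tri_sym tt_sym ext)
  then show ?thesis by (simp add: K3_def tt_sym[of s] add_ac mult_ac)
qed

lemma Kv_linear: "Kv q (\<lambda>a. v a + w a) b = Kv q v b + Kv q w b" "Kv q (\<lambda>a. v a - w a) b = Kv q v b - Kv q w b"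
  "Kv q (\<lambda>a. - v a) b = - Kv q v b" "Kv q (\<lambda>a. k * v a) b = k * Kv q v b" "Kv q (\<lambda>a. v a * k) b = Kv q v b * k"
  by (simp_all add: Kv_def multilinear ring_distribs add_divide_distrib diff_divide_distrib)

lemma K3_linear: "K3 q (\<lambda>a. v a + w a) z b = K3 q v z b + K3 q w z b" "K3 q (\<lambda>a. v a - w a) z b = K3 q v z b - K3 q w z b"
  "K3 q (\<lambda>a. - v a) z b = - K3 q v z b" "K3 q (\<lambda>a. k * v a) z b = k * K3 q v z b"
  by (simp_all add: K3_def multilinear ring_distribs add_divide_distrib diff_divide_distrib mult_ac)

lemma K3_linear_right: "K3 q z (\<lambda>a. v a + w a) b = K3 q z v b + K3 q z w b" "K3 q z (\<lambda>a. v a - w a) b = K3 q z v b - K3 q z w b"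
  "K3 q z (\<lambda>a. - v a) b = - K3 q z v b" "K3 q z (\<lambda>a. k * v a) b = k * K3 q z v b"
  by (simp_all add: K3_sym[of q z] K3_linear)

lemma dot_Kv_sym: "dot v (Kv q w) = dot w (Kv q v)"
proof -
  have "dot v (tt (xc q) w) = dot w (tt (xc q) v)"
    by (metis dot_sym tri_sym tt_sym ext)
  then show ?thesis
    by (simp add: Kv_def[abs_def] multilinear dot_sym[of _ "hd q"] mult_ac)
qed

lemma dot_K3_sym: "dot v (K3 q s w) = dot s (K3 q v w)"
proof -
  have "dot v (tt s w) = dot s (tt v w)" by (rule tri_sym)
  moreover have "dot v (tt (xc q) s) = dot s (tt (xc q) v)" for v s
    by (metis dot_sym tri_sym tt_sym ext)
  ultimately show ?thesis
    by (simp add: K3_def[abs_def] multilinear dot_sym[of _ "hd q"] mult_ac add_ac)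
qed

lemma cnj_Kv: "cnj (Kv q w a) = Kv q (\<lambda>a. cnj (w a)) a"
  by (simp add: Kv_def cnj_TT cnj_dot)

lemma cnj_K3: "cnj (K3 q s w a) = K3 q (\<lambda>a. cnj (s a)) (\<lambda>a. cnj (w a)) a"
  by (simp add: K3_def cnj_TT cnj_dot)

lemma has_derivative_hc: "(hc has_derivative (\<lambda>u. dot (hd q) (xc u))) (at q)"
  by (rule has_derivative_H0) (rule has_derivative_coords)

lemma has_derivative_hd: "((\<lambda>q. hd q a) has_derivative (\<lambda>u. tt (xc q) (xc u) a)) (at q)"
  by (rule has_derivative_H1) (rule has_derivative_coords)

lemma has_derivative_Kv:
  assumes h: "hc q \<noteq> 0" and w: "\<And>a. ((\<lambda>q. w q a) has_derivative (\<lambda>u. w' u a)) (at q)"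
  shows "((\<lambda>q. Kv q (w q) a) has_derivative (\<lambda>u. K3 q (w q) (xc u) a + Kv q (w' u) a)) (at q)"
proof -
  have inv: "((\<lambda>q. inverse (hc q)) has_derivative (\<lambda>u. - (inverse (hc q) * dot (hd q) (xc u) * inverse (hc q)))) (at q)"
    by (rule Deriv.has_derivative_inverse[OF h has_derivative_hc])
  have dw: "((\<lambda>q. dot (hd q) (w q)) has_derivative (\<lambda>u. dot (tt (xc q) (xc u)) (w q) + dot (hd q) (w' u))) (at q)"
    by (intro has_derivative_dot has_derivative_hd w refl)
  have tw: "((\<lambda>q. tt (xc q) (w q) a) has_derivative (\<lambda>u. tt (xc u) (w q) a + tt (xc q) (w' u) a)) (at q)"
    by (intro has_derivative_TT has_derivative_coords w refl)
  have sy: "dot (tt (xc q) (xc u)) (w q) = dot (w q) (tt (xc q) (xc u))" for u by (rule dot_sym)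
  have alg: "(H * Hw * (inverse h * - (inverse h * Hu * inverse h) + - (inverse h * Hu * inverse h) * inverse h) +
      (H * (wtu + Hw') + tu * Hw) * (inverse h * inverse h) -
      (tw * - (inverse h * Hu * inverse h) + (twu + tw') * inverse h)) / 4 =
     (- twu / h + (tw * Hu + Hw * tu + H * wtu) / h\<^sup>2 - 2 * H * Hw * Hu / h ^ 3) / 4 + (H * Hw' / h\<^sup>2 - tw' / h) / 4"
    if "h \<noteq> 0" for H Hw h Hu wtu Hw' tu tw twu tw' :: complex
  proof -
    define i where "i = inverse h"
    have div: "x / h = x * i" "x / h\<^sup>2 = x * (i * i)" "x / h ^ 3 = x * (i * (i * i))" for x
      by (simp_all add: i_def divide_inverse power2_eq_square power3_eq_cube)
    show ?thesis unfolding i_def[symmetric] div by (simp add: algebra_simps add_divide_distrib diff_divide_distrib)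
  qed
  have "((\<lambda>q. (hd q a * dot (hd q) (w q) * (inverse (hc q) * inverse (hc q)) - tt (xc q) (w q) a * inverse (hc q)) / 4)
      has_derivative (\<lambda>u. K3 q (w q) (xc u) a + Kv q (w' u) a)) (at q)"
    by (rule has_derivative_eq_rhs[OF bounded_linear.has_derivative[OF bounded_linear_divide
          has_derivative_diff[OF has_derivative_mult[OF has_derivative_mult[OF has_derivative_hd dw] has_derivative_mult[OF inv inv]]
          has_derivative_mult[OF tw inv]]]])
      (simp only: K3_def Kv_def fun_eq_iff sy tt_sym[of "w q"], intro allI, rule alg[OF h])
  moreover have "Kv q (w q) a = (hd q a * dot (hd q) (w q) * (inverse (hc q) * inverse (hc q)) - tt (xc q) (w q) a * inverse (hc q)) / 4" for q
    unfolding Kv_def power2_eq_square divide_inverse[of _ "hc q * hc q"] divide_inverse[of _ "hc q"] inverse_mult_distrib ..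
  ultimately show ?thesis by presburger
qed

definition rr :: "'a \<Rightarrow> complex" where "rr q = of_real (rh q)"
definition tau :: "'a \<Rightarrow> complex" where "tau q = of_real (1 / sqrt (8 * vol q * rh q))"
definition kap :: "'a \<Rightarrow> 'a \<Rightarrow> complex" where "kap q u = \<i> / (2 * hc q) * dot (hd q) (yc u)"
definition kv :: "'a \<Rightarrow> 'n \<Rightarrow> complex" where "kv q a = \<i> * hd q a / (2 * hc q)"
definition bh :: "'a \<Rightarrow> 'a \<Rightarrow> complex" where
  "bh q v = q0f q v - dot (hd q) (pf q v) + \<i> * (dot (xc q) (qf q v) + hc q * p0f v)"
definition Af :: "'a \<Rightarrow> 'a \<Rightarrow> 'n \<Rightarrow> complex" where
  "Af q v a = qf q v a + hd q a * p0f v + \<i> * tt (xc q) (pf q v) a"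
definition bf :: "'a \<Rightarrow> 'a \<Rightarrow> complex" where "bf q v = \<i> * tau q * bh q v"
definition af :: "'a \<Rightarrow> 'a \<Rightarrow> 'n \<Rightarrow> complex" where "af q v a = - \<i> * tau q * (Af q v a + kv q a * bh q v)"

lemma has_derivative_vol: "(vol has_derivative (\<lambda>u. Re (dot (hd q) (xc u)))) (at q)"
  unfolding vol_def by (rule has_derivative_Re[OF has_derivative_hc])

lemma cnj_dot_hd: "cnj (dot (hd q) (xc u)) = dot (hd q) (xc u)"
  by (simp add: cnj_dot)

lemma Re_dot_hd: "of_real (Re (dot (hd q) (xc u))) = dot (hd q) (xc u)"
  by (rule of_real_Re) (simp add: Reals_cnj_iff cnj_dot)

lemma has_derivative_tau:
  assumes "vol q > 0" "rh q > 0"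
  shows "(tau has_derivative (\<lambda>u. - tau q * (rr u / (2 * rr q) + dot (hd q) (xc u) / (2 * hc q)))) (at q)"
proof -
  have pos: "8 * vol q * rh q > 0" using assms by simp
  have der: "((\<lambda>t. 1 / sqrt t) has_real_derivative (- (1 / sqrt t) / (2 * t))) (at t)" if "t > 0" for t :: real
    using that by (auto intro!: derivative_eq_intros simp: field_simps)
  have in': "((\<lambda>q. 8 * vol q * rh q) has_derivative (\<lambda>u. 8 * (Re (dot (hd q) (xc u)) * rh q + vol q * rh u))) (at q)"
    by (auto intro!: derivative_eq_intros has_derivative_vol has_derivative_coords simp: algebra_simps)
  have "((\<lambda>q. 1 / sqrt (8 * vol q * rh q)) has_derivative
      (\<lambda>u. - (1 / sqrt (8 * vol q * rh q)) / (2 * (8 * vol q * rh q)) * (8 * (Re (dot (hd q) (xc u)) * rh q + vol q * rh u)))) (at q)"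
    using has_derivative_compose[OF in' der[OF pos, unfolded has_field_derivative_def]] .
  from has_derivative_of_real[OF this]
  have "(tau has_derivative (\<lambda>u. complex_of_real (- (1 / sqrt (8 * vol q * rh q)) / (2 * (8 * vol q * rh q)) * (8 * (Re (dot (hd q) (xc u)) * rh q + vol q * rh u))))) (at q)"
    unfolding tau_def .
  moreover have "complex_of_real (- (1 / sqrt (8 * vol q * rh q)) / (2 * (8 * vol q * rh q)) * (8 * (Re (dot (hd q) (xc u)) * rh q + vol q * rh u)))
     = - tau q * (rr u / (2 * rr q) + dot (hd q) (xc u) / (2 * hc q))" for u
    unfolding of_real_mult of_real_add of_real_divide of_real_minus Re_dot_hd hc_vol rr_def tau_def using assms
    by (simp add: field_simps)
  ultimately show ?thesis by simp
qed

lemma Kv_x: "hc q \<noteq> 0 \<Longrightarrow> Kv q (xc q) a = hd q a / (4 * hc q)"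
  by (simp add: Kv_def dot_hd_x tt_x_x field_simps power2_eq_square)

lemma has_derivative_bh:
  "((\<lambda>q. bh q v) has_derivative (\<lambda>u. dot (XX u) (Af q v))) (at q)"
proof -
  have dp: "((\<lambda>q. dot (hd q) (pf q v)) has_derivative
      (\<lambda>u. dot (tt (xc q) (xc u)) (pf q v) + dot (hd q) (\<lambda>a. - (yc u a * p0f v)))) (at q)"
    by (intro has_derivative_dot has_derivative_hd has_derivative_pf refl)
  have dq: "((\<lambda>q. dot (xc q) (qf q v)) has_derivative
      (\<lambda>u. dot (xc u) (qf q v) + dot (xc q) (tt (yc u) (pf q v)))) (at q)"
    by (intro has_derivative_dot has_derivative_coords has_derivative_qf refl)
  have "((\<lambda>q. bh q v) has_derivative (\<lambda>u. dot (yc u) (qf q v)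
      - (dot (tt (xc q) (xc u)) (pf q v) + dot (hd q) (\<lambda>a. - (yc u a * p0f v)))
      + \<i> * ((dot (xc u) (qf q v) + dot (xc q) (tt (yc u) (pf q v))) + dot (hd q) (xc u) * p0f v))) (at q)"
    unfolding bh_def
    by (intro has_derivative_add has_derivative_diff has_derivative_q0f dp dq has_derivative_mult_right
        has_derivative_mult_left has_derivative_hc)
  moreover have "dot (yc u) (qf q v)
      - (dot (tt (xc q) (xc u)) (pf q v) + dot (hd q) (\<lambda>a. - (yc u a * p0f v)))
      + \<i> * ((dot (xc u) (qf q v) + dot (xc q) (tt (yc u) (pf q v))) + dot (hd q) (xc u) * p0f v)
      = dot (XX u) (Af q v)" for u
  proof -
    have "dot (tt (xc q) (xc u)) (pf q v) = dot (xc u) (tt (xc q) (pf q v))"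
      by (metis dot_sym tri_sym tt_sym ext)
    moreover have "dot (xc q) (tt (yc u) (pf q v)) = dot (yc u) (tt (xc q) (pf q v))"
      by (rule tri_sym)
    ultimately show ?thesis
      unfolding Af_def XX_eq by (simp add: multilinear dot_sym[of _ "hd q"] algebra_simps)
  qed
  ultimately show ?thesis by simp
qed

lemma has_derivative_Af:
  "((\<lambda>q. Af q v a) has_derivative (\<lambda>u. tt (XX u) (pf q v) a - \<i> * tt (xc q) (XX u) a * p0f v)) (at q)"
proof -
  have "((\<lambda>q. Af q v a) has_derivative (\<lambda>u. tt (yc u) (pf q v) a + tt (xc q) (xc u) a * p0f v
     + \<i> * (tt (xc u) (pf q v) a + tt (xc q) (\<lambda>a. - (yc u a * p0f v)) a))) (at q)"
    unfolding Af_def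
    by (intro has_derivative_add has_derivative_mult_right has_derivative_mult_left has_derivative_hd
        has_derivative_qf has_derivative_TT has_derivative_coords has_derivative_pf refl)
  moreover have "tt (yc u) (pf q v) a + tt (xc q) (xc u) a * p0f v
     + \<i> * (tt (xc u) (pf q v) a + tt (xc q) (\<lambda>a. - (yc u a * p0f v)) a)
     = tt (XX u) (pf q v) a - \<i> * tt (xc q) (XX u) a * p0f v" for u
    unfolding XX_eq by (simp add: multilinear algebra_simps)
  ultimately show ?thesis by simp
qed

lemma has_derivative_kv:
  assumes "hc q \<noteq> 0"
  shows "((\<lambda>q. kv q a) has_derivative (\<lambda>u. - 2 * \<i> * Kv q (xc u) a)) (at q)"
proof -
  have inv: "((\<lambda>q. inverse (hc q)) has_derivative (\<lambda>u. - (inverse (hc q) * dot (hd q) (xc u) * inverse (hc q)))) (at q)"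
    by (rule Deriv.has_derivative_inverse[OF assms has_derivative_hc])
  have alg: "\<i> / 2 * (H * - (inverse h * D * inverse h) + t * inverse h) = - 2 * \<i> * ((H * D / h\<^sup>2 - t / h) / 4)"
    if "h \<noteq> 0" for H D t h :: complex
    using that by (simp add: field_simps power2_eq_square)
  have "((\<lambda>q. \<i> / 2 * (hd q a * inverse (hc q))) has_derivative (\<lambda>u. - 2 * \<i> * Kv q (xc u) a)) (at q)"
    by (rule has_derivative_eq_rhs[OF has_derivative_mult_right[OF has_derivative_mult[OF has_derivative_hd inv]]])
      (simp only: Kv_def fun_eq_iff, intro allI, rule alg[OF assms])
  moreover have "kv q a = \<i> / 2 * (hd q a * inverse (hc q))" for q
    by (simp add: kv_def field_simps)
  ultimately show ?thesis by presburger
qed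

lemma kv_dot: "dot (kv q) w = \<i> * dot (hd q) w / (2 * hc q)" "dot w (kv q) = \<i> * dot (hd q) w / (2 * hc q)"
proof -
  show "dot (kv q) w = \<i> * dot (hd q) w / (2 * hc q)"
    unfolding kv_def by (simp add: multilinear)
  then show "dot w (kv q) = \<i> * dot (hd q) w / (2 * hc q)" by (simp add: dot_sym[of w "kv q"])
qed

lemma has_derivative_bf:
  assumes "vol q > 0" "rh q > 0"
  shows "((\<lambda>q. bf q v) has_derivative
     (\<lambda>u. - (rr u / (2 * rr q) + kap q u) * bf q v - dot (XX u) (af q v))) (at q)"
proof -
  have h: "hc q \<noteq> 0" using assms by (simp add: hc_vol)
  have "((\<lambda>q. bf q v) has_derivative
     (\<lambda>u. \<i> * (tau q * dot (XX u) (Af q v) + (- tau q * (rr u / (2 * rr q) + dot (hd q) (xc u) / (2 * hc q))) * bh q v))) (at q)"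
    unfolding bf_def mult.assoc
    using has_derivative_mult_right[OF has_derivative_mult[OF has_derivative_tau[OF assms] has_derivative_bh]]
    by (simp only: mult.assoc)
  moreover have "\<i> * (tau q * dot (XX u) (Af q v) + (- tau q * (rr u / (2 * rr q) + dot (hd q) (xc u) / (2 * hc q))) * bh q v)
     = - (rr u / (2 * rr q) + kap q u) * bf q v - dot (XX u) (af q v)" for u
    unfolding af_def bf_def kap_def
    by (simp add: multilinear kv_dot) (simp add: XX_eq multilinear algebra_simps add_divide_distrib diff_divide_distrib)
  ultimately show ?thesis by simp
qed

end

locale qmap_chart = cubic_chart T X rh ph Zt0 Z0 Zt Z
  for T :: "'n::finite \<Rightarrow> 'n \<Rightarrow> 'n \<Rightarrow> real" and X :: "'n \<Rightarrow> 'a::euclidean_space \<Rightarrow> complex"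
    and rh ph Zt0 Z0 Zt Z +
  fixes S :: "'a set" and Qm :: "'a \<Rightarrow> 'n \<Rightarrow> 'n \<Rightarrow> complex"
  assumes S_open: "open S" and vol_pos: "\<And>q. q \<in> S \<Longrightarrow> vol q > 0" and rh_pos: "\<And>q. q \<in> S \<Longrightarrow> rh q > 0"
    and Qm_real: "\<And>q a b. cnj (Qm q a b) = Qm q a b"
    and Kv_Qm: "\<And>q w a. q \<in> S \<Longrightarrow> Kv q (\<lambda>a. dot (Qm q a) w) a = w a"
    and Qm_Kv: "\<And>q w a. q \<in> S \<Longrightarrow> dot (Qm q a) (Kv q w) = w a"
    and Qm_differentiable: "\<And>q a b. q \<in> S \<Longrightarrow> (\<lambda>q. Qm q a b) differentiable (at q)"
begin

lemma h_nonzero: "q \<in> S \<Longrightarrow> hc q \<noteq> 0"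
  using vol_pos by (force simp: hc_vol)

definition Qv :: "'a \<Rightarrow> ('n \<Rightarrow> complex) \<Rightarrow> 'n \<Rightarrow> complex" where "Qv q w a = dot (Qm q a) w"

lemma Kv_Qv: "q \<in> S \<Longrightarrow> Kv q (Qv q w) = w"
  using Kv_Qm by (simp add: Qv_def[abs_def] fun_eq_iff)

lemma Qv_Kv: "q \<in> S \<Longrightarrow> Qv q (Kv q w) = w"
  using Qm_Kv by (simp add: Qv_def[abs_def] fun_eq_iff)

lemma Qv_sym: "q \<in> S \<Longrightarrow> dot (Qv q w) z = dot w (Qv q z)"
  by (metis Kv_Qv dot_Kv_sym dot_sym)

lemma Qv_linear: "Qv q (\<lambda>a. v a + w a) b = Qv q v b + Qv q w b" "Qv q (\<lambda>a. v a - w a) b = Qv q v b - Qv q w b"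
  "Qv q (\<lambda>a. - v a) b = - Qv q v b" "Qv q (\<lambda>a. k * v a) b = k * Qv q v b" "Qv q (\<lambda>a. v a * k) b = Qv q v b * k"
  by (simp_all add: Qv_def multilinear)

lemma cnj_Qv: "cnj (Qv q w a) = Qv q (\<lambda>a. cnj (w a)) a"
  by (simp add: Qv_def cnj_dot Qm_real)

lemma has_derivative_Qv:
  assumes q: "q \<in> S" and w: "\<And>a. ((\<lambda>q. w q a) has_derivative (\<lambda>u. w' u a)) (at q)"
  shows "((\<lambda>q. Qv q (w q) a) has_derivative (\<lambda>u. Qv q (\<lambda>a. w' u a - K3 q (Qv q (w q)) (xc u) a) a)) (at q)"
proof -
  define z' where "z' u a = frechet_derivative (\<lambda>q. Qv q (w q) a) (at q) u" for u a
  have "(\<lambda>q. Qv q (w q) a) differentiable (at q)" for a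
    unfolding Qv_def dot_def
    by (intro differentiable_sum ballI derivative_intros Qm_differentiable[OF q] differentiableI[OF w] finite)
  then have z': "((\<lambda>q. Qv q (w q) a) has_derivative (\<lambda>u. z' u a)) (at q)" for a
    unfolding z'_def by (rule frechet_derivative_works[THEN iffD1])
  have "((\<lambda>q. Kv q (Qv q (w q)) a) has_derivative (\<lambda>u. K3 q (Qv q (w q)) (xc u) a + Kv q (z' u) a)) (at q)" for a
    by (rule has_derivative_Kv[OF h_nonzero[OF q] z'])
  then have "((\<lambda>q. w q a) has_derivative (\<lambda>u. K3 q (Qv q (w q)) (xc u) a + Kv q (z' u) a)) (at q)" for a
    by (rule has_derivative_transform_within_open[OF _ S_open q]) (simp add: Kv_Qv)
  then have "w' u a = K3 q (Qv q (w q)) (xc u) a + Kv q (z' u) a" for u a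
    using has_derivative_unique[OF w] by metis
  then have "(\<lambda>a. w' u a - K3 q (Qv q (w q)) (xc u) a) = Kv q (z' u)" for u by (auto simp: fun_eq_iff)
  then have "z' u a = Qv q (\<lambda>a. w' u a - K3 q (Qv q (w q)) (xc u) a) a" for u a
    by (simp add: Qv_Kv[OF q])
  with z'[of a] show ?thesis by simp
qed

definition aup :: "'a \<Rightarrow> 'a \<Rightarrow> 'n \<Rightarrow> complex" where "aup q v = Qv q (af q v)"
definition aub :: "'a \<Rightarrow> 'a \<Rightarrow> 'n \<Rightarrow> complex" where "aub q v a = cnj (aup q v a)"
definition cf :: "'a \<Rightarrow> 'a \<Rightarrow> 'n \<Rightarrow> complex" where
  "cf q v a = 2 * (dot (hd q) (pf q v) + q0f q v) * xc q a - 4 * hc q * pf q v a"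
definition ef :: "'a \<Rightarrow> 'a \<Rightarrow> 'n \<Rightarrow> complex" where
  "ef q v a = Qv q (qf q v) a + 2 * (hc q * p0f v - dot (xc q) (qf q v)) * xc q a"

lemma cnj_tau [simp]: "cnj (tau q) = tau q"
  by (simp add: tau_def)

lemma Kv_cf: "q \<in> S \<Longrightarrow> Kv q (cf q v) a = hd q a * (q0f q v - dot (hd q) (pf q v)) / (2 * hc q) + tt (xc q) (pf q v) a"
  unfolding cf_def Kv_linear
  by (simp add: Kv_x h_nonzero) (simp add: Kv_def h_nonzero field_simps power2_eq_square)

lemma Kv_ef: "q \<in> S \<Longrightarrow> Kv q (ef q v) a = qf q v a + hd q a * p0f v / 2 - hd q a * dot (xc q) (qf q v) / (2 * hc q)"
  unfolding ef_def Kv_linear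
  by (simp add: Kv_x h_nonzero Kv_Qv) (simp add: h_nonzero field_simps)

lemma aup_eq:
  assumes q: "q \<in> S"
  shows "aup q v = (\<lambda>a. tau q * (cf q v a - \<i> * ef q v a))"
proof -
  have "Kv q (\<lambda>a. tau q * (cf q v a - \<i> * ef q v a)) a = af q v a" for a
    unfolding Kv_linear Kv_cf[OF q] Kv_ef[OF q] af_def Af_def bh_def kv_def
    using h_nonzero[OF q] by (simp add: field_simps)
  then have "af q v = Kv q (\<lambda>a. tau q * (cf q v a - \<i> * ef q v a))" by (simp add: fun_eq_iff)
  then show ?thesis by (simp add: aup_def Qv_Kv[OF q])
qed

lemma Kv_aup: "q \<in> S \<Longrightarrow> Kv q (aup q v) = af q v"
  by (simp add: aup_def Kv_Qv)

lemma cnj_cf_ef [simp]: "cnj (cf q v a) = cf q v a" "cnj (ef q v a) = ef q v a"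
  by (simp_all add: cf_def ef_def cnj_dot cnj_Qv)

lemma aub_eq: "q \<in> S \<Longrightarrow> aub q v = (\<lambda>a. tau q * (cf q v a + \<i> * ef q v a))"
  by (simp add: aub_def[abs_def] aup_eq)

lemma dot_hd_Qv: "q \<in> S \<Longrightarrow> dot (hd q) (Qv q w) = 4 * hc q * dot (xc q) w"
proof -
  assume q: "q \<in> S"
  have "dot (xc q) w = dot (xc q) (Kv q (Qv q w))" by (simp add: Kv_Qv[OF q])
  also have "\<dots> = dot (Qv q w) (Kv q (xc q))" by (rule dot_Kv_sym)
  also have "\<dots> = dot (hd q) (Qv q w) / (4 * hc q)"
    using Kv_x[OF h_nonzero[OF q]] by (simp add: dot_def sum_divide_distrib mult.commute)
  finally show ?thesis using h_nonzero[OF q] by simp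
qed

lemma dot_hd_cf: "dot (hd q) (cf q v) = 2 * hc q * dot (hd q) (pf q v) + 6 * hc q * q0f q v"
  unfolding cf_def by (simp add: multilinear dot_hd_x algebra_simps)

lemma dot_hd_ef: "q \<in> S \<Longrightarrow> dot (hd q) (ef q v) = 6 * (hc q)\<^sup>2 * p0f v - 2 * hc q * dot (xc q) (qf q v)"
  unfolding ef_def by (simp add: multilinear dot_hd_x dot_hd_Qv algebra_simps power2_eq_square)

lemma has_derivative_af:
  assumes q: "q \<in> S"
  shows "((\<lambda>q. af q v a) has_derivative (\<lambda>u. - (rr u / (2 * rr q) + kap q u) * af q v a
     - \<i> / 2 * K3 q (aup q v) (XX u) a - Kv q (XB u) a * bf q v
     + \<i> / (8 * hc q) * tt (XX u) (aub q v) a)) (at q)"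
proof -
  have h: "hc q \<noteq> 0" by (rule h_nonzero[OF q])
  have 1: "((\<lambda>q. af q v a) has_derivative
     (\<lambda>u. - \<i> * (tau q * ((tt (XX u) (pf q v) a - \<i> * tt (xc q) (XX u) a * p0f v)
        + (kv q a * dot (XX u) (Af q v) + - 2 * \<i> * Kv q (xc u) a * bh q v))
      + - tau q * (rr u / (2 * rr q) + dot (hd q) (xc u) / (2 * hc q)) * (Af q v a + kv q a * bh q v)))) (at q)"
    unfolding af_def mult.assoc[of "- \<i>"]
    by (rule has_derivative_mult_right[OF has_derivative_mult[OF has_derivative_tau[OF vol_pos[OF q] rh_pos[OF q]]
        has_derivative_add[OF has_derivative_Af has_derivative_mult[OF has_derivative_kv[OF h] has_derivative_bh]]]])
  have 2: "- \<i> * (tau q * ((tt (XX u) (pf q v) a - \<i> * tt (xc q) (XX u) a * p0f v)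
        + (kv q a * dot (XX u) (Af q v) + - 2 * \<i> * Kv q (xc u) a * bh q v))
      + - tau q * (rr u / (2 * rr q) + dot (hd q) (xc u) / (2 * hc q)) * (Af q v a + kv q a * bh q v))
     = - (rr u / (2 * rr q) + kap q u) * af q v a
     - \<i> / 2 * K3 q (aup q v) (XX u) a - Kv q (XB u) a * bf q v
     + \<i> / (8 * hc q) * tt (XX u) (aub q v) a" for u
  proof -
    define s where "s = dot (hd q) (aup q v)"
    have ttup: "tt (xc q) (aup q v) a = hd q a * s / hc q - 4 * hc q * af q v a" for a
    proof -
      have "Kv q (aup q v) a = af q v a" by (simp add: Kv_aup[OF q])
      then show ?thesis using h by (simp add: Kv_def s_def field_simps power2_eq_square)
    qed
    have up_tt: "dot (aup q v) (tt (xc q) (XX u)) = dot (hd q) (XX u) * s / hc q - 4 * hc q * dot (XX u) (af q v)"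
    proof -
      have "dot (aup q v) (tt (xc q) (XX u)) = dot (XX u) (tt (xc q) (aup q v))"
        by (metis dot_sym tri_sym tt_sym ext)
      also have "\<dots> = dot (XX u) (\<lambda>a. hd q a * (s / hc q) - 4 * hc q * af q v a)"
        by (simp add: ttup[abs_def])
      finally show ?thesis by (simp add: multilinear dot_sym[of "XX u" "hd q"])
    qed
    have s: "s = tau q * (2 * hc q * dot (hd q) (pf q v) + 6 * hc q * q0f q v
        - \<i> * (6 * (hc q)\<^sup>2 * p0f v - 2 * hc q * dot (xc q) (qf q v)))"
      unfolding s_def aup_eq[OF q] multilinear dot_hd_cf dot_hd_ef[OF q] ..
    have ub: "tt (XX u) (aub q v) a = tau q * (4 * (dot (hd q) (pf q v) + q0f q v) * tt (xc q) (XX u) a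
        - 8 * hc q * tt (XX u) (pf q v) a) - tt (aup q v) (XX u) a"
      unfolding aub_eq[OF q] aup_eq[OF q] cf_def
      by (simp add: multilinear tt_sym[of _ "XX u"] algebra_simps)
    have Xaf: "dot (XX u) (af q v) = - \<i> * tau q * (dot (XX u) (Af q v) + \<i> * dot (hd q) (XX u) / (2 * hc q) * bh q v)"
      unfolding af_def by (simp add: multilinear kv_dot algebra_simps)
    define hx hy tx ty where d: "hx = dot (hd q) (xc u)" "hy = dot (hd q) (yc u)" "tx = tt (xc q) (xc u) a" "ty = tt (xc q) (yc u) a"
    have XX: "dot (hd q) (XX u) = hy + \<i> * hx" "tt (xc q) (XX u) a = ty + \<i> * tx"
      "dot (hd q) (XB u) = hy - \<i> * hx" "tt (xc q) (XB u) a = ty - \<i> * tx"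
      unfolding XX_eq d by (simp_all add: multilinear)
    show ?thesis
      unfolding K3_def Kv_def ub up_tt ttup s_def[symmetric] Xaf bf_def kap_def XX
      unfolding XX d(1-4)[symmetric] af_def kv_def s
      unfolding bh_def
      using h by (simp add: field_simps power2_eq_square power3_eq_cube)
  qed
  show ?thesis using 1 unfolding 2 .
qed

lemma has_derivative_aup:
  assumes q: "q \<in> S"
  shows "((\<lambda>q. aup q v a) has_derivative (\<lambda>u. - (rr u / (2 * rr q) + kap q u) * aup q v a
     - \<i> / 2 * Qv q (K3 q (aup q v) (XB u)) a - XB u a * bf q v
     + \<i> / (8 * hc q) * Qv q (tt (XX u) (aub q v)) a)) (at q)"
proof -
  have "Qv q (\<lambda>a. - (rr u / (2 * rr q) + kap q u) * af q v a
     - \<i> / 2 * K3 q (aup q v) (XX u) a - Kv q (XB u) a * bf q v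
     + \<i> / (8 * hc q) * tt (XX u) (aub q v) a - K3 q (Qv q (af q v)) (xc u) a) a
    = - (rr u / (2 * rr q) + kap q u) * aup q v a
     - \<i> / 2 * Qv q (K3 q (aup q v) (XB u)) a - XB u a * bf q v
     + \<i> / (8 * hc q) * Qv q (tt (XX u) (aub q v)) a" for u
  proof -
    have x: "K3 q (aup q v) (XX u) = (\<lambda>a. K3 q (aup q v) (XB u) a + 2 * \<i> * K3 q (aup q v) (xc u) a)"
      unfolding XX_eq K3_linear_right by (simp add: fun_eq_iff)
    have "(\<lambda>a. - (rr u / (2 * rr q) + kap q u) * af q v a
     - \<i> / 2 * K3 q (aup q v) (XX u) a - Kv q (XB u) a * bf q v
     + \<i> / (8 * hc q) * tt (XX u) (aub q v) a - K3 q (Qv q (af q v)) (xc u) a)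
     = (\<lambda>a. - (rr u / (2 * rr q) + kap q u) * af q v a
     - \<i> / 2 * K3 q (aup q v) (XB u) a - Kv q (XB u) a * bf q v
     + \<i> / (8 * hc q) * tt (XX u) (aub q v) a)"
      unfolding aup_def[symmetric] x by (simp add: fun_eq_iff algebra_simps)
    then show ?thesis
      by (simp only: Qv_linear Qv_Kv[OF q] aup_def)
  qed
  with has_derivative_Qv[where w="\<lambda>q. af q v" and a=a, OF q has_derivative_af[OF q]] show ?thesis
    by (simp add: aup_def)
qed

lemma cnj_rr [simp]: "cnj (rr q) = rr q" by (simp add: rr_def)
lemma cnj_kap: "cnj (kap q u) = - kap q u" by (simp add: kap_def cnj_dot)
lemma cnj_aub [simp]: "cnj (aub q v a) = aup q v a" "cnj (aup q v a) = aub q v a"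
  by (simp_all add: aub_def)

lemma has_derivative_aub:
  assumes q: "q \<in> S"
  shows "((\<lambda>q. aub q v a) has_derivative (\<lambda>u. - (rr u / (2 * rr q) - kap q u) * aub q v a
     + \<i> / 2 * Qv q (K3 q (aub q v) (XX u)) a - XX u a * cnj (bf q v)
     - \<i> / (8 * hc q) * Qv q (tt (XB u) (aup q v)) a)) (at q)"
  using has_derivative_cnj[OF has_derivative_aup[OF q, where v=v and a=a]]
  by (simp add: cnj_kap cnj_Qv cnj_K3 cnj_TT)

lemma has_derivative_kap:
  assumes q: "q \<in> S"
  shows "((\<lambda>q. kap q v) has_derivative (\<lambda>u. - 2 * \<i> * dot (Kv q (xc u)) (yc v))) (at q)"
proof -
  have "((\<lambda>q. dot (kv q) (yc v)) has_derivative
      (\<lambda>u. dot (\<lambda>a. - 2 * \<i> * Kv q (xc u) a) (yc v) + dot (kv q) (\<lambda>a. 0))) (at q)"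
    by (intro has_derivative_dot has_derivative_kv h_nonzero[OF q] has_derivative_const refl)
  moreover have "dot w (\<lambda>a. 0) = 0" for w :: "'n \<Rightarrow> complex" by (simp add: dot_def)
  ultimately show ?thesis by (simp only: kv_dot dot_scale) (simp add: kap_def)
qed

definition Ps :: "'a \<Rightarrow> 'a \<Rightarrow> complex" where
  "Ps q v = of_real (ph v) + of_real (Z0 q) * of_real (Zt0 v) - of_real (Zt0 q) * of_real (Z0 v)
     + dot (Zc q) (Ztc v) - dot (Ztc q) (Zc v)"
definition a0 :: "'a \<Rightarrow> 'a \<Rightarrow> complex" where
  "a0 q v = - (inverse (2 * rr q) * (rr v - \<i> * Ps q v))"
definition symf :: "'a \<Rightarrow> 'a \<Rightarrow> complex" where
  "symf u v = of_real (Z0 u) * of_real (Zt0 v) - of_real (Zt0 u) * of_real (Z0 v)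
     + dot (Zc u) (Ztc v) - dot (Ztc u) (Zc v)"

lemma rr_nonzero: "q \<in> S \<Longrightarrow> rr q \<noteq> 0"
  using rh_pos by (force simp: rr_def)

lemma cnj_Ps [simp]: "cnj (Ps q v) = Ps q v" by (simp add: Ps_def cnj_dot)

lemma rr_a0: "q \<in> S \<Longrightarrow> rr v / rr q = - (a0 q v + cnj (a0 q v))"
  using rr_nonzero by (simp add: a0_def field_simps)

lemma has_derivative_a0:
  assumes q: "q \<in> S"
  shows "((\<lambda>q. a0 q v) has_derivative (\<lambda>u. - (rr u / rr q) * a0 q v + \<i> / (2 * rr q) * symf u v)) (at q)"
proof -
  have dr: "((\<lambda>q. 2 * rr q) has_derivative (\<lambda>u. 2 * rr u)) (at q)"
    unfolding rr_def by (intro has_derivative_mult_right has_derivative_of_real has_derivative_coords)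
  have nz: "2 * rr q \<noteq> 0" using rr_nonzero[OF q] by simp
  have z: "dot w (\<lambda>a. 0) = 0" for w :: "'n \<Rightarrow> complex" by (simp add: dot_def)
  have dP: "((\<lambda>q. Ps q v) has_derivative (\<lambda>u. symf u v)) (at q)"
  proof -
    have "((\<lambda>q. Ps q v) has_derivative (\<lambda>u. 0 + of_real (Z0 u) * of_real (Zt0 v) - of_real (Zt0 u) * of_real (Z0 v)
       + (dot (Zc u) (Ztc v) + dot (Zc q) (\<lambda>a. 0)) - (dot (Ztc u) (Zc v) + dot (Ztc q) (\<lambda>a. 0)))) (at q)"
      unfolding Ps_def
      by (intro has_derivative_add has_derivative_diff has_derivative_const has_derivative_mult_left
          has_derivative_of_real has_derivative_dot has_derivative_coords refl)
    then show ?thesis by (simp add: z symf_def)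
  qed
  have 1: "((\<lambda>q. a0 q v) has_derivative (\<lambda>u. - (inverse (2 * rr q) * (0 - \<i> * symf u v)
      + - (inverse (2 * rr q) * (2 * rr u) * inverse (2 * rr q)) * (rr v - \<i> * Ps q v)))) (at q)"
    unfolding a0_def
    by (intro has_derivative_minus has_derivative_mult Deriv.has_derivative_inverse[OF nz dr] has_derivative_diff
        has_derivative_const has_derivative_mult_right dP)
  have "- (inverse (2 * rr q) * (0 - \<i> * symf u v)
      + - (inverse (2 * rr q) * (2 * rr u) * inverse (2 * rr q)) * (rr v - \<i> * Ps q v))
      = - (rr u / rr q) * a0 q v + \<i> / (2 * rr q) * symf u v" for u
    using rr_nonzero[OF q] by (simp add: a0_def field_simps)
  with 1 show ?thesis by simp
qed

lemma symf_shift: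
  "symf u v = p0f u * q0f q v - q0f q u * p0f v + dot (pf q u) (qf q v) - dot (qf q u) (pf q v)"
proof -
  have 1: "dot (Zc u) (tt (yc q) (Zc v)) = dot (Zc v) (tt (yc q) (Zc u))"
    by (metis dot_sym tri_sym tt_sym ext)
  have 2: "dot (yc q) (tt (yc q) w) = 2 * dot (H1 (yc q)) w" for w
  proof -
    have "dot (yc q) (tt (yc q) w) = dot w (tt (yc q) (yc q))" by (metis dot_sym tri_sym tt_sym ext)
    then show ?thesis by (simp add: H1_def[abs_def] dot_divide dot_sym)
  qed
  have 3: "dot (yc q) (H1 (yc q)) = 3 * H0 (yc q)"
    by (simp add: H0_def dot_sym)
  show ?thesis
    unfolding symf_def pf_def qf_def q0f_def multilinear
    using 1 by (simp add: 2 3 dot_sym[of "Zc _" "H1 _"] dot_sym[of "Ztc _" "yc _"] dot_sym[of "tt _ _" "yc _"]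
        dot_sym[of "tt _ _" "Zc _"] dot_sym[of "H1 _" "yc _"] algebra_simps)
qed

lemma tau_squared: "q \<in> S \<Longrightarrow> tau q * tau q = 1 / (8 * hc q * rr q)"
proof -
  assume q: "q \<in> S"
  have "8 * vol q * rh q > 0" using vol_pos[OF q] rh_pos[OF q] by simp
  then have "1 / sqrt (8 * vol q * rh q) * (1 / sqrt (8 * vol q * rh q)) = 1 / (8 * vol q * rh q)"
    by simp
  then show ?thesis unfolding tau_def hc_vol rr_def of_real_mult[symmetric]
    by (simp only: of_real_divide of_real_mult of_real_1 of_real_numeral)
qed

lemma symplectic_identity:
  assumes q: "q \<in> S"
  shows "\<i> / rr q * symf u v = bf q u * cnj (bf q v) - bf q v * cnj (bf q u)
     - (dot (af q u) (aub q v) - dot (af q v) (aub q u))"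
proof -
  have h: "hc q \<noteq> 0" "rr q \<noteq> 0" by (rule h_nonzero[OF q], rule rr_nonzero[OF q])
  have af: "af q v = (\<lambda>a. tau q * (Kv q (cf q v) a - \<i> * Kv q (ef q v) a))" for v
    unfolding Kv_aup[OF q, symmetric] aup_eq[OF q] by (simp add: fun_eq_iff Kv_linear)
  define c where "c u v = dot (cf q u) (Kv q (ef q v))" for u v
  have ev: "dot (Kv q (cf q u)) (ef q v) = c u v" "dot (Kv q (ef q u)) (cf q v) = c v u" for u v
    unfolding c_def by (metis dot_Kv_sym dot_sym)+
  have sy: "dot (Kv q (cf q u)) (cf q v) = dot (Kv q (cf q v)) (cf q u)"
    "dot (Kv q (ef q u)) (ef q v) = dot (Kv q (ef q v)) (ef q u)"
    by (metis dot_Kv_sym dot_sym)+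
  have 1: "dot (af q u) (aub q v) - dot (af q v) (aub q u) = 2 * \<i> * (tau q * tau q) * (c u v - c v u)"
    unfolding af aub_eq[OF q] by (simp add: multilinear ev sy) (simp add: algebra_simps)
  have Ke: "Kv q (ef q v) = (\<lambda>a. qf q v a + hd q a * p0f v / 2 - hd q a * dot (xc q) (qf q v) / (2 * hc q))" for v
    by (simp add: Kv_ef[OF q] fun_eq_iff)
  have c: "c u v = dot (hd q) (pf q u) * dot (xc q) (qf q v) - q0f q u * dot (xc q) (qf q v)
      + hc q * dot (hd q) (pf q u) * p0f v + 3 * hc q * q0f q u * p0f v - 4 * hc q * dot (pf q u) (qf q v)" for u v
    unfolding c_def Ke cf_def
    by (simp add: multilinear dot_sym[of "xc q" "hd q"] dot_hd_x dot_sym[of "pf q u" "hd q"]) (use h in \<open>simp add: field_simps\<close>)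
  have 2: "bf q u * cnj (bf q v) = tau q * tau q * (bh q u * cnj (bh q v))" for u v
    by (simp add: bf_def mult_ac)
  have 3: "cnj (bh q v) = q0f q v - dot (hd q) (pf q v) - \<i> * (dot (xc q) (qf q v) + hc q * p0f v)" for v
    by (simp add: bh_def cnj_dot)
  have "bf q u * cnj (bf q v) - bf q v * cnj (bf q u)
     - (dot (af q u) (aub q v) - dot (af q v) (aub q u)) = tau q * tau q * (8 * \<i> * hc q * symf u v)"
    unfolding 1 2 3 c symf_shift[of u v q] unfolding bh_def by (simp add: dot_sym[of "qf q _" "pf q _"]) (simp add: algebra_simps)
  then show ?thesis using h by (simp add: tau_squared[OF q])
qed

end

lemma dot_delta: "dot (\<lambda>b. of_bool (b = n)) w = w n" "dot w (\<lambda>b. of_bool (b = n)) = w n"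
  by (simp_all add: dot_def)

lemma linear_functional_delta:
  fixes f :: "('n::finite \<Rightarrow> complex) \<Rightarrow> complex"
  assumes add: "\<And>v w. f (\<lambda>a. v a + w a) = f v + f w" and scale: "\<And>k v. f (\<lambda>a. k * v a) = k * f v"
  shows "(\<Sum>n\<in>UNIV. f (\<lambda>b. of_bool (b = n)) * w n) = f w"
proof -
  have "f (\<lambda>a. \<Sum>n\<in>I. w n * of_bool (a = n)) = (\<Sum>n\<in>I. f (\<lambda>b. of_bool (b = n)) * w n)" if "finite I" for I
    using that
  proof induction
    case empty
    show ?case using scale[of 0 "\<lambda>_. 0"] by simp
  next
    case (insert n I)
    then show ?case
      by (simp add: add scale mult.commute del: sum_mult_of_bool_eq sum_of_bool_mult_eq)
  qed
  from this[of UNIV] show ?thesis by simp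
qed

lemma sum_fidx: "(\<Sum>\<Gamma>\<in>UNIV. f (\<Gamma> :: 'n::finite fidx)) =
    f (Inl None) + (\<Sum>a\<in>UNIV. f (Inl (Some a))) + f (Inr None) + (\<Sum>a\<in>UNIV. f (Inr (Some a)))"
proof -
  have o: "(\<Sum>A\<in>UNIV. g (A :: 'n option)) = g None + (\<Sum>a\<in>UNIV. g (Some a))" for g :: "'n option \<Rightarrow> 'b::comm_monoid_add"
    by (simp add: UNIV_option_conv sum.reindex)
  have "(\<Sum>\<Gamma>\<in>UNIV. f (\<Gamma> :: 'n fidx)) = (\<Sum>A\<in>UNIV. f (Inl A)) + (\<Sum>A\<in>UNIV. f (Inr A))"
    by (subst UNIV_Plus_UNIV[symmetric], subst sum.Plus) auto
  then show ?thesis by (simp add: o add.assoc)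
qed

lemma sum_pair: "(\<Sum>j\<in>UNIV. f (j :: 2 \<times> 'n::finite fidx)) = (\<Sum>\<Gamma>\<in>UNIV. f (1, \<Gamma>)) + (\<Sum>\<Gamma>\<in>UNIV. f (2, \<Gamma>))"
proof -
  have "(\<Sum>j\<in>UNIV. f j) = (\<Sum>\<alpha>\<in>UNIV. \<Sum>\<Gamma>\<in>UNIV. f (\<alpha>, \<Gamma>))"
    by (simp add: sum.cartesian_product)
  then show ?thesis by (simp add: sum_2)
qed

lemma forall_2: "(\<forall>\<alpha>::2. P \<alpha>) \<longleftrightarrow> P 1 \<and> P 2"
  by (metis exhaust_2)

lemma forall_fidx: "(\<forall>\<Gamma>::'n fidx. P \<Gamma>) \<longleftrightarrow> P (Inl None) \<and> (\<forall>a. P (Inl (Some a))) \<and> P (Inr None) \<and> (\<forall>a. P (Inr (Some a)))"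
  by (metis sum.exhaust option.exhaust)

context cubic_chart
begin

lemma coords_linear:
  "XX (u + v) = (\<lambda>a. XX u a + XX v a)" "XX (r *\<^sub>R v) = (\<lambda>a. of_real r * XX v a)"
  "XB (u + v) = (\<lambda>a. XB u a + XB v a)" "XB (r *\<^sub>R v) = (\<lambda>a. of_real r * XB v a)"
  "yc (u + v) = (\<lambda>a. yc u a + yc v a)" "yc (r *\<^sub>R v) = (\<lambda>a. of_real r * yc v a)"
  "Zc (u + v) = (\<lambda>a. Zc u a + Zc v a)" "Zc (r *\<^sub>R v) = (\<lambda>a. of_real r * Zc v a)"
  "Ztc (u + v) = (\<lambda>a. Ztc u a + Ztc v a)" "Ztc (r *\<^sub>R v) = (\<lambda>a. of_real r * Ztc v a)"
  "rh (u + v) = rh u + rh v" "rh (r *\<^sub>R v) = r * rh v"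
  "ph (u + v) = ph u + ph v" "ph (r *\<^sub>R v) = r * ph v"
  "Z0 (u + v) = Z0 u + Z0 v" "Z0 (r *\<^sub>R v) = r * Z0 v"
  "Zt0 (u + v) = Zt0 u + Zt0 v" "Zt0 (r *\<^sub>R v) = r * Zt0 v"
  using lin by (simp_all add: XX_def XB_def yc_def Zc_def Ztc_def fun_eq_iff linear_add linear_scale scaleR_conv_of_real)

lemma forms_linear:
  "pf q (u + v) = (\<lambda>a. pf q u a + pf q v a)" "pf q (r *\<^sub>R v) = (\<lambda>a. of_real r * pf q v a)"
  "qf q (u + v) = (\<lambda>a. qf q u a + qf q v a)" "qf q (r *\<^sub>R v) = (\<lambda>a. of_real r * qf q v a)"
  "q0f q (u + v) = q0f q u + q0f q v" "q0f q (r *\<^sub>R v) = of_real r * q0f q v"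
  by (simp_all add: pf_def qf_def q0f_def coords_linear multilinear fun_eq_iff algebra_simps)

lemma bh_linear: "bh q (u + v) = bh q u + bh q v" "bh q (r *\<^sub>R v) = of_real r * bh q v"
  by (simp_all add: bh_def forms_linear coords_linear multilinear algebra_simps)

lemma Af_linear: "Af q (u + v) = (\<lambda>a. Af q u a + Af q v a)" "Af q (r *\<^sub>R v) = (\<lambda>a. of_real r * Af q v a)"
  by (simp_all add: Af_def forms_linear coords_linear multilinear fun_eq_iff algebra_simps)

lemma bf_linear: "bf q (u + v) = bf q u + bf q v" "bf q (r *\<^sub>R v) = of_real r * bf q v"
  by (simp_all add: bf_def bh_linear algebra_simps)

lemma af_linear: "af q (u + v) = (\<lambda>a. af q u a + af q v a)" "af q (r *\<^sub>R v) = (\<lambda>a. of_real r * af q v a)"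
  by (simp_all add: af_def bh_linear Af_linear fun_eq_iff algebra_simps)

lemma kap_linear: "kap q (u + v) = kap q u + kap q v" "kap q (r *\<^sub>R v) = of_real r * kap q v"
  by (simp_all add: kap_def coords_linear multilinear algebra_simps)

end

context qmap_chart
begin

lemma aup_linear: "aup q (u + v) = (\<lambda>a. aup q u a + aup q v a)" "aup q (r *\<^sub>R v) = (\<lambda>a. of_real r * aup q v a)"
  by (simp_all add: aup_def af_linear Qv_linear fun_eq_iff)

lemma aub_linear: "aub q (u + v) = (\<lambda>a. aub q u a + aub q v a)" "aub q (r *\<^sub>R v) = (\<lambda>a. of_real r * aub q v a)"
  by (simp_all add: aub_def aup_linear fun_eq_iff del: cnj_aub)

lemma Ps_linear: "Ps q (u + v) = Ps q u + Ps q v" "Ps q (r *\<^sub>R v) = of_real r * Ps q v"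
  by (simp_all add: Ps_def coords_linear multilinear algebra_simps)

lemma rr_linear: "rr (u + v) = rr u + rr v" "rr (r *\<^sub>R v) = of_real r * rr v"
  by (simp_all add: rr_def coords_linear)

lemma a0_linear: "a0 q (u + v) = a0 q u + a0 q v" "a0 q (r *\<^sub>R v) = of_real r * a0 q v"
proof -
  have "- (k * (x + y - \<i> * (x' + y'))) = - (k * (x - \<i> * x')) + - (k * (y - \<i> * y'))"
    "- (k * (z * x - \<i> * (z * x'))) = z * - (k * (x - \<i> * x'))" for k x y x' y' z :: complex
    by (simp_all add: algebra_simps)
  then show "a0 q (u + v) = a0 q u + a0 q v" "a0 q (r *\<^sub>R v) = of_real r * a0 q v"
    unfolding a0_def Ps_linear rr_linear by blast+
qed

definition E1 :: "'a \<Rightarrow> 'n fidx \<Rightarrow> 'a \<Rightarrow> complex" where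
  "E1 q \<Gamma> v = (case \<Gamma> of Inl A \<Rightarrow> (case A of None \<Rightarrow> bf q v | Some a \<Rightarrow> XX v a)
                        | Inr A \<Rightarrow> (case A of None \<Rightarrow> a0 q v | Some a \<Rightarrow> af q v a))"

definition E2 :: "'a \<Rightarrow> 'n fidx \<Rightarrow> 'a \<Rightarrow> complex" where
  "E2 q \<Gamma> v = (case \<Gamma> of Inl A \<Rightarrow> (case A of None \<Rightarrow> - cnj (a0 q v) | Some a \<Rightarrow> - aub q v a)
                        | Inr A \<Rightarrow> (case A of None \<Rightarrow> cnj (bf q v) | Some a \<Rightarrow> Kv q (XB v) a))"

lemma E1_simps [simp]:
  "E1 q (Inl None) v = bf q v" "E1 q (Inl (Some a)) v = XX v a" "E1 q (Inr None) v = a0 q v" "E1 q (Inr (Some a)) v = af q v a"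
  by (simp_all add: E1_def)

lemma E2_simps [simp]:
  "E2 q (Inl None) v = - cnj (a0 q v)" "E2 q (Inl (Some a)) v = - aub q v a"
  "E2 q (Inr None) v = cnj (bf q v)" "E2 q (Inr (Some a)) v = Kv q (XB v) a"
  by (simp_all add: E2_def)

definition fr :: "'a \<Rightarrow> 2 \<times> 'n fidx \<Rightarrow> 'a \<Rightarrow> complex" where
  "fr q i v = (if fst i = 1 then E1 q (snd i) v else E2 q (snd i) v)"

lemma E1_linear: "E1 q \<Gamma> (u + v) = E1 q \<Gamma> u + E1 q \<Gamma> v" "E1 q \<Gamma> (r *\<^sub>R v) = of_real r * E1 q \<Gamma> v"
  by (simp_all add: E1_def bf_linear coords_linear a0_linear af_linear split: sum.split option.split)

lemma E2_linear: "E2 q \<Gamma> (u + v) = E2 q \<Gamma> u + E2 q \<Gamma> v" "E2 q \<Gamma> (r *\<^sub>R v) = of_real r * E2 q \<Gamma> v"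
  by (simp_all add: E2_def bf_linear coords_linear a0_linear aub_linear Kv_linear split: sum.split option.split)

lemma fr_linear: "linear (fr q i)"
  by (intro linearI) (simp_all add: fr_def E1_linear E2_linear scaleR_conv_of_real)

text \<open>The connection forms.\<close>

definition vp :: "'a \<Rightarrow> 'a \<Rightarrow> complex" where "vp q u = (a0 q u - cnj (a0 q u)) / 4 + kap q u / 2"
definition la :: "'a \<Rightarrow> 'a \<Rightarrow> complex" where "la q u = 3 / 4 * (cnj (a0 q u) - a0 q u) + kap q u / 2"

abbreviation delta :: "'n \<Rightarrow> 'n \<Rightarrow> complex" where "delta n \<equiv> (\<lambda>b. of_bool (b = n))"

definition Gam :: "'a \<Rightarrow> 'a \<Rightarrow> 'n \<Rightarrow> 'n \<Rightarrow> complex" where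
  "Gam q u m n = - \<i> / 2 * Qv q (K3 q (delta n) (XX u)) m"
definition tf :: "'a \<Rightarrow> 'a \<Rightarrow> 'n \<Rightarrow> 'n \<Rightarrow> complex" where
  "tf q u m n = \<i> / (8 * hc q) * tt (delta n) (aub q u) m"
definition sf :: "'a \<Rightarrow> 'a \<Rightarrow> 'n \<Rightarrow> 'n \<Rightarrow> complex" where
  "sf q u m n = \<i> / (8 * hc q) * Qv q (tt (Qv q (delta n)) (aup q u)) m"

definition wH :: "'a \<Rightarrow> 'a \<Rightarrow> 2 \<Rightarrow> 2 \<Rightarrow> complex" where
  "wH q u \<alpha> \<beta> = (if \<alpha> = 1 then (if \<beta> = 1 then vp q u else - bf q u) else (if \<beta> = 1 then cnj (bf q u) else - vp q u))"

fun wE :: "'a \<Rightarrow> 'a \<Rightarrow> 'n fidx \<Rightarrow> 'n fidx \<Rightarrow> complex" where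
  "wE q u (Inl None) (Inl None) = la q u"
| "wE q u (Inl None) (Inl (Some n)) = - af q u n"
| "wE q u (Inl None) (Inr B) = 0"
| "wE q u (Inl (Some m)) (Inl None) = aub q u m"
| "wE q u (Inl (Some m)) (Inl (Some n)) = Gam q u m n - of_bool (m = n) * vp q u"
| "wE q u (Inl (Some m)) (Inr None) = 0"
| "wE q u (Inl (Some m)) (Inr (Some n)) = sf q u m n"
| "wE q u (Inr None) (Inl B) = 0"
| "wE q u (Inr None) (Inr None) = - la q u"
| "wE q u (Inr None) (Inr (Some n)) = - aub q u n"
| "wE q u (Inr (Some m)) (Inl None) = 0"
| "wE q u (Inr (Some m)) (Inl (Some n)) = tf q u m n"
| "wE q u (Inr (Some m)) (Inr None) = af q u m"
| "wE q u (Inr (Some m)) (Inr (Some n)) = of_bool (m = n) * vp q u - Gam q u n m"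

definition w :: "'a \<Rightarrow> 'a \<Rightarrow> 2 \<times> 'n fidx \<Rightarrow> 2 \<times> 'n fidx \<Rightarrow> complex" where
  "w q u i j = of_bool (snd i = snd j) * wH q u (fst i) (fst j) + of_bool (fst i = fst j) * wE q u (snd i) (snd j)"

lemma linear_fun:
  "K3 q (\<lambda>a. v a + v' a) z = (\<lambda>b. K3 q v z b + K3 q v' z b)" "K3 q (\<lambda>a. k * v a) z = (\<lambda>b. k * K3 q v z b)"
  "tt (\<lambda>a. v a + v' a) z = (\<lambda>b. tt v z b + tt v' z b)" "tt (\<lambda>a. k * v a) z = (\<lambda>b. k * tt v z b)"
  "Qv q (\<lambda>a. v a + v' a) = (\<lambda>b. Qv q v b + Qv q v' b)" "Qv q (\<lambda>a. k * v a) = (\<lambda>b. k * Qv q v b)"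
  by (simp_all add: fun_eq_iff K3_linear Qv_linear TT_add TT_scale)

lemma Gam_apply: "(\<Sum>n\<in>UNIV. Gam q u m n * z n) = - \<i> / 2 * Qv q (K3 q z (XX u)) m"
  unfolding Gam_def
  by (rule linear_functional_delta[where f="\<lambda>z. - \<i> / 2 * Qv q (K3 q z (XX u)) m"])
    (simp_all only: linear_fun distrib_left mult.left_commute)

lemma Gam_apply_transposed:
  assumes "q \<in> S"
  shows "(\<Sum>n\<in>UNIV. Gam q u n m * z n) = - \<i> / 2 * K3 q (Qv q z) (XX u) m"
proof -
  have "(\<Sum>n\<in>UNIV. Gam q u n m * z n) = - \<i> / 2 * dot (Qv q (K3 q (delta m) (XX u))) z"
    unfolding Gam_def dot_def sum_distrib_left by (simp only: mult.assoc)
  also have "dot (Qv q (K3 q (delta m) (XX u))) z = dot (K3 q (delta m) (XX u)) (Qv q z)" by (rule Qv_sym[OF assms])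
  also have "\<dots> = dot (delta m) (K3 q (Qv q z) (XX u))" by (metis dot_K3_sym dot_sym)
  finally show ?thesis by (simp add: dot_delta)
qed

lemma tf_apply: "(\<Sum>n\<in>UNIV. tf q u m n * z n) = \<i> / (8 * hc q) * tt z (aub q u) m"
  unfolding tf_def
  by (rule linear_functional_delta[where f="\<lambda>z. \<i> / (8 * hc q) * tt z (aub q u) m"])
    (simp_all only: linear_fun distrib_left mult.left_commute)

lemma sf_apply: "(\<Sum>n\<in>UNIV. sf q u m n * z n) = \<i> / (8 * hc q) * Qv q (tt (Qv q z) (aup q u)) m"
  unfolding sf_def
  by (rule linear_functional_delta[where f="\<lambda>z. \<i> / (8 * hc q) * Qv q (tt (Qv q z) (aup q u)) m"])
    (simp_all only: linear_fun distrib_left mult.left_commute)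

lemma delta_apply: "(\<Sum>n\<in>UNIV. of_bool ((m :: 'n) = n) * k * z n) = k * (z m :: complex)"
  by (simp add: mult.assoc)

lemma sum_w: "(\<Sum>j\<in>UNIV. w q u (\<alpha>, \<Gamma>) j * f j) =
    wH q u \<alpha> 1 * f (1, \<Gamma>) + wH q u \<alpha> 2 * f (2, \<Gamma>) + (\<Sum>\<Delta>\<in>UNIV. wE q u \<Gamma> \<Delta> * f (\<alpha>, \<Delta>))"
proof -
  have d: "(\<Sum>\<Delta>\<in>UNIV. of_bool (\<Gamma> = \<Delta>) * k * g \<Delta>) = k * (g \<Gamma> :: complex)" for k g
    by (simp add: mult.assoc)
  have "\<alpha> = 1 \<or> \<alpha> = 2" using exhaust_2 by blast
  then show ?thesis
    by (auto simp: sum_pair w_def distrib_right sum.distrib d)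
qed

lemma sum_wE:
  "(\<Sum>\<Delta>\<in>UNIV. wE q u (Inl None) \<Delta> * f \<Delta>) = la q u * f (Inl None) - dot (af q u) (\<lambda>n. f (Inl (Some n)))"
  "(\<Sum>\<Delta>\<in>UNIV. wE q u (Inl (Some m)) \<Delta> * f \<Delta>) = aub q u m * f (Inl None)
     + (- \<i> / 2 * Qv q (K3 q (\<lambda>n. f (Inl (Some n))) (XX u)) m - vp q u * f (Inl (Some m)))
     + \<i> / (8 * hc q) * Qv q (tt (Qv q (\<lambda>n. f (Inr (Some n)))) (aup q u)) m"
  "(\<Sum>\<Delta>\<in>UNIV. wE q u (Inr None) \<Delta> * f \<Delta>) = - la q u * f (Inr None) - dot (aub q u) (\<lambda>n. f (Inr (Some n)))"
  "q \<in> S \<Longrightarrow> (\<Sum>\<Delta>\<in>UNIV. wE q u (Inr (Some m)) \<Delta> * f \<Delta>) = \<i> / (8 * hc q) * tt (\<lambda>n. f (Inl (Some n))) (aub q u) m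
     + af q u m * f (Inr None) + (vp q u * f (Inr (Some m)) + \<i> / 2 * K3 q (Qv q (\<lambda>n. f (Inr (Some n)))) (XX u) m)"
  by (simp_all add: sum_fidx left_diff_distrib sum_subtractf sum_negf dot_def delta_apply
      Gam_apply[where z="\<lambda>n. f (Inl (Some n))"] tf_apply[where z="\<lambda>n. f (Inl (Some n))"] sf_apply[where z="\<lambda>n. f (Inr (Some n))"]
      Gam_apply_transposed[where z="\<lambda>n. f (Inr (Some n))"])

end

context qmap_chart
begin

lemma has_ext_cnjE: "has_ext \<phi> q \<Phi> \<Longrightarrow> has_ext (\<lambda>q v. cnj (\<phi> q v)) q (\<lambda>u v. cnj (\<Phi> u v))"
  by (rule has_ext_cnj)

lemma half_rr:
  assumes q: "q \<in> S"
  shows "rr u / (2 * rr q) = - (a0 q u + cnj (a0 q u)) / 2"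
proof -
  have "rr u / (2 * rr q) = rr u / rr q / 2" by simp
  then show ?thesis by (simp only: rr_a0[OF q])
qed

lemma ext_bf:
  assumes q: "q \<in> S"
  shows "has_ext bf q (\<lambda>u v. ((a0 q u + cnj (a0 q u)) / 2 - kap q u) * bf q v - dot (XX u) (af q v)
      - (((a0 q v + cnj (a0 q v)) / 2 - kap q v) * bf q u - dot (XX v) (af q u)))"
proof -
  have e: "- (rr u / (2 * rr q) + kap q u) = (a0 q u + cnj (a0 q u)) / 2 - kap q u" for u
    unfolding half_rr[OF q] by (simp add: add_divide_distrib diff_divide_distrib)
  show ?thesis
    by (rule has_extI[OF has_derivative_bf[OF vol_pos[OF q] rh_pos[OF q], unfolded e]]) simp
qed

lemma ext_af:
  assumes q: "q \<in> S"
  shows "has_ext (\<lambda>q v. af q v a) q (\<lambda>u v.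
     ((a0 q u + cnj (a0 q u)) / 2 - kap q u) * af q v a - \<i> / 2 * K3 q (aup q v) (XX u) a
       - Kv q (XB u) a * bf q v + \<i> / (8 * hc q) * tt (XX u) (aub q v) a
     - (((a0 q v + cnj (a0 q v)) / 2 - kap q v) * af q u a - \<i> / 2 * K3 q (aup q u) (XX v) a
       - Kv q (XB v) a * bf q u + \<i> / (8 * hc q) * tt (XX v) (aub q u) a))"
  by (rule has_extI[OF has_derivative_af[OF q]]) (simp add: half_rr[OF q] algebra_simps add_divide_distrib diff_divide_distrib)

lemma ext_aub:
  assumes q: "q \<in> S"
  shows "has_ext (\<lambda>q v. aub q v a) q (\<lambda>u v.
     ((a0 q u + cnj (a0 q u)) / 2 + kap q u) * aub q v a + \<i> / 2 * Qv q (K3 q (aub q v) (XX u)) a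
       - XX u a * cnj (bf q v) - \<i> / (8 * hc q) * Qv q (tt (XB u) (aup q v)) a
     - (((a0 q v + cnj (a0 q v)) / 2 + kap q v) * aub q u a + \<i> / 2 * Qv q (K3 q (aub q u) (XX v)) a
       - XX v a * cnj (bf q u) - \<i> / (8 * hc q) * Qv q (tt (XB v) (aup q u)) a))"
  by (rule has_extI[OF has_derivative_aub[OF q]]) (simp add: half_rr[OF q] algebra_simps add_divide_distrib diff_divide_distrib)

lemma symf_antisym: "symf v u = - symf u v"
  by (simp add: symf_def dot_sym[of "Zc v"] dot_sym[of "Ztc v"])

lemma ext_a0:
  assumes q: "q \<in> S"
  shows "has_ext a0 q (\<lambda>u v. (a0 q u + cnj (a0 q u)) * a0 q v - (a0 q v + cnj (a0 q v)) * a0 q u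
     + (bf q u * cnj (bf q v) - bf q v * cnj (bf q u)) - (dot (af q u) (aub q v) - dot (af q v) (aub q u)))"
proof (rule has_extI[OF has_derivative_a0[OF q]])
  fix u v
  have "\<i> / (2 * rr q) * symf u v - \<i> / (2 * rr q) * symf v u = \<i> / rr q * symf u v"
    by (simp add: symf_antisym[of v u])
  then show "(a0 q u + cnj (a0 q u)) * a0 q v - (a0 q v + cnj (a0 q v)) * a0 q u
     + (bf q u * cnj (bf q v) - bf q v * cnj (bf q u)) - (dot (af q u) (aub q v) - dot (af q v) (aub q u))
     = - (rr u / rr q) * a0 q v + \<i> / (2 * rr q) * symf u v - (- (rr v / rr q) * a0 q u + \<i> / (2 * rr q) * symf v u)"
    unfolding rr_a0[OF q] using symplectic_identity[OF q, of u v] by (simp add: algebra_simps)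
qed

lemma ext_kap:
  assumes q: "q \<in> S"
  shows "has_ext kap q (\<lambda>u v. dot (Kv q (XB u)) (XX v) - dot (Kv q (XB v)) (XX u))"
proof (rule has_extI[OF has_derivative_kap[OF q]])
  fix u v
  have s: "dot (Kv q w) z = dot (Kv q z) w" for w z by (metis dot_Kv_sym dot_sym)
  show "dot (Kv q (XB u)) (XX v) - dot (Kv q (XB v)) (XX u)
      = - 2 * \<i> * dot (Kv q (xc u)) (yc v) - - 2 * \<i> * dot (Kv q (xc v)) (yc u)"
    unfolding XX_eq Kv_linear multilinear using s[of "xc u" "yc v"] s[of "xc v" "yc u"] s[of "xc u" "xc v"] s[of "yc u" "yc v"]
    by (simp add: Kv_linear[abs_def] multilinear algebra_simps)
qed

lemma ext_KXB:
  assumes q: "q \<in> S"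
  shows "has_ext (\<lambda>q v. Kv q (XB v) a) q (\<lambda>u v. - \<i> / 2 * (K3 q (XB v) (XX u) a - K3 q (XB u) (XX v) a))"
proof -
  have z: "Kv q (\<lambda>a. 0) a = 0" using Kv_linear(4)[of q 0] by simp
  have 1: "((\<lambda>q. Kv q (XB v) a) has_derivative (\<lambda>u. K3 q (XB v) (xc u) a + Kv q (\<lambda>a. 0) a)) (at q)" for v
    by (rule has_derivative_Kv[OF h_nonzero[OF q]]) (rule has_derivative_const)
  have x: "xc u = (\<lambda>a. - \<i> / 2 * (XX u a - XB u a))" for u
    by (simp add: XX_eq fun_eq_iff)
  show ?thesis
  proof (rule has_extI[OF 1])
    fix u v
    show "- \<i> / 2 * (K3 q (XB v) (XX u) a - K3 q (XB u) (XX v) a)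
      = K3 q (XB v) (xc u) a + Kv q (\<lambda>a. 0) a - (K3 q (XB u) (xc v) a + Kv q (\<lambda>a. 0) a)"
      unfolding z x[of u] x[of v] K3_linear_right K3_sym[of q "XB v" "XB u"] by (simp add: algebra_simps)
  qed
qed

lemma Kv_aub: "q \<in> S \<Longrightarrow> Kv q (aub q v) a = cnj (af q v a)"
  by (simp add: Kv_aup[symmetric] cnj_Kv)

lemma Kv_aub_fun: "q \<in> S \<Longrightarrow> Kv q (aub q v) = (\<lambda>a. cnj (af q v a))"
  by (simp add: Kv_aub fun_eq_iff)

lemma dot_cnj_af: "q \<in> S \<Longrightarrow> dot (\<lambda>a. cnj (af q u a)) (aup q v) = dot (af q v) (aub q u)"
  using dot_Kv_sym[of "aup q v" q "aub q u"] by (simp add: Kv_aub_fun Kv_aup dot_sym)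

lemma dot_aub_Kv: "q \<in> S \<Longrightarrow> dot (aub q u) (Kv q z) = dot z (\<lambda>a. cnj (af q u a))"
  using dot_Kv_sym[of "aub q u" q z] by (simp add: Kv_aub_fun)

lemma two_cases: "(\<alpha> :: 2) = 1 \<or> \<alpha> = 2" using exhaust_2 by blast

lemma torsion:
  assumes q: "q \<in> S"
  shows "has_ext (\<lambda>q. fr q i) q (\<lambda>u v. - (\<Sum>j\<in>UNIV. w q u i j * fr q j v - w q v i j * fr q j u))"
proof -
  obtain \<alpha> \<Gamma> where i: "i = (\<alpha>, \<Gamma>)" by force
  have eta: "(\<lambda>n. XX v n) = XX v" "(\<lambda>n. af q v n) = af q v" "(\<lambda>n. Kv q (XB v) n) = Kv q (XB v)" for v by simp_all
  have neg: "K3 q (\<lambda>n. - z n) y m = - K3 q z y m" "tt (\<lambda>n. - z n) y m = - tt z y m" "Qv q (\<lambda>n. - z n) m = - Qv q z m"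
     "K3 q (\<lambda>n. - z n) y = (\<lambda>m. - K3 q z y m)" "tt (\<lambda>n. - z n) y = (\<lambda>m. - tt z y m)" for z y m
    by (simp_all add: K3_linear TT_minus Qv_linear fun_eq_iff)
  have fsym: "K3 q y z = K3 q z y" "tt y z = tt z y" for y z
    by (simp_all add: fun_eq_iff K3_sym[of q y] tt_sym[of y])
  have E1: "has_ext (\<lambda>q. E1 q \<Gamma>) q (\<lambda>u v. - (\<Sum>j\<in>UNIV. w q u (1, \<Gamma>) j * fr q j v - w q v (1, \<Gamma>) j * fr q j u))"
  proof -
    consider "\<Gamma> = Inl None" | a where "\<Gamma> = Inl (Some a)" | "\<Gamma> = Inr None" | a where "\<Gamma> = Inr (Some a)"
      by (metis option.exhaust sum.exhaust)
    then show ?thesis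
    proof cases
      case 1
      show ?thesis unfolding 1 sum_subtractf sum_w sum_wE(1) fr_def fst_conv snd_conv E1_simps E2_simps wH_def
        by (rule has_ext_eqI[OF ext_bf[OF q]])
          (simp add: vp_def la_def dot_sym[of "af q _" "XX _"] field_simps)
    next
      case (2 a)
      show ?thesis unfolding 2 sum_subtractf sum_w sum_wE(2) fr_def fst_conv snd_conv E1_simps E2_simps wH_def
        by (rule has_ext_eqI[OF has_ext_const])
          (simp add: aup_def[symmetric] fsym(1)[of "XX _" "XX _"] fsym(2)[of "aup q _" "aup q _"] field_simps)
    next
      case 3
      show ?thesis unfolding 3 sum_subtractf sum_w sum_wE(3) fr_def fst_conv snd_conv E1_simps E2_simps wH_def
        by (rule has_ext_eqI[OF ext_a0[OF q]])
          (simp add: vp_def la_def dot_sym[of "aub q _" "af q _"] field_simps)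
    next
      case (4 a)
      show ?thesis unfolding 4 sum_subtractf sum_w sum_wE(4)[OF q] fr_def fst_conv snd_conv E1_simps E2_simps wH_def
        by (rule has_ext_eqI[OF ext_af[OF q]])
          (simp add: aup_def[symmetric] vp_def la_def field_simps)
    qed
  qed
  have E2: "has_ext (\<lambda>q. E2 q \<Gamma>) q (\<lambda>u v. - (\<Sum>j\<in>UNIV. w q u (2, \<Gamma>) j * fr q j v - w q v (2, \<Gamma>) j * fr q j u))"
  proof -
    consider "\<Gamma> = Inl None" | a where "\<Gamma> = Inl (Some a)" | "\<Gamma> = Inr None" | a where "\<Gamma> = Inr (Some a)"
      by (metis option.exhaust sum.exhaust)
    then show ?thesis
    proof cases
      case 1
      show ?thesis unfolding 1 sum_subtractf sum_w sum_wE(1) fr_def fst_conv snd_conv E1_simps E2_simps wH_def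
        by (rule has_ext_eqI[OF has_ext_minus[OF has_ext_cnj[OF ext_a0[OF q]]]])
          (simp add: vp_def la_def cnj_dot multilinear dot_sym[of "aup q _" "aub q _"] dot_cnj_af[OF q]
            dot_sym[of "aub q _" "af q _"] field_simps)
    next
      case (2 a)
      show ?thesis unfolding 2 sum_subtractf sum_w sum_wE(2) fr_def fst_conv snd_conv E1_simps E2_simps wH_def
        by (rule has_ext_eqI[OF has_ext_minus[OF ext_aub[OF q]]])
          (simp add: Qv_Kv[OF q] vp_def la_def neg field_simps)
    next
      case 3
      show ?thesis unfolding 3 sum_subtractf sum_w sum_wE(3) fr_def fst_conv snd_conv E1_simps E2_simps wH_def
        by (rule has_ext_eqI[OF has_ext_cnj[OF ext_bf[OF q]]])
          (simp add: vp_def la_def cnj_dot cnj_kap dot_aub_Kv[OF q] field_simps)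
    next
      case (4 a)
      show ?thesis unfolding 4 sum_subtractf sum_w sum_wE(4)[OF q] fr_def fst_conv snd_conv E1_simps E2_simps wH_def
        by (rule has_ext_eqI[OF ext_KXB[OF q]])
          (simp add: Qv_Kv[OF q] vp_def la_def neg tt_sym[of "aub q _" "aub q _"] field_simps)
    qed
  qed
  show ?thesis unfolding i using two_cases[of \<alpha>] E1 E2 by (auto simp: fr_def[abs_def])
qed

end

locale qmap_frame = qmap_chart T X rh ph Zt0 Z0 Zt Z S Qm
  for T :: "'n::finite \<Rightarrow> 'n \<Rightarrow> 'n \<Rightarrow> real" and X :: "'n \<Rightarrow> 'a::euclidean_space \<Rightarrow> complex"
    and rh ph Zt0 Z0 Zt Z S Qm +
  assumes coords_inj: "\<And>v. (\<And>a. X a v = 0) \<Longrightarrow> rh v = 0 \<Longrightarrow> ph v = 0 \<Longrightarrow> Zt0 v = 0 \<Longrightarrow> Z0 v = 0 \<Longrightarrow>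
      (\<And>a. Zt a v = 0) \<Longrightarrow> (\<And>a. Z a v = 0) \<Longrightarrow> v = 0"
    and dimension: "DIM('a) = DIM(complex ^ 'n fidx)"
begin

lemma real_imag_zero:
  assumes "x + \<i> * y = 0" "cnj x = x" "cnj y = y"
  shows "x = 0" "y = (0 :: complex)"
proof -
  have "x - \<i> * y = 0" using arg_cong[OF assms(1), of cnj] assms(2,3) by simp
  with assms(1) have "2 * x = 0" by algebra
  then show "x = 0" by simp
  with assms(1) show "y = 0" by simp
qed

lemma tau_nonzero: "q \<in> S \<Longrightarrow> tau q \<noteq> 0"
  using vol_pos[of q] rh_pos[of q] by (simp add: tau_def)

lemma frame_inj:
  assumes q: "q \<in> S" and v: "\<And>\<Gamma>. E1 q \<Gamma> v = 0"
  shows "v = 0"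
proof -
  have h: "hc q \<noteq> 0" and t: "tau q \<noteq> 0" and r: "rr q \<noteq> 0"
    using h_nonzero tau_nonzero rr_nonzero q by auto
  have X: "XX v a = 0" for a using v[of "Inl (Some a)"] by simp
  have "bf q v = 0" using v[of "Inl None"] by simp
  then have "bh q v = 0" using t by (simp add: bf_def)
  moreover have "cnj (q0f q v - dot (hd q) (pf q v)) = q0f q v - dot (hd q) (pf q v)"
    "cnj (dot (xc q) (qf q v) + hc q * p0f v) = dot (xc q) (qf q v) + hc q * p0f v"
    by (simp_all add: cnj_dot)
  ultimately have RI: "q0f q v - dot (hd q) (pf q v) = 0" "dot (xc q) (qf q v) + hc q * p0f v = 0"
    unfolding bh_def using real_imag_zero by blast+
  have "af q v = (\<lambda>a. 0)" using v[of "Inr (Some _)"] by (auto simp: fun_eq_iff)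
  then have "aup q v a = 0" for a by (simp add: aup_def Qv_def dot_def)
  then have ce0: "cf q v a - \<i> * ef q v a = 0" for a using t unfolding aup_eq[OF q] by simp
  have ce: "cf q v a = 0" "ef q v a = 0" for a
    using real_imag_zero[of "cf q v a" "- ef q v a"] ce0[of a] by simp_all
  have "dot (hd q) (cf q v) = 0" "dot (hd q) (ef q v) = 0" by (simp_all add: dot_def ce)
  then have c1: "2 * hc q * dot (hd q) (pf q v) + 6 * hc q * q0f q v = 0"
    and c2: "6 * (hc q)\<^sup>2 * p0f v - 2 * hc q * dot (xc q) (qf q v) = 0"
    unfolding dot_hd_cf dot_hd_ef[OF q] .
  from c1 RI(1) have "8 * hc q * dot (hd q) (pf q v) = 0" by algebra
  then have hp: "dot (hd q) (pf q v) = 0" using h by simp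
  with RI(1) have q0: "q0f q v = 0" by simp
  from c2 RI(2) have "8 * (hc q)\<^sup>2 * p0f v = 0" by algebra
  then have p0: "p0f v = 0" using h by simp
  with RI(2) have xq: "dot (xc q) (qf q v) = 0" by simp
  have p: "pf q v a = 0" for a using ce(1)[of a] h by (simp add: cf_def hp q0)
  have "Qv q (qf q v) = (\<lambda>a. 0)" using ce(2) by (auto simp: ef_def p0 xq fun_eq_iff)
  then have "Kv q (Qv q (qf q v)) a = 0" for a using Kv_linear(4)[of q 0 "\<lambda>a. 0" a] by simp
  then have qq: "qf q v a = 0" for a by (simp add: Kv_Qv[OF q])
  have Z: "Zc v a = 0" for a using p[of a] p0 by (simp add: pf_def)
  have Zt: "Ztc v a = 0" for a using qq[of a] p0 by (simp add: qf_def TT_def Z)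
  have Zt0: "Zt0 v = 0" using q0 p0 by (simp add: q0f_def dot_def Z Zt)
  have "Ps q v = of_real (ph v)" using Zt0 p0 by (simp add: Ps_def dot_def Z Zt)
  moreover have "a0 q v = 0" using v[of "Inr None"] by simp
  ultimately have "rr v + \<i> * (- of_real (ph v)) = 0" using r by (simp add: a0_def)
  from real_imag_zero[OF this] have "rh v = 0" "ph v = 0" by (simp_all add: rr_def)
  then show "v = 0"
    using coords_inj[of v] X Z Zt Zt0 p0 by (simp add: XX_def Zc_def Ztc_def)
qed

lemma frame_surj:
  assumes q: "q \<in> S"
  shows "\<exists>v. \<forall>\<Gamma>. E1 q \<Gamma> v = s \<Gamma>"
proof -
  define L where "L v = (\<chi> \<Gamma>. E1 q \<Gamma> v)" for v
  have linL: "linear L" unfolding L_def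
    by (intro linearI) (simp_all add: E1_linear vec_eq_iff scaleR_conv_of_real[where 'a=complex])
  have "inj L"
    using frame_inj[OF q] by (simp add: linear_injective_0[OF linL]) (simp add: L_def vec_eq_iff)
  have "dim (L ` UNIV) = dim (UNIV :: 'a set)"
    by (rule dim_image_eq[OF linL]) (use \<open>inj L\<close> in \<open>simp add: inj_on_def\<close>)
  then have "dim (range L) = DIM(complex ^ 'n fidx)" using dimension by simp
  moreover have "subspace (range L)" using linL linear_subspace_image subspace_UNIV by blast
  ultimately have "range L = UNIV" by (metis dim_eq_full span_eq_iff)
  then obtain v where "L v = (\<chi> \<Gamma>. s \<Gamma>)" by (metis surjD)
  then show ?thesis by (auto simp: L_def vec_eq_iff)
qed

lemma E2_times_i:
  assumes q: "q \<in> S" and "\<And>\<Gamma>. E1 q \<Gamma> v' = \<i> * E1 q \<Gamma> v"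
  shows "E2 q \<Gamma> v' = - \<i> * E2 q \<Gamma> v"
proof -
  have 1: "bf q v' = \<i> * bf q v" "a0 q v' = \<i> * a0 q v" "af q v' = (\<lambda>a. \<i> * af q v a)" "XX v' = (\<lambda>a. \<i> * XX v a)"
    using assms(2)[of "Inl None"] assms(2)[of "Inr None"] assms(2)[of "Inl (Some _)"] assms(2)[of "Inr (Some _)"]
    by (simp_all add: fun_eq_iff)
  have "aub q v' a = - \<i> * aub q v a" for a
  proof -
    have "aup q v' a = \<i> * aup q v a" by (simp add: aup_def 1 Qv_linear)
    then have "cnj (aup q v' a) = cnj (\<i> * aup q v a)" by (rule arg_cong)
    then show ?thesis by simp
  qed
  moreover have "XB v' = (\<lambda>a. - \<i> * XB v a)"
  proof
    fix a
    have "cnj (XX v' a) = cnj (\<i> * XX v a)" by (simp only: 1)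
    then show "XB v' a = - \<i> * XB v a" by simp
  qed
  ultimately show ?thesis
    by (cases \<Gamma>; rename_tac A; case_tac A) (simp_all add: 1 Kv_linear)
qed

lemma E2_surj:
  assumes q: "q \<in> S"
  shows "\<exists>v. \<forall>\<Gamma>. E2 q \<Gamma> v = s \<Gamma>"
proof -
  define s' where "s' \<Gamma> = (case \<Gamma> of Inl A \<Rightarrow> (case A of None \<Rightarrow> cnj (s (Inr None)) | Some a \<Rightarrow> cnj (Qv q (\<lambda>a. s (Inr (Some a))) a))
     | Inr A \<Rightarrow> (case A of None \<Rightarrow> - cnj (s (Inl None)) | Some a \<Rightarrow> Kv q (\<lambda>a. - cnj (s (Inl (Some a)))) a))" for \<Gamma>
  obtain v where v: "\<And>\<Gamma>. E1 q \<Gamma> v = s' \<Gamma>" using frame_surj[OF q] by blast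
  have 1: "bf q v = cnj (s (Inr None))" "a0 q v = - cnj (s (Inl None))" "af q v = Kv q (\<lambda>a. - cnj (s (Inl (Some a))))"
     "XX v = (\<lambda>a. cnj (Qv q (\<lambda>a. s (Inr (Some a))) a))"
    using v[of "Inl None"] v[of "Inr None"] v[of "Inl (Some _)"] v[of "Inr (Some _)"]
    by (simp_all add: s'_def fun_eq_iff)
  have "aub q v a = - s (Inl (Some a))" for a
    by (simp add: aub_def aup_def 1(3) Qv_Kv[OF q] del: cnj_aub)
  moreover have "XB v = Qv q (\<lambda>a. s (Inr (Some a)))"
  proof
    fix a
    have "cnj (XX v a) = cnj (cnj (Qv q (\<lambda>a. s (Inr (Some a))) a))" by (simp only: 1)
    then show "XB v a = Qv q (\<lambda>a. s (Inr (Some a))) a" by simp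
  qed
  ultimately have "E2 q \<Gamma> v = s \<Gamma>" for \<Gamma>
    by (cases \<Gamma>; rename_tac A; case_tac A) (simp_all add: 1 Kv_Qv[OF q])
  then show ?thesis by blast
qed

lemma frame_span:
  assumes q: "q \<in> S" and c: "\<And>z. (\<Sum>i\<in>UNIV. c i * fr q i z) = 0"
  shows "c i = 0"
proof -
  have c': "(\<Sum>\<Gamma>\<in>UNIV. c (1, \<Gamma>) * E1 q \<Gamma> z) + (\<Sum>\<Gamma>\<in>UNIV. c (2, \<Gamma>) * E2 q \<Gamma> z) = 0" for z
    using c[of z] by (simp add: sum_pair fr_def)
  have split: "(\<Sum>\<Gamma>\<in>UNIV. c (1, \<Gamma>) * E1 q \<Gamma> z) = 0 \<and> (\<Sum>\<Gamma>\<in>UNIV. c (2, \<Gamma>) * E2 q \<Gamma> z) = 0" for z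
  proof -
    obtain z' where z': "\<And>\<Gamma>. E1 q \<Gamma> z' = \<i> * E1 q \<Gamma> z" using frame_surj[OF q, of "\<lambda>\<Gamma>. \<i> * E1 q \<Gamma> z"] by blast
    have "\<i> * (\<Sum>\<Gamma>\<in>UNIV. c (1, \<Gamma>) * E1 q \<Gamma> z) - \<i> * (\<Sum>\<Gamma>\<in>UNIV. c (2, \<Gamma>) * E2 q \<Gamma> z) = 0"
      using c'[of z'] E2_times_i[OF q z'] by (simp add: z' sum_distrib_left sum_negf mult_ac)
    then have "(\<Sum>\<Gamma>\<in>UNIV. c (1, \<Gamma>) * E1 q \<Gamma> z) = (\<Sum>\<Gamma>\<in>UNIV. c (2, \<Gamma>) * E2 q \<Gamma> z)" by simp
    with c'[of z] show ?thesis by simp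
  qed
  have "c (1, \<Gamma>) = 0" for \<Gamma>
  proof -
    obtain z where "\<And>\<Delta>. E1 q \<Delta> z = of_bool (\<Delta> = \<Gamma>)" using frame_surj[OF q, of "\<lambda>\<Delta>. of_bool (\<Delta> = \<Gamma>)"] by blast
    then show ?thesis using split[of z] by simp
  qed
  moreover have "c (2, \<Gamma>) = 0" for \<Gamma>
  proof -
    obtain z where "\<And>\<Delta>. E2 q \<Delta> z = of_bool (\<Delta> = \<Gamma>)" using E2_surj[OF q, of "\<lambda>\<Delta>. of_bool (\<Delta> = \<Gamma>)"] by blast
    then show ?thesis using split[of z] by simp
  qed
  ultimately show ?thesis using two_cases by (cases i) metis
qed

text \<open>Differentiability.\<close>

lemma differentiable_lincomb:
  fixes F :: "'a \<Rightarrow> 'n \<Rightarrow> complex"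
  assumes "\<And>a. (\<lambda>q. F q a) differentiable (at q)" "\<And>a. (\<lambda>q. G q a) differentiable (at q)"
  shows "(\<lambda>q. dot (F q) (G q)) differentiable (at q)" "(\<lambda>q. tt (F q) (G q) b) differentiable (at q)"
  unfolding dot_def TT_def
  by (intro differentiable_sum ballI derivative_intros assms finite)+

lemma basic_differentiable:
  assumes q: "q \<in> S"
  shows "rr differentiable (at q)" "hc differentiable (at q)" "(\<lambda>q. hd q a) differentiable (at q)"
    "(\<lambda>q. xc q a) differentiable (at q)" "(\<lambda>q. kap q u) differentiable (at q)" "(\<lambda>q. bf q u) differentiable (at q)"
    "(\<lambda>q. af q u a) differentiable (at q)" "(\<lambda>q. aup q u a) differentiable (at q)" "(\<lambda>q. aub q u a) differentiable (at q)"
    "(\<lambda>q. a0 q u) differentiable (at q)"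
  unfolding rr_def
  by (rule differentiableI, rule has_derivative_of_real has_derivative_coords has_derivative_hc has_derivative_hd has_derivative_kap[OF q]
    has_derivative_bf[OF vol_pos[OF q] rh_pos[OF q]] has_derivative_af[OF q] has_derivative_aup[OF q] has_derivative_aub[OF q]
    has_derivative_a0[OF q], (rule has_derivative_coords)?)+

lemma differentiable_cnj: "f differentiable F \<Longrightarrow> (\<lambda>q. cnj (f q)) differentiable F"
  unfolding differentiable_def using has_derivative_cnj by blast

lemma operator_differentiable:
  assumes q: "q \<in> S" and F: "\<And>a. (\<lambda>q. F q a) differentiable (at q)"
  shows "(\<lambda>q. K3 q (F q) z b) differentiable (at q)" "(\<lambda>q. Qv q (F q) b) differentiable (at q)"
    "(\<lambda>q. Kv q (F q) b) differentiable (at q)"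
proof -
  note d = basic_differentiable[OF q] Qm_differentiable[OF q] F
  have h: "hc q \<noteq> 0" "(hc q)\<^sup>2 \<noteq> 0" "hc q ^ 3 \<noteq> 0" using h_nonzero[OF q] by simp_all
  show "(\<lambda>q. K3 q (F q) z b) differentiable (at q)"
    unfolding K3_def by (intro derivative_intros differentiable_lincomb d h differentiable_const) simp_all
  show "(\<lambda>q. Qv q (F q) b) differentiable (at q)"
    unfolding Qv_def by (intro differentiable_lincomb d)
  show "(\<lambda>q. Kv q (F q) b) differentiable (at q)"
    unfolding Kv_def by (intro derivative_intros differentiable_lincomb d h) simp_all
qed

lemma frame_diff2:
  assumes q: "q \<in> S"
  shows "diff2 (\<lambda>q. fr q i v) q"
proof -
  note d = basic_differentiable[OF q]
  have h: "8 * hc q \<noteq> 0" "2 * rr q \<noteq> 0" "rr q \<noteq> 0" using h_nonzero[OF q] rr_nonzero[OF q] by simp_all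
  have b: "diff2 (\<lambda>q. bf q v) q"
    by (rule diff2I[OF S_open q has_derivative_bf[OF vol_pos rh_pos]], assumption, assumption)
      (intro derivative_intros differentiable_lincomb d h differentiable_const)
  have a: "diff2 (\<lambda>q. af q v a) q" for a
    by (rule diff2I[OF S_open q has_derivative_af], assumption)
      (intro derivative_intros differentiable_lincomb operator_differentiable[OF q] d h differentiable_const)
  have ab: "diff2 (\<lambda>q. aub q v a) q" for a
    by (rule diff2I[OF S_open q has_derivative_aub], assumption)
      (intro derivative_intros differentiable_lincomb operator_differentiable[OF q] d h differentiable_const differentiable_cnj)
  have a0: "diff2 (\<lambda>q. a0 q v) q"
    by (rule diff2I[OF S_open q has_derivative_a0], assumption)
      (intro derivative_intros d h differentiable_const)
  have K: "diff2 (\<lambda>q. Kv q (XB v) a) q" for a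
    by (rule diff2I[OF S_open q has_derivative_Kv[OF h_nonzero has_derivative_const]], assumption)
      (intro derivative_intros operator_differentiable[OF q] differentiable_const)
  have "diff2 (\<lambda>q. E1 q \<Gamma> v) q" for \<Gamma>
    by (cases \<Gamma>; rename_tac A; case_tac A) (simp_all add: a b a0 diff2_const)
  moreover have "diff2 (\<lambda>q. E2 q \<Gamma> v) q" for \<Gamma>
    by (cases \<Gamma>; rename_tac A; case_tac A)
      (auto intro!: diff2_compose_linear[OF bounded_linear_cnj]
        diff2_compose_linear[OF bounded_linear_minus[OF bounded_linear_ident]] ab b a0 K)
  ultimately show ?thesis by (cases "fst i = 1") (simp_all add: fr_def)
qed

lemma wE_differentiable:
  assumes q: "q \<in> S"
  shows "(\<lambda>q. wE q u \<Gamma> \<Delta>) differentiable (at q)"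
proof -
  note d = basic_differentiable[OF q]
  have h: "8 * hc q \<noteq> 0" using h_nonzero[OF q] by simp
  have vp: "(\<lambda>q. vp q u) differentiable (at q)" "(\<lambda>q. la q u) differentiable (at q)"
    unfolding vp_def la_def by (intro derivative_intros d differentiable_cnj differentiable_const; simp)+
  have G: "(\<lambda>q. Gam q u m n) differentiable (at q)" "(\<lambda>q. tf q u m n) differentiable (at q)" "(\<lambda>q. sf q u m n) differentiable (at q)" for m n
    unfolding Gam_def tf_def sf_def
    by (intro derivative_intros d h differentiable_lincomb operator_differentiable[OF q] differentiable_const)+
  show ?thesis
    by (cases \<Gamma>; cases \<Delta>; rename_tac A B; case_tac A; case_tac B)
      (auto intro!: derivative_intros d vp G)
qed

lemma wH_differentiable:
  assumes q: "q \<in> S"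
  shows "(\<lambda>q. wH q u \<alpha> \<beta>) differentiable (at q)"
proof -
  have "(\<lambda>q. vp q u) differentiable (at q)"
    unfolding vp_def by (intro derivative_intros basic_differentiable[OF q] differentiable_cnj differentiable_const; simp)
  then show ?thesis
    unfolding wH_def by (cases "\<alpha> = 1"; cases "\<beta> = 1") (auto intro!: derivative_intros basic_differentiable[OF q] differentiable_cnj)
qed

lemma w_differentiable: "q \<in> S \<Longrightarrow> (\<lambda>q. w q u i j) differentiable (at q)"
  unfolding w_def by (intro derivative_intros differentiable_const wE_differentiable wH_differentiable)

lemma vp_la_linear: "vp q (u + v) = vp q u + vp q v" "vp q (r *\<^sub>R v) = of_real r * vp q v"
  "la q (u + v) = la q u + la q v" "la q (r *\<^sub>R v) = of_real r * la q v"
  by (simp_all add: vp_def la_def a0_linear kap_linear field_simps)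

lemma linear_fun_right:
  "K3 q z (\<lambda>a. v a + v' a) = (\<lambda>b. K3 q z v b + K3 q z v' b)" "K3 q z (\<lambda>a. k * v a) = (\<lambda>b. k * K3 q z v b)"
  "tt z (\<lambda>a. v a + v' a) = (\<lambda>b. tt z v b + tt z v' b)" "tt z (\<lambda>a. k * v a) = (\<lambda>b. k * tt z v b)"
  by (simp_all add: fun_eq_iff K3_linear_right TT_add TT_scale)

lemma GTS_linear:
  "Gam q (u + v) m n = Gam q u m n + Gam q v m n" "Gam q (r *\<^sub>R v) m n = of_real r * Gam q v m n"
  "tf q (u + v) m n = tf q u m n + tf q v m n" "tf q (r *\<^sub>R v) m n = of_real r * tf q v m n"
  "sf q (u + v) m n = sf q u m n + sf q v m n" "sf q (r *\<^sub>R v) m n = of_real r * sf q v m n"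
  unfolding Gam_def tf_def sf_def coords_linear aub_linear aup_linear linear_fun_right linear_fun
  by (simp_all only: distrib_left mult.left_commute)

lemma wE_linear: "wE q (u + v) \<Gamma> \<Delta> = wE q u \<Gamma> \<Delta> + wE q v \<Gamma> \<Delta>" "wE q (r *\<^sub>R v) \<Gamma> \<Delta> = of_real r * wE q v \<Gamma> \<Delta>"
  by (cases \<Gamma>; cases \<Delta>; rename_tac A B; case_tac A; case_tac B;
      simp add: vp_la_linear GTS_linear af_linear aub_linear algebra_simps)+

lemma wH_linear: "wH q (u + v) \<alpha> \<beta> = wH q u \<alpha> \<beta> + wH q v \<alpha> \<beta>" "wH q (r *\<^sub>R v) \<alpha> \<beta> = of_real r * wH q v \<alpha> \<beta>"
  by (simp_all add: wH_def vp_la_linear bf_linear)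

lemma w_linear: "linear (\<lambda>u. w q u i j)"
  by (rule linearI) (simp_all add: w_def wE_linear wH_linear algebra_simps scaleR_conv_of_real)

definition Bf :: "2 \<times> 'n fidx \<Rightarrow> 2 \<times> 'n fidx \<Rightarrow> complex" where
  "Bf i j = eps (fst i) (fst j) * C_low (snd i) (snd j) / 2"

lemma sum_C_low:
  "(\<Sum>\<Lambda>\<in>UNIV. C_low \<Lambda> (Inr A) * f \<Lambda>) = f (Inl (A :: 'n option))"
  "(\<Sum>\<Lambda>\<in>UNIV. C_low \<Lambda> (Inl A) * f \<Lambda>) = - f (Inr A)"
  "(\<Sum>\<Lambda>\<in>UNIV. C_low (Inl A) \<Lambda> * f \<Lambda>) = f (Inr A)"
  "(\<Sum>\<Lambda>\<in>UNIV. C_low (Inr A) \<Lambda> * f \<Lambda>) = - f (Inl A)"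
  by (cases A; simp add: sum_fidx sum_negf)+

lemma sum_eps:
  "(\<Sum>\<gamma>\<in>UNIV. eps \<gamma> \<beta> * f \<gamma>) = (if \<beta> = 1 then - f 2 else f 1)"
  "(\<Sum>\<gamma>\<in>UNIV. eps \<beta> \<gamma> * f \<gamma>) = (if \<beta> = 1 then f 2 else - f 1)"
  using two_cases[of \<beta>] by (auto simp: sum_2 eps_def)

lemma tf_sym: "tf q u m n = tf q u n m"
proof -
  have "dot (delta m) (tt (delta n) (aub q u)) = dot (delta n) (tt (delta m) (aub q u))" by (rule tri_sym)
  then show ?thesis by (simp add: tf_def dot_delta)
qed

lemma sf_sym:
  assumes q: "q \<in> S"
  shows "sf q u m n = sf q u n m"
proof -
  have "dot (delta m) (Qv q (tt (Qv q (delta n)) (aup q u))) = dot (Qv q (delta m)) (tt (Qv q (delta n)) (aup q u))"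
    by (rule Qv_sym[OF q, symmetric])
  also have "\<dots> = dot (Qv q (delta n)) (tt (Qv q (delta m)) (aup q u))" by (rule tri_sym)
  also have "\<dots> = dot (delta n) (Qv q (tt (Qv q (delta m)) (aup q u)))" by (rule Qv_sym[OF q])
  finally show ?thesis by (simp add: sf_def dot_delta)
qed

lemma wE_symplectic:
  assumes q: "q \<in> S"
  shows "(\<Sum>\<Lambda>\<in>UNIV. C_low \<Lambda> \<Delta> * wE q u \<Lambda> \<Gamma>) + (\<Sum>\<Lambda>\<in>UNIV. C_low \<Gamma> \<Lambda> * wE q u \<Lambda> \<Delta>) = 0"
  by (cases \<Gamma>; cases \<Delta>; rename_tac A B; case_tac A; case_tac B)
    (auto simp: sum_C_low tf_sym sf_sym[OF q])

lemma wH_symplectic: "(\<Sum>\<gamma>\<in>UNIV. eps \<gamma> \<beta> * wH q u \<gamma> \<alpha>) + (\<Sum>\<gamma>\<in>UNIV. eps \<alpha> \<gamma> * wH q u \<gamma> \<beta>) = 0"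
  using two_cases[of \<alpha>] two_cases[of \<beta>] by (auto simp: sum_eps wH_def)

lemma sum_pair_swap: "(\<Sum>k\<in>UNIV. f (k :: 2 \<times> 'n fidx)) = (\<Sum>\<gamma>\<in>UNIV. \<Sum>\<Lambda>\<in>UNIV. f (\<gamma>, \<Lambda>))"
  by (simp add: sum.cartesian_product)

lemma sum_delta2:
  fixes f g :: "2 \<Rightarrow> 'n fidx \<Rightarrow> complex"
  shows "(\<Sum>\<gamma>\<in>UNIV. \<Sum>\<Lambda>\<in>UNIV. of_bool (\<Lambda> = \<Gamma>) * f \<gamma> \<Lambda> + of_bool (\<gamma> = \<alpha>) * g \<gamma> \<Lambda>)
     = (\<Sum>\<gamma>\<in>UNIV. f \<gamma> \<Gamma>) + (\<Sum>\<Lambda>\<in>UNIV. g \<alpha> \<Lambda>)"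
  by (simp add: sum.distrib sum_distrib_left[symmetric])

lemma w_skew:
  assumes q: "q \<in> S"
  shows "(\<Sum>k\<in>UNIV. Bf k j * w q u k i + Bf i k * w q u k j) = 0"
proof -
  obtain \<alpha> \<Gamma> \<beta> \<Delta> where ij: "i = (\<alpha>, \<Gamma>)" "j = (\<beta>, \<Delta>)" by (metis surj_pair)
  have 1: "(\<Sum>k\<in>UNIV. Bf k j * w q u k i) = C_low \<Gamma> \<Delta> / 2 * (\<Sum>\<gamma>\<in>UNIV. eps \<gamma> \<beta> * wH q u \<gamma> \<alpha>)
      + eps \<alpha> \<beta> / 2 * (\<Sum>\<Lambda>\<in>UNIV. C_low \<Lambda> \<Delta> * wE q u \<Lambda> \<Gamma>)"
  proof -
    have "Bf (\<gamma>, \<Lambda>) j * w q u (\<gamma>, \<Lambda>) i = of_bool (\<Lambda> = \<Gamma>) * (C_low \<Lambda> \<Delta> / 2 * (eps \<gamma> \<beta> * wH q u \<gamma> \<alpha>))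
       + of_bool (\<gamma> = \<alpha>) * (eps \<gamma> \<beta> / 2 * (C_low \<Lambda> \<Delta> * wE q u \<Lambda> \<Gamma>))" for \<gamma> \<Lambda>
      by (simp add: ij Bf_def w_def algebra_simps)
    then show ?thesis
      by (simp only: sum_pair_swap sum_delta2) (simp add: sum_distrib_left mult_ac)
  qed
  have 2: "(\<Sum>k\<in>UNIV. Bf i k * w q u k j) = C_low \<Gamma> \<Delta> / 2 * (\<Sum>\<gamma>\<in>UNIV. eps \<alpha> \<gamma> * wH q u \<gamma> \<beta>)
      + eps \<alpha> \<beta> / 2 * (\<Sum>\<Lambda>\<in>UNIV. C_low \<Gamma> \<Lambda> * wE q u \<Lambda> \<Delta>)"
  proof -
    have "Bf i (\<gamma>, \<Lambda>) * w q u (\<gamma>, \<Lambda>) j = of_bool (\<Lambda> = \<Delta>) * (C_low \<Gamma> \<Lambda> / 2 * (eps \<alpha> \<gamma> * wH q u \<gamma> \<beta>))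
       + of_bool (\<gamma> = \<beta>) * (eps \<alpha> \<gamma> / 2 * (C_low \<Gamma> \<Lambda> * wE q u \<Lambda> \<Delta>))" for \<gamma> \<Lambda>
      by (simp add: ij Bf_def w_def algebra_simps)
    then show ?thesis
      by (simp only: sum_pair_swap sum_delta2) (simp add: sum_distrib_left mult_ac)
  qed
  show ?thesis
    unfolding sum.distrib 1 2 using wH_symplectic[of \<beta> q u \<alpha>] wE_symplectic[OF q, of \<Delta> u \<Gamma>] by algebra
qed

lemma Bf_nondegenerate:
  assumes "\<And>j. (\<Sum>i\<in>UNIV. c i * Bf i j) = 0"
  shows "c i = 0"
proof -
  have "(\<Sum>i\<in>UNIV. c i * Bf i (\<beta>, \<Delta>)) = (\<Sum>\<gamma>\<in>UNIV. eps \<gamma> \<beta> * (\<Sum>\<Lambda>\<in>UNIV. C_low \<Lambda> \<Delta> * (c (\<gamma>, \<Lambda>) / 2)))" for \<beta> :: 2 and \<Delta>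
    by (simp add: sum_pair_swap Bf_def sum_distrib_left algebra_simps)
  then have "(if \<beta> = 1 then - (\<Sum>\<Lambda>\<in>UNIV. C_low \<Lambda> \<Delta> * (c (2, \<Lambda>) / 2)) else (\<Sum>\<Lambda>\<in>UNIV. C_low \<Lambda> \<Delta> * (c (1, \<Lambda>) / 2))) = 0" for \<beta> :: 2 and \<Delta>
    using assms[of "(\<beta>, \<Delta>)"] by (simp only: sum_eps)
  from this[of 1] this[of 2] have "(\<Sum>\<Lambda>\<in>UNIV. C_low \<Lambda> \<Delta> * (c (\<gamma>, \<Lambda>) / 2)) = 0" for \<gamma> \<Delta>
    using two_cases[of \<gamma>] by auto
  from this[of "Inl _"] this[of "Inr _"] have "c (\<gamma>, Inl A) = 0" "c (\<gamma>, Inr A) = 0" for \<gamma> A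
    unfolding sum_C_low by simp_all
  then show ?thesis by (cases i; cases "snd i") auto
qed

end

locale qmap_point = qmap_frame T X rh ph Zt0 Z0 Zt Z S Qm
  for T :: "'n::finite \<Rightarrow> 'n \<Rightarrow> 'n \<Rightarrow> real" and X :: "'n \<Rightarrow> 'a::euclidean_space \<Rightarrow> complex"
    and rh ph Zt0 Z0 Zt Z S Qm +
  fixes g :: "'a \<Rightarrow> 'a \<Rightarrow> 'a \<Rightarrow> real" and p :: 'a
  assumes p: "p \<in> S" and Kv_p: "\<And>z a. Kv p z a = z a"
    and metric: "\<And>q u v. q \<in> S \<Longrightarrow> of_real (g q u v) = (\<Sum>i\<in>UNIV. \<Sum>j\<in>UNIV. Bf i j * fr q i u * fr q j v)"

lemma C_low_antisym: "C_low \<Gamma> \<Delta> = - C_low \<Delta> \<Gamma>"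
  by (cases \<Gamma>; cases \<Delta>) auto

lemma eps_antisym: "eps \<alpha> \<beta> = - eps \<beta> \<alpha>"
  by (simp add: eps_def)

sublocale qmap_point \<subseteq> cart: cartan_frame g fr Bf w S p
proof
  show "open S" "p \<in> S" by (rule S_open, rule p)
  show "fr q i (y + z) = fr q i y + fr q i z" "fr q i (r *\<^sub>R z) = r *\<^sub>R fr q i z" for q i y z r
    by (rule linear_add[OF fr_linear], rule linear_scale[OF fr_linear])
  show "c i = 0" if "q \<in> S" "\<And>z. (\<Sum>i\<in>UNIV. c i * fr q i z) = 0" for q c i
    using frame_span that by blast
  show "v = 0" if q: "q \<in> S" and 0: "\<And>i. fr q i v = 0" for q v
  proof (rule frame_inj[OF q])
    show "E1 q \<Gamma> v = 0" for \<Gamma> using 0[of "(1, \<Gamma>)"] by (simp add: fr_def)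
  qed
  show "Bf i j = Bf j i" for i j
    using eps_antisym[of "fst i" "fst j"] C_low_antisym[of "snd i" "snd j"] by (simp add: Bf_def)
  show "c i = 0" if "\<And>j. (\<Sum>i\<in>UNIV. c i * Bf i j) = 0" for c i
    using Bf_nondegenerate that by blast
  show "of_real (g q u v) = (\<Sum>i\<in>UNIV. \<Sum>j\<in>UNIV. Bf i j * fr q i u * fr q j v)" if "q \<in> S" for q u v
    by (rule metric[OF that])
  show "has_ext (\<lambda>q. fr q i) q (\<lambda>u v. - (\<Sum>j\<in>UNIV. w q u i j * fr q j v - w q v i j * fr q j u))" if "q \<in> S" for q i
    by (rule torsion[OF that])
  show "(\<Sum>k\<in>UNIV. Bf k j * w q u k i + Bf i k * w q u k j) = 0" if "q \<in> S" for q u i j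
    by (rule w_skew[OF that])
  show "w q (y + z) i j = w q y i j + w q z i j" "w q (r *\<^sub>R z) i j = r *\<^sub>R w q z i j" for q i j y z r
    by (rule linear_add[OF w_linear], rule linear_scale[OF w_linear])
  show "diff2 (\<lambda>q. fr q i v) p" for i v by (rule frame_diff2[OF p])
  show "(\<lambda>q. w q u i j) differentiable (at p)" for u i j by (rule w_differentiable[OF p])
qed

context qmap_point
begin

definition DH :: "2 \<Rightarrow> 2 \<Rightarrow> 'a \<Rightarrow> 'a \<Rightarrow> complex" where
  "DH \<alpha> \<beta> u v = frechet_derivative (\<lambda>q. wH q v \<alpha> \<beta>) (at p) u"
definition DE :: "'n fidx \<Rightarrow> 'n fidx \<Rightarrow> 'a \<Rightarrow> 'a \<Rightarrow> complex" where
  "DE \<Gamma> \<Delta> u v = frechet_derivative (\<lambda>q. wE q v \<Gamma> \<Delta>) (at p) u"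

definition RH :: "2 \<Rightarrow> 2 \<Rightarrow> 'a \<Rightarrow> 'a \<Rightarrow> complex" where
  "RH \<alpha> \<beta> u v = DH \<alpha> \<beta> u v - DH \<alpha> \<beta> v u + (\<Sum>\<gamma>\<in>UNIV. wH p u \<alpha> \<gamma> * wH p v \<gamma> \<beta> - wH p v \<alpha> \<gamma> * wH p u \<gamma> \<beta>)"
definition RE :: "'n fidx \<Rightarrow> 'n fidx \<Rightarrow> 'a \<Rightarrow> 'a \<Rightarrow> complex" where
  "RE \<Gamma> \<Delta> u v = DE \<Gamma> \<Delta> u v - DE \<Gamma> \<Delta> v u + (\<Sum>\<Lambda>\<in>UNIV. wE p u \<Gamma> \<Lambda> * wE p v \<Lambda> \<Delta> - wE p v \<Gamma> \<Lambda> * wE p u \<Lambda> \<Delta>)"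

lemma has_derivative_wH: "((\<lambda>q. wH q v \<alpha> \<beta>) has_derivative (\<lambda>u. DH \<alpha> \<beta> u v)) (at p)"
  unfolding DH_def by (rule frechet_derivative_works[THEN iffD1, OF wH_differentiable[OF p]])

lemma has_derivative_wE: "((\<lambda>q. wE q v \<Gamma> \<Delta>) has_derivative (\<lambda>u. DE \<Gamma> \<Delta> u v)) (at p)"
  unfolding DE_def by (rule frechet_derivative_works[THEN iffD1, OF wE_differentiable[OF p]])

lemma DH_eqI: "((\<lambda>q. wH q v \<alpha> \<beta>) has_derivative D) (at p) \<Longrightarrow> DH \<alpha> \<beta> u v = D u"
  by (rule fun_cong[OF has_derivative_unique[OF has_derivative_wH]])

lemma DE_eqI: "((\<lambda>q. wE q v \<Gamma> \<Delta>) has_derivative D) (at p) \<Longrightarrow> DE \<Gamma> \<Delta> u v = D u"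
  by (rule fun_cong[OF has_derivative_unique[OF has_derivative_wE]])

lemma curvature_splits:
  "cart.curv_form (\<alpha>, \<Gamma>) (\<beta>, \<Delta>) u v = of_bool (\<Gamma> = \<Delta>) * RH \<alpha> \<beta> u v + of_bool (\<alpha> = \<beta>) * RE \<Gamma> \<Delta> u v"
proof -
  have "((\<lambda>q. w q v (\<alpha>, \<Gamma>) (\<beta>, \<Delta>)) has_derivative
      (\<lambda>u. of_bool (\<Gamma> = \<Delta>) * DH \<alpha> \<beta> u v + of_bool (\<alpha> = \<beta>) * DE \<Gamma> \<Delta> u v)) (at p)" for v
    unfolding w_def fst_conv snd_conv
    by (intro has_derivative_add has_derivative_mult_right has_derivative_wH has_derivative_wE)
  then have 1: "frechet_derivative (\<lambda>q. w q v (\<alpha>, \<Gamma>) (\<beta>, \<Delta>)) (at p) u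
      = of_bool (\<Gamma> = \<Delta>) * DH \<alpha> \<beta> u v + of_bool (\<alpha> = \<beta>) * DE \<Gamma> \<Delta> u v" for u v
    by (rule fun_cong[OF frechet_derivative_at[symmetric]])
  have 2: "(\<Sum>k\<in>UNIV. w p u (\<alpha>, \<Gamma>) k * w p v k (\<beta>, \<Delta>))
     = of_bool (\<Gamma> = \<Delta>) * (\<Sum>\<gamma>\<in>UNIV. wH p u \<alpha> \<gamma> * wH p v \<gamma> \<beta>) + wH p u \<alpha> \<beta> * wE p v \<Gamma> \<Delta>
       + wE p u \<Gamma> \<Delta> * wH p v \<alpha> \<beta> + of_bool (\<alpha> = \<beta>) * (\<Sum>\<Lambda>\<in>UNIV. wE p u \<Gamma> \<Lambda> * wE p v \<Lambda> \<Delta>)" for u v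
  proof -
    have "w p u (\<alpha>, \<Gamma>) (\<gamma>, \<Lambda>) * w p v (\<gamma>, \<Lambda>) (\<beta>, \<Delta>) =
        of_bool (\<Lambda> = \<Gamma>) * (wH p u \<alpha> \<gamma> * (of_bool (\<Lambda> = \<Delta>) * wH p v \<gamma> \<beta> + of_bool (\<gamma> = \<beta>) * wE p v \<Lambda> \<Delta>))
      + of_bool (\<gamma> = \<alpha>) * (wE p u \<Gamma> \<Lambda> * (of_bool (\<Lambda> = \<Delta>) * wH p v \<gamma> \<beta> + of_bool (\<gamma> = \<beta>) * wE p v \<Lambda> \<Delta>))" for \<gamma> \<Lambda>
      by (simp add: w_def algebra_simps)
    then have "(\<Sum>k\<in>UNIV. w p u (\<alpha>, \<Gamma>) k * w p v k (\<beta>, \<Delta>))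
      = (\<Sum>\<gamma>\<in>UNIV. wH p u \<alpha> \<gamma> * (of_bool (\<Gamma> = \<Delta>) * wH p v \<gamma> \<beta> + of_bool (\<gamma> = \<beta>) * wE p v \<Gamma> \<Delta>))
      + (\<Sum>\<Lambda>\<in>UNIV. wE p u \<Gamma> \<Lambda> * (of_bool (\<Lambda> = \<Delta>) * wH p v \<alpha> \<beta> + of_bool (\<alpha> = \<beta>) * wE p v \<Lambda> \<Delta>))"
      by (simp only: sum_pair_swap sum_delta2)
    moreover have "wH p u \<alpha> \<gamma> * (of_bool (\<Gamma> = \<Delta>) * wH p v \<gamma> \<beta> + of_bool (\<gamma> = \<beta>) * wE p v \<Gamma> \<Delta>)
       = of_bool (\<Gamma> = \<Delta>) * (wH p u \<alpha> \<gamma> * wH p v \<gamma> \<beta>) + of_bool (\<gamma> = \<beta>) * (wH p u \<alpha> \<gamma> * wE p v \<Gamma> \<Delta>)" for \<gamma>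
      by (simp add: algebra_simps)
    moreover have "wE p u \<Gamma> \<Lambda> * (of_bool (\<Lambda> = \<Delta>) * wH p v \<alpha> \<beta> + of_bool (\<alpha> = \<beta>) * wE p v \<Lambda> \<Delta>)
       = of_bool (\<Lambda> = \<Delta>) * (wE p u \<Gamma> \<Lambda> * wH p v \<alpha> \<beta>) + of_bool (\<alpha> = \<beta>) * (wE p u \<Gamma> \<Lambda> * wE p v \<Lambda> \<Delta>)" for \<Lambda>
      by (simp add: algebra_simps)
    ultimately show ?thesis
      by (simp add: sum.distrib sum_distrib_left[symmetric])
  qed
  show ?thesis
    unfolding cart.curv_form_def 1 sum_subtractf 2 RH_def RE_def by (simp add: algebra_simps)
qed

lemma frame_curvature_split:
  "fr p (\<alpha>, \<Gamma>) (curvature_at g p u v z) = RH \<alpha> 1 u v * fr p (1, \<Gamma>) z + RH \<alpha> 2 u v * fr p (2, \<Gamma>) z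
     + (\<Sum>\<Delta>\<in>UNIV. RE \<Gamma> \<Delta> u v * fr p (\<alpha>, \<Delta>) z)"
proof -
  have d: "(\<Sum>\<Delta>\<in>UNIV. of_bool (\<Gamma> = \<Delta>) * k * f \<Delta>) = k * (f \<Gamma> :: complex)" for k f
    by (simp add: mult.assoc)
  show ?thesis
    unfolding cart.frame_curvature sum_pair curvature_splits
    using two_cases[of \<alpha>] by (auto simp: distrib_right sum.distrib d)
qed

text \<open>Symmetries of the two curvature factors.\<close>

lemma has_derivative_cnj_unique: "((\<lambda>q. f q) has_derivative D) (at p) \<Longrightarrow> ((\<lambda>q. cnj (f q)) has_derivative D') (at p) \<Longrightarrow> D' u = cnj (D u)"
  by (rule fun_cong[OF has_derivative_unique[OF _ has_derivative_cnj]])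

lemma cnj_vp: "cnj (vp q u) = - vp q u"
  by (simp add: vp_def cnj_kap diff_divide_distrib)

lemma wH_hermitian: "cnj (wH q u \<alpha> \<beta>) = - wH q u \<beta> \<alpha>"
  using two_cases[of \<alpha>] two_cases[of \<beta>] by (auto simp: wH_def cnj_vp)

lemma DH_hermitian: "cnj (DH \<alpha> \<beta> u v) = - DH \<beta> \<alpha> u v"
proof -
  have "((\<lambda>q. cnj (wH q v \<alpha> \<beta>)) has_derivative (\<lambda>u. - DH \<beta> \<alpha> u v)) (at p)"
    unfolding wH_hermitian by (intro has_derivative_minus has_derivative_wH)
  from has_derivative_cnj_unique[OF has_derivative_wH this] show ?thesis by simp
qed

lemma RH_hermitian: "cnj (RH \<alpha> \<beta> u v) = - RH \<beta> \<alpha> u v"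
  by (simp add: RH_def DH_hermitian wH_hermitian sum_subtractf sum_negf mult.commute)

lemma DH_trace: "DH 2 2 u v = - DH 1 1 u v"
  by (rule DH_eqI) (use has_derivative_minus[OF has_derivative_wH[of v 1 1]] in \<open>simp add: wH_def\<close>)

lemma RH_trace: "RH 2 2 u v = - RH 1 1 u v"
  by (simp add: RH_def DH_trace sum_2 wH_def)

lemma RH_sp: "(\<lambda>\<alpha> \<beta>. RH \<alpha> \<beta> u v) \<in> sp_algebra eps"
proof -
  have "(\<Sum>k\<in>UNIV. RH k i u v * eps k j + eps i k * RH k j u v) = 0" for i j
    using two_cases[of i] two_cases[of j] RH_trace[of u v] by (auto simp: sum_2 eps_def)
  then show ?thesis unfolding sp_algebra_def by (auto simp: RH_hermitian)
qed

lemma wE_sym: "wE q u (Inr A) (Inr B) = - wE q u (Inl B) (Inl A)" "wE q u (Inr A) (Inl B) = wE q u (Inr B) (Inl A)"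
  "q \<in> S \<Longrightarrow> wE q u (Inl A) (Inr B) = wE q u (Inl B) (Inr A)"
  by (cases A; cases B; auto simp: tf_sym[of q u] sf_sym)+

lemma DE_sym: "DE (Inr A) (Inr B) u v = - DE (Inl B) (Inl A) u v" "DE (Inr A) (Inl B) u v = DE (Inr B) (Inl A) u v"
proof -
  show "DE (Inr A) (Inr B) u v = - DE (Inl B) (Inl A) u v"
    by (rule DE_eqI) (use has_derivative_minus[OF has_derivative_wE[of v "Inl B" "Inl A"]] in \<open>simp add: wE_sym(1)\<close>)
  show "DE (Inr A) (Inl B) u v = DE (Inr B) (Inl A) u v"
    by (rule DE_eqI) (use has_derivative_wE[of v "Inr B" "Inl A"] in \<open>simp add: wE_sym(2)[of _ _ A B]\<close>)
qed

lemma sum_lr: "(\<Sum>\<Gamma>\<in>UNIV. f (\<Gamma> :: 'n fidx)) = (\<Sum>A\<in>UNIV. f (Inl A)) + (\<Sum>A\<in>UNIV. f (Inr A))"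
  by (subst UNIV_Plus_UNIV[symmetric], subst sum.Plus) auto

lemma RE_sym: "RE (Inr A) (Inr B) u v = - RE (Inl B) (Inl A) u v" "RE (Inr A) (Inl B) u v = RE (Inr B) (Inl A) u v"
proof -
  show "RE (Inr A) (Inr B) u v = - RE (Inl B) (Inl A) u v"
    unfolding RE_def sum_lr DE_sym wE_sym(1)
    by (simp add: wE_sym(2)[of p u A] wE_sym(2)[of p v A] wE_sym(3)[OF p, of u _ B] wE_sym(3)[OF p, of v _ B] sum_subtractf sum_negf mult.commute)
  show "RE (Inr A) (Inl B) u v = RE (Inr B) (Inl A) u v"
    unfolding RE_def sum_lr DE_sym(2)[of A B] wE_sym(1)
    by (simp add: wE_sym(2)[of p u _ B] wE_sym(2)[of p v _ B] wE_sym(2)[of p u _ A] wE_sym(2)[of p v _ A] sum_subtractf sum_negf mult.commute)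
qed

fun bar :: "'n fidx \<Rightarrow> 'n fidx" where "bar (Inl A) = Inr A" | "bar (Inr A) = Inl A"
fun sg :: "'n fidx \<Rightarrow> complex" where "sg (Inl A) = 1" | "sg (Inr A) = -1"

lemma bar_bar [simp]: "bar (bar \<Gamma>) = \<Gamma>" by (cases \<Gamma>) auto
lemma sg_bar: "sg (bar \<Gamma>) = - sg \<Gamma>" by (cases \<Gamma>) auto
lemma sg_sg [simp]: "sg \<Gamma> * sg \<Gamma> = 1" by (cases \<Gamma>) auto

lemma Qv_p: "Qv p z a = z a"
proof -
  have "Kv p z = z" for z by (simp add: Kv_p fun_eq_iff)
  then show ?thesis using Qv_Kv[OF p, of z] by simp
qed

lemma aup_p: "aup p v = af p v" "aub p v a = cnj (af p v a)"
  by (simp_all add: aup_def aub_def Qv_p fun_eq_iff del: cnj_aub)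

lemma cnj_frame: "cnj (E1 p \<Gamma> z) = sg \<Gamma> * E2 p (bar \<Gamma>) z" "cnj (E2 p \<Gamma> z) = - sg \<Gamma> * E1 p (bar \<Gamma>) z"
  by (cases \<Gamma>; rename_tac A; case_tac A; simp add: Kv_p aup_p)+

lemma RE_real: "cnj (RE \<Gamma> \<Delta> u v) = sg \<Gamma> * sg \<Delta> * RE (bar \<Gamma>) (bar \<Delta>) u v"
proof -
  define c where "c i = (if fst i = 1 then 0
      else cnj (RE \<Gamma> (bar (snd i)) u v) * sg (bar (snd i)) * sg \<Gamma> - RE (bar \<Gamma>) (snd i) u v)" for i :: "2 \<times> 'n fidx"
  have "c (2, bar \<Delta>) = 0"
  proof (rule frame_span[OF p, of c])
    fix z
    let ?R = "curvature_at g p u v z"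
    have 1: "E1 p \<Gamma> ?R = RH 1 1 u v * E1 p \<Gamma> z + RH 1 2 u v * E2 p \<Gamma> z + (\<Sum>\<Lambda>\<in>UNIV. RE \<Gamma> \<Lambda> u v * E1 p \<Lambda> z)"
      using frame_curvature_split[of 1 \<Gamma> u v z] by (simp add: fr_def)
    have 2: "E2 p (bar \<Gamma>) ?R = RH 2 1 u v * E1 p (bar \<Gamma>) z + RH 2 2 u v * E2 p (bar \<Gamma>) z
        + (\<Sum>\<Lambda>\<in>UNIV. RE (bar \<Gamma>) \<Lambda> u v * E2 p \<Lambda> z)"
      using frame_curvature_split[of 2 "bar \<Gamma>" u v z] by (simp add: fr_def)
    have "bij bar" by (rule o_bij[of bar]) auto
    then have re: "(\<Sum>\<Lambda>\<in>UNIV. f (bar \<Lambda>)) = (\<Sum>\<Lambda>\<in>UNIV. f \<Lambda>)" for f :: "'n fidx \<Rightarrow> complex"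
      by (rule sum.reindex_bij_betw)
    have "sg \<Gamma> * E2 p (bar \<Gamma>) ?R = cnj (E1 p \<Gamma> ?R)" by (simp add: cnj_frame)
    also have "\<dots> = - RH 1 1 u v * (sg \<Gamma> * E2 p (bar \<Gamma>) z) + RH 2 1 u v * (sg \<Gamma> * E1 p (bar \<Gamma>) z)
       + (\<Sum>\<Lambda>\<in>UNIV. cnj (RE \<Gamma> \<Lambda> u v) * (sg \<Lambda> * E2 p (bar \<Lambda>) z))"
      unfolding 1 by (simp add: cnj_frame RH_hermitian)
    also have "(\<Sum>\<Lambda>\<in>UNIV. cnj (RE \<Gamma> \<Lambda> u v) * (sg \<Lambda> * E2 p (bar \<Lambda>) z))
       = (\<Sum>\<Lambda>\<in>UNIV. cnj (RE \<Gamma> (bar \<Lambda>) u v) * (sg (bar \<Lambda>) * E2 p \<Lambda> z))"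
      using re[of "\<lambda>\<Lambda>. cnj (RE \<Gamma> (bar \<Lambda>) u v) * (sg (bar \<Lambda>) * E2 p \<Lambda> z)"] by simp
    finally have 3: "sg \<Gamma> * E2 p (bar \<Gamma>) ?R = - RH 1 1 u v * (sg \<Gamma> * E2 p (bar \<Gamma>) z) + RH 2 1 u v * (sg \<Gamma> * E1 p (bar \<Gamma>) z)
       + (\<Sum>\<Lambda>\<in>UNIV. cnj (RE \<Gamma> (bar \<Lambda>) u v) * (sg (bar \<Lambda>) * E2 p \<Lambda> z))" .
    have "(\<Sum>\<Lambda>\<in>UNIV. cnj (RE \<Gamma> (bar \<Lambda>) u v) * (sg (bar \<Lambda>) * E2 p \<Lambda> z))
      = sg \<Gamma> * (\<Sum>\<Lambda>\<in>UNIV. RE (bar \<Gamma>) \<Lambda> u v * E2 p \<Lambda> z)"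
      using 3 unfolding 2 RH_trace by (simp add: algebra_simps)
    then have "sg \<Gamma> * (\<Sum>\<Lambda>\<in>UNIV. cnj (RE \<Gamma> (bar \<Lambda>) u v) * (sg (bar \<Lambda>) * E2 p \<Lambda> z))
      = (\<Sum>\<Lambda>\<in>UNIV. RE (bar \<Gamma>) \<Lambda> u v * E2 p \<Lambda> z)"
      by (simp add: mult.assoc[symmetric])
    moreover have "c (2, \<Lambda>) * fr p (2, \<Lambda>) z = sg \<Gamma> * (cnj (RE \<Gamma> (bar \<Lambda>) u v) * (sg (bar \<Lambda>) * E2 p \<Lambda> z))
        - RE (bar \<Gamma>) \<Lambda> u v * E2 p \<Lambda> z" "c (1, \<Lambda>) = 0" for \<Lambda>
      by (simp_all add: c_def fr_def algebra_simps)
    ultimately show "(\<Sum>i\<in>UNIV. c i * fr p i z) = 0"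
      by (simp only: sum_pair sum_subtractf sum_distrib_left[symmetric]) simp
  qed
  then have R: "cnj (RE \<Gamma> \<Delta> u v) * sg \<Delta> * sg \<Gamma> = RE (bar \<Gamma>) (bar \<Delta>) u v"
    by (simp add: c_def)
  have "sg \<Gamma> * sg \<Delta> * RE (bar \<Gamma>) (bar \<Delta>) u v = (sg \<Gamma> * sg \<Gamma>) * (sg \<Delta> * sg \<Delta>) * cnj (RE \<Gamma> \<Delta> u v)"
    unfolding R[symmetric] by (simp only: mult_ac)
  then show ?thesis by simp
qed

lemma RE_sym_lr: "RE (Inl A) (Inr B) u v = RE (Inl B) (Inr A) u v"
proof -
  have "cnj (RE (Inl A) (Inr B) u v) = cnj (RE (Inl B) (Inr A) u v)"
    by (simp add: RE_real RE_sym(2)[of A B])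
  then show ?thesis by simp
qed

lemma RE_sp: "(\<lambda>\<Gamma> \<Delta>. RE \<Gamma> \<Delta> u v) \<in> sp_algebra C_low"
proof -
  have "RE \<Gamma> \<Delta> u v = - cnj (RE \<Delta> \<Gamma> u v)" for \<Gamma> \<Delta>
    unfolding RE_real
    by (cases \<Gamma>; cases \<Delta>) (auto simp: RE_sym(1) RE_sym(2)[symmetric] intro: RE_sym(2) RE_sym_lr)
  moreover have "(\<Sum>k\<in>UNIV. RE k i u v * C_low k j + C_low i k * RE k j u v) = 0" for i j
    by (cases i; cases j) (auto simp: sum.distrib mult.commute[of "RE _ _ u v"] sum_C_low RE_sym(1) RE_sym_lr intro: RE_sym(2))
  ultimately show ?thesis unfolding sp_algebra_def by blast
qed

end

context cubic_chart
begin

definition K4 :: "'a \<Rightarrow> ('n \<Rightarrow> complex) \<Rightarrow> ('n \<Rightarrow> complex) \<Rightarrow> ('n \<Rightarrow> complex) \<Rightarrow> 'n \<Rightarrow> complex" where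
  "K4 q s y z a =
    ((tt s y a * dot (hd q) z + tt s z a * dot (hd q) y + tt y z a * dot (hd q) s + hd q a * dot s (tt y z)
       + tt (xc q) s a * dot y (tt (xc q) z) + tt (xc q) y a * dot s (tt (xc q) z) + tt (xc q) z a * dot s (tt (xc q) y)) / (hc q)\<^sup>2
     - 2 * (tt (xc q) s a * dot (hd q) y * dot (hd q) z + tt (xc q) y a * dot (hd q) s * dot (hd q) z
          + tt (xc q) z a * dot (hd q) s * dot (hd q) y
          + hd q a * (dot s (tt (xc q) y) * dot (hd q) z + dot s (tt (xc q) z) * dot (hd q) y + dot y (tt (xc q) z) * dot (hd q) s)) / (hc q) ^ 3
     + 6 * hd q a * dot (hd q) s * dot (hd q) y * dot (hd q) z / (hc q) ^ 4) / 4"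

lemma has_derivative_K3:
  assumes h: "hc q \<noteq> 0"
  shows "((\<lambda>q. K3 q s y a) has_derivative (\<lambda>u. K4 q s y (xc u) a)) (at q)"
proof -
  let ?i = "\<lambda>q. inverse (hc q)"
  have z: "dot c (\<lambda>a. 0) = 0" "tt c (\<lambda>a. 0) b = 0" for c b by (simp_all add: dot_def TT_def)
  have inv: "(?i has_derivative (\<lambda>u. - (?i q * dot (hd q) (xc u) * ?i q))) (at q)"
    by (rule Deriv.has_derivative_inverse[OF h has_derivative_hc])
  have d: "((\<lambda>q. dot (hd q) c) has_derivative (\<lambda>u. dot c (tt (xc q) (xc u)))) (at q)" for c
  proof -
    have "((\<lambda>q. dot (hd q) c) has_derivative (\<lambda>u. dot (tt (xc q) (xc u)) c + dot (hd q) (\<lambda>a. 0))) (at q)"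
      by (intro has_derivative_dot has_derivative_hd has_derivative_const refl)
    then show ?thesis by (simp only: z add_0_right dot_sym[of _ c])
  qed
  have t: "((\<lambda>q. tt (xc q) c b) has_derivative (\<lambda>u. tt c (xc u) b)) (at q)" for c b
  proof -
    have "((\<lambda>q. tt (xc q) c b) has_derivative (\<lambda>u. tt (xc u) c b + tt (xc q) (\<lambda>a. 0) b)) (at q)"
      by (intro has_derivative_TT has_derivative_coords has_derivative_const refl)
    then show ?thesis by (simp only: z add_0_right tt_sym[of _ c])
  qed
  have dt: "((\<lambda>q. dot s (tt (xc q) c)) has_derivative (\<lambda>u. dot s (tt c (xc u)))) (at q)" for c
  proof -
    have "((\<lambda>q. dot s (tt (xc q) c)) has_derivative (\<lambda>u. dot (\<lambda>a. 0) (tt (xc q) c) + dot s (tt c (xc u)))) (at q)"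
      by (intro has_derivative_dot has_derivative_const t refl)
    then show ?thesis by (simp only: dot_sym[of "\<lambda>a. 0"] z add_0_left)
  qed
  have eq: "K3 q s y a = (- tt s y a * ?i q
     + (tt (xc q) s a * dot (hd q) y + dot (hd q) s * tt (xc q) y a + hd q a * dot s (tt (xc q) y)) * (?i q * ?i q)
     - 2 * (hd q a * (dot (hd q) s * dot (hd q) y)) * (?i q * (?i q * ?i q))) / 4" for q
    by (simp add: K3_def power2_eq_square power3_eq_cube divide_inverse[of _ "hc q * _"] divide_inverse[of _ "hc q"] mult.assoc)
  have 1: "((\<lambda>q. K3 q s y a) has_derivative (\<lambda>u. (- tt s y a * - (?i q * dot (hd q) (xc u) * ?i q)
     + ((tt (xc q) s a * dot (hd q) y + dot (hd q) s * tt (xc q) y a + hd q a * dot s (tt (xc q) y))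
           * (?i q * - (?i q * dot (hd q) (xc u) * ?i q) + - (?i q * dot (hd q) (xc u) * ?i q) * ?i q)
        + ((tt (xc q) s a * dot y (tt (xc q) (xc u)) + tt s (xc u) a * dot (hd q) y)
           + (dot (hd q) s * tt y (xc u) a + dot s (tt (xc q) (xc u)) * tt (xc q) y a)
           + (hd q a * dot s (tt y (xc u)) + tt (xc q) (xc u) a * dot s (tt (xc q) y))) * (?i q * ?i q))
     - (2 * (hd q a * (dot (hd q) s * dot (hd q) y)) * (?i q * (?i q * - (?i q * dot (hd q) (xc u) * ?i q) + - (?i q * dot (hd q) (xc u) * ?i q) * ?i q)
            + - (?i q * dot (hd q) (xc u) * ?i q) * (?i q * ?i q))
        + 2 * (hd q a * (dot (hd q) s * dot y (tt (xc q) (xc u)) + dot s (tt (xc q) (xc u)) * dot (hd q) y)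
            + tt (xc q) (xc u) a * (dot (hd q) s * dot (hd q) y)) * (?i q * (?i q * ?i q)))) / 4)) (at q)"
    unfolding eq
    by (intro bounded_linear.has_derivative[OF bounded_linear_divide] has_derivative_add has_derivative_diff has_derivative_mult
        has_derivative_mult_right inv d t dt has_derivative_hd)
  show ?thesis
  proof (rule has_derivative_eq_rhs[OF 1], rule ext)
    fix u
    define i where "i = ?i q"
    have div: "c / hc q = c * i" "c / (hc q)\<^sup>2 = c * (i * i)" "c / hc q ^ 3 = c * (i * (i * i))" "c / hc q ^ 4 = c * (i * (i * (i * i)))" for c
      by (simp_all add: i_def divide_inverse power2_eq_square power3_eq_cube power4_eq_xxxx)
    show "(- tt s y a * - (?i q * dot (hd q) (xc u) * ?i q)
     + ((tt (xc q) s a * dot (hd q) y + dot (hd q) s * tt (xc q) y a + hd q a * dot s (tt (xc q) y))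
           * (?i q * - (?i q * dot (hd q) (xc u) * ?i q) + - (?i q * dot (hd q) (xc u) * ?i q) * ?i q)
        + ((tt (xc q) s a * dot y (tt (xc q) (xc u)) + tt s (xc u) a * dot (hd q) y)
           + (dot (hd q) s * tt y (xc u) a + dot s (tt (xc q) (xc u)) * tt (xc q) y a)
           + (hd q a * dot s (tt y (xc u)) + tt (xc q) (xc u) a * dot s (tt (xc q) y))) * (?i q * ?i q))
     - (2 * (hd q a * (dot (hd q) s * dot (hd q) y)) * (?i q * (?i q * - (?i q * dot (hd q) (xc u) * ?i q) + - (?i q * dot (hd q) (xc u) * ?i q) * ?i q)
            + - (?i q * dot (hd q) (xc u) * ?i q) * (?i q * ?i q))
        + 2 * (hd q a * (dot (hd q) s * dot y (tt (xc q) (xc u)) + dot s (tt (xc q) (xc u)) * dot (hd q) y)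
            + tt (xc q) (xc u) a * (dot (hd q) s * dot (hd q) y)) * (?i q * (?i q * ?i q)))) / 4 = K4 q s y (xc u) a"
      unfolding K4_def div i_def[symmetric] by (simp add: algebra_simps add_divide_distrib diff_divide_distrib)
  qed
qed

end

context qmap_point
begin

definition te :: "('n \<Rightarrow> complex) \<Rightarrow> ('n \<Rightarrow> complex) \<Rightarrow> 'n \<Rightarrow> complex" where "te y z a = tt y z a / (8 * hc p)"

lemma h_p: "hc p \<noteq> 0" by (rule h_nonzero[OF p])

lemma hd_p: "hd p a = 4 * hc p * xc p a"
  using Kv_x[OF h_p, of a] h_p by (simp add: Kv_p field_simps)

lemma dot_hd_p: "dot (hd p) z = 4 * hc p * dot (xc p) z"
  using hd_p by (simp add: dot_def sum_distrib_left mult_ac)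

lemma x_x: "dot (xc p) (xc p) = 3 / 4"
  using dot_hd_x[of p] h_p unfolding dot_hd_p by (simp add: eq_divide_eq mult.commute)

lemma tt_te: "tt y z a = 8 * hc p * te y z a"
  using h_p by (simp add: te_def)

lemma tt_te_fun: "tt y z = (\<lambda>a. 8 * hc p * te y z a)"
  by (simp add: tt_te fun_eq_iff)

lemma te_sym: "te y z = te z y"
  by (simp add: te_def[abs_def] tt_sym[of y])

lemma te_tri: "dot y (te z s) = dot z (te y s)"
  using tri_sym[of y z s] h_p by (simp add: te_def[abs_def] dot_divide)

lemma te_linear: "te (\<lambda>a. v a + v' a) z b = te v z b + te v' z b" "te z (\<lambda>a. v a + v' a) b = te z v b + te z v' b"
  "te (\<lambda>a. v a - v' a) z b = te v z b - te v' z b" "te z (\<lambda>a. v a - v' a) b = te z v b - te z v' b"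
  "te (\<lambda>a. - v a) z b = - te v z b" "te z (\<lambda>a. - v a) b = - te z v b"
  "te (\<lambda>a. k * v a) z b = k * te v z b" "te z (\<lambda>a. k * v a) b = k * te z v b"
  "te (\<lambda>a. v a * k) z b = te v z b * k" "te z (\<lambda>a. v a * k) b = te z v b * k"
  "te (\<lambda>a. v a / k) z b = te v z b / k" "te z (\<lambda>a. v a / k) b = te z v b / k"
  by (simp_all add: te_def multilinear add_divide_distrib diff_divide_distrib)

lemma te_x: "te (xc p) z a = 2 * xc p a * dot (xc p) z - z a / 2"
proof -
  have "Kv p z a = z a" by (rule Kv_p)
  then have "(16 * xc p a * dot (xc p) z - 8 * te (xc p) z a) / 4 = z a"
    unfolding Kv_def dot_hd_p hd_p tt_te using h_p by (simp add: field_simps power2_eq_square)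
  then have "te (xc p) z a = (16 * xc p a * dot (xc p) z - 4 * z a) / 8"
    by (simp add: eq_divide_eq divide_eq_eq algebra_simps)
  then show ?thesis by (simp add: diff_divide_distrib)
qed

lemma dot_te_x: "dot y (te (xc p) z) = 2 * dot (xc p) y * dot (xc p) z - dot y z / 2"
  by (simp add: te_x[abs_def] dot_diff dot_scale dot_scale' dot_divide dot_sym[of y "xc p"])

lemma K3_p: "K3 p s z a = - 2 * te s z a + 16 * xc p a * dot (xc p) s * dot (xc p) z
    - 4 * (s a * dot (xc p) z + z a * dot (xc p) s + xc p a * dot s z)"
proof -
  have K: "K3 p s z a = (- (8 * te s z a) + 32 * (te (xc p) s a * dot (xc p) z + dot (xc p) s * te (xc p) z a
      + xc p a * dot s (te (xc p) z)) - 128 * xc p a * dot (xc p) s * dot (xc p) z) / 4"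
    unfolding K3_def dot_hd_p hd_p tt_te tt_te_fun dot_scale using h_p by (simp add: field_simps power2_eq_square power3_eq_cube)
  show ?thesis unfolding K te_x dot_te_x by (simp add: algebra_simps add_divide_distrib diff_divide_distrib)
qed

lemma K4_p: "K4 p s y z a = 8 * (te s y a * dot (xc p) z + te s z a * dot (xc p) y + te y z a * dot (xc p) s + xc p a * dot s (te y z))
    + 16 * (te (xc p) s a * dot y (te (xc p) z) + te (xc p) y a * dot s (te (xc p) z) + te (xc p) z a * dot s (te (xc p) y))
    - 64 * (te (xc p) s a * dot (xc p) y * dot (xc p) z + te (xc p) y a * dot (xc p) s * dot (xc p) z + te (xc p) z a * dot (xc p) s * dot (xc p) y
       + xc p a * (dot s (te (xc p) y) * dot (xc p) z + dot s (te (xc p) z) * dot (xc p) y + dot y (te (xc p) z) * dot (xc p) s))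
    + 384 * xc p a * dot (xc p) s * dot (xc p) y * dot (xc p) z"
  unfolding K4_def dot_hd_p hd_p tt_te tt_te_fun dot_scale using h_p
  by (simp add: field_simps power2_eq_square power3_eq_cube power4_eq_xxxx)

lemma kap_p: "kap p u = 2 * \<i> * dot (xc p) (yc u)"
  unfolding kap_def dot_hd_p using h_p by simp

lemma Gam_p: "Gam p u m n = - \<i> / 2 * K3 p (delta n) (XX u) m"
  by (simp add: Gam_def Qv_p)

lemma tf_p: "tf p u m n = \<i> * te (delta n) (aub p u) m"
  using h_p by (simp add: tf_def te_def)

lemma sf_p: "sf p u m n = \<i> * te (delta n) (af p u) m"
proof -
  have "Qv p z = z" for z by (simp add: Qv_p fun_eq_iff)
  then show ?thesis using h_p by (simp add: sf_def te_def aup_p)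
qed

text \<open>Exterior derivatives at the point.\<close>

lemma DE_ext:
  assumes "has_ext (\<lambda>q v. wE q v \<Gamma> \<Delta>) p \<Phi>"
  shows "DE \<Gamma> \<Delta> u v - DE \<Gamma> \<Delta> v u = \<Phi> u v"
  using has_ext_frechet[OF assms, of u v] by (simp add: DE_def)

lemma Kv_p_fun: "Kv p z = z" by (simp add: Kv_p fun_eq_iff)
lemma Qv_p_fun: "Qv p z = z" by (simp add: Qv_p fun_eq_iff)

definition da0 :: "'a \<Rightarrow> 'a \<Rightarrow> complex" where
  "da0 u v = cnj (a0 p u) * a0 p v - cnj (a0 p v) * a0 p u + (bf p u * cnj (bf p v) - bf p v * cnj (bf p u))
     - (dot (af p u) (aub p v) - dot (af p v) (aub p u))"

lemma ext_a0_p: "has_ext a0 p da0"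
  by (rule has_ext_eqI[OF ext_a0[OF p]]) (simp add: da0_def algebra_simps)

lemma cnj_da0: "cnj (da0 u v) = - da0 u v"
  by (simp add: da0_def cnj_dot aup_p(1)[symmetric] dot_sym[of "aub p _" "aup p _"] algebra_simps)

lemma ext_kap_p: "has_ext kap p (\<lambda>u v. dot (XB u) (XX v) - dot (XB v) (XX u))"
  using ext_kap[OF p] by (simp add: Kv_p_fun)

lemma ext_la_p: "has_ext la p (\<lambda>u v. - 3 / 2 * da0 u v + (dot (XB u) (XX v) - dot (XB v) (XX u)) / 2)"
proof -
  have "has_ext (\<lambda>q v. 3 / 4 * (cnj (a0 q v) - a0 q v) + kap q v / 2) p
     (\<lambda>u v. 3 / 4 * (cnj (da0 u v) - da0 u v) + (dot (XB u) (XX v) - dot (XB v) (XX u)) / 2)"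
    by (intro has_ext_add has_ext_cmult has_ext_diff has_ext_cnj ext_a0_p has_ext_linear[OF bounded_linear_divide] ext_kap_p)
  then show ?thesis unfolding la_def[abs_def] by (simp add: cnj_da0)
qed

lemma ext_vp_p: "has_ext vp p (\<lambda>u v. da0 u v / 2 + (dot (XB u) (XX v) - dot (XB v) (XX u)) / 2)"
proof -
  have "has_ext (\<lambda>q v. (a0 q v - cnj (a0 q v)) / 4 + kap q v / 2) p
     (\<lambda>u v. (da0 u v - cnj (da0 u v)) / 4 + (dot (XB u) (XX v) - dot (XB v) (XX u)) / 2)"
    by (intro has_ext_add has_ext_diff has_ext_cnj ext_a0_p has_ext_linear[OF bounded_linear_divide] ext_kap_p)
  then show ?thesis unfolding vp_def[abs_def] by (simp add: cnj_da0)
qed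

lemma ext_Gam_p: "has_ext (\<lambda>q v. Gam q v m n) p
   (\<lambda>u v. - \<i> / 2 * (K4 p (delta n) (XX v) (xc u) m - K3 p (K3 p (delta n) (XX v)) (xc u) m)
      - - \<i> / 2 * (K4 p (delta n) (XX u) (xc v) m - K3 p (K3 p (delta n) (XX u)) (xc v) m))"
proof (rule has_extI)
  fix v
  have "((\<lambda>q. Gam q v m n) has_derivative (\<lambda>u. - \<i> / 2 * Qv p (\<lambda>a. K4 p (delta n) (XX v) (xc u) a
      - K3 p (Qv p (K3 p (delta n) (XX v))) (xc u) a) m)) (at p)"
    unfolding Gam_def
    by (intro has_derivative_mult_right has_derivative_Qv[OF p] has_derivative_K3[OF h_p])
  then show "((\<lambda>q. Gam q v m n) has_derivative (\<lambda>u. - \<i> / 2 * (K4 p (delta n) (XX v) (xc u) m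
      - K3 p (K3 p (delta n) (XX v)) (xc u) m))) (at p)"
    by (simp only: Qv_p_fun)
qed simp

lemma has_ext_tt:
  assumes "\<And>a. has_ext (\<lambda>q v. \<phi> q v a) p (\<lambda>u v. \<Phi> u v a)"
  shows "has_ext (\<lambda>q v. tt c (\<phi> q v) m) p (\<lambda>u v. tt c (\<Phi> u v) m)"
  unfolding TT_def by (intro has_ext_sum has_ext_cmult assms)

definition daub :: "'a \<Rightarrow> 'a \<Rightarrow> 'n \<Rightarrow> complex" where
  "daub u v a = ((a0 p u + cnj (a0 p u)) / 2 + kap p u) * aub p v a + \<i> / 2 * K3 p (aub p v) (XX u) a
       - XX u a * cnj (bf p v) - \<i> * te (XB u) (af p v) a
     - (((a0 p v + cnj (a0 p v)) / 2 + kap p v) * aub p u a + \<i> / 2 * K3 p (aub p u) (XX v) a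
       - XX v a * cnj (bf p u) - \<i> * te (XB v) (af p u) a)"

lemma ext_aub_p: "has_ext (\<lambda>q v. aub q v a) p (\<lambda>u v. daub u v a)"
  by (rule has_ext_eqI[OF ext_aub[OF p]]) (use h_p in \<open>simp add: daub_def Qv_p_fun aup_p(1) te_def\<close>)

lemma ext_tf_p: "has_ext (\<lambda>q v. tf q v m n) p (\<lambda>u v. \<i> * te (delta n) (daub u v) m
    - 4 * \<i> * (dot (xc p) (xc u) * te (delta n) (aub p v) m - dot (xc p) (xc v) * te (delta n) (aub p u) m))"
proof -
  have inv: "((\<lambda>q. inverse (hc q)) has_derivative (\<lambda>u. - (inverse (hc p) * dot (hd p) (xc u) * inverse (hc p)))) (at p)"
    by (rule Deriv.has_derivative_inverse[OF h_p has_derivative_hc])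
  have tf: "tf q v m n = \<i> / 8 * (inverse (hc q) * tt (delta n) (aub q v) m)" for q v
    by (simp add: tf_def field_simps)
  have "has_ext (\<lambda>q v. \<i> / 8 * (inverse (hc q) * tt (delta n) (aub q v) m)) p
     (\<lambda>u v. \<i> / 8 * (- (inverse (hc p) * dot (hd p) (xc u) * inverse (hc p)) * tt (delta n) (aub p v) m
        - - (inverse (hc p) * dot (hd p) (xc v) * inverse (hc p)) * tt (delta n) (aub p u) m
        + inverse (hc p) * tt (delta n) (daub u v) m))"
    by (intro has_ext_cmult has_ext_mult inv has_ext_tt ext_aub_p)
  then have "has_ext (\<lambda>q v. tf q v m n) p
     (\<lambda>u v. \<i> / 8 * (- (inverse (hc p) * dot (hd p) (xc u) * inverse (hc p)) * tt (delta n) (aub p v) m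
        - - (inverse (hc p) * dot (hd p) (xc v) * inverse (hc p)) * tt (delta n) (aub p u) m
        + inverse (hc p) * tt (delta n) (daub u v) m))"
    unfolding tf .
  then show ?thesis
    by (rule has_ext_eqI) (use h_p in \<open>simp add: dot_hd_p tt_te field_simps\<close>)
qed

end

context qmap_point
begin

lemma te_te: "te (te (delta n) y) z m = dot (te (delta n) y) (te (delta m) z)"
proof -
  have "te (te (delta n) y) z m = dot (delta m) (te (te (delta n) y) z)" by (simp add: dot_delta)
  also have "\<dots> = dot (te (delta n) y) (te (delta m) z)" by (rule te_tri)
  finally show ?thesis .
qed

lemma te_delta: "te (delta n) z m = te (delta m) z n"
proof -
  have "dot (delta m) (te (delta n) z) = dot (delta n) (te (delta m) z)" by (rule te_tri)
  then show ?thesis by (simp add: dot_delta)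
qed

lemma te_delta_dot: "dot y (te (delta n) z) = te y z n"
  using te_tri[of y "delta n" z] by (simp add: dot_delta)

lemma te_delta2: "te (delta n) (te y z) m = dot (te (delta m) (delta n)) (te y z)"
proof -
  have "te (delta n) (te y z) m = dot (delta m) (te (te y z) (delta n))" by (simp add: dot_delta te_sym[of "delta n"])
  also have "\<dots> = dot (te y z) (te (delta m) (delta n))" by (rule te_tri)
  finally show ?thesis by (simp add: dot_sym)
qed

lemma Gam_p_fun: "(\<lambda>k. Gam p v k n) = (\<lambda>k. - \<i> / 2 * K3 p (delta n) (XX v) k)"
  by (simp add: Gam_p fun_eq_iff)

lemma tf_p_fun: "(\<lambda>k. tf p v k n) = (\<lambda>k. \<i> * te (delta n) (aub p v) k)"
  by (simp add: tf_p fun_eq_iff)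

lemma RE_00: "RE (Inl None) (Inl None) u v = - 3 / 2 * da0 u v + (dot (XB u) (XX v) - dot (XB v) (XX u)) / 2
    - (dot (af p u) (aub p v) - dot (af p v) (aub p u))"
proof -
  have "has_ext (\<lambda>q v. wE q v (Inl None) (Inl None)) p (\<lambda>u v. - 3 / 2 * da0 u v + (dot (XB u) (XX v) - dot (XB v) (XX u)) / 2)"
    using ext_la_p by simp
  from DE_ext[OF this, of u v] show ?thesis
    unfolding RE_def sum_subtractf sum_wE by simp
qed

lemma RE_0n: "RE (Inl None) (Inl (Some n)) u v =
   - (((a0 p u + cnj (a0 p u)) / 2 - kap p u + la p u + vp p u) * af p v n - XB u n * bf p v + \<i> * te (XX u) (aub p v) n
    - (((a0 p v + cnj (a0 p v)) / 2 - kap p v + la p v + vp p v) * af p u n - XB v n * bf p u + \<i> * te (XX v) (aub p u) n))"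
proof -
  have "has_ext (\<lambda>q v. wE q v (Inl None) (Inl (Some n))) p (\<lambda>u v. -
     (((a0 p u + cnj (a0 p u)) / 2 - kap p u) * af p v n - \<i> / 2 * K3 p (af p v) (XX u) n
       - XB u n * bf p v + \<i> * te (XX u) (aub p v) n
     - (((a0 p v + cnj (a0 p v)) / 2 - kap p v) * af p u n - \<i> / 2 * K3 p (af p u) (XX v) n
       - XB v n * bf p u + \<i> * te (XX v) (aub p u) n)))"
    using has_ext_minus[OF ext_af[OF p, of n]] by (simp add: Kv_p_fun aup_p(1) te_def)
  note 1 = DE_ext[OF this, of u v]
  have 2: "dot y (\<lambda>m. Gam p v m n - of_bool (m = n) * k) = - \<i> / 2 * K3 p y (XX v) n - k * y n" for y v k
  proof -
    have "dot y (\<lambda>m. Gam p v m n) = - \<i> / 2 * K3 p (Qv p y) (XX v) n"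
      unfolding Gam_apply_transposed[OF p, symmetric] by (simp add: dot_def mult.commute)
    then show ?thesis by (simp add: multilinear dot_delta Qv_p_fun)
  qed
  show ?thesis
    unfolding RE_def 1 sum_subtractf sum_wE by (simp add: 2 algebra_simps)
qed

lemma RE_mn: "RE (Inl (Some m)) (Inl (Some n)) u v =
   - \<i> / 2 * (K4 p (delta n) (XX v) (xc u) m - K3 p (K3 p (delta n) (XX v)) (xc u) m)
   + \<i> / 2 * (K4 p (delta n) (XX u) (xc v) m - K3 p (K3 p (delta n) (XX u)) (xc v) m)
   - of_bool (m = n) * (da0 u v / 2 + (dot (XB u) (XX v) - dot (XB v) (XX u)) / 2)
   - (aub p u m * af p v n - aub p v m * af p u n)
   - 1 / 4 * (K3 p (K3 p (delta n) (XX v)) (XX u) m - K3 p (K3 p (delta n) (XX u)) (XX v) m)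
   - (te (te (delta n) (aub p v)) (af p u) m - te (te (delta n) (aub p u)) (af p v) m)"
proof -
  have "has_ext (\<lambda>q v. wE q v (Inl (Some m)) (Inl (Some n))) p
    (\<lambda>u v. (- \<i> / 2 * (K4 p (delta n) (XX v) (xc u) m - K3 p (K3 p (delta n) (XX v)) (xc u) m)
      - - \<i> / 2 * (K4 p (delta n) (XX u) (xc v) m - K3 p (K3 p (delta n) (XX u)) (xc v) m))
      - of_bool (m = n) * (da0 u v / 2 + (dot (XB u) (XX v) - dot (XB v) (XX u)) / 2))"
    unfolding wE.simps by (intro has_ext_diff has_ext_cmult ext_Gam_p ext_vp_p)
  note 1 = DE_ext[OF this, of u v]
  have G: "K3 p (\<lambda>k. Gam p v k n - of_bool (k = n) * c) y m = - \<i> / 2 * K3 p (K3 p (delta n) (XX v)) y m - c * K3 p (delta n) y m" for v c y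
    unfolding K3_linear Gam_p_fun by (simp add: K3_sym[of p _ y] K3_linear_right mult.commute[of _ c])
  have t: "tt (\<lambda>k. tf p v k n) y m = \<i> * (8 * hc p) * te (te (delta n) (aub p v)) y m" for v y
    unfolding tf_p_fun by (simp add: multilinear tt_te)
  show ?thesis
    unfolding RE_def 1 sum_subtractf sum_wE wE.simps Qv_p_fun unfolding G t
    using h_p by (simp add: Qv_p_fun aup_p(1) Gam_p algebra_simps add_divide_distrib diff_divide_distrib)
qed

lemma RE_rl_00: "RE (Inr None) (Inl A) u v = 0"
proof -
  have "has_ext (\<lambda>q v. wE q v (Inr None) (Inl A)) p (\<lambda>u v. 0)" by (simp add: has_ext_const)
  note 1 = DE_ext[OF this, of u v]
  have z: "dot y (\<lambda>n. 0) = 0" for y :: "'n \<Rightarrow> complex" by (simp add: dot_def)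
  show ?thesis
  proof (cases A)
    case None
    then show ?thesis unfolding RE_def using 1 by (simp add: sum_subtractf sum_wE z)
  next
    case (Some n)
    then show ?thesis unfolding RE_def using 1
      by (simp add: sum_subtractf sum_wE tf_p_fun dot_scale te_delta_dot te_sym[of "aub p u" "aub p v"])
  qed
qed

lemma RE_rl_mn: "RE (Inr (Some m)) (Inl (Some n)) u v =
   \<i> * te (delta n) (daub u v) m
    - 4 * \<i> * (dot (xc p) (xc u) * te (delta n) (aub p v) m - dot (xc p) (xc v) * te (delta n) (aub p u) m)
   + 1 / 2 * (te (K3 p (delta n) (XX v)) (aub p u) m - te (K3 p (delta n) (XX u)) (aub p v) m)
   + 2 * \<i> * (vp p u * te (delta n) (aub p v) m - vp p v * te (delta n) (aub p u) m)
   - 1 / 2 * (K3 p (te (delta n) (aub p v)) (XX u) m - K3 p (te (delta n) (aub p u)) (XX v) m)"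
proof -
  have "has_ext (\<lambda>q v. wE q v (Inr (Some m)) (Inl (Some n))) p (\<lambda>u v. \<i> * te (delta n) (daub u v) m
    - 4 * \<i> * (dot (xc p) (xc u) * te (delta n) (aub p v) m - dot (xc p) (xc v) * te (delta n) (aub p u) m))"
    unfolding wE.simps by (rule ext_tf_p)
  note 1 = DE_ext[OF this, of u v]
  have G: "te (\<lambda>k. Gam p v k n - of_bool (k = n) * c) y m = - \<i> / 2 * te (K3 p (delta n) (XX v)) y m - c * te (delta n) y m" for v c y
    unfolding te_linear Gam_p_fun by (simp add: te_linear mult.commute[of _ c])
  have t: "K3 p (\<lambda>k. tf p v k n) y m = \<i> * K3 p (te (delta n) (aub p v)) y m" for v y
    unfolding tf_p_fun by (rule K3_linear(4))
  show ?thesis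
    unfolding RE_def 1 sum_subtractf sum_wE(4)[OF p] wE.simps tt_te Qv_p_fun unfolding G t
    using h_p by (simp add: aup_p(1) tf_p algebra_simps add_divide_distrib diff_divide_distrib)
qed

text \<open>The quartic tensor.\<close>

definition mm :: "('n \<Rightarrow> complex) \<Rightarrow> ('n \<Rightarrow> complex) \<Rightarrow> complex" where
  "mm y z = 2 * dot (xc p) y * dot (xc p) z - dot y z / 2"

definition SS :: "('n \<Rightarrow> complex) \<Rightarrow> ('n \<Rightarrow> complex) \<Rightarrow> ('n \<Rightarrow> complex) \<Rightarrow> ('n \<Rightarrow> complex) \<Rightarrow> complex" where
  "SS y1 y2 y3 y4 = - (1 / 2) * (
      (dot (te y2 y3) (te y1 y4) - 4 * mm y2 y3 * mm y1 y4)
    + (dot (te y1 y3) (te y2 y4) - 4 * mm y1 y3 * mm y2 y4)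
    + (dot (te y1 y2) (te y3 y4) - 4 * mm y1 y2 * mm y3 y4)
    + 2 * (dot (xc p) y1 * dot y2 (te y3 y4) + dot (xc p) y2 * dot y3 (te y4 y1)
         + dot (xc p) y3 * dot y4 (te y1 y2) + dot (xc p) y4 * dot y1 (te y2 y3)))"

lemma RE_rl_mn': "RE (Inr (Some m)) (Inl (Some n)) u v =
    2 * (SS (delta m) (delta n) (XX v) (aub p u) - SS (delta m) (delta n) (XX u) (aub p v))
    + \<i> * (te (delta n) (\<lambda>a. a0 p u * aub p v a - a0 p v * aub p u a + cnj (bf p u) * XX v a - cnj (bf p v) * XX u a) m)
    - (dot (te (delta m) (delta n)) (te (af p u) (XB v)) - dot (te (delta m) (delta n)) (te (af p v) (XB u)))"
proof -
  have xr: "xc p' = (\<lambda>a. - \<i> / 2 * (XX p' a - XB p' a))" for p' by (simp add: XX_eq fun_eq_iff)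
  have K3f: "K3 p s z = (\<lambda>a. - 2 * te s z a + 16 * xc p a * dot (xc p) s * dot (xc p) z
    - 4 * (s a * dot (xc p) z + z a * dot (xc p) s + xc p a * dot s z))" for s z
    by (simp add: K3_p fun_eq_iff)
  have kx: "kap p u = \<i> * (dot (xc p) (XX u) + dot (xc p) (XB u))" for u
    unfolding kap_p XX_eq by (simp add: multilinear algebra_simps)
  have vpx: "vp p u = (a0 p u - cnj (a0 p u)) / 4 + \<i> * (dot (xc p) (XX u) + dot (xc p) (XB u)) / 2" for u
    unfolding vp_def kx ..
  have dx: "dot (xc p) (xc u) = - \<i> / 2 * (dot (xc p) (XX u) - dot (xc p) (XB u))" for u
    unfolding XX_eq by (simp add: multilinear algebra_simps)
  have te_x': "te z (xc p) a = 2 * xc p a * dot (xc p) z - z a / 2" for z a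
    using te_x[of z a] by (simp only: te_sym[of z "xc p"])
  have dd: "dot (xc p) (te (delta n) z) = 2 * xc p n * dot (xc p) z - z n / 2" for n z
    by (simp add: te_delta_dot te_x)
  have dt: "dot (delta m) (te y z) = te y z m" "dot y (te z (delta m)) = te y z m" for m y z
    by (rule dot_delta(1)) (simp only: te_sym[of z "delta m"] te_delta_dot)
  show ?thesis
    unfolding RE_rl_mn daub_def K3f vpx kx dx
    using te_delta[of n "aub p u" m] te_delta[of n "aub p v" m]
    apply (simp add: te_linear te_te te_x' dd dt dot_delta te_x multilinear SS_def mm_def)
    by (simp add: te_sym[of "XX _" "aub p _"] te_sym[of "XB _" "af p _"] te_sym[of "aub p _" "delta _"] te_sym[of "XX _" "delta _"]
        dot_sym[of "aub p _" "XX _"] te_delta2 dot_sym[of "te (delta _) _" "XX _"] te_delta_dot[of "XX _"]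
        dot_sym[of "te (delta _) _" "aub p _"] te_delta_dot[of "aub p _"] dot_sym[of "te (delta _) (aub p _)" "te (delta _) (XX _)"]
        algebra_simps add_divide_distrib diff_divide_distrib)
qed

lemma RE_0n': "RE (Inl None) (Inl (Some n)) u v =
   - (cnj (a0 p u) * af p v n - XB u n * bf p v + \<i> * te (XX u) (aub p v) n
    - (cnj (a0 p v) * af p u n - XB v n * bf p u + \<i> * te (XX v) (aub p u) n))"
proof -
  have "(a0 p u + cnj (a0 p u)) / 2 - kap p u + la p u + vp p u = cnj (a0 p u)" for u
    by (simp add: la_def vp_def field_simps)
  then show ?thesis by (simp only: RE_0n)
qed

lemma RE_mn': "RE (Inl (Some m)) (Inl (Some n)) u v =
   - (XX u m * XB v n - XX v m * XB u n + aub p u m * af p v n - aub p v m * af p u n)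
   - 1 / 2 * of_bool (m = n) * (bf p u * cnj (bf p v) - bf p v * cnj (bf p u) + cnj (a0 p u) * a0 p v - cnj (a0 p v) * a0 p u
       + dot (XX u) (XB v) - dot (XX v) (XB u) + dot (aub p u) (af p v) - dot (aub p v) (af p u))
   + dot (te (delta n) (XX u)) (te (delta m) (XB v)) - dot (te (delta n) (XX v)) (te (delta m) (XB u))
   + dot (te (delta n) (aub p u)) (te (delta m) (af p v)) - dot (te (delta n) (aub p v)) (te (delta m) (af p u))"
proof -
  have xr: "xc p' = (\<lambda>a. - \<i> / 2 * (XX p' a - XB p' a))" for p' by (simp add: XX_eq fun_eq_iff)
  have K3f: "K3 p s z = (\<lambda>a. - 2 * te s z a + 16 * xc p a * dot (xc p) s * dot (xc p) z
    - 4 * (s a * dot (xc p) z + z a * dot (xc p) s + xc p a * dot s z))" for s z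
    by (simp add: K3_p fun_eq_iff)
  define KX where "KX u v = - \<i> / 2 * (K4 p (delta n) (XX v) (xc u) m - K3 p (K3 p (delta n) (XX v)) (xc u) m)
    - 1 / 4 * K3 p (K3 p (delta n) (XX v)) (XX u) m" for u v
  have K4_lin: "K4 p (delta n) y (xc u) m = - \<i> / 2 * (K4 p (delta n) y (XX u) m - K4 p (delta n) y (XB u) m)" for y u
    unfolding K4_p xr[of u] by (simp add: te_linear dot_delta dot_te_x te_x multilinear algebra_simps add_divide_distrib diff_divide_distrib)
  have K3_lin: "K3 p y (xc u) m = - \<i> / 2 * (K3 p y (XX u) m - K3 p y (XB u) m)" for y u
    unfolding xr[of u] K3_linear_right ..
  have K4_sym: "K4 p (delta n) y z m = K4 p (delta n) z y m" for y z
    unfolding K4_p by (simp add: te_sym[of y z] te_tri[of "delta n" y z] dot_te_x dot_sym[of y z] algebra_simps)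
  have KX: "KX u v = - 1 / 4 * K4 p (delta n) (XX v) (XX u) m + 1 / 4 * (K4 p (delta n) (XX v) (XB u) m - K3 p (K3 p (delta n) (XX v)) (XB u) m)" for u v
    unfolding KX_def K4_lin K3_lin by (simp add: algebra_simps)
  have key: "K4 p (delta n) y z m - K3 p (K3 p (delta n) y) z m
     = 4 * (of_bool (m = n) * dot y z + y m * z n - dot (te (delta n) y) (te (delta m) z))" for y z
  proof -
    have dd: "dot (xc p) (te (delta n) z) = 2 * xc p n * dot (xc p) z - z n / 2" for n z
      by (simp add: te_delta_dot te_x)
    have te_x': "te z (xc p) a = 2 * xc p a * dot (xc p) z - z a / 2" for z a
      using te_x[of z a] by (simp only: te_sym[of z "xc p"])
    have dt: "dot (delta m) (te y z) = te y z m" for m y z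
      by (rule dot_delta(1))
    show ?thesis
      unfolding K4_p K3f using te_delta[of n z m] te_delta[of n y m]
      by (simp add: te_linear te_te te_x' dd dt dot_delta te_x dot_te_x multilinear x_x te_delta_dot[of z] te_sym[of y z] dot_sym[of y z] dot_sym[of "te (delta _) _" z]
          algebra_simps add_divide_distrib diff_divide_distrib)
  qed
  have KX': "KX u v - KX v u = of_bool (m = n) * dot (XX v) (XB u) + XX v m * XB u n - dot (te (delta n) (XX v)) (te (delta m) (XB u))
     - (of_bool (m = n) * dot (XX u) (XB v) + XX u m * XB v n - dot (te (delta n) (XX u)) (te (delta m) (XB v)))"
    unfolding KX key by (simp add: K4_sym[of "XX v" "XX u"] add_divide_distrib diff_divide_distrib)
  have "RE (Inl (Some m)) (Inl (Some n)) u v = KX u v - KX v u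
   - of_bool (m = n) * (da0 u v / 2 + (dot (XB u) (XX v) - dot (XB v) (XX u)) / 2)
   - (aub p u m * af p v n - aub p v m * af p u n)
   - (te (te (delta n) (aub p v)) (af p u) m - te (te (delta n) (aub p u)) (af p v) m)"
    unfolding RE_mn KX_def by (simp add: algebra_simps)
  then show ?thesis
    unfolding KX' te_te da0_def
    by (simp add: dot_sym[of "XB _" "XX _"] dot_sym[of "aub p _" "af p _"] algebra_simps add_divide_distrib diff_divide_distrib)
qed

end

lemma sum_option: "(\<Sum>A\<in>UNIV. f (A :: 'n::finite option)) = f None + (\<Sum>a\<in>UNIV. f (Some a))"
  by (simp add: UNIV_option_conv sum.reindex)

lemma bilinear_delta:
  fixes F :: "('n::finite \<Rightarrow> complex) \<Rightarrow> ('n \<Rightarrow> complex) \<Rightarrow> complex"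
  assumes "\<And>v v' z. F (\<lambda>a. v a + v' a) z = F v z + F v' z" "\<And>k v z. F (\<lambda>a. k * v a) z = k * F v z"
    and "\<And>v v' z. F z (\<lambda>a. v a + v' a) = F z v + F z v'" "\<And>k v z. F z (\<lambda>a. k * v a) = k * F z v"
  shows "(\<Sum>a\<in>UNIV. \<Sum>b\<in>UNIV. F (\<lambda>c. of_bool (c = a)) (\<lambda>c. of_bool (c = b)) * (y a * z b)) = F y z"
proof -
  have "(\<Sum>b\<in>UNIV. F (\<lambda>c. of_bool (c = a)) (\<lambda>c. of_bool (c = b)) * (y a * z b)) = F (\<lambda>c. of_bool (c = a)) z * y a" for a
    using linear_functional_delta[of "F (\<lambda>c. of_bool (c = a))" z, OF assms(3,4)]
    by (simp add: sum_distrib_right[symmetric] mult.assoc[symmetric] mult.commute[of "y a"] del: sum_distrib_right)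
  then show ?thesis using linear_functional_delta[of "\<lambda>v. F v z" y, OF assms(1,2)] by simp
qed

lemma symmetric4I:
  fixes T :: "'n fidx \<Rightarrow> 'n fidx \<Rightarrow> 'n fidx \<Rightarrow> 'n fidx \<Rightarrow> complex"
  assumes "\<And>i j k l. T i j k l = T j i k l" "\<And>i j k l. T i j k l = T i k j l" "\<And>i j k l. T i j k l = T i j l k"
  shows "symmetric4 T"
  unfolding symmetric4_def
proof (intro allI impI)
  fix i j k l i' j' k' l' :: "'n fidx"
  assume eq: "{#i, j, k, l#} = {#i', j', k', l'#}"
  have two: "T a b k l = T a b k' l'" if "{#k, l#} = {#k', l'#}" for a b k l k' l'
  proof (cases "k = k'")
    case True
    then show ?thesis using that by simp
  next
    case False
    have "k \<in># {#k', l'#}" unfolding that[symmetric] by simp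
    with False have k: "k = l'" by simp
    then have "{#l#} = {#k'#}" using that by (simp add: add_mset_commute)
    then show ?thesis using k assms(3) by simp
  qed
  have three: "T a j k l = T a j' k' l'" if e: "{#j, k, l#} = {#j', k', l'#}" for a j k l j' k' l'
  proof -
    have "j \<in># {#j', k', l'#}" unfolding e[symmetric] by simp
    then consider "j = j'" | "j = k'" | "j = l'" by auto
    then show ?thesis
    proof cases
      case 1
      then show ?thesis using e two[of k l k' l' a j] by simp
    next
      case 2
      then have "{#k, l#} = {#j', l'#}" using e by (simp add: add_mset_commute)
      then show ?thesis using two[of k l j' l' a j] 2 assms(2)[of a j'] by simp
    next
      case 3
      then have "{#k, l#} = {#j', k'#}" using e by (simp add: add_mset_commute)
      then show ?thesis using two[of k l j' k' a j] 3 assms(2)[of a j' l'] assms(3)[of a j'] by simp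
    qed
  qed
  have "i \<in># {#i', j', k', l'#}" unfolding eq[symmetric] by simp
  then consider "i = i'" | "i = j'" | "i = k'" | "i = l'" by auto
  then show "T i j k l = T i' j' k' l'"
  proof cases
    case 1
    then show ?thesis using eq three[of j k l j' k' l' i] by simp
  next
    case 2
    then have "{#j, k, l#} = {#i', k', l'#}" using eq by (simp add: add_mset_commute)
    then show ?thesis using three[of j k l i' k' l' i] 2 assms(1)[of i'] by simp
  next
    case 3
    then have "{#j, k, l#} = {#i', j', l'#}" using eq by (simp add: add_mset_commute)
    then show ?thesis using three[of j k l i' j' l' i] 3 assms(1)[of i' k'] assms(2)[of i' j'] by simp
  next
    case 4
    then have "{#j, k, l#} = {#i', j', k'#}" using eq by (simp add: add_mset_commute)
    then show ?thesis using three[of j k l i' j' k' i] 4 assms(1)[of i' l'] assms(2)[of i' j' l'] assms(3)[of i' j'] by simp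
  qed
qed

context qmap_point
begin

fun oT :: "'n option \<Rightarrow> 'n option \<Rightarrow> 'n option \<Rightarrow> 'n option \<Rightarrow> complex" where
  "oT (Some a) (Some b) (Some c) None = - \<i> / 2 * dot (delta a) (te (delta b) (delta c))"
| "oT _ _ _ _ = 0"

fun oS :: "'n option \<Rightarrow> 'n option \<Rightarrow> 'n option \<Rightarrow> 'n option \<Rightarrow> complex" where
  "oS (Some a) (Some b) (Some c) (Some d) = SS (delta a) (delta b) (delta c) (delta d)"
| "oS _ _ _ _ = 0"

fun oV :: "'n option \<Rightarrow> 'n option \<Rightarrow> 'n option \<Rightarrow> 'n option \<Rightarrow> complex" where
  "oV (Some a) (Some b) (Some c) (Some d) = - 1 / 2 * dot (te (delta a) (delta b)) (te (delta c) (delta d))"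
| "oV _ _ _ _ = 0"

definition oU :: "'n option \<Rightarrow> 'n option \<Rightarrow> 'n option \<Rightarrow> 'n option \<Rightarrow> complex" where
  "oU A B C D = 1 / 4 * (of_bool (A = C) * of_bool (B = D) + of_bool (A = D) * of_bool (B = C)) + oV A B C D"

fun Om :: "'n fidx \<Rightarrow> 'n fidx \<Rightarrow> 'n fidx \<Rightarrow> 'n fidx \<Rightarrow> complex" where
  "Om (Inl A) (Inl B) (Inl C) (Inl D) = oS A B C D"
| "Om (Inr A) (Inr B) (Inr C) (Inr D) = oS A B C D"
| "Om (Inl A) (Inl B) (Inl C) (Inr D) = oT A B C D"
| "Om (Inl A) (Inl B) (Inr D) (Inl C) = oT A B C D"
| "Om (Inl A) (Inr D) (Inl B) (Inl C) = oT A B C D"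
| "Om (Inr D) (Inl A) (Inl B) (Inl C) = oT A B C D"
| "Om (Inr A) (Inr B) (Inr C) (Inl D) = oT A B C D"
| "Om (Inr A) (Inr B) (Inl D) (Inr C) = oT A B C D"
| "Om (Inr A) (Inl D) (Inr B) (Inr C) = oT A B C D"
| "Om (Inl D) (Inr A) (Inr B) (Inr C) = oT A B C D"
| "Om (Inl A) (Inl B) (Inr C) (Inr D) = oU A B C D"
| "Om (Inl A) (Inr C) (Inl B) (Inr D) = oU A B C D"
| "Om (Inl A) (Inr C) (Inr D) (Inl B) = oU A B C D"
| "Om (Inr C) (Inl A) (Inl B) (Inr D) = oU A B C D"
| "Om (Inr C) (Inl A) (Inr D) (Inl B) = oU A B C D"
| "Om (Inr C) (Inr D) (Inl A) (Inl B) = oU A B C D"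

lemma dte_perm: "dot y1 (te y2 y3) = dot y2 (te y1 y3)" "dot y1 (te y2 y3) = dot y1 (te y3 y2)"
  by (rule te_tri, simp only: te_sym[of y2])

lemma mm_sym: "mm y z = mm z y"
  by (simp add: mm_def dot_sym[of y z])

lemma SS_sym: "SS y1 y2 y3 y4 = SS y2 y1 y3 y4" "SS y1 y2 y3 y4 = SS y1 y3 y2 y4" "SS y1 y2 y3 y4 = SS y1 y2 y4 y3"
proof -
  define D where "D a b c d = dot (te a b) (te c d)" for a b c d
  define t where "t a b c = dot a (te b c)" for a b c
  have D1: "D a b c d = D b a c d" and D2: "D a b c d = D a b d c" and D3: "D a b c d = D c d a b" for a b c d
    unfolding D_def by (simp_all only: te_sym[of a b]) (simp only: te_sym[of c d], rule dot_sym)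
  have t: "t a b c = t b a c" "t a b c = t a c b" for a b c
    unfolding t_def by (rule te_tri) (simp only: te_sym[of b c])
  have S: "SS y1 y2 y3 y4 = - (1 / 2) * (
      (D y2 y3 y1 y4 - 4 * mm y2 y3 * mm y1 y4) + (D y1 y3 y2 y4 - 4 * mm y1 y3 * mm y2 y4)
    + (D y1 y2 y3 y4 - 4 * mm y1 y2 * mm y3 y4)
    + 2 * (dot (xc p) y1 * t y2 y3 y4 + dot (xc p) y2 * t y3 y4 y1 + dot (xc p) y3 * t y4 y1 y2 + dot (xc p) y4 * t y1 y2 y3))" for y1 y2 y3 y4
    unfolding SS_def D_def t_def ..
  show "SS y1 y2 y3 y4 = SS y2 y1 y3 y4"
    unfolding S by (simp add: D1[of y2 y1] mm_sym[of y2 y1] t ac_simps)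
  show "SS y1 y2 y3 y4 = SS y1 y3 y2 y4"
    unfolding S by (simp add: D1[of y3 y2] mm_sym[of y3 y2] t ac_simps)
  show "SS y1 y2 y3 y4 = SS y1 y2 y4 y3"
    unfolding S by (simp add: D2[of y1 y2 y4] D3[of y2 y4] D3[of y1 y4] mm_sym[of y4 y3] t ac_simps)
qed

lemma oS_sym: "oS A B C D = oS B A C D" "oS A B C D = oS A C B D" "oS A B C D = oS A B D C"
  by (cases A; cases B; cases C; cases D; simp; rule SS_sym)+

lemma oT_sym: "oT A B C D = oT B A C D" "oT A B C D = oT A C B D"
proof -
  have "dot a (te b c) = dot b (te a c)" "dot a (te b c) = dot a (te c b)" for a b c
    by (rule te_tri) (simp only: te_sym[of b c])
  then show "oT A B C D = oT B A C D" "oT A B C D = oT A C B D"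
    by (cases A; cases B; cases C; cases D; simp)+
qed

lemma oV_sym: "oV A B C D = oV B A C D" "oV A B C D = oV A B D C" "oV A B C D = oV C D A B"
proof -
  have "te a b = te b a" "dot (te a b) (te c d) = dot (te c d) (te a b)" for a b c d
    by (rule te_sym) (rule dot_sym)
  then show "oV A B C D = oV B A C D" "oV A B C D = oV A B D C" "oV A B C D = oV C D A B"
    by (cases A; cases B; cases C; cases D; simp)+
qed

lemma oU_sym: "oU A B C D = oU B A C D" "oU A B C D = oU A B D C" "oU A B C D = oU C D A B"
  using oV_sym[of A B C D] by (auto simp: oU_def)

lemma Om_sym: "Om \<Gamma> \<Delta> \<Lambda> \<Xi> = Om \<Delta> \<Gamma> \<Lambda> \<Xi>" "Om \<Gamma> \<Delta> \<Lambda> \<Xi> = Om \<Gamma> \<Lambda> \<Delta> \<Xi>" "Om \<Gamma> \<Delta> \<Lambda> \<Xi> = Om \<Gamma> \<Delta> \<Xi> \<Lambda>"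
  by (cases \<Gamma>; cases \<Delta>; cases \<Lambda>; cases \<Xi>; simp only: Om.simps; (rule refl oS_sym oT_sym oU_sym)?)+

lemma Om_symmetric4: "symmetric4 Om"
  by (rule symmetric4I) (rule Om_sym)+

text \<open>The two-forms that the quartic tensor is contracted with.\<close>

definition Th :: "'n fidx \<Rightarrow> 'n fidx \<Rightarrow> 'a \<Rightarrow> 'a \<Rightarrow> complex" where
  "Th \<Gamma> \<Delta> u v = E1 p \<Gamma> u * E2 p \<Delta> v - E1 p \<Gamma> v * E2 p \<Delta> u - E2 p \<Gamma> u * E1 p \<Delta> v + E2 p \<Gamma> v * E1 p \<Delta> u"

lemma Th_sym: "Th \<Gamma> \<Delta> u v = Th \<Delta> \<Gamma> u v"
  by (simp add: Th_def algebra_simps)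

definition GG :: "('n fidx \<Rightarrow> 'n fidx \<Rightarrow> 'n fidx \<Rightarrow> 'n fidx \<Rightarrow> complex) \<Rightarrow> 'n fidx \<Rightarrow> 'n fidx \<Rightarrow> 'a \<Rightarrow> 'a \<Rightarrow> complex" where
  "GG W \<Lambda> \<Xi> u v = (\<Sum>\<Gamma>\<in>UNIV. \<Sum>\<Delta>\<in>UNIV. W \<Lambda> \<Xi> \<Gamma> \<Delta> * Th \<Gamma> \<Delta> u v)"

definition FE :: "('n fidx \<Rightarrow> 'n fidx \<Rightarrow> 'n fidx \<Rightarrow> 'n fidx \<Rightarrow> complex) \<Rightarrow> 'n fidx \<Rightarrow> 'n fidx \<Rightarrow> 'a \<Rightarrow> 'a \<Rightarrow> complex" where
  "FE W \<Lambda> \<Xi> u v = - 1 / 2 * (\<Sum>\<Delta>\<in>UNIV. C_low \<Xi> \<Delta> * Th \<Lambda> \<Delta> u v) + (\<Sum>\<Lambda>'\<in>UNIV. C_up \<Lambda> \<Lambda>' * GG W \<Lambda>' \<Xi> u v)"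

lemma FE_blocks:
  "FE W (Inl A) (Inl B) u v = - 1 / 2 * Th (Inl A) (Inr B) u v - GG W (Inr A) (Inl B) u v"
  "FE W (Inl A) (Inr B) u v = 1 / 2 * Th (Inl A) (Inl B) u v - GG W (Inr A) (Inr B) u v"
  "FE W (Inr A) (Inl B) u v = - 1 / 2 * Th (Inr A) (Inr B) u v + GG W (Inl A) (Inl B) u v"
  "FE W (Inr A) (Inr B) u v = 1 / 2 * Th (Inr A) (Inl B) u v + GG W (Inl A) (Inr B) u v"
proof -
  have "(\<Sum>\<Lambda>'\<in>UNIV. C_up \<Lambda> \<Lambda>' * f \<Lambda>') = - (\<Sum>\<Lambda>'\<in>UNIV. C_low \<Lambda> \<Lambda>' * f \<Lambda>')" for \<Lambda> and f :: "'n fidx \<Rightarrow> complex"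
    by (simp add: C_up_def sum_negf)
  note eq = FE_def[unfolded this]
  show "FE W (Inl A) (Inl B) u v = - 1 / 2 * Th (Inl A) (Inr B) u v - GG W (Inr A) (Inl B) u v"
    "FE W (Inl A) (Inr B) u v = 1 / 2 * Th (Inl A) (Inl B) u v - GG W (Inr A) (Inr B) u v"
    "FE W (Inr A) (Inl B) u v = - 1 / 2 * Th (Inr A) (Inr B) u v + GG W (Inl A) (Inl B) u v"
    "FE W (Inr A) (Inr B) u v = 1 / 2 * Th (Inr A) (Inl B) u v + GG W (Inl A) (Inr B) u v"
    unfolding eq sum_C_low by simp_all
qed

lemma GG_sym: "GG Om \<Lambda> \<Xi> u v = GG Om \<Xi> \<Lambda> u v"
  unfolding GG_def by (simp only: Om_sym(1)[of \<Lambda> \<Xi>])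

lemma FE_sym: "FE Om (Inr A) (Inr B) u v = - FE Om (Inl B) (Inl A) u v" "FE Om (Inr A) (Inl B) u v = FE Om (Inr B) (Inl A) u v"
  unfolding FE_blocks by (simp_all add: GG_sym[of "Inl A"] Th_sym[of "Inr A"])

lemma cnj_of_bool: "cnj (of_bool P) = of_bool P"
  by (cases P) auto

lemma cnj_te: "cnj (te (delta a) (delta b) c) = te (delta a) (delta b) c"
  by (simp add: te_def cnj_TT cnj_of_bool)

lemma Om_real: "cnj (Om \<Gamma> \<Delta> \<Lambda> \<Xi>) = sg \<Gamma> * sg \<Delta> * sg \<Lambda> * sg \<Xi> * Om (bar \<Gamma>) (bar \<Delta>) (bar \<Lambda>) (bar \<Xi>)"
proof -
  have S: "cnj (oS A B C D) = oS A B C D" for A B C D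
    by (cases A; cases B; cases C; cases D) (simp_all add: SS_def mm_def cnj_dot cnj_te cnj_of_bool)
  have T: "cnj (oT A B C D) = - oT A B C D" for A B C D
    by (cases A; cases B; cases C; cases D) (simp_all add: cnj_dot cnj_te cnj_of_bool)
  have V: "cnj (oV A B C D) = oV A B C D" for A B C D
    by (cases A; cases B; cases C; cases D) (simp_all add: cnj_dot cnj_te cnj_of_bool)
  have U: "cnj (oU A B C D) = oU A B C D" for A B C D
    by (simp add: oU_def V cnj_of_bool)
  show ?thesis
    by (cases \<Gamma>; cases \<Delta>; cases \<Lambda>; cases \<Xi>; simp add: S T U; rule oU_sym(3))
qed

lemma Th_real: "cnj (Th \<Gamma> \<Delta> u v) = sg \<Gamma> * sg \<Delta> * Th (bar \<Gamma>) (bar \<Delta>) u v"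
  unfolding Th_def by (simp add: cnj_frame algebra_simps)

lemma GG_real: "cnj (GG Om \<Lambda> \<Xi> u v) = sg \<Lambda> * sg \<Xi> * GG Om (bar \<Lambda>) (bar \<Xi>) u v"
proof -
  have "bij bar" by (rule o_bij[of bar]) auto
  then have re: "(\<Sum>\<Lambda>\<in>UNIV. f (bar \<Lambda>)) = (\<Sum>\<Lambda>\<in>UNIV. f \<Lambda>)" for f :: "'n fidx \<Rightarrow> complex"
    by (rule sum.reindex_bij_betw)
  have "cnj (GG Om \<Lambda> \<Xi> u v) = (\<Sum>\<Gamma>\<in>UNIV. \<Sum>\<Delta>\<in>UNIV. sg \<Lambda> * sg \<Xi> * (Om (bar \<Lambda>) (bar \<Xi>) (bar \<Gamma>) (bar \<Delta>) * Th (bar \<Gamma>) (bar \<Delta>) u v))"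
  proof -
    have "cnj (Om \<Lambda> \<Xi> \<Gamma> \<Delta> * Th \<Gamma> \<Delta> u v) =
      (sg \<Gamma> * sg \<Gamma>) * (sg \<Delta> * sg \<Delta>) * (sg \<Lambda> * sg \<Xi> * (Om (bar \<Lambda>) (bar \<Xi>) (bar \<Gamma>) (bar \<Delta>) * Th (bar \<Gamma>) (bar \<Delta>) u v))" for \<Gamma> \<Delta>
      unfolding complex_cnj_mult Om_real Th_real by (simp only: mult_ac)
    then show ?thesis unfolding GG_def cnj_sum sg_sg mult_1 by (simp only:)
  qed
  also have "\<dots> = (\<Sum>\<Gamma>\<in>UNIV. \<Sum>\<Delta>\<in>UNIV. sg \<Lambda> * sg \<Xi> * (Om (bar \<Lambda>) (bar \<Xi>) \<Gamma> \<Delta> * Th \<Gamma> \<Delta> u v))"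
    using re[of "\<lambda>\<Gamma>. \<Sum>\<Delta>\<in>UNIV. sg \<Lambda> * sg \<Xi> * (Om (bar \<Lambda>) (bar \<Xi>) \<Gamma> (bar \<Delta>) * Th \<Gamma> (bar \<Delta>) u v)"]
      re[of "\<lambda>\<Delta>. sg \<Lambda> * sg \<Xi> * (Om (bar \<Lambda>) (bar \<Xi>) _ \<Delta> * Th _ \<Delta> u v)"] by simp
  finally show ?thesis unfolding GG_def sum_distrib_left .
qed

lemma FE_real: "cnj (FE Om \<Gamma> \<Delta> u v) = sg \<Gamma> * sg \<Delta> * FE Om (bar \<Gamma>) (bar \<Delta>) u v"
  by (cases \<Gamma>; cases \<Delta>) (simp_all add: FE_blocks Th_real GG_real)

end

context qmap_point
begin

definition QQ :: "('n fidx \<Rightarrow> 'n fidx \<Rightarrow> 'n fidx \<Rightarrow> 'n fidx \<Rightarrow> complex) \<Rightarrow> 'n fidx \<Rightarrow> 'n fidx \<Rightarrow> 'a \<Rightarrow> 'a \<Rightarrow> complex" where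
  "QQ W \<Lambda> \<Xi> u v = (\<Sum>\<Gamma>\<in>UNIV. \<Sum>\<Delta>\<in>UNIV. W \<Lambda> \<Xi> \<Gamma> \<Delta> * (E1 p \<Gamma> u * E2 p \<Delta> v))"

lemma GG_QQ:
  assumes W: "\<And>\<Gamma> \<Delta>. W \<Lambda> \<Xi> \<Gamma> \<Delta> = W \<Lambda> \<Xi> \<Delta> \<Gamma>"
  shows "GG W \<Lambda> \<Xi> u v = 2 * (QQ W \<Lambda> \<Xi> u v - QQ W \<Lambda> \<Xi> v u)"
proof -
  have 1: "QQ W \<Lambda> \<Xi> u v = (\<Sum>\<Gamma>\<in>UNIV. \<Sum>\<Delta>\<in>UNIV. W \<Lambda> \<Xi> \<Gamma> \<Delta> * (E1 p \<Delta> u * E2 p \<Gamma> v))" for u v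
    unfolding QQ_def by (subst sum.swap) (simp only: W)
  have "GG W \<Lambda> \<Xi> u v = (QQ W \<Lambda> \<Xi> u v - QQ W \<Lambda> \<Xi> v u)
      + ((\<Sum>\<Gamma>\<in>UNIV. \<Sum>\<Delta>\<in>UNIV. W \<Lambda> \<Xi> \<Gamma> \<Delta> * (E1 p \<Delta> u * E2 p \<Gamma> v)) - (\<Sum>\<Gamma>\<in>UNIV. \<Sum>\<Delta>\<in>UNIV. W \<Lambda> \<Xi> \<Gamma> \<Delta> * (E1 p \<Delta> v * E2 p \<Gamma> u)))"
    unfolding GG_def QQ_def Th_def sum_subtractf[symmetric] sum.distrib[symmetric]
    by (simp only: algebra_simps)
  then show ?thesis unfolding 1[symmetric] by simp
qed

lemma QQ_rl: "QQ Om (Inr A) (Inl B) u v =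
   (\<Sum>C\<in>UNIV. \<Sum>D\<in>UNIV. oT B C D A * (E1 p (Inl C) u * E2 p (Inl D) v)) + (\<Sum>C\<in>UNIV. \<Sum>D\<in>UNIV. oU B C A D * (E1 p (Inl C) u * E2 p (Inr D) v))
 + ((\<Sum>C\<in>UNIV. \<Sum>D\<in>UNIV. oU B D A C * (E1 p (Inr C) u * E2 p (Inl D) v)) + (\<Sum>C\<in>UNIV. \<Sum>D\<in>UNIV. oT A C D B * (E1 p (Inr C) u * E2 p (Inr D) v)))"
  unfolding QQ_def sum_lr Om.simps sum.distrib by (simp only: add_ac)

lemma QQ_ll: "QQ Om (Inl A) (Inl B) u v =
   (\<Sum>C\<in>UNIV. \<Sum>D\<in>UNIV. oS A B C D * (E1 p (Inl C) u * E2 p (Inl D) v)) + (\<Sum>C\<in>UNIV. \<Sum>D\<in>UNIV. oT A B C D * (E1 p (Inl C) u * E2 p (Inr D) v))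
 + ((\<Sum>C\<in>UNIV. \<Sum>D\<in>UNIV. oT A B D C * (E1 p (Inr C) u * E2 p (Inl D) v)) + (\<Sum>C\<in>UNIV. \<Sum>D\<in>UNIV. oU A B C D * (E1 p (Inr C) u * E2 p (Inr D) v)))"
  unfolding QQ_def sum_lr Om.simps sum.distrib by (simp only: add_ac)

lemma te_add_scale:
  "te (\<lambda>a. y a + y' a) z = (\<lambda>a. te y z a + te y' z a)" "te z (\<lambda>a. y a + y' a) = (\<lambda>a. te z y a + te z y' a)"
  "te (\<lambda>a. k * y a) z = (\<lambda>a. k * te y z a)" "te z (\<lambda>a. k * y a) = (\<lambda>a. k * te z y a)"
  by (simp_all add: te_linear fun_eq_iff)

lemma contract_V: "(\<Sum>c\<in>UNIV. \<Sum>d\<in>UNIV. dot (te s (delta c)) (te s' (delta d)) * (y c * z d)) = dot (te s y) (te s' z)"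
  by (rule bilinear_delta[of "\<lambda>y z. dot (te s y) (te s' z)"]) (simp_all only: te_add_scale dot_add dot_scale)

lemma contract_V2: "(\<Sum>c\<in>UNIV. \<Sum>d\<in>UNIV. dot s (te (delta c) (delta d)) * (y c * z d)) = dot s (te y z)"
  by (rule bilinear_delta[of "\<lambda>y z. dot s (te y z)"]) (simp_all only: te_add_scale dot_add dot_scale)

lemma contract_T: "(\<Sum>c\<in>UNIV. dot s (te s' (delta c)) * y c) = dot s (te s' y)"
  by (rule linear_functional_delta[of "\<lambda>y. dot s (te s' y)"]) (simp_all only: te_add_scale dot_add dot_scale)

lemma contract_S: "(\<Sum>c\<in>UNIV. \<Sum>d\<in>UNIV. SS s s' (delta c) (delta d) * (y c * z d)) = SS s s' y z"
  by (rule bilinear_delta[of "SS s s'"]) (simp_all only: SS_def mm_def te_add_scale dot_add dot_scale, simp_all add: algebra_simps add_divide_distrib)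

lemma contract_delta: "(\<Sum>c\<in>UNIV. \<Sum>d\<in>UNIV. of_bool (c = d) * (y c * z d)) = dot y z"
  "(\<Sum>c\<in>UNIV. \<Sum>d\<in>UNIV. of_bool (d = c) * (y c * z d)) = dot y z"
  by (simp_all add: dot_def)

lemma oT_0 [simp]: "oT None B C D = 0" "oT A None C D = 0" "oT A B None D = 0" "oT A B C (Some d) = 0"
  by (cases A; cases B; cases C; simp)+

lemma oS_0 [simp]: "oS None B C D = 0" "oS A None C D = 0" "oS A B None D = 0" "oS A B C None = 0"
  by (cases A; cases B; cases C; simp)+

lemma oV_0 [simp]: "oV None B C D = 0" "oV A None C D = 0" "oV A B None D = 0" "oV A B C None = 0"
  by (cases A; cases B; cases C; simp)+

lemma sum_oU:
  "(\<Sum>C\<in>UNIV. \<Sum>D\<in>UNIV. oU B C A D * (y C * z D)) = 1 / 4 * (of_bool (A = B) * (\<Sum>C\<in>UNIV. y C * z C) + y A * z B)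
     + (\<Sum>C\<in>UNIV. \<Sum>D\<in>UNIV. oV B C A D * (y C * z D))"
  "(\<Sum>C\<in>UNIV. \<Sum>D\<in>UNIV. oU B D A C * (y C * z D)) = 1 / 4 * (of_bool (A = B) * (\<Sum>C\<in>UNIV. y C * z C) + y B * z A)
     + (\<Sum>C\<in>UNIV. \<Sum>D\<in>UNIV. oV B D A C * (y C * z D))"
  "(\<Sum>C\<in>UNIV. \<Sum>D\<in>UNIV. oU A B C D * (y C * z D)) = 1 / 4 * (y A * z B + y B * z A)
     + (\<Sum>C\<in>UNIV. \<Sum>D\<in>UNIV. oV A B C D * (y C * z D))"
proof -
  have 1: "(\<Sum>C\<in>UNIV. \<Sum>D\<in>UNIV. of_bool (C = D) * (y C * z D)) = (\<Sum>C\<in>UNIV. y C * z C)"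
    "(\<Sum>C\<in>UNIV. \<Sum>D\<in>UNIV. of_bool (D = C) * (y C * z D)) = (\<Sum>C\<in>UNIV. y C * z C)"
    "(\<Sum>C\<in>UNIV. \<Sum>D\<in>UNIV. of_bool (A = C) * of_bool (B = D) * (y C * z D)) = y A * z B"
    "(\<Sum>C\<in>UNIV. \<Sum>D\<in>UNIV. of_bool (B = D) * of_bool (C = A) * (y C * z D)) = y A * z B"
    "(\<Sum>C\<in>UNIV. \<Sum>D\<in>UNIV. of_bool (B = C) * of_bool (D = A) * (y C * z D)) = y B * z A"
    "(\<Sum>C\<in>UNIV. \<Sum>D\<in>UNIV. of_bool (A = D) * of_bool (B = C) * (y C * z D)) = y B * z A" for A B
    by (simp_all add: mult.assoc sum_distrib_left[symmetric])
  have 2: "(\<Sum>C\<in>UNIV. \<Sum>D\<in>UNIV. (1 / 4 * (b * f C D + g C D) + h C D) * (y C * z D)) =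
     1 / 4 * (b * (\<Sum>C\<in>UNIV. \<Sum>D\<in>UNIV. f C D * (y C * z D)) + (\<Sum>C\<in>UNIV. \<Sum>D\<in>UNIV. g C D * (y C * z D)))
       + (\<Sum>C\<in>UNIV. \<Sum>D\<in>UNIV. h C D * (y C * z D))" for b f g h
    unfolding distrib_right sum.distrib distrib_left sum_distrib_left mult.assoc ..
  have 3: "of_bool (P \<and> Q) = of_bool P * (of_bool Q :: complex)" for P Q by simp
  show "(\<Sum>C\<in>UNIV. \<Sum>D\<in>UNIV. oU B C A D * (y C * z D)) = 1 / 4 * (of_bool (A = B) * (\<Sum>C\<in>UNIV. y C * z C) + y A * z B)
     + (\<Sum>C\<in>UNIV. \<Sum>D\<in>UNIV. oV B C A D * (y C * z D))"
    unfolding oU_def 2 1 by (simp only: eq_commute[of B A])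
  show "(\<Sum>C\<in>UNIV. \<Sum>D\<in>UNIV. oU B D A C * (y C * z D)) = 1 / 4 * (of_bool (A = B) * (\<Sum>C\<in>UNIV. y C * z C) + y B * z A)
     + (\<Sum>C\<in>UNIV. \<Sum>D\<in>UNIV. oV B D A C * (y C * z D))"
    unfolding oU_def 2 1 by (simp only: eq_commute[of B A])
  show "(\<Sum>C\<in>UNIV. \<Sum>D\<in>UNIV. oU A B C D * (y C * z D)) = 1 / 4 * (y A * z B + y B * z A)
     + (\<Sum>C\<in>UNIV. \<Sum>D\<in>UNIV. oV A B C D * (y C * z D))"
    unfolding oU_def using 2[of 1 "\<lambda>C D. of_bool (A = C) * of_bool (B = D)" "\<lambda>C D. of_bool (A = D) * of_bool (B = C)"]
    unfolding mult_1 1 .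
qed

lemma Q_r0l0: "QQ Om (Inr None) (Inl None) u v = 1 / 4 * (2 * bf p u * cnj (bf p v) + dot (XX u) (XB v) - 2 * a0 p u * cnj (a0 p v) - dot (af p u) (aub p v))"
  unfolding QQ_rl sum_oU
  by (simp add: sum_option Kv_p dot_def sum_negf algebra_simps)

lemma Q_r0ln: "QQ Om (Inr None) (Inl (Some n)) u v = \<i> / 2 * te (XX u) (aub p v) n + 1 / 4 * (bf p u * XB v n - af p u n * cnj (a0 p v))"
proof -
  have "(\<Sum>C\<in>UNIV. \<Sum>D\<in>UNIV. oT (Some n) C D None * (E1 p (Inl C) u * E2 p (Inl D) v))
     = \<i> / 2 * (\<Sum>c\<in>UNIV. \<Sum>d\<in>UNIV. dot (delta n) (te (delta c) (delta d)) * (XX u c * aub p v d))"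
    by (simp add: sum_option sum_distrib_left mult.assoc)
  also have "\<dots> = \<i> / 2 * te (XX u) (aub p v) n" unfolding contract_V2 by (simp add: dot_delta)
  finally have 1: "(\<Sum>C\<in>UNIV. \<Sum>D\<in>UNIV. oT (Some n) C D None * (E1 p (Inl C) u * E2 p (Inl D) v)) = \<i> / 2 * te (XX u) (aub p v) n" .
  show ?thesis
    unfolding QQ_rl sum_oU 1 by (simp add: sum_option Kv_p algebra_simps)
qed

lemma Q_rmln: "QQ Om (Inr (Some m)) (Inl (Some n)) u v =
   1 / 4 * (of_bool (m = n) * (bf p u * cnj (bf p v) + dot (XX u) (XB v) - a0 p u * cnj (a0 p v) - dot (af p u) (aub p v))
     + XX u m * XB v n - af p u n * aub p v m)
   - 1 / 2 * dot (te (delta n) (XX u)) (te (delta m) (XB v)) + 1 / 2 * dot (te (delta n) (aub p v)) (te (delta m) (af p u))"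
proof -
  have "(\<Sum>C\<in>UNIV. \<Sum>D\<in>UNIV. oV (Some n) C (Some m) D * (E1 p (Inl C) u * E2 p (Inr D) v))
     = - 1 / 2 * (\<Sum>c\<in>UNIV. \<Sum>d\<in>UNIV. dot (te (delta n) (delta c)) (te (delta m) (delta d)) * (XX u c * XB v d))"
    by (simp add: sum_option sum_distrib_left mult.assoc Kv_p)
  then have 1: "(\<Sum>C\<in>UNIV. \<Sum>D\<in>UNIV. oV (Some n) C (Some m) D * (E1 p (Inl C) u * E2 p (Inr D) v)) = - 1 / 2 * dot (te (delta n) (XX u)) (te (delta m) (XB v))"
    unfolding contract_V .
  have "(\<Sum>C\<in>UNIV. \<Sum>D\<in>UNIV. oV (Some n) D (Some m) C * (E1 p (Inr C) u * E2 p (Inl D) v))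
     = 1 / 2 * (\<Sum>c\<in>UNIV. \<Sum>d\<in>UNIV. dot (te (delta m) (delta c)) (te (delta n) (delta d)) * (af p u c * aub p v d))"
    by (simp add: sum_option sum_distrib_left mult.assoc dot_sym[of "te (delta n) _" "te (delta m) _"])
  then have 2: "(\<Sum>C\<in>UNIV. \<Sum>D\<in>UNIV. oV (Some n) D (Some m) C * (E1 p (Inr C) u * E2 p (Inl D) v)) = 1 / 2 * dot (te (delta n) (aub p v)) (te (delta m) (af p u))"
    unfolding contract_V dot_sym[of "te (delta m) (af p u)"] .
  show ?thesis
    unfolding QQ_rl sum_oU 1 2
    by (simp add: sum_option Kv_p dot_def sum_negf algebra_simps)
qed

lemma Q_l0lB: "QQ Om (Inl None) (Inl B) u v = 1 / 4 * (a0 p u * E2 p (Inr B) v + E1 p (Inr B) u * cnj (bf p v))"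
  unfolding QQ_ll sum_oU by (cases B) (simp_all add: sum_option Kv_p algebra_simps)

lemma Q_lmln: "QQ Om (Inl (Some m)) (Inl (Some n)) u v =
   - SS (delta m) (delta n) (XX u) (aub p v)
   - \<i> / 2 * te (delta n) (XX u) m * cnj (bf p v) + \<i> / 2 * te (delta n) (aub p v) m * a0 p u
   + 1 / 4 * (af p u m * XB v n + af p u n * XB v m) - 1 / 2 * dot (te (delta m) (delta n)) (te (af p u) (XB v))"
proof -
  have "(\<Sum>C\<in>UNIV. \<Sum>D\<in>UNIV. oS (Some m) (Some n) C D * (E1 p (Inl C) u * E2 p (Inl D) v))
    = - (\<Sum>c\<in>UNIV. \<Sum>d\<in>UNIV. SS (delta m) (delta n) (delta c) (delta d) * (XX u c * aub p v d))"
    by (simp add: sum_option sum_negf)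
  then have 1: "(\<Sum>C\<in>UNIV. \<Sum>D\<in>UNIV. oS (Some m) (Some n) C D * (E1 p (Inl C) u * E2 p (Inl D) v)) = - SS (delta m) (delta n) (XX u) (aub p v)"
    unfolding contract_S .
  have "(\<Sum>C\<in>UNIV. \<Sum>D\<in>UNIV. oT (Some m) (Some n) C D * (E1 p (Inl C) u * E2 p (Inr D) v))
    = - \<i> / 2 * (\<Sum>c\<in>UNIV. dot (delta m) (te (delta n) (delta c)) * XX u c) * cnj (bf p v)"
    by (simp add: sum_option sum_distrib_left sum_distrib_right mult_ac)
  then have 2: "(\<Sum>C\<in>UNIV. \<Sum>D\<in>UNIV. oT (Some m) (Some n) C D * (E1 p (Inl C) u * E2 p (Inr D) v)) = - \<i> / 2 * te (delta n) (XX u) m * cnj (bf p v)"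
    unfolding contract_T unfolding dot_delta .
  have "(\<Sum>C\<in>UNIV. \<Sum>D\<in>UNIV. oT (Some m) (Some n) D C * (E1 p (Inr C) u * E2 p (Inl D) v))
    = \<i> / 2 * (\<Sum>c\<in>UNIV. dot (delta m) (te (delta n) (delta c)) * aub p v c) * a0 p u"
    by (simp add: sum_option sum_distrib_left sum_distrib_right mult_ac)
  then have 3: "(\<Sum>C\<in>UNIV. \<Sum>D\<in>UNIV. oT (Some m) (Some n) D C * (E1 p (Inr C) u * E2 p (Inl D) v)) = \<i> / 2 * te (delta n) (aub p v) m * a0 p u"
    unfolding contract_T unfolding dot_delta .
  have "(\<Sum>C\<in>UNIV. \<Sum>D\<in>UNIV. oV (Some m) (Some n) C D * (E1 p (Inr C) u * E2 p (Inr D) v))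
     = - 1 / 2 * (\<Sum>c\<in>UNIV. \<Sum>d\<in>UNIV. dot (te (delta m) (delta n)) (te (delta c) (delta d)) * (af p u c * XB v d))"
    by (simp add: sum_option sum_distrib_left mult.assoc Kv_p)
  then have 4: "(\<Sum>C\<in>UNIV. \<Sum>D\<in>UNIV. oV (Some m) (Some n) C D * (E1 p (Inr C) u * E2 p (Inr D) v)) = - 1 / 2 * dot (te (delta m) (delta n)) (te (af p u) (XB v))"
    unfolding contract_V2 .
  show ?thesis
    unfolding QQ_ll sum_oU 1 2 3 4
    by (simp add: sum_option Kv_p algebra_simps)
qed

lemma Om_sym_last: "Om \<Lambda> \<Xi> \<Gamma> \<Delta> = Om \<Lambda> \<Xi> \<Delta> \<Gamma>"
  by (rule Om_sym(3))

lemma RE_FE_ll: "RE (Inl A) (Inl B) u v = FE Om (Inl A) (Inl B) u v"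
proof -
  have 00: "RE (Inl None) (Inl None) u v = FE Om (Inl None) (Inl None) u v"
    unfolding FE_blocks GG_QQ[of Om, OF Om_sym_last] Q_r0l0 RE_00 Th_def da0_def
    by (simp add: dot_sym[of "XB _" "XX _"] algebra_simps add_divide_distrib diff_divide_distrib)
  have h0n: "RE (Inl None) (Inl (Some n)) u v = FE Om (Inl None) (Inl (Some n)) u v" for n
    unfolding FE_blocks GG_QQ[of Om, OF Om_sym_last] Q_r0ln RE_0n' Th_def
    by (simp add: Kv_p algebra_simps add_divide_distrib diff_divide_distrib)
  have n0: "RE (Inl (Some n)) (Inl None) u v = FE Om (Inl (Some n)) (Inl None) u v" for n
  proof -
    have "RE (Inl (Some n)) (Inl None) u v = - cnj (RE (Inl None) (Inl (Some n)) u v)"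
      by (simp add: RE_real RE_sym)
    also have "\<dots> = FE Om (Inl (Some n)) (Inl None) u v"
      unfolding h0n FE_real by (simp add: FE_sym)
    finally show ?thesis .
  qed
  have mn: "RE (Inl (Some m)) (Inl (Some n)) u v = FE Om (Inl (Some m)) (Inl (Some n)) u v" for m n
    unfolding FE_blocks GG_QQ[of Om, OF Om_sym_last] Q_rmln RE_mn' Th_def
    by (simp add: Kv_p dot_sym[of "aub p _" "af p _"] algebra_simps add_divide_distrib diff_divide_distrib)
  show ?thesis
    by (cases A; cases B) (simp_all only: 00 h0n n0 mn)
qed

lemma RE_FE_rl: "RE (Inr A) (Inl B) u v = FE Om (Inr A) (Inl B) u v"
proof -
  have 0: "RE (Inr None) (Inl B) u v = FE Om (Inr None) (Inl B) u v" for B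
    unfolding FE_blocks GG_QQ[of Om, OF Om_sym_last] Q_l0lB RE_rl_00 Th_def
    by (simp add: algebra_simps)
  have mn: "RE (Inr (Some m)) (Inl (Some n)) u v = FE Om (Inr (Some m)) (Inl (Some n)) u v" for m n
    unfolding FE_blocks GG_QQ[of Om, OF Om_sym_last] Q_lmln RE_rl_mn' Th_def
    by (simp add: Kv_p te_linear algebra_simps add_divide_distrib diff_divide_distrib)
  show ?thesis
    by (cases A; cases B) (simp_all only: 0 RE_sym(2)[of A] FE_sym(2)[of A] mn RE_sym(2)[of "Some _" None] FE_sym(2)[of "Some _" None])
qed

lemma RE_FE: "RE \<Lambda> \<Xi> u v = FE Om \<Lambda> \<Xi> u v"
proof -
  have "RE (Inl A) (Inr B) u v = FE Om (Inl A) (Inr B) u v" for A B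
  proof -
    have "cnj (RE (Inl A) (Inr B) u v) = cnj (FE Om (Inl A) (Inr B) u v)"
      unfolding RE_real FE_real by (simp add: RE_FE_rl)
    then show ?thesis by simp
  qed
  then show ?thesis
    by (cases \<Lambda>; cases \<Xi>) (simp_all only: RE_FE_ll RE_FE_rl RE_sym(1) FE_sym(1))
qed

end

context qmap_point
begin

abbreviation cfr :: "2 \<Rightarrow> 'n fidx \<Rightarrow> 'a \<Rightarrow> complex" where "cfr \<alpha> \<Gamma> \<equiv> fr p (\<alpha>, \<Gamma>)"

definition duals :: "2 \<Rightarrow> 'n fidx \<Rightarrow> 'a \<times> 'a \<Rightarrow> bool" where
  "duals \<beta> \<Delta> x \<longleftrightarrow> (\<forall>\<alpha> \<Gamma>. cx_form (cfr \<alpha> \<Gamma>) x = of_bool (\<alpha> = \<beta> \<and> \<Gamma> = \<Delta>))"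

lemma cx_frame_surj: "\<exists>x. \<forall>\<Gamma>. cx_form (E1 p \<Gamma>) x = s \<Gamma> \<and> cx_form (E2 p \<Gamma>) x = t \<Gamma>"
proof -
  obtain a where a: "\<And>\<Gamma>. E1 p \<Gamma> a = (s \<Gamma> + sg \<Gamma> * cnj (t (bar \<Gamma>))) / 2"
    using frame_surj[OF p, of "\<lambda>\<Gamma>. (s \<Gamma> + sg \<Gamma> * cnj (t (bar \<Gamma>))) / 2"] by blast
  obtain b where b: "\<And>\<Gamma>. E1 p \<Gamma> b = - \<i> * (s \<Gamma> - sg \<Gamma> * cnj (t (bar \<Gamma>))) / 2"
    using frame_surj[OF p, of "\<lambda>\<Gamma>. - \<i> * (s \<Gamma> - sg \<Gamma> * cnj (t (bar \<Gamma>))) / 2"] by blast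
  have csg: "cnj (sg \<Gamma>) = sg \<Gamma>" for \<Gamma> by (cases \<Gamma>) auto
  have E2: "E2 p \<Gamma> z = - sg \<Gamma> * cnj (E1 p (bar \<Gamma>) z)" for \<Gamma> z
  proof -
    have "cnj (E2 p \<Gamma> z) = - sg \<Gamma> * E1 p (bar \<Gamma>) z" by (rule cnj_frame)
    from arg_cong[OF this, of cnj] show ?thesis by (simp add: csg)
  qed
  have 1: "cx_form (E1 p \<Gamma>) (a, b) = s \<Gamma>" for \<Gamma>
    unfolding cx_form_def fst_conv snd_conv a b by (simp add: field_simps)
  have 2: "cx_form (E2 p \<Gamma>) (a, b) = t \<Gamma>" for \<Gamma>
  proof -
    have "cx_form (E2 p \<Gamma>) (a, b) = (sg \<Gamma> * sg \<Gamma>) * t \<Gamma>"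
      unfolding cx_form_def fst_conv snd_conv E2 a b by (simp add: csg sg_bar algebra_simps add_divide_distrib diff_divide_distrib)
    then show ?thesis by simp
  qed
  show ?thesis using 1 2 by blast
qed

lemma cx_frame_inj:
  assumes "\<And>\<Gamma>. cx_form (E1 p \<Gamma>) x = cx_form (E1 p \<Gamma>) x'" "\<And>\<Gamma>. cx_form (E2 p \<Gamma>) x = cx_form (E2 p \<Gamma>) x'"
  shows "x = x'"
proof -
  define a where "a = fst x - fst x'"
  define b where "b = snd x - snd x'"
  have ld: "E1 p \<Gamma> (u - v) = E1 p \<Gamma> u - E1 p \<Gamma> v" "E2 p \<Gamma> (u - v) = E2 p \<Gamma> u - E2 p \<Gamma> v" for \<Gamma> u v
    using linear_diff[OF fr_linear[of p "(1, \<Gamma>)"]] linear_diff[OF fr_linear[of p "(2, \<Gamma>)"]] by (simp_all add: fr_def)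
  have 1: "E1 p \<Gamma> a + \<i> * E1 p \<Gamma> b = 0" for \<Gamma>
    using assms(1)[of \<Gamma>] by (simp add: cx_form_def a_def b_def ld algebra_simps)
  have 2: "E2 p \<Gamma> a + \<i> * E2 p \<Gamma> b = 0" for \<Gamma>
    using assms(2)[of \<Gamma>] by (simp add: cx_form_def a_def b_def ld algebra_simps)
  have 3: "E1 p \<Gamma> a - \<i> * E1 p \<Gamma> b = 0" for \<Gamma>
    using arg_cong[OF 2[of "bar \<Gamma>"], of cnj] sg_sg[of \<Gamma>] by (cases \<Gamma>) (simp_all add: cnj_frame)
  have "E1 p \<Gamma> a = 0" "E1 p \<Gamma> b = 0" for \<Gamma>
  proof -
    show "E1 p \<Gamma> a = 0" using 1[of \<Gamma>] 3[of \<Gamma>] by algebra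
    then show "E1 p \<Gamma> b = 0" using 1[of \<Gamma>] by simp
  qed
  then have "a = 0" "b = 0" using frame_inj[OF p] by blast+
  then show ?thesis by (simp add: a_def b_def prod_eq_iff)
qed

lemma duals_iff: "duals \<beta> \<Delta> x \<longleftrightarrow> (\<forall>\<Gamma>. cx_form (E1 p \<Gamma>) x = of_bool (1 = \<beta> \<and> \<Gamma> = \<Delta>) \<and> cx_form (E2 p \<Gamma>) x = of_bool (2 = \<beta> \<and> \<Gamma> = \<Delta>))"
proof -
  have "fr p (1, \<Gamma>) = E1 p \<Gamma>" "fr p (2, \<Gamma>) = E2 p \<Gamma>" for \<Gamma> by (simp_all add: fr_def fun_eq_iff)
  then show ?thesis unfolding duals_def forall_2 by auto
qed

lemma duals_ex1: "\<exists>!x. duals \<beta> \<Delta> x"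
proof -
  obtain x where "duals \<beta> \<Delta> x"
    using cx_frame_surj[of "\<lambda>\<Gamma>. of_bool (1 = \<beta> \<and> \<Gamma> = \<Delta>)" "\<lambda>\<Gamma>. of_bool (2 = \<beta> \<and> \<Gamma> = \<Delta>)"] unfolding duals_iff by blast
  moreover have "x = x'" if "duals \<beta> \<Delta> x" "duals \<beta> \<Delta> x'" for x x'
    by (rule cx_frame_inj) (use that in \<open>simp_all add: duals_iff\<close>)
  ultimately show ?thesis by blast
qed

lemma curvature_duals:
  assumes "duals \<beta> \<Delta> z"
  shows "cx_form (cfr \<alpha> \<Gamma>) (cx_endo (curvature_at g p u v) z) = RH \<alpha> \<beta> u v * of_bool (\<Gamma> = \<Delta>) + of_bool (\<alpha> = \<beta>) * RE \<Gamma> \<Delta> u v"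
proof -
  have d: "fr p (\<alpha>, \<Gamma>) (fst z) + \<i> * fr p (\<alpha>, \<Gamma>) (snd z) = of_bool (\<alpha> = \<beta> \<and> \<Gamma> = \<Delta>)" for \<alpha> \<Gamma>
    using assms unfolding duals_def cx_form_def by blast
  have "cx_form (cfr \<alpha> \<Gamma>) (cx_endo (curvature_at g p u v) z) =
      RH \<alpha> 1 u v * (fr p (1, \<Gamma>) (fst z) + \<i> * fr p (1, \<Gamma>) (snd z)) + RH \<alpha> 2 u v * (fr p (2, \<Gamma>) (fst z) + \<i> * fr p (2, \<Gamma>) (snd z))
      + (\<Sum>\<Delta>\<in>UNIV. RE \<Gamma> \<Delta> u v * (fr p (\<alpha>, \<Delta>) (fst z) + \<i> * fr p (\<alpha>, \<Delta>) (snd z)))"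
    unfolding cx_form_def cx_endo_def fst_conv snd_conv frame_curvature_split
    by (simp add: distrib_left sum.distrib sum_distrib_left mult.left_commute[of \<i>])
  also have "\<dots> = RH \<alpha> \<beta> u v * of_bool (\<Gamma> = \<Delta>) + of_bool (\<alpha> = \<beta>) * RE \<Gamma> \<Delta> u v"
    unfolding d using two_cases[of \<beta>] by (auto simp: of_bool_conj)
  finally show ?thesis .
qed

text \<open>The two-forms are linearly independent over symmetric coefficients.\<close>

lemma GG_zero:
  assumes W: "\<And>\<Gamma> \<Delta>. W \<Lambda> \<Xi> \<Gamma> \<Delta> = W \<Lambda> \<Xi> \<Delta> \<Gamma>" and G: "\<And>u v. GG W \<Lambda> \<Xi> u v = 0"
  shows "W \<Lambda> \<Xi> \<Gamma> \<Delta> = 0"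
proof -
  have Q: "QQ W \<Lambda> \<Xi> u v - QQ W \<Lambda> \<Xi> v u = 0" for u v
    using G[of u v] unfolding GG_QQ[of W, OF W] by simp
  obtain z where z: "duals 1 \<Gamma> z" using duals_ex1 by blast
  obtain y where y: "duals 2 \<Delta> y" using duals_ex1 by blast
  have z1: "E1 p \<Gamma>' (fst z) + \<i> * E1 p \<Gamma>' (snd z) = of_bool (\<Gamma>' = \<Gamma>)" "E2 p \<Gamma>' (fst z) + \<i> * E2 p \<Gamma>' (snd z) = 0" for \<Gamma>'
    using z unfolding duals_iff cx_form_def by auto
  have y1: "E2 p \<Gamma>' (fst y) + \<i> * E2 p \<Gamma>' (snd y) = of_bool (\<Gamma>' = \<Delta>)" for \<Gamma>'
    using y unfolding duals_iff cx_form_def by auto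
  have L: "QQ W \<Lambda> \<Xi> u v + \<i> * QQ W \<Lambda> \<Xi> u' v = (\<Sum>\<Gamma>\<in>UNIV. \<Sum>\<Delta>\<in>UNIV. W \<Lambda> \<Xi> \<Gamma> \<Delta> * ((E1 p \<Gamma> u + \<i> * E1 p \<Gamma> u') * E2 p \<Delta> v))" for u u' v
    unfolding QQ_def sum_distrib_left sum.distrib[symmetric] by (simp only: algebra_simps)
  have R: "QQ W \<Lambda> \<Xi> v u + \<i> * QQ W \<Lambda> \<Xi> v u' = (\<Sum>\<Gamma>\<in>UNIV. \<Sum>\<Delta>\<in>UNIV. W \<Lambda> \<Xi> \<Gamma> \<Delta> * (E1 p \<Gamma> v * (E2 p \<Delta> u + \<i> * E2 p \<Delta> u')))" for u u' v
    unfolding QQ_def sum_distrib_left sum.distrib[symmetric] by (simp only: algebra_simps)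
  have 1: "(\<Sum>\<Delta>\<in>UNIV. W \<Lambda> \<Xi> \<Gamma> \<Delta> * E2 p \<Delta> v) = 0" for v
  proof -
    have "(QQ W \<Lambda> \<Xi> (fst z) v + \<i> * QQ W \<Lambda> \<Xi> (snd z) v) - (QQ W \<Lambda> \<Xi> v (fst z) + \<i> * QQ W \<Lambda> \<Xi> v (snd z)) = 0"
      using Q[of "fst z" v] Q[of "snd z" v] by algebra
    then have "(\<Sum>\<Gamma>'\<in>UNIV. \<Sum>\<Delta>\<in>UNIV. W \<Lambda> \<Xi> \<Gamma>' \<Delta> * (of_bool (\<Gamma>' = \<Gamma>) * E2 p \<Delta> v)) = 0"
      unfolding L R z1 by simp
    moreover have "(\<Sum>\<Delta>\<in>UNIV. W \<Lambda> \<Xi> \<Gamma>' \<Delta> * (of_bool (\<Gamma>' = \<Gamma>) * E2 p \<Delta> v)) = of_bool (\<Gamma>' = \<Gamma>) * (\<Sum>\<Delta>\<in>UNIV. W \<Lambda> \<Xi> \<Gamma>' \<Delta> * E2 p \<Delta> v)" for \<Gamma>'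
      unfolding sum_distrib_left by (simp only: mult.left_commute)
    ultimately show ?thesis by simp
  qed
  have "(\<Sum>\<Delta>'\<in>UNIV. W \<Lambda> \<Xi> \<Gamma> \<Delta>' * (E2 p \<Delta>' (fst y) + \<i> * E2 p \<Delta>' (snd y))) = 0"
    using 1[of "fst y"] arg_cong[OF 1[of "snd y"], of "\<lambda>z. \<i> * z"]
    by (simp add: distrib_left sum.distrib sum_distrib_left mult.left_commute)
  then show ?thesis unfolding y1 by simp
qed

lemma FE_unique:
  assumes W: "symmetric4 W" and eq: "\<And>\<Lambda> \<Xi> u v. FE W \<Lambda> \<Xi> u v = FE Om \<Lambda> \<Xi> u v"
  shows "W = Om"
proof -
  have G: "GG W \<Lambda> \<Xi> u v = GG Om \<Lambda> \<Xi> u v" for \<Lambda> \<Xi> u v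
  proof (cases \<Lambda>)
    case (Inl A)
    then show ?thesis using eq[of "Inr A" \<Xi> u v] by (cases \<Xi>) (simp_all add: FE_blocks)
  next
    case (Inr A)
    then show ?thesis using eq[of "Inl A" \<Xi> u v] by (cases \<Xi>) (simp_all add: FE_blocks)
  qed
  have "W \<Lambda> \<Xi> \<Gamma> \<Delta> - Om \<Lambda> \<Xi> \<Gamma> \<Delta> = 0" for \<Lambda> \<Xi> \<Gamma> \<Delta>
  proof (rule GG_zero[of "\<lambda>\<Lambda> \<Xi> \<Gamma> \<Delta>. W \<Lambda> \<Xi> \<Gamma> \<Delta> - Om \<Lambda> \<Xi> \<Gamma> \<Delta>"])
    show "GG (\<lambda>\<Lambda> \<Xi> \<Gamma> \<Delta>. W \<Lambda> \<Xi> \<Gamma> \<Delta> - Om \<Lambda> \<Xi> \<Gamma> \<Delta>) \<Lambda> \<Xi> u v = 0" for u v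
      using G[of \<Lambda> \<Xi> u v] by (simp add: GG_def left_diff_distrib sum_subtractf)
    have "W \<Lambda> \<Xi> \<Gamma> \<Delta> = W \<Lambda> \<Xi> \<Delta> \<Gamma>" for \<Gamma> \<Delta>
      by (rule W[unfolded symmetric4_def, rule_format]) (simp only: add_mset_commute[of \<Gamma> \<Delta>])
    then show "W \<Lambda> \<Xi> \<Gamma> \<Delta> - Om \<Lambda> \<Xi> \<Gamma> \<Delta> = W \<Lambda> \<Xi> \<Delta> \<Gamma> - Om \<Lambda> \<Xi> \<Delta> \<Gamma>" for \<Gamma> \<Delta>
      by (simp only: Om_sym(3)[of \<Lambda> \<Xi> \<Gamma> \<Delta>])
  qed
  then show ?thesis by (simp add: fun_eq_iff)
qed

lemma FE_formula:
  "(\<Sum>\<alpha>\<in>UNIV. \<Sum>\<beta>\<in>UNIV. \<Sum>\<Delta>\<in>UNIV. reduced_scal / 4 * eps \<alpha> \<beta> * C_low \<Xi> \<Delta> * wedge (cfr \<alpha> \<Lambda>) (cfr \<beta> \<Delta>) u v)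
   + (\<Sum>\<alpha>\<in>UNIV. \<Sum>\<beta>\<in>UNIV. \<Sum>\<Lambda>'\<in>UNIV. \<Sum>\<Gamma>\<in>UNIV. \<Sum>\<Delta>\<in>UNIV. C_up \<Lambda> \<Lambda>' * W \<Lambda>' \<Xi> \<Gamma> \<Delta> * eps \<alpha> \<beta> * wedge (cfr \<alpha> \<Gamma>) (cfr \<beta> \<Delta>) u v)
   = FE W \<Lambda> \<Xi> u v"
proof -
  have T: "Th \<Gamma> \<Delta> u v = wedge (cfr 1 \<Gamma>) (cfr 2 \<Delta>) u v - wedge (cfr 2 \<Gamma>) (cfr 1 \<Delta>) u v" for \<Gamma> \<Delta>
    by (simp add: Th_def wedge_def fr_def)
  have 1: "(\<Sum>\<alpha>\<in>UNIV. \<Sum>\<beta>\<in>UNIV. \<Sum>\<Delta>\<in>UNIV. reduced_scal / 4 * eps \<alpha> \<beta> * C_low \<Xi> \<Delta> * wedge (cfr \<alpha> \<Lambda>) (cfr \<beta> \<Delta>) u v)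
    = - 1 / 2 * (\<Sum>\<Delta>\<in>UNIV. C_low \<Xi> \<Delta> * Th \<Lambda> \<Delta> u v)"
    by (simp add: sum_2 eps_def reduced_scal_def T sum_distrib_left right_diff_distrib sum_subtractf sum_negf)
  have 2: "(\<Sum>\<alpha>\<in>UNIV. \<Sum>\<beta>\<in>UNIV. \<Sum>\<Lambda>'\<in>UNIV. \<Sum>\<Gamma>\<in>UNIV. \<Sum>\<Delta>\<in>UNIV. C_up \<Lambda> \<Lambda>' * W \<Lambda>' \<Xi> \<Gamma> \<Delta> * eps \<alpha> \<beta> * wedge (cfr \<alpha> \<Gamma>) (cfr \<beta> \<Delta>) u v)
    = (\<Sum>\<Lambda>'\<in>UNIV. C_up \<Lambda> \<Lambda>' * GG W \<Lambda>' \<Xi> u v)"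
    by (simp add: sum_2 eps_def GG_def T sum_distrib_left right_diff_distrib sum_subtractf sum_negf mult.assoc)
  show ?thesis unfolding 1 2 FE_def ..
qed

definition quartic :: "('n fidx \<Rightarrow> 'n fidx \<Rightarrow> 'n fidx \<Rightarrow> 'n fidx \<Rightarrow> complex) \<Rightarrow> bool" where
  "quartic W \<longleftrightarrow> symmetric4 W \<and> (\<exists>R_H R_E.
        (\<forall>u v. R_H u v \<in> sp_algebra eps \<and> R_E u v \<in> sp_algebra C_low) \<and>
        (\<forall>u v \<alpha> \<Gamma> \<beta> \<Delta>. cx_form (cfr \<alpha> \<Gamma>) (cx_endo (curvature_at g p u v) (The (duals \<beta> \<Delta>)))
           = R_H u v \<alpha> \<beta> * of_bool (\<Gamma> = \<Delta>) + of_bool (\<alpha> = \<beta>) * R_E u v \<Gamma> \<Delta>) \<and>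
        (\<forall>u v \<Lambda> \<Xi>. R_E u v \<Lambda> \<Xi> = FE W \<Lambda> \<Xi> u v))"

lemma quartic_iff: "quartic W \<longleftrightarrow> W = Om"
proof
  assume "W = Om"
  have "cx_form (cfr \<alpha> \<Gamma>) (cx_endo (curvature_at g p u v) (The (duals \<beta> \<Delta>)))
      = RH \<alpha> \<beta> u v * of_bool (\<Gamma> = \<Delta>) + of_bool (\<alpha> = \<beta>) * RE \<Gamma> \<Delta> u v" for u v \<alpha> \<beta> \<Gamma> \<Delta>
    by (rule curvature_duals[OF theI'[OF duals_ex1]])
  then show "quartic W"
    unfolding quartic_def \<open>W = Om\<close> using Om_symmetric4 RH_sp RE_sp RE_FE
    by (intro conjI exI[of _ "\<lambda>u v \<alpha> \<beta>. RH \<alpha> \<beta> u v"] exI[of _ "\<lambda>u v \<Gamma> \<Delta>. RE \<Gamma> \<Delta> u v"]) auto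
next
  assume "quartic W"
  then have W: "symmetric4 W" and ex: "\<exists>R_H R_E.
        (\<forall>u v. R_H u v \<in> sp_algebra eps \<and> R_E u v \<in> sp_algebra C_low) \<and>
        (\<forall>u v \<alpha> \<Gamma> \<beta> \<Delta>. cx_form (cfr \<alpha> \<Gamma>) (cx_endo (curvature_at g p u v) (The (duals \<beta> \<Delta>)))
           = R_H u v \<alpha> \<beta> * of_bool (\<Gamma> = \<Delta>) + of_bool (\<alpha> = \<beta>) * R_E u v \<Gamma> \<Delta>) \<and>
        (\<forall>u v \<Lambda> \<Xi>. R_E u v \<Lambda> \<Xi> = FE W \<Lambda> \<Xi> u v)"
    unfolding quartic_def by (rule conjunct1, rule conjunct2)
  from ex obtain R_H R_E where RR: "(\<forall>u v. R_H u v \<in> sp_algebra eps \<and> R_E u v \<in> sp_algebra C_low) \<and>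
        (\<forall>u v \<alpha> \<Gamma> \<beta> \<Delta>. cx_form (cfr \<alpha> \<Gamma>) (cx_endo (curvature_at g p u v) (The (duals \<beta> \<Delta>)))
           = R_H u v \<alpha> \<beta> * of_bool (\<Gamma> = \<Delta>) + of_bool (\<alpha> = \<beta>) * R_E u v \<Gamma> \<Delta>) \<and>
        (\<forall>u v \<Lambda> \<Xi>. R_E u v \<Lambda> \<Xi> = FE W \<Lambda> \<Xi> u v)" by (elim exE)
  have sp: "R_H u v \<in> sp_algebra eps"
    and C: "cx_form (cfr \<alpha> \<Gamma>) (cx_endo (curvature_at g p u v) (The (duals \<beta> \<Delta>)))
           = R_H u v \<alpha> \<beta> * of_bool (\<Gamma> = \<Delta>) + of_bool (\<alpha> = \<beta>) * R_E u v \<Gamma> \<Delta>"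
    and R: "R_E u v \<Lambda> \<Xi> = FE W \<Lambda> \<Xi> u v" for u v \<alpha> \<Gamma> \<beta> \<Delta> \<Lambda> \<Xi>
    using RR by simp_all
  have tr: "R_H u v 1 1 + R_H u v 2 2 = 0" for u v
  proof -
    have "(\<Sum>k\<in>UNIV. R_H u v k 1 * eps k 2 + eps 1 k * R_H u v k 2) = 0"
      using sp[of u v] unfolding sp_algebra_def by blast
    then show ?thesis by (simp add: sum_2 eps_def)
  qed
  have "FE W \<Lambda> \<Xi> u v = FE Om \<Lambda> \<Xi> u v" for \<Lambda> \<Xi> u v
  proof -
    have "R_H u v \<alpha> \<alpha> * of_bool (\<Lambda> = \<Xi>) + R_E u v \<Lambda> \<Xi> = RH \<alpha> \<alpha> u v * of_bool (\<Lambda> = \<Xi>) + RE \<Lambda> \<Xi> u v" for \<alpha>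
      using C[of \<alpha> \<Lambda> u v \<alpha> \<Xi>] curvature_duals[OF theI'[OF duals_ex1], of \<alpha> \<Lambda> u v \<alpha> \<Xi>] by simp
    from this[of 1] this[of 2] have "2 * R_E u v \<Lambda> \<Xi> = 2 * RE \<Lambda> \<Xi> u v"
      using tr[of u v] RH_trace[of u v] by algebra
    then show ?thesis by (simp add: R RE_FE)
  qed
  then show "W = Om" by (rule FE_unique[OF W])
qed

end

definition c3 :: "('n \<Rightarrow> 'n \<Rightarrow> 'n \<Rightarrow> real) \<Rightarrow> 'n \<Rightarrow> 'n \<Rightarrow> 'n \<Rightarrow> real" where
  "c3 c i j k = c i j k + c j i k + c j k i"

definition csym :: "('n \<Rightarrow> 'n \<Rightarrow> 'n \<Rightarrow> real) \<Rightarrow> 'n \<Rightarrow> 'n \<Rightarrow> 'n \<Rightarrow> real" where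
  "csym c i j k = c3 c i j k + c3 c i k j"

lemma csym_sym: "csym c i j k = csym c j i k" "csym c i j k = csym c i k j"
  by (simp_all add: csym_def c3_def)

lemma axis_component: "(x + axis m t) $ i = x $ i + of_bool (i = m) * (t :: 'k::real_normed_field)"
  by (simp add: axis_def)

lemma axis_0: "axis m 0 = (0 :: 'k::real_normed_field ^ 'n)"
  by (simp add: axis_def vec_eq_iff)

lemma axis_Some_None: "axis (Some l) t $ None = (0 :: 'k::real_normed_field)"
  by (simp add: axis_def)

lemma has_derivative_component: "((\<lambda>t. (x + axis m t) $ i) has_field_derivative of_bool (i = m)) (at (0 :: 'k::real_normed_field))"
  unfolding axis_component by (auto intro!: derivative_eq_intros)

lemma cubic_axis_derivative:
  fixes x :: "'k::real_normed_field ^ 'n"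
  shows "((\<lambda>t. cubic c (x + axis m t)) has_field_derivative (\<Sum>j\<in>UNIV. \<Sum>k\<in>UNIV. of_real (c3 c m j k) * x $ j * x $ k)) (at 0)"
proof -
  have "((\<lambda>t. cubic c (x + axis m t)) has_field_derivative
     (\<Sum>i\<in>UNIV. \<Sum>j\<in>UNIV. \<Sum>k\<in>UNIV. of_real (c i j k) * of_bool (i = m) * x $ j * x $ k
        + of_real (c i j k) * x $ i * of_bool (j = m) * x $ k + of_real (c i j k) * x $ i * x $ j * of_bool (k = m))) (at 0)"
    unfolding cubic_def
    by (intro DERIV_sum)
      (rule derivative_eq_intros has_derivative_component refl | simp add: axis_component axis_0 algebra_simps)+
  moreover have "(\<Sum>i\<in>UNIV. \<Sum>j\<in>UNIV. \<Sum>k\<in>UNIV. of_real (c i j k) * of_bool (i = m) * x $ j * x $ k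
        + of_real (c i j k) * x $ i * of_bool (j = m) * x $ k + of_real (c i j k) * x $ i * x $ j * of_bool (k = m))
     = (\<Sum>j\<in>UNIV. \<Sum>k\<in>UNIV. of_real (c3 c m j k) * x $ j * x $ k)"
  proof -
    have 1: "(\<Sum>i\<in>UNIV. \<Sum>j\<in>UNIV. \<Sum>k\<in>UNIV. of_real (c i j k) * of_bool (i = m) * x $ j * x $ k) = (\<Sum>j\<in>UNIV. \<Sum>k\<in>UNIV. of_real (c m j k) * x $ j * x $ k)"
    proof -
      have "(\<Sum>i\<in>UNIV. \<Sum>j\<in>UNIV. \<Sum>k\<in>UNIV. of_real (c i j k) * of_bool (i = m) * x $ j * x $ k)
        = (\<Sum>i\<in>UNIV. of_bool (i = m) * (\<Sum>j\<in>UNIV. \<Sum>k\<in>UNIV. of_real (c i j k) * x $ j * x $ k))"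
        unfolding sum_distrib_left by (simp only: mult_ac)
      then show ?thesis by simp
    qed
    have 2: "(\<Sum>j\<in>UNIV. \<Sum>k\<in>UNIV. of_real (c i j k) * x $ i * of_bool (j = m) * x $ k) = (\<Sum>k\<in>UNIV. of_real (c i m k) * x $ i * x $ k)" for i
    proof -
      have "(\<Sum>j\<in>UNIV. \<Sum>k\<in>UNIV. of_real (c i j k) * x $ i * of_bool (j = m) * x $ k)
        = (\<Sum>j\<in>UNIV. of_bool (j = m) * (\<Sum>k\<in>UNIV. of_real (c i j k) * x $ i * x $ k))"
        unfolding sum_distrib_left by (simp only: mult_ac)
      then show ?thesis by simp
    qed
    show ?thesis
      unfolding sum.distrib 1 2 by (simp add: c3_def distrib_right sum.distrib)
  qed
  ultimately show ?thesis by simp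
qed

lemma partial_cubic: "partial m (cubic c) x = (\<Sum>j\<in>UNIV. \<Sum>k\<in>UNIV. of_real (c3 c m j k) * x $ j * x $ k)"
  unfolding partial_def by (rule DERIV_imp_deriv[OF cubic_axis_derivative])

lemma partial_cubic_axis_derivative:
  fixes x :: "'k::real_normed_field ^ 'n"
  shows "((\<lambda>t. partial m (cubic c) (x + axis l t)) has_field_derivative (\<Sum>k\<in>UNIV. of_real (csym c m l k) * x $ k)) (at 0)"
proof -
  have "((\<lambda>t. partial m (cubic c) (x + axis l t)) has_field_derivative
     (\<Sum>j\<in>UNIV. \<Sum>k\<in>UNIV. of_real (c3 c m j k) * of_bool (j = l) * x $ k + of_real (c3 c m j k) * x $ j * of_bool (k = l))) (at 0)"
    unfolding partial_cubic
    by (intro DERIV_sum)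
      (rule derivative_eq_intros has_derivative_component refl | simp add: axis_component axis_0 algebra_simps)+
  moreover have "(\<Sum>j\<in>UNIV. \<Sum>k\<in>UNIV. of_real (c3 c m j k) * of_bool (j = l) * x $ k + of_real (c3 c m j k) * x $ j * of_bool (k = l))
     = (\<Sum>k\<in>UNIV. of_real (csym c m l k) * x $ k)"
  proof -
    have 1: "(\<Sum>j\<in>UNIV. \<Sum>k\<in>UNIV. of_real (c3 c m j k) * of_bool (j = l) * x $ k) = (\<Sum>k\<in>UNIV. of_real (c3 c m l k) * x $ k)"
    proof -
      have "(\<Sum>j\<in>UNIV. \<Sum>k\<in>UNIV. of_real (c3 c m j k) * of_bool (j = l) * x $ k)
        = (\<Sum>j\<in>UNIV. of_bool (j = l) * (\<Sum>k\<in>UNIV. of_real (c3 c m j k) * x $ k))"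
        unfolding sum_distrib_left by (simp only: mult_ac)
      then show ?thesis by simp
    qed
    show ?thesis
      unfolding sum.distrib 1 by (simp add: csym_def distrib_right sum.distrib)
  qed
  ultimately show ?thesis by simp
qed

lemma partial_partial_cubic: "partial l (partial m (cubic c)) x = (\<Sum>k\<in>UNIV. of_real (csym c m l k) * x $ k)"
  unfolding partial_def[of l] by (rule DERIV_imp_deriv[OF partial_cubic_axis_derivative])

lemma partial3_cubic: "partial s (partial l (partial m (cubic c))) (x :: 'k::real_normed_field ^ 'n) = of_real (csym c m l s)"
proof -
  have "((\<lambda>t. partial l (partial m (cubic c)) (x + axis s t)) has_field_derivative (\<Sum>k\<in>UNIV. of_real (csym c m l k) * of_bool (k = s))) (at 0)"
    unfolding partial_partial_cubic
    by (intro DERIV_sum)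
      (rule derivative_eq_intros has_derivative_component refl | simp add: axis_component axis_0 algebra_simps)+
  from DERIV_imp_deriv[OF this] show ?thesis unfolding partial_def[of s] by simp
qed

text \<open>The cubic and its derivatives in terms of the symmetric coefficients, over the complex numbers.\<close>

lemma TT_csym_cubic:
  fixes x :: "complex ^ 'n"
  shows "TT (csym c) (($) x) (($) x) m / 2 = partial m (cubic c) x"
proof -
  have "(\<Sum>j\<in>UNIV. \<Sum>k\<in>UNIV. of_real (c3 c m k j) * x $ j * x $ k) = (\<Sum>j\<in>UNIV. \<Sum>k\<in>UNIV. of_real (c3 c m j k) * x $ j * x $ k)"
    by (subst sum.swap) (simp add: mult_ac)
  then show ?thesis unfolding partial_cubic TT_def csym_def by (simp add: distrib_right sum.distrib)
qed

lemma euler_cubic: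
  fixes x :: "complex ^ 'n"
  shows "dot (\<lambda>m. partial m (cubic c) x) (($) x) / 3 = cubic c x"
proof -
  have s1: "(\<Sum>m\<in>UNIV. \<Sum>j\<in>UNIV. \<Sum>k\<in>UNIV. of_real (c j m k) * x $ j * x $ k * x $ m) = cubic c x"
    unfolding cubic_def by (subst sum.swap) (simp add: mult_ac)
  have "(\<Sum>m\<in>UNIV. \<Sum>j\<in>UNIV. \<Sum>k\<in>UNIV. of_real (c j k m) * x $ j * x $ k * x $ m) = (\<Sum>j\<in>UNIV. \<Sum>m\<in>UNIV. \<Sum>k\<in>UNIV. of_real (c j k m) * x $ j * x $ k * x $ m)"
    by (rule sum.swap)
  also have "\<dots> = (\<Sum>j\<in>UNIV. \<Sum>k\<in>UNIV. \<Sum>m\<in>UNIV. of_real (c j k m) * x $ j * x $ k * x $ m)"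
    by (rule sum.cong[OF refl], rule sum.swap)
  finally have s2: "(\<Sum>m\<in>UNIV. \<Sum>j\<in>UNIV. \<Sum>k\<in>UNIV. of_real (c j k m) * x $ j * x $ k * x $ m) = cubic c x"
    unfolding cubic_def .
  have s3: "(\<Sum>m\<in>UNIV. \<Sum>j\<in>UNIV. \<Sum>k\<in>UNIV. of_real (c m j k) * x $ j * x $ k * x $ m) = cubic c x"
    unfolding cubic_def by (simp add: mult_ac)
  show ?thesis
    unfolding dot_def partial_cubic c3_def sum_distrib_right of_real_add distrib_right sum.distrib s1 s2 s3 by simp
qed

text \<open>The prepotential.\<close>

lemma F_mat_entries:
  fixes X :: "complex ^ 'n::finite"
  shows
  "F_mat c X None None = 2 * cubic c X" "F_mat c X (Some m) None = - partial m (cubic c) X"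
  "F_mat c X None (Some m) = - partial m (cubic c) X" "F_mat c X (Some l) (Some m) = partial l (partial m (cubic c)) X"
proof -
  have h0: "(\<chi> m. (z + axis None t) $ Some m) = (\<chi> m. z $ Some m)" for z :: "complex ^ 'n option" and t
    by (simp add: vec_eq_iff axis_def)
  have h1: "(\<chi> m. (z + axis (Some l) t) $ Some m) = (\<chi> m. z $ Some m) + axis l t" for z :: "complex ^ 'n option" and l t
    by (simp add: vec_eq_iff axis_def)
  have p0: "partial None (prepotential c) z = - cubic c (\<chi> m. z $ Some m) / (z $ None)\<^sup>2" if "z $ None \<noteq> 0" for z
  proof -
    have "((\<lambda>t. prepotential c (z + axis None t)) has_field_derivative - cubic c (\<chi> m. z $ Some m) / (z $ None)\<^sup>2) (at 0)"
      unfolding prepotential_def h0 using that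
      by (auto intro!: derivative_eq_intros has_derivative_component simp: axis_component power2_eq_square)
    then show ?thesis unfolding partial_def by (rule DERIV_imp_deriv)
  qed
  have p1: "partial (Some l) (prepotential c) z = partial l (cubic c) (\<chi> m. z $ Some m) / z $ None" for z l
  proof -
    have "((\<lambda>t. prepotential c (z + axis (Some l) t)) has_field_derivative partial l (cubic c) (\<chi> m. z $ Some m) / z $ None) (at 0)"
      unfolding prepotential_def h1 partial_cubic
      using DERIV_cdivide[OF cubic_axis_derivative, of c "\<chi> m. z $ Some m" l "z $ None"] by (simp add: axis_Some_None)
    then show ?thesis unfolding partial_def[of "Some l"] by (rule DERIV_imp_deriv)
  qed
  let ?z = "hom_coords X"
  have z: "?z $ None = 1" "(\<chi> m. ?z $ Some m) = X" by (simp_all add: hom_coords_def vec_eq_iff)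
  have ev: "\<forall>\<^sub>F t in nhds 0. 1 + t \<noteq> (0 :: complex)"
  proof -
    have "open {t. 1 + t \<noteq> (0 :: complex)}" by (intro open_Collect_neq continuous_intros)
    then show ?thesis unfolding eventually_nhds by (intro exI[of _ "{t. 1 + t \<noteq> (0 :: complex)}"]) auto
  qed
  have p0': "partial None (prepotential c) (?z + axis None t) = - cubic c X / (1 + t)\<^sup>2" if "1 + t \<noteq> 0" for t
    using p0[of "?z + axis None t"] that unfolding h0 z by (simp add: axis_component z)
  have zN: "(?z + axis (Some m) t) $ None = 1" for m t by (simp add: axis_Some_None z)
  have pm': "partial None (prepotential c) (?z + axis (Some m) t) = - cubic c (X + axis m t)" for m t
    using p0[of "?z + axis (Some m) t"] unfolding h1 z zN by simp
  have p1': "partial (Some m) (prepotential c) (?z + axis None t) = partial m (cubic c) X / (1 + t)" for m t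
    using p1[of m "?z + axis None t"] unfolding h0 z by (simp add: axis_component z)
  have p1'': "partial (Some m) (prepotential c) (?z + axis (Some l) t) = partial m (cubic c) (X + axis l t)" for l m t
    using p1[of m "?z + axis (Some l) t"] unfolding h1 z zN by simp
  show "F_mat c X None None = 2 * cubic c X"
  proof -
    have "F_mat c X None None = deriv (\<lambda>t. - cubic c X / (1 + t)\<^sup>2) 0"
      unfolding F_mat_def partial_def[of None "partial _ _"]
      by (rule deriv_cong_ev[OF _ refl], rule eventually_mono[OF ev]) (rule p0')
    also have "\<dots> = 2 * cubic c X"
      by (rule DERIV_imp_deriv) (auto intro!: derivative_eq_intros)
    finally show ?thesis .
  qed
  show "F_mat c X (Some m) None = - partial m (cubic c) X"
  proof -
    have "F_mat c X (Some m) None = deriv (\<lambda>t. - cubic c (X + axis m t)) 0"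
      unfolding F_mat_def partial_def[of "Some m" "partial _ _"] pm' ..
    also have "\<dots> = - partial m (cubic c) X"
      unfolding partial_cubic by (rule DERIV_imp_deriv[OF DERIV_minus[OF cubic_axis_derivative]])
    finally show ?thesis .
  qed
  show "F_mat c X None (Some m) = - partial m (cubic c) X"
  proof -
    have "F_mat c X None (Some m) = deriv (\<lambda>t. partial m (cubic c) X / (1 + t)) 0"
      unfolding F_mat_def partial_def[of None "partial _ _"] p1' ..
    also have "\<dots> = - partial m (cubic c) X"
      by (rule DERIV_imp_deriv) (auto intro!: derivative_eq_intros)
    finally show ?thesis .
  qed
  show "F_mat c X (Some l) (Some m) = partial l (partial m (cubic c)) X"
  proof -
    have "F_mat c X (Some l) (Some m) = deriv (\<lambda>t. partial m (cubic c) (X + axis l t)) 0"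
      unfolding F_mat_def partial_def[of "Some l" "partial _ _"] p1'' ..
    then show ?thesis unfolding partial_def[of l] .
  qed
qed

text \<open>Positivity on the cone.\<close>

lemma cubic_scaleR: "cubic c (r *\<^sub>R x) = r ^ 3 * cubic c (x :: real ^ 'n)"
  by (simp add: cubic_def sum_distrib_left power3_eq_cube mult_ac)

lemma cubic_cone_pos:
  assumes "projective_special_real c H" "x \<in> cone H"
  shows "cubic c x > 0"
proof -
  obtain r y where "x = r *\<^sub>R y" "r > 0" "y \<in> H" using assms(2) by (auto simp: cone_def)
  then show ?thesis using assms(1) by (auto simp: projective_special_real_def cubic_scaleR)
qed

text \<open>The metric of the Kaehler potential.\<close>


lemma im_vec_linear: "linear im_vec"
  by (intro linearI) (simp_all add: im_vec_def vec_eq_iff)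

definition cvec :: "real ^ 'n \<Rightarrow> complex ^ 'n" where "cvec x = (\<chi> m. of_real (x $ m))"

lemma cubic_cvec: "cubic c (cvec x) = of_real (cubic c x)" "partial l (cubic c) (cvec x) = of_real (partial l (cubic c) x)"
  "partial l (partial m (cubic c)) (cvec x) = of_real (partial l (partial m (cubic c)) x)"
  unfolding cubic_def partial_cubic partial_partial_cubic cvec_def by simp_all

text \<open>A chart whose base coordinates are the standard ones.\<close>

locale standard_chart = cubic_chart "csym c" "\<lambda>a q. B q $ a" rh ph Zt0 Z0 Zt Z
  for c :: "'n::finite \<Rightarrow> 'n \<Rightarrow> 'n \<Rightarrow> real" and B :: "'a::euclidean_space \<Rightarrow> complex ^ 'n" and rh ph Zt0 Z0 Zt Z
begin

lemma xc_cvec: "xc q = ($) (cvec (im_vec (B q)))"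
  by (simp add: xc_def cvec_def im_vec_def fun_eq_iff)

lemma H1_partial: "H1 (($) z) a = partial a (cubic c) z"
  unfolding H1_def by (rule TT_csym_cubic)

lemma H0_cubic: "H0 (($) z) = cubic c z"
proof -
  have "H1 (($) z) = (\<lambda>a. partial a (cubic c) z)" by (simp add: H1_partial fun_eq_iff)
  then show ?thesis unfolding H0_def by (simp only: euler_cubic)
qed

lemma hc_cubic: "hc q = of_real (cubic c (im_vec (B q)))"
  unfolding xc_cvec H0_cubic cubic_cvec ..

lemma vol_cubic: "vol q = cubic c (im_vec (B q))"
  by (simp add: vol_def hc_cubic)

lemma hd_partial: "hd q a = of_real (partial a (cubic c) (im_vec (B q)))"
  unfolding xc_cvec H1_partial cubic_cvec ..

lemma tt_partial2: "tt (($) z) v a = (\<Sum>b\<in>UNIV. partial a (partial b (cubic c)) z * v b)"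
proof -
  have "tt (($) z) v a = tt v (($) z) a" by (rule tt_sym)
  then show ?thesis
    unfolding TT_def partial_partial_cubic sum_distrib_right by (simp add: csym_sym(1)[of c a] mult_ac)
qed

lemma tt_x_partial2: "tt (xc q) v a = (\<Sum>b\<in>UNIV. of_real (partial a (partial b (cubic c)) (im_vec (B q))) * v b)"
  unfolding xc_cvec tt_partial2 cubic_cvec ..

end

lemma kahler_metric_Kv:
  fixes c :: "'n::finite \<Rightarrow> 'n \<Rightarrow> 'n \<Rightarrow> real"
  assumes V: "open V" "X \<in> V" and pos: "\<And>X. X \<in> V \<Longrightarrow> cubic c (im_vec X) > 0"
  defines "x \<equiv> im_vec X"
  shows "kahler_metric c l m X = of_real ((partial l (cubic c) x * partial m (cubic c) x / (cubic c x)\<^sup>2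
     - partial m (partial l (cubic c)) x / cubic c x) / 4)"
proof -
  interpret k: standard_chart c "\<lambda>X. X" "\<lambda>_. 0" "\<lambda>_. 0" "\<lambda>_. 0" "\<lambda>_. 0" "\<lambda>_ _. 0" "\<lambda>_ _. 0"
    by unfold_locales (simp_all add: csym_sym linear_zero bounded_linear.linear[OF bounded_linear_vec_nth])
  have h: "k.hc X \<noteq> 0" if "X \<in> V" for X using pos[OF that] by (simp add: k.hc_cubic)
  have xaxis: "k.xc (axis l 1) = (\<lambda>_. 0)" "k.xc (axis l \<i>) = (\<lambda>b. of_bool (b = l))" for l
    by (simp_all add: k.xc_def axis_def fun_eq_iff)
  have z: "dot v (\<lambda>_. 0) = 0" "k.tt v (\<lambda>_. 0) a = 0" for v :: "'n \<Rightarrow> complex" and a by (simp_all add: dot_def TT_def)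
  have wb: "wirtinger_bar m (\<lambda>X. of_real (kahler_pot c X)) X = - \<i> / 2 * (k.hd X m * inverse (k.hc X))" if X: "X \<in> V" for X
  proof -
    have v: "k.vol X > 0" using pos[OF X] by (simp add: k.vol_cubic)
    have "((\<lambda>X. - ln (8 * k.vol X)) has_derivative (\<lambda>u. - (Re (dot (k.hd X) (k.xc u)) / k.vol X))) (at X)"
      using v by (auto intro!: derivative_eq_intros k.has_derivative_vol simp: field_simps)
    from has_derivative_of_real[OF this]
    have "((\<lambda>X. complex_of_real (kahler_pot c X)) has_derivative (\<lambda>u. of_real (- (Re (dot (k.hd X) (k.xc u)) / k.vol X)))) (at X)"
      unfolding kahler_pot_def k.vol_cubic .
    note D = fun_cong[OF frechet_derivative_at[OF this, symmetric]]
    have R: "complex_of_real (- (Re (dot (k.hd X) (k.xc u)) / k.vol X)) = - (dot (k.hd X) (k.xc u) / k.hc X)" for u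
      by (simp only: of_real_minus of_real_divide k.Re_dot_hd k.hc_vol)
    show ?thesis
      unfolding wirtinger_bar_def D R using h[OF X] by (simp only: xaxis z dot_delta) (simp add: field_simps)
  qed
  have "((\<lambda>X. - \<i> / 2 * (k.hd X m * inverse (k.hc X))) has_derivative
      (\<lambda>u. - \<i> / 2 * (k.hd X m * - (inverse (k.hc X) * dot (k.hd X) (k.xc u) * inverse (k.hc X)) + k.tt (k.xc X) (k.xc u) m * inverse (k.hc X)))) (at X)"
    by (intro has_derivative_mult_right has_derivative_mult k.has_derivative_hd Deriv.has_derivative_inverse[OF h[OF V(2)] k.has_derivative_hc])
  then have "(wirtinger_bar m (\<lambda>X. of_real (kahler_pot c X)) has_derivative
      (\<lambda>u. - \<i> / 2 * (k.hd X m * - (inverse (k.hc X) * dot (k.hd X) (k.xc u) * inverse (k.hc X)) + k.tt (k.xc X) (k.xc u) m * inverse (k.hc X)))) (at X)"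
    by (rule has_derivative_transform_within_open[OF _ V]) (simp add: wb)
  from frechet_derivative_at[OF this, symmetric]
  have "kahler_metric c l m X = - \<i> / 2 * (- \<i> / 2 * (k.hd X m * - (inverse (k.hc X) * k.hd X l * inverse (k.hc X)) + k.tt (k.xc X) (\<lambda>b. of_bool (b = l)) m * inverse (k.hc X)))"
    unfolding kahler_metric_def wirtinger_def by (simp add: xaxis z dot_delta)
  also have "\<dots> = (k.hd X l * k.hd X m / (k.hc X)\<^sup>2 - k.tt (k.xc X) (\<lambda>b. of_bool (b = l)) m / k.hc X) / 4"
    using h[OF V(2)] by (simp add: field_simps power2_eq_square)
  finally show ?thesis
    unfolding k.tt_x_partial2 k.hc_cubic k.hd_partial x_def by simp
qed

context cubic_chart
begin

lemma tt_sym_fun: "tt v y = tt y v"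
  by (rule ext) (rule tt_sym)

lemma H1_polarize: "H1 (\<lambda>a. v a + k * y a) a = H1 v a + k * tt v y a + k\<^sup>2 * H1 y a"
  by (simp add: H1_def multilinear tt_sym[of y v] algebra_simps power2_eq_square add_divide_distrib)

lemma H0_polarize: "H0 (\<lambda>a. v a + k * y a) = H0 v + k * dot (H1 v) y + k\<^sup>2 * dot (H1 y) v + k ^ 3 * H0 y"
proof -
  have 1: "dot (tt v y) v = 2 * dot (H1 v) y" "dot (tt v y) y = 2 * dot (H1 y) v"
  proof -
    have "dot (tt v y) v = dot v (tt y v)" by (subst dot_sym) (simp only: tt_sym_fun[of v y])
    also have "\<dots> = dot y (tt v v)" by (rule tri_sym)
    finally show "dot (tt v y) v = 2 * dot (H1 v) y" by (simp add: H1_def[abs_def] dot_divide dot_sym[of y])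
    have "dot (tt v y) y = dot y (tt v y)" by (rule dot_sym)
    also have "\<dots> = dot v (tt y y)" by (rule tri_sym)
    finally show "dot (tt v y) y = 2 * dot (H1 y) v" by (simp add: H1_def[abs_def] dot_divide dot_sym[of v])
  qed
  have "H1 (\<lambda>a. v a + k * y a) = (\<lambda>a. H1 v a + k * tt v y a + k\<^sup>2 * H1 y a)"
    by (simp add: H1_polarize fun_eq_iff)
  then show ?thesis
    unfolding H0_def by (simp add: multilinear 1 algebra_simps power2_eq_square power3_eq_cube add_divide_distrib)
qed

lemma H1_XX: "H1 (XX q) a = H1 (yc q) a + \<i> * tt (yc q) (xc q) a - hd q a"
  unfolding XX_eq H1_polarize by simp

lemma H0_XX: "H0 (XX q) = H0 (yc q) + \<i> * dot (H1 (yc q)) (xc q) - dot (hd q) (yc q) - \<i> * hc q"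
  unfolding XX_eq H0_polarize by (simp add: power3_eq_cube)

lemma Af_translated: "Af q v a = Ztc v a + tt (XX q) (Zc v) a - H1 (XX q) a * p0f v"
  unfolding H1_XX unfolding Af_def qf_def pf_def XX_eq
  by (simp add: multilinear tt_sym[of "yc q" "xc q"] algebra_simps)

lemma bh_translated: "bh q v = of_real (Zt0 v) + dot (XX q) (Ztc v) + dot (H1 (XX q)) (Zc v) - H0 (XX q) * p0f v"
proof -
  have 1: "dot (xc q) (tt (yc q) (Zc v)) = dot (tt (yc q) (xc q)) (Zc v)"
  proof -
    have "dot (xc q) (tt (yc q) (Zc v)) = dot (xc q) (tt (Zc v) (yc q))" by (simp only: tt_sym_fun[of "yc q" "Zc v"])
    also have "\<dots> = dot (Zc v) (tt (xc q) (yc q))" by (rule tri_sym)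
    finally show ?thesis by (simp only: dot_sym[of "Zc v"] tt_sym_fun[of "xc q" "yc q"])
  qed
  have H1f: "H1 (XX q) = (\<lambda>a. H1 (yc q) a + \<i> * tt (yc q) (xc q) a - hd q a)" by (simp add: H1_XX fun_eq_iff)
  show ?thesis
    unfolding H0_XX H1f unfolding bh_def q0f_def qf_def pf_def XX_eq
    by (simp add: multilinear 1 dot_sym[of "xc q" "H1 (yc q)"] algebra_simps)
qed

lemma dot_XX_H1: "dot (XX q) (H1 (XX q)) = 3 * H0 (XX q)"
  by (simp add: H0_def dot_sym[of "XX q"])

lemma dot_XX_tt: "dot (XX q) (tt (XX q) z) = 2 * dot (H1 (XX q)) z"
proof -
  have "dot (XX q) (tt (XX q) z) = dot (XX q) (tt z (XX q))" by (simp only: tt_sym_fun[of "XX q" z])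
  also have "\<dots> = dot z (tt (XX q) (XX q))" by (rule tri_sym)
  finally show ?thesis by (simp add: H1_def[abs_def] dot_divide dot_sym[of z])
qed

text \<open>The imaginary part of the Hessian of the prepotential.\<close>

lemma Im_eqI: "z - cnj z = 2 * \<i> * y \<Longrightarrow> of_real (2 * Im z) = 2 * y"
proof -
  assume "z - cnj z = 2 * \<i> * y"
  moreover have "z - cnj z = 2 * \<i> * of_real (Im z)" by (simp add: complex_eq_iff)
  ultimately show ?thesis by simp
qed

lemma Im_H1_XX: "of_real (2 * Im (H1 (XX q) a)) = 2 * tt (xc q) (yc q) a"
  by (rule Im_eqI) (simp add: H1_XX cnj_H1 cnj_TT tt_sym[of "xc q"])

lemma Im_H0_XX: "of_real (2 * Im (H0 (XX q))) = 2 * (dot (H1 (yc q)) (xc q) - hc q)"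
  by (rule Im_eqI) (simp add: H0_XX cnj_H0 cnj_H1 cnj_dot algebra_simps)

lemma period_contraction:
  assumes h: "hc q \<noteq> 0"
  shows "dot z (kv q) * (4 * (dot (H1 (yc q)) (xc q) - hc q)) + dot (\<lambda>a. z a + dot z (kv q) * XX q a) (\<lambda>a. - 2 * tt (xc q) (yc q) a)
       = 8 * hc q * dot (Kv q z) (XB q)"
    "dot z (kv q) * (- 2 * tt (xc q) (yc q) b) + 2 * tt (xc q) (\<lambda>a. z a + dot z (kv q) * XX q a) b = - 8 * hc q * Kv q z b"
proof -
  have k: "dot z (kv q) = \<i> * dot (hd q) z / (2 * hc q)"
    by (simp add: kv_def[abs_def] multilinear dot_sym[of z])
  have sw: "dot y (tt (xc q) y') = dot y' (tt (xc q) y)" for y y'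
  proof -
    have "dot y (tt (xc q) y') = dot y (tt y' (xc q))" by (simp only: tt_sym_fun[of "xc q" y'])
    also have "\<dots> = dot y' (tt y (xc q))" by (rule tri_sym)
    finally show ?thesis by (simp only: tt_sym_fun[of "xc q" y])
  qed
  have yy: "dot (yc q) (tt (xc q) (yc q)) = 2 * dot (H1 (yc q)) (xc q)"
  proof -
    have "dot (yc q) (tt (xc q) (yc q)) = dot (xc q) (tt (yc q) (yc q))" by (rule tri_sym)
    then show ?thesis by (simp add: H1_def[abs_def] dot_divide dot_sym[of "xc q"])
  qed
  have txB: "tt (xc q) z = (\<lambda>a. tt (xc q) z a)" by simp
  have tz: "dot (tt (xc q) z) y = dot z (tt (xc q) y)" for y
    using sw[of y z] by (simp add: dot_sym[of "tt (xc q) z"])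
  show "dot z (kv q) * (4 * (dot (H1 (yc q)) (xc q) - hc q)) + dot (\<lambda>a. z a + dot z (kv q) * XX q a) (\<lambda>a. - 2 * tt (xc q) (yc q) a)
       = 8 * hc q * dot (Kv q z) (XB q)"
    unfolding k XX_eq Kv_def[abs_def] using h
    by (simp add: multilinear yy tz dot_x_tt dot_hd_x tt_x_x[abs_def] dot_sym[of z "hd q"] field_simps power2_eq_square)
  show "dot z (kv q) * (- 2 * tt (xc q) (yc q) b) + 2 * tt (xc q) (\<lambda>a. z a + dot z (kv q) * XX q a) b = - 8 * hc q * Kv q z b"
    unfolding k XX_eq Kv_def using h
    by (simp add: multilinear tt_x_x field_simps power2_eq_square)
qed

end

lemma sum_swap3: "(\<Sum>b\<in>A. \<Sum>d\<in>B. \<Sum>m\<in>C. g b d m) = (\<Sum>m\<in>C. \<Sum>b\<in>A. \<Sum>d\<in>B. g b d m)"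
proof -
  have "(\<Sum>b\<in>A. \<Sum>d\<in>B. \<Sum>m\<in>C. g b d m) = (\<Sum>b\<in>A. \<Sum>m\<in>C. \<Sum>d\<in>B. g b d m)"
    by (rule sum.cong[OF refl], rule sum.swap)
  also have "\<dots> = (\<Sum>m\<in>C. \<Sum>b\<in>A. \<Sum>d\<in>B. g b d m)" by (rule sum.swap)
  finally show ?thesis .
qed

text \<open>A constant linear change of the base coordinates.\<close>

locale chart_change = N: cubic_chart T X rh ph Zt0 Z0 Zt Z
  for T :: "'n::finite \<Rightarrow> 'n \<Rightarrow> 'n \<Rightarrow> real" and X :: "'n \<Rightarrow> 'a::euclidean_space \<Rightarrow> complex"
    and rh ph Zt0 Z0 Zt Z +
  fixes e0 E :: "'n \<Rightarrow> 'n \<Rightarrow> real"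
  assumes E_e0: "\<And>m l. (\<Sum>a\<in>UNIV. E m a * e0 a l) = of_bool (m = l)"
begin

definition up :: "('n \<Rightarrow> complex) \<Rightarrow> 'n \<Rightarrow> complex" where "up v a = (\<Sum>m\<in>UNIV. of_real (e0 a m) * v m)"
definition dn :: "('n \<Rightarrow> complex) \<Rightarrow> 'n \<Rightarrow> complex" where "dn v a = (\<Sum>m\<in>UNIV. of_real (E m a) * v m)"
definition bk :: "('n \<Rightarrow> complex) \<Rightarrow> 'n \<Rightarrow> complex" where "bk v m = (\<Sum>a\<in>UNIV. of_real (E m a) * v a)"

lemma up_linear: "up (\<lambda>a. v a + w a) b = up v b + up w b" "up (\<lambda>a. v a - w a) b = up v b - up w b"
  "up (\<lambda>a. k * v a) b = k * up v b" "up (\<lambda>a. v a * k) b = up v b * k"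
  by (simp_all add: up_def algebra_simps sum.distrib sum_subtractf sum_distrib_left)

lemma dn_linear: "dn (\<lambda>a. v a + w a) b = dn v b + dn w b" "dn (\<lambda>a. v a - w a) b = dn v b - dn w b"
  "dn (\<lambda>a. k * v a) b = k * dn v b" "dn (\<lambda>a. v a * k) b = dn v b * k" "dn (\<lambda>a. v a / k) b = dn v b / k"
  by (simp_all add: dn_def algebra_simps sum.distrib sum_subtractf sum_distrib_left sum_divide_distrib)

lemma bk_up: "bk (up v) = v"
proof
  fix m
  have "bk (up v) m = (\<Sum>l\<in>UNIV. of_real (\<Sum>a\<in>UNIV. E m a * e0 a l) * v l)"
    unfolding bk_def up_def sum_distrib_left of_real_sum sum_distrib_right by (subst sum.swap) (simp add: mult.assoc)
  moreover have "complex_of_real (of_bool (m = l)) = of_bool (m = l)" for l by simp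
  ultimately show "bk (up v) m = v m" by (simp only: E_e0) simp
qed

lemma dot_dn: "dot (dn w) v = dot w (bk v)"
  unfolding dot_def dn_def bk_def sum_distrib_left sum_distrib_right by (subst sum.swap) (simp add: mult_ac)

lemma dot_dn_up: "dot (dn w) (up v) = dot w v" "dot (up v) (dn w) = dot v w"
  by (simp_all add: dot_dn bk_up dot_sym[of "up v"] dot_sym[of w v])

definition T' :: "'n \<Rightarrow> 'n \<Rightarrow> 'n \<Rightarrow> real" where
  "T' a b d = (\<Sum>m\<in>UNIV. \<Sum>l\<in>UNIV. \<Sum>s\<in>UNIV. E m a * E l b * E s d * T m l s)"

lemma TT_change: "TT T' v w a = dn (TT T (bk v) (bk w)) a"
proof -
  have "TT T' v w a = (\<Sum>b\<in>UNIV. \<Sum>d\<in>UNIV. \<Sum>m\<in>UNIV. \<Sum>l\<in>UNIV. \<Sum>s\<in>UNIV.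
      of_real (E m a) * (of_real (T m l s) * (of_real (E l b) * v b) * (of_real (E s d) * w d)))"
    unfolding TT_def T'_def of_real_sum sum_distrib_right of_real_mult by (simp only: mult_ac)
  also have "\<dots> = (\<Sum>m\<in>UNIV. \<Sum>l\<in>UNIV. \<Sum>s\<in>UNIV. \<Sum>b\<in>UNIV. \<Sum>d\<in>UNIV.
      of_real (E m a) * (of_real (T m l s) * (of_real (E l b) * v b) * (of_real (E s d) * w d)))"
    by (subst sum_swap3, rule sum.cong[OF refl], subst sum_swap3, rule sum.cong[OF refl], rule sum_swap3)
  also have "\<dots> = dn (TT T (bk v) (bk w)) a"
  proof -
    have "(\<Sum>b\<in>UNIV. \<Sum>d\<in>UNIV. of_real (E m a) * (of_real (T m l s) * (of_real (E l b) * v b) * (of_real (E s d) * w d)))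
       = of_real (E m a) * (of_real (T m l s) * bk v l * bk w s)" for m l s
    proof -
      have "bk v l * bk w s = (\<Sum>b\<in>UNIV. \<Sum>d\<in>UNIV. (of_real (E l b) * v b) * (of_real (E s d) * w d))"
        unfolding bk_def by (rule sum_product)
      then show ?thesis by (simp only: mult.assoc sum_distrib_left)
    qed
    then show ?thesis unfolding TT_def dn_def by (simp add: sum_distrib_left)
  qed
  finally show ?thesis .
qed

lemma TT_change_up: "TT T' (up v) (up w) = dn (TT T v w)"
  by (simp add: TT_change bk_up fun_eq_iff)

definition X' :: "'n \<Rightarrow> 'a \<Rightarrow> complex" where "X' a q = up (\<lambda>m. X m q) a"
definition Z' :: "'n \<Rightarrow> 'a \<Rightarrow> real" where "Z' a q = (\<Sum>m\<in>UNIV. e0 a m * Z m q)"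
definition Zt' :: "'n \<Rightarrow> 'a \<Rightarrow> real" where "Zt' a q = (\<Sum>m\<in>UNIV. E m a * Zt m q)"

lemma T'_sym: "T' a b d = T' b a d" "T' a b d = T' a d b"
proof -
  have 1: "E m a * E l b * E s d * T m l s = E l b * E m a * E s d * T l m s" for m l s
    using N.T_sym(1)[of m l s] by simp
  have 2: "E m a * E l b * E s d * T m l s = E m a * E s d * E l b * T m s l" for m l s
    using N.T_sym(2)[of m l s] by simp
  have "T' a b d = (\<Sum>l\<in>UNIV. \<Sum>m\<in>UNIV. \<Sum>s\<in>UNIV. E m a * E l b * E s d * T m l s)"
    unfolding T'_def by (rule sum.swap)
  also have "\<dots> = T' b a d" unfolding T'_def by (intro sum.cong refl 1)
  finally show "T' a b d = T' b a d" .
  have "T' a b d = (\<Sum>m\<in>UNIV. \<Sum>s\<in>UNIV. \<Sum>l\<in>UNIV. E m a * E l b * E s d * T m l s)"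
    unfolding T'_def by (rule sum.cong[OF refl], rule sum.swap)
  also have "\<dots> = T' a d b" unfolding T'_def by (intro sum.cong refl 2)
  finally show "T' a b d = T' a d b" .
qed

end

lemma (in chart_change) linear_change: "linear (X' a)" "linear (Zt' a)" "linear (Z' a)"
proof -
  show "linear (X' a)"
    unfolding X'_def[abs_def] up_def using N.lin(1)
    by (intro linear_compose_sum ballI) (auto intro!: linearI simp: linear_add linear_scale algebra_simps scaleR_conv_of_real)
  show "linear (Zt' a)"
    unfolding Zt'_def[abs_def] using N.lin(6)
    by (intro linear_compose_sum ballI) (auto intro!: linearI simp: linear_add linear_scale algebra_simps)
  show "linear (Z' a)"
    unfolding Z'_def[abs_def] using N.lin(7)
    by (intro linear_compose_sum ballI) (auto intro!: linearI simp: linear_add linear_scale algebra_simps)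
qed

sublocale chart_change \<subseteq> C: cubic_chart T' X' rh ph Zt0 Z0 Zt' Z'
  by (rule cubic_chart.intro) (rule T'_sym linear_change N.lin)+

context chart_change
begin

lemma coords_change: "C.XX q = up (N.XX q)" "C.XB q = up (N.XB q)" "C.xc q = up (N.xc q)" "C.yc q = up (N.yc q)"
  "C.Zc q = up (N.Zc q)" "C.Ztc q = dn (N.Ztc q)"
  unfolding fun_eq_iff C.XX_def C.XB_def C.xc_def C.yc_def C.Zc_def C.Ztc_def
  unfolding N.XX_def N.XB_def N.xc_def N.yc_def N.Zc_def N.Ztc_def X'_def Z'_def Zt'_def up_def dn_def
  by simp_all

lemma H1_change: "C.H1 (up v) a = dn (N.H1 v) a"
  by (simp add: C.H1_def N.H1_def[abs_def] TT_change_up dn_linear)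

lemma H1_change_fun: "C.H1 (up v) = dn (N.H1 v)"
  by (simp add: H1_change fun_eq_iff)

lemma H0_change: "C.H0 (up v) = N.H0 v"
  by (simp add: C.H0_def N.H0_def H1_change_fun dot_dn_up)

lemma hc_change: "C.hc q = N.hc q" "C.vol q = N.vol q" "C.tau q = N.tau q" "C.hd q = dn (N.hd q)"
  by (simp_all add: C.vol_def N.vol_def C.tau_def N.tau_def coords_change H0_change H1_change_fun)

lemma pf_change: "C.pf q v = up (N.pf q v)"
  by (simp add: C.pf_def[abs_def] N.pf_def[abs_def] coords_change up_linear fun_eq_iff)

lemma qf_change: "C.qf q v = dn (N.qf q v)"
  by (simp add: C.qf_def[abs_def] N.qf_def[abs_def] coords_change TT_change_up H1_change dn_linear fun_eq_iff)

lemma q0f_change: "C.q0f q v = N.q0f q v"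
  by (simp add: C.q0f_def N.q0f_def coords_change H1_change_fun H0_change dot_dn_up)

lemma bh_change: "C.bh q v = N.bh q v"
  unfolding C.bh_def N.bh_def q0f_change hc_change qf_change pf_change coords_change H1_change_fun H0_change dot_dn_up ..

lemma bf_change: "C.bf q v = N.bf q v"
  by (simp add: C.bf_def N.bf_def bh_change hc_change)

lemma Af_change: "C.Af q v = dn (N.Af q v)"
  by (simp add: C.Af_def[abs_def] N.Af_def[abs_def] qf_change pf_change hc_change coords_change TT_change_up H1_change_fun H0_change dn_linear fun_eq_iff)

lemma af_change: "C.af q v = dn (N.af q v)"
proof
  fix a
  have kv: "C.kv q a = dn (N.kv q) a"
  proof -
    have "dn (N.kv q) a = dn (\<lambda>b. \<i> * N.hd q b / (2 * N.hc q)) a"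
      by (rule arg_cong[of _ _ "\<lambda>f. dn f a"]) (rule ext, rule N.kv_def)
    also have "\<dots> = \<i> * dn (N.hd q) a / (2 * N.hc q)" by (subst dn_linear(5), subst dn_linear(3)) (rule refl)
    also have "\<dots> = C.kv q a" by (simp only: C.kv_def hc_change)
    finally show ?thesis by (rule sym)
  qed
  have "N.af q v = (\<lambda>a. - \<i> * N.tau q * (N.Af q v a + N.kv q a * N.bh q v))"
    by (intro ext, rule N.af_def)
  then have "dn (N.af q v) a = - \<i> * N.tau q * (dn (N.Af q v) a + dn (N.kv q) a * N.bh q v)"
    by (simp only: dn_linear(1,3,4))
  then show "C.af q v a = dn (N.af q v) a"
    by (simp only: C.af_def Af_change hc_change bh_change kv)
qed

lemma Kv_change: "C.Kv q (up z) = dn (N.Kv q z)"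
proof -
  have N: "N.Kv q z = (\<lambda>a. (N.hd q a * (dot (N.hd q) z / (N.hc q)\<^sup>2) - TT T (N.xc q) z a / N.hc q) / 4)"
    by (simp add: N.Kv_def fun_eq_iff)
  show ?thesis
    unfolding N by (simp add: fun_eq_iff C.Kv_def hc_change dot_dn_up coords_change TT_change_up H1_change_fun H0_change dn_linear)
qed

end

lemma differentiable_vec_lambda:
  fixes f :: "'a::real_normed_vector \<Rightarrow> 'n::finite \<Rightarrow> complex"
  assumes "\<And>a. (\<lambda>q. f q a) differentiable (at p)"
  shows "(\<lambda>q. \<chi> a. f q a) differentiable (at p)"
proof -
  have bl: "bounded_linear (axis a :: complex \<Rightarrow> complex ^ 'n)" for a
    unfolding linear_conv_bounded_linear[symmetric] by (intro linearI) (simp_all add: vec_eq_iff axis_def)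
  have "(\<chi> a. f q a) = (\<Sum>a\<in>UNIV. axis a (f q a))" for q
    by (simp add: vec_eq_iff axis_def)
  moreover have "(\<lambda>q. \<Sum>a\<in>UNIV. axis a (f q a)) differentiable (at p)"
  proof (intro differentiable_sum ballI finite)
    fix a
    obtain D where "((\<lambda>q. f q a) has_derivative D) (at p)" using assms[of a] by (auto simp: differentiable_def)
    from bounded_linear.has_derivative[OF bl this] show "(\<lambda>q. axis a (f q a)) differentiable (at p)"
      by (rule differentiableI)
  qed
  ultimately show ?thesis by simp
qed

definition mv :: "('n::finite \<Rightarrow> 'm::finite \<Rightarrow> real) \<Rightarrow> ('m \<Rightarrow> complex) \<Rightarrow> 'n \<Rightarrow> complex" where
  "mv M v a = (\<Sum>b\<in>UNIV. of_real (M a b) * v b)"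

abbreviation (input) tp :: "('n \<Rightarrow> 'm \<Rightarrow> real) \<Rightarrow> 'm \<Rightarrow> 'n \<Rightarrow> real" where "tp M \<equiv> (\<lambda>a b. M b a)"

lemma mv_inverse:
  fixes N M :: "'n::finite \<Rightarrow> 'n \<Rightarrow> real"
  assumes "\<And>a b. (\<Sum>d\<in>UNIV. M a d * N d b) = of_bool (a = b)"
  shows "mv M (mv N v) = v"
proof
  fix a
  have "mv M (mv N v) a = (\<Sum>b\<in>UNIV. of_real (\<Sum>d\<in>UNIV. M a d * N d b) * v b)"
    unfolding mv_def sum_distrib_left of_real_sum sum_distrib_right by (subst sum.swap) (simp add: mult.assoc)
  moreover have "complex_of_real (of_bool (a = b)) = of_bool (a = b)" for b by simp
  ultimately show "mv M (mv N v) a = v a" by (simp only: assms) simp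
qed

lemma dot_mv: "dot (mv M v) w = dot v (mv (tp M) w)"
  unfolding dot_def mv_def sum_distrib_left sum_distrib_right by (subst sum.swap) (simp add: mult_ac)

lemma cnj_mv: "cnj (mv M v a) = mv M (\<lambda>b. cnj (v b)) a"
  by (simp add: mv_def)

lemma mv_linear: "mv M (\<lambda>a. v a - w a) b = mv M v b - mv M w b" "mv M (\<lambda>a. k * v a) b = k * mv M v b" "mv M (\<lambda>a. v a * k) b = mv M v b * k"
  by (simp_all add: mv_def algebra_simps sum_subtractf sum_distrib_left)

lemma mv_mv: "mv M (mv N v) = mv (\<lambda>a b. \<Sum>d\<in>UNIV. M a d * N d b) v"
proof
  fix a
  show "mv M (mv N v) a = mv (\<lambda>a b. \<Sum>d\<in>UNIV. M a d * N d b) v a"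
    unfolding mv_def sum_distrib_left of_real_sum sum_distrib_right by (subst sum.swap) (simp add: mult.assoc)
qed

lemma matrix_inv_entries:
  fixes A :: "real ^ 'n ^ 'n"
  assumes "invertible A"
  shows "(\<Sum>d\<in>UNIV. A $ a $ d * matrix_inv A $ d $ b) = of_bool (a = b)"
    "(\<Sum>d\<in>UNIV. matrix_inv A $ a $ d * A $ d $ b) = of_bool (a = b)"
proof -
  have "A ** matrix_inv A = mat 1 \<and> matrix_inv A ** A = mat 1"
    unfolding matrix_inv_def by (rule someI_ex) (use assms in \<open>simp add: invertible_def\<close>)
  then show "(\<Sum>d\<in>UNIV. A $ a $ d * matrix_inv A $ d $ b) = of_bool (a = b)"
    "(\<Sum>d\<in>UNIV. matrix_inv A $ a $ d * A $ d $ b) = of_bool (a = b)"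
    by (simp_all add: vec_eq_iff matrix_matrix_mult_def mat_def)
qed

lemma qpoint_linear: "linear (\<lambda>q :: 'n::finite qpoint. base q $ a)" "linear (rho :: 'n qpoint \<Rightarrow> real)"
  "linear (phit :: 'n qpoint \<Rightarrow> real)" "linear (\<lambda>q :: 'n qpoint. zetat q I)" "linear (\<lambda>q :: 'n qpoint. zeta q I)"
  by (intro linearI; simp add: base_def rho_def phit_def zetat_def zeta_def)+

locale rqmap =
  fixes c :: "'n::finite \<Rightarrow> 'n \<Rightarrow> 'n \<Rightarrow> real" and V :: "(complex ^ 'n) set"
    and e :: "complex ^ 'n \<Rightarrow> real ^ 'n ^ 'n" and p :: "'n qpoint"
  assumes V_open: "open V" and V_pos: "\<And>X. X \<in> V \<Longrightarrow> cubic c (im_vec X) > 0"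
    and V_inv: "\<And>X. X \<in> V \<Longrightarrow> invertible (e X)"
    and V_metric: "\<And>X l m. X \<in> V \<Longrightarrow> of_real (\<Sum>a\<in>UNIV. e X $ a $ l * e X $ a $ m) = kahler_metric c l m X"
    and base_p: "base p \<in> V" and rho_p: "rho p > 0"
begin

definition Mf :: "'n qpoint \<Rightarrow> 'n \<Rightarrow> 'n \<Rightarrow> real" where "Mf q a m = e (base q) $ a $ m"
definition Rf :: "'n qpoint \<Rightarrow> 'n \<Rightarrow> 'n \<Rightarrow> real" where "Rf q m a = matrix_inv (e (base q)) $ m $ a"
definition Sdom :: "'n qpoint set" where "Sdom = {q. base q \<in> V \<and> rho q > 0}"

lemma Mf_Rf: "q \<in> Sdom \<Longrightarrow> (\<Sum>d\<in>UNIV. Mf q a d * Rf q d b) = of_bool (a = b)"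
  "q \<in> Sdom \<Longrightarrow> (\<Sum>d\<in>UNIV. Rf q a d * Mf q d b) = of_bool (a = b)"
  unfolding Mf_def Rf_def Sdom_def using matrix_inv_entries[OF V_inv[of "base q"]] by auto

lemma p_Sdom: "p \<in> Sdom" using base_p rho_p by (simp add: Sdom_def)

end

sublocale rqmap \<subseteq> S: standard_chart c base rho phit "\<lambda>q. zetat q None" "\<lambda>q. zeta q None" "\<lambda>a q. zetat q (Some a)" "\<lambda>a q. zeta q (Some a)"
  by (rule standard_chart.intro, rule cubic_chart.intro) (rule csym_sym qpoint_linear)+

sublocale rqmap \<subseteq> chart_change "csym c" "\<lambda>a q. base q $ a" rho phit "\<lambda>q. zetat q None" "\<lambda>q. zeta q None"
    "\<lambda>a q. zetat q (Some a)" "\<lambda>a q. zeta q (Some a)" "Mf p" "Rf p"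
  by (rule chart_change.intro, rule S.cubic_chart_axioms, rule chart_change_axioms.intro) (rule Mf_Rf(2)[OF p_Sdom])

context rqmap
begin

lemma mv_cancel:
  assumes "q \<in> Sdom"
  shows "mv (Mf q) (mv (Rf q) v) = v" "mv (Rf q) (mv (Mf q) v) = v"
    "mv (tp (Mf q)) (mv (tp (Rf q)) v) = v" "mv (tp (Rf q)) (mv (tp (Mf q)) v) = v"
proof -
  have 1: "(\<Sum>d\<in>UNIV. Rf q d a * Mf q b d) = of_bool (a = b)" for a b
    using Mf_Rf(1)[OF assms, of b a] by (simp only: mult.commute[of "Rf q _ a"] eq_commute[of b a])
  have 2: "(\<Sum>d\<in>UNIV. Mf q d a * Rf q b d) = of_bool (a = b)" for a b
    using Mf_Rf(2)[OF assms, of b a] by (simp only: mult.commute[of "Mf q _ a"] eq_commute[of b a])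
  show "mv (Mf q) (mv (Rf q) v) = v" "mv (Rf q) (mv (Mf q) v) = v"
    by (rule mv_inverse, rule Mf_Rf[OF assms])+
  show "mv (tp (Mf q)) (mv (tp (Rf q)) v) = v" "mv (tp (Rf q)) (mv (tp (Mf q)) v) = v"
    by (rule mv_inverse, rule 1 2)+
qed

end

context rqmap
begin

lemma h_pos: "q \<in> Sdom \<Longrightarrow> S.vol q > 0" "q \<in> Sdom \<Longrightarrow> S.hc q \<noteq> 0"
  using V_pos[of "base q"] by (simp_all add: Sdom_def S.vol_cubic S.hc_cubic)

text \<open>The Kaehler metric.\<close>

lemma Kv_frame:
  assumes q: "q \<in> Sdom"
  shows "S.Kv q z = mv (tp (Mf q)) (mv (Mf q) z)"
proof
  fix m
  let ?x = "im_vec (base q)"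
  have b: "base q \<in> V" using q by (simp add: Sdom_def)
  have sym: "partial m (partial l (cubic c)) ?x = partial l (partial m (cubic c)) ?x" for l
    by (simp add: partial_partial_cubic csym_sym(1)[of c l m])
  have K: "of_real (\<Sum>a\<in>UNIV. Mf q a m * Mf q a l) = (S.hd q m * S.hd q l / (S.hc q)\<^sup>2
      - of_real (partial m (partial l (cubic c)) ?x) / S.hc q) / 4" for l
  proof -
    have "kahler_metric c m l (base q) = of_real ((partial m (cubic c) ?x * partial l (cubic c) ?x / (cubic c ?x)\<^sup>2
     - partial l (partial m (cubic c)) ?x / cubic c ?x) / 4)"
      by (rule kahler_metric_Kv[OF V_open b]) (rule V_pos)
    then show ?thesis unfolding Mf_def V_metric[OF b] S.hd_partial S.hc_cubic sym by simp
  qed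
  have "mv (tp (Mf q)) (mv (Mf q) z) m = (\<Sum>l\<in>UNIV. of_real (\<Sum>a\<in>UNIV. Mf q a m * Mf q a l) * z l)"
    unfolding mv_mv mv_def ..
  also have "\<dots> = S.Kv q z m"
    unfolding K S.Kv_def S.tt_x_partial2 dot_def
    by (simp add: left_diff_distrib right_diff_distrib sum_subtractf sum_distrib_left sum_divide_distrib diff_divide_distrib mult_ac)
  finally show "S.Kv q z m = mv (tp (Mf q)) (mv (Mf q) z) m" by (rule HOL.sym)
qed

text \<open>The fibre one-forms.\<close>

lemma XX_base: "S.XX q = ($) (base q)"
  by (simp add: S.XX_def fun_eq_iff)

lemma A_form_Some: "A_form c q (Some m) v = S.Af q v m"
proof -
  have "S.tt (S.XX q) (S.Zc v) m = (\<Sum>n\<in>UNIV. partial m (partial n (cubic c)) (base q) * S.Zc v n)"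
    unfolding XX_base S.tt_partial2 ..
  moreover have "S.H1 (S.XX q) m = partial m (cubic c) (base q)"
    unfolding XX_base S.H1_partial ..
  ultimately show ?thesis
    unfolding S.Af_translated A_form_def sum_option F_mat_entries by (simp add: S.Zc_def S.Ztc_def)
qed

lemma A_form_total: "(\<Sum>I\<in>UNIV. hom_coords (base q) $ I * A_form c q I v) = S.bh q v"
proof -
  have H1: "partial m (cubic c) (base q) = S.H1 (S.XX q) m" for m unfolding XX_base S.H1_partial ..
  have H0: "cubic c (base q) = S.H0 (S.XX q)" unfolding XX_base S.H0_cubic ..
  have A0: "A_form c q None v = of_real (zetat v None) + 2 * S.H0 (S.XX q) * of_real (zeta v None) - dot (S.H1 (S.XX q)) (S.Zc v)"
    unfolding A_form_def sum_option F_mat_entries by (simp add: H1 H0 dot_def S.Zc_def sum_negf)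
  have "(\<Sum>I\<in>UNIV. hom_coords (base q) $ I * A_form c q I v) = A_form c q None v + dot (S.XX q) (S.Af q v)"
    unfolding sum_option A_form_Some by (simp add: hom_coords_def dot_def S.XX_def)
  moreover have "S.Af q v = (\<lambda>a. S.Ztc v a + S.tt (S.XX q) (S.Zc v) a - S.H1 (S.XX q) a * of_real (zeta v None))"
    by (intro ext, rule S.Af_translated)
  ultimately show ?thesis
    unfolding A0 S.bh_translated by (simp add: multilinear S.dot_XX_tt S.dot_XX_H1)
qed

text \<open>The period matrix.\<close>

definition yv :: "'n qpoint \<Rightarrow> ('n \<Rightarrow> complex) \<Rightarrow> 'n option \<Rightarrow> complex" where
  "yv q z I = (case I of None \<Rightarrow> dot z (S.kv q) | Some m \<Rightarrow> z m + dot z (S.kv q) * S.XX q m)"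

lemma N_mat_entries:
  "of_real (N_mat c (base q) $ None $ None) = 4 * (dot (S.H1 (S.yc q)) (S.xc q) - S.hc q)"
  "of_real (N_mat c (base q) $ Some m $ None) = - 2 * S.tt (S.xc q) (S.yc q) m"
  "of_real (N_mat c (base q) $ None $ Some m) = - 2 * S.tt (S.xc q) (S.yc q) m"
  "of_real (N_mat c (base q) $ Some l $ Some m) = 2 * of_real (partial m (partial l (cubic c)) (im_vec (base q)))"
proof -
  have H1: "partial m (cubic c) (base q) = S.H1 (S.XX q) m" for m unfolding XX_base S.H1_partial ..
  have H0: "cubic c (base q) = S.H0 (S.XX q)" unfolding XX_base S.H0_cubic ..
  have "complex_of_real (2 * Im (2 * z)) = 2 * of_real (2 * Im z)" for z by simp
  then show "of_real (N_mat c (base q) $ None $ None) = 4 * (dot (S.H1 (S.yc q)) (S.xc q) - S.hc q)"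
    unfolding N_mat_def vec_lambda_beta F_mat_entries H0 by (simp only: S.Im_H0_XX) simp
  have "complex_of_real (2 * Im (- z)) = - of_real (2 * Im z)" for z by simp
  then show "of_real (N_mat c (base q) $ Some m $ None) = - 2 * S.tt (S.xc q) (S.yc q) m"
    "of_real (N_mat c (base q) $ None $ Some m) = - 2 * S.tt (S.xc q) (S.yc q) m"
    unfolding N_mat_def vec_lambda_beta F_mat_entries H1 by (simp_all only: S.Im_H1_XX) simp_all
  show "of_real (N_mat c (base q) $ Some l $ Some m) = 2 * of_real (partial m (partial l (cubic c)) (im_vec (base q)))"
    unfolding N_mat_def vec_lambda_beta F_mat_entries partial_partial_cubic
    by (simp add: im_vec_def csym_sym(1)[of c l m] sum_distrib_left)
qed

lemma yv_N:
  assumes q: "q \<in> Sdom"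
  shows "(\<Sum>J\<in>UNIV. yv q z J * of_real (N_mat c (base q) $ J $ None)) = 8 * S.hc q * dot (S.Kv q z) (S.XB q)"
    "(\<Sum>J\<in>UNIV. yv q z J * of_real (N_mat c (base q) $ J $ Some b)) = - 8 * S.hc q * S.Kv q z b"
proof -
  note P = S.period_contraction[OF h_pos(2)[OF q], of z]
  show "(\<Sum>J\<in>UNIV. yv q z J * of_real (N_mat c (base q) $ J $ None)) = 8 * S.hc q * dot (S.Kv q z) (S.XB q)"
    unfolding sum_option N_mat_entries P(1)[symmetric] by (simp add: yv_def dot_def)
  have "S.tt (S.xc q) (\<lambda>a. z a + dot z (S.kv q) * S.XX q a) b =
     (\<Sum>m\<in>UNIV. of_real (partial b (partial m (cubic c)) (im_vec (base q))) * (z m + dot z (S.kv q) * S.XX q m))"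
    by (rule S.tt_x_partial2)
  then show "(\<Sum>J\<in>UNIV. yv q z J * of_real (N_mat c (base q) $ J $ Some b)) = - 8 * S.hc q * S.Kv q z b"
    unfolding sum_option N_mat_entries P(2)[symmetric] by (simp add: yv_def sum_distrib_left mult_ac)
qed

lemma P_mat_N:
  assumes q: "q \<in> Sdom"
  shows "cnj (P_mat e (base q) a K) = - 1 / (8 * S.hc q) * (\<Sum>J\<in>UNIV. yv q (\<lambda>m. of_real (Rf q m a)) J * of_real (N_mat c (base q) $ J $ K))"
proof -
  let ?s = "\<lambda>m. complex_of_real (Rf q m a)"
  have M: "mv (Mf q) ?s = (\<lambda>b. of_bool (b = a))"
  proof
    fix b
    have "mv (Mf q) ?s b = of_real (\<Sum>d\<in>UNIV. Mf q b d * Rf q d a)" by (simp add: mv_def)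
    then show "mv (Mf q) ?s b = of_bool (b = a)" by (simp add: Mf_Rf(1)[OF q])
  qed
  have K: "S.Kv q ?s m = of_real (Mf q a m)" for m
    unfolding Kv_frame[OF q] M by (simp add: mv_def)
  show ?thesis
  proof (cases K)
    case None
    have "cnj (P_mat e (base q) a None) = - dot (S.Kv q ?s) (S.XB q)"
      unfolding K dot_def by (simp add: P_mat_def K Mf_def S.XB_def)
    then show ?thesis unfolding None yv_N[OF q] using h_pos(2)[OF q] by simp
  next
    case (Some m)
    have "cnj (P_mat e (base q) a (Some m)) = S.Kv q ?s m"
      unfolding K by (simp add: P_mat_def Mf_def)
    then show ?thesis unfolding Some yv_N[OF q] using h_pos(2)[OF q] by simp
  qed
qed

lemma N_mat_invertible:
  assumes q: "q \<in> Sdom"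
  shows "invertible (N_mat c (base q))"
  unfolding invertible_left_inverse matrix_left_invertible_ker
proof (intro allI impI)
  fix z :: "real ^ 'n option"
  assume Nz: "N_mat c (base q) *v z = 0"
  define z0 where "z0 = complex_of_real (z $ None)"
  define zz where "zz m = complex_of_real (z $ Some m)" for m
  have N0: "(\<Sum>K\<in>UNIV. of_real (N_mat c (base q) $ J $ K) * complex_of_real (z $ K)) = 0" for J
  proof -
    have "(\<Sum>K\<in>UNIV. N_mat c (base q) $ J $ K * z $ K) = 0"
      using arg_cong[OF Nz, of "\<lambda>v. v $ J"] by (simp add: matrix_vector_mult_def)
    from arg_cong[OF this, of complex_of_real] show ?thesis by simp
  qed
  have P0: "(\<Sum>K\<in>UNIV. cnj (P_mat e (base q) a K) * complex_of_real (z $ K)) = 0" for a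
  proof -
    let ?y = "yv q (\<lambda>m. of_real (Rf q m a))"
    have "(\<Sum>K\<in>UNIV. cnj (P_mat e (base q) a K) * complex_of_real (z $ K))
       = - 1 / (8 * S.hc q) * (\<Sum>K\<in>UNIV. \<Sum>J\<in>UNIV. ?y J * (of_real (N_mat c (base q) $ J $ K) * of_real (z $ K)))"
      unfolding P_mat_N[OF q] by (simp only: sum_distrib_left sum_distrib_right mult.assoc)
    also have "(\<Sum>K\<in>UNIV. \<Sum>J\<in>UNIV. ?y J * (of_real (N_mat c (base q) $ J $ K) * of_real (z $ K))) = (\<Sum>J\<in>UNIV. ?y J * 0)"
      by (subst sum.swap) (simp only: sum_distrib_left[symmetric] N0)
    finally show ?thesis by simp
  qed
  have "mv (Mf q) (\<lambda>m. zz m - S.XB q m * z0) = (\<lambda>a. 0)"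
  proof
    fix a
    show "mv (Mf q) (\<lambda>m. zz m - S.XB q m * z0) a = 0"
      using P0[of a] unfolding sum_option
      by (simp add: P_mat_def mv_def Mf_def zz_def z0_def S.XB_def right_diff_distrib sum_subtractf sum_distrib_left sum_distrib_right mult_ac)
  qed
  then have "mv (Rf q) (\<lambda>a. 0) = (\<lambda>m. zz m - S.XB q m * z0)"
    using mv_cancel(2)[OF q, of "\<lambda>m. zz m - S.XB q m * z0"] by simp
  then have zz: "zz m = S.XB q m * z0" for m
    by (simp add: mv_def fun_eq_iff)
  have x0: "im_vec (base q) $ m * z $ None = 0" for m
    using arg_cong[OF zz[of m], of Im] by (simp add: zz_def z0_def S.XB_def im_vec_def)
  have "z $ None = 0"
  proof (rule ccontr)
    assume "z $ None \<noteq> 0"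
    then have "im_vec (base q) $ m = 0" for m using x0[of m] by simp
    then have "cubic c (im_vec (base q)) = 0" by (simp add: cubic_def)
    then show False using V_pos[of "base q"] q by (simp add: Sdom_def)
  qed
  then have "z $ Some m = 0" for m using zz[of m] by (simp add: zz_def z0_def)
  with \<open>z $ None = 0\<close> show "z = 0" unfolding vec_eq_iff by (metis option.exhaust zero_index)
qed

lemma P_mat_inverse:
  assumes q: "q \<in> Sdom"
  shows "(\<Sum>I\<in>UNIV. cnj (P_mat e (base q) a I) * of_real (matrix_inv (N_mat c (base q)) $ I $ L))
     = - 1 / (8 * S.hc q) * yv q (\<lambda>m. of_real (Rf q m a)) L"
proof -
  let ?y = "yv q (\<lambda>m. of_real (Rf q m a))"
  let ?N = "N_mat c (base q)"
  have NN: "(\<Sum>K\<in>UNIV. complex_of_real (?N $ J $ K) * of_real (matrix_inv ?N $ K $ L)) = of_bool (J = L)" for J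
    using arg_cong[OF matrix_inv_entries(1)[OF N_mat_invertible[OF q], of J L], of complex_of_real] by simp
  have "(\<Sum>I\<in>UNIV. cnj (P_mat e (base q) a I) * of_real (matrix_inv ?N $ I $ L))
     = - 1 / (8 * S.hc q) * (\<Sum>K\<in>UNIV. \<Sum>J\<in>UNIV. ?y J * (of_real (?N $ J $ K) * of_real (matrix_inv ?N $ K $ L)))"
    unfolding P_mat_N[OF q] by (simp only: sum_distrib_left sum_distrib_right mult.assoc)
  also have "(\<Sum>K\<in>UNIV. \<Sum>J\<in>UNIV. ?y J * (of_real (?N $ J $ K) * of_real (matrix_inv ?N $ K $ L))) = (\<Sum>J\<in>UNIV. ?y J * of_bool (J = L))"
    by (subst sum.swap) (simp only: sum_distrib_left[symmetric] NN)
  finally show ?thesis by simp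
qed

lemma exp_kahler_pot:
  assumes q: "q \<in> Sdom"
  shows "exp (kahler_pot c (base q)) = 1 / (8 * S.vol q)"
    "of_real (exp (kahler_pot c (base q) / 2) / sqrt (rho q)) = S.tau q"
    "of_real (1 / sqrt (rho q) * exp (- kahler_pot c (base q) / 2)) = 8 * S.hc q * S.tau q"
proof -
  have v: "8 * S.vol q > 0" using h_pos(1)[OF q] by simp
  have K: "kahler_pot c (base q) = - ln (8 * S.vol q)" by (simp add: kahler_pot_def S.vol_cubic)
  show "exp (kahler_pot c (base q)) = 1 / (8 * S.vol q)"
    unfolding K exp_minus using v by (simp add: inverse_eq_divide)
  have e: "exp (ln (8 * S.vol q) / 2) = sqrt (8 * S.vol q)"
    using v by (simp add: ln_sqrt[symmetric])
  show "of_real (exp (kahler_pot c (base q) / 2) / sqrt (rho q)) = S.tau q"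
    unfolding K S.tau_def minus_divide_left[symmetric] exp_minus e by (simp add: real_sqrt_mult inverse_eq_divide)
  have "1 / sqrt (rho q) * sqrt (8 * S.vol q) = 8 * S.vol q * (1 / sqrt (8 * S.vol q * rho q))"
  proof -
    define s where "s = sqrt (8 * S.vol q)"
    have s: "8 * S.vol q = s * s" "s \<noteq> 0" using v by (simp_all add: s_def)
    have r: "sqrt (8 * S.vol q * rho q) = s * sqrt (rho q)" unfolding s_def by (rule real_sqrt_mult)
    show ?thesis unfolding r s_def[symmetric] unfolding s(1) using s(2) by simp
  qed
  then show "of_real (1 / sqrt (rho q) * exp (- kahler_pot c (base q) / 2)) = 8 * S.hc q * S.tau q"
    unfolding K minus_minus e S.tau_def S.hc_vol of_real_mult[symmetric] of_real_numeral[symmetric, where 'a=complex]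
    by (simp only: of_real_mult)
qed

lemma alpha_Some:
  assumes q: "q \<in> Sdom"
  shows "alpha c e q (Some a) v = mv (tp (Rf q)) (S.af q v) a"
proof -
  let ?s = "\<lambda>m. complex_of_real (Rf q m a)"
  have "(\<Sum>I\<in>UNIV. \<Sum>J\<in>UNIV. cnj (P_mat e (base q) a I) * of_real (matrix_inv (N_mat c (base q)) $ I $ J) * A_form c q J v)
     = (\<Sum>J\<in>UNIV. (- 1 / (8 * S.hc q) * yv q ?s J) * A_form c q J v)"
    by (subst sum.swap) (simp only: sum_distrib_right[symmetric] P_mat_inverse[OF q])
  also have "\<dots> = - 1 / (8 * S.hc q) * (\<Sum>J\<in>UNIV. yv q ?s J * A_form c q J v)"
    by (simp only: sum_distrib_left mult.assoc)
  also have "(\<Sum>J\<in>UNIV. yv q ?s J * A_form c q J v) = dot ?s (S.Af q v) + dot ?s (S.kv q) * S.bh q v"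
  proof -
    have "yv q ?s (Some m) = ?s m + dot ?s (S.kv q) * hom_coords (base q) $ (Some m)" for m
      by (simp add: yv_def hom_coords_def S.XX_def)
    moreover have "yv q ?s None = dot ?s (S.kv q) * hom_coords (base q) $ None" by (simp add: yv_def hom_coords_def)
    ultimately show ?thesis
      unfolding A_form_total[symmetric] sum_option A_form_Some
      by (simp add: dot_def[of ?s "S.Af q v"] distrib_right distrib_left sum.distrib sum_distrib_left mult.assoc)
  qed
  finally have sum: "(\<Sum>I\<in>UNIV. \<Sum>J\<in>UNIV. cnj (P_mat e (base q) a I) * of_real (matrix_inv (N_mat c (base q)) $ I $ J) * A_form c q J v)
     = - 1 / (8 * S.hc q) * (dot ?s (S.Af q v) + dot ?s (S.kv q) * S.bh q v)" .
  have "alpha c e q (Some a) v = \<i> * (8 * S.hc q * S.tau q) * (- 1 / (8 * S.hc q) * (dot ?s (S.Af q v) + dot ?s (S.kv q) * S.bh q v))"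
    unfolding alpha_def option.case sum exp_kahler_pot(3)[OF q] ..
  also have "\<dots> = - \<i> * S.tau q * (dot ?s (S.Af q v) + dot ?s (S.kv q) * S.bh q v)"
    using h_pos(2)[OF q] by simp
  also have "\<dots> = dot ?s (S.af q v)"
  proof -
    have "S.af q v = (\<lambda>a. - \<i> * S.tau q * (S.Af q v a + S.kv q a * S.bh q v))" by (intro ext, rule S.af_def)
    then show ?thesis by (simp only: dot_add dot_scale dot_scale')
  qed
  finally show ?thesis by (simp add: mv_def dot_def)
qed

lemma beta_None: "q \<in> Sdom \<Longrightarrow> beta c e q None v = S.bf q v"
  unfolding beta_def option.case exp_kahler_pot(2) A_form_total S.bf_def ..

lemma beta_Some: "beta c e q (Some a) v = mv (Mf q) (S.XX v) a"
  by (simp add: beta_def mv_def Mf_def S.XX_def)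

end

context qmap_frame
begin

lemma frame_metric: "(\<Sum>i\<in>UNIV. \<Sum>j\<in>UNIV. Bf i j * fr q i u * fr q j v) =
   ((bf q u * cnj (bf q v) + dot (XX u) (Kv q (XB v)) + a0 q u * cnj (a0 q v) + dot (af q u) (aub q v))
  + (bf q v * cnj (bf q u) + dot (XX v) (Kv q (XB u)) + a0 q v * cnj (a0 q u) + dot (af q v) (aub q u))) / 2"
proof -
  have 1: "(\<Sum>\<Gamma>\<in>UNIV. f \<Gamma> * (\<Sum>\<Delta>\<in>UNIV. C_low \<Gamma> \<Delta> * g \<Delta>)) =
     f (Inl None) * g (Inr None) + (\<Sum>a\<in>UNIV. f (Inl (Some a)) * g (Inr (Some a)))
     - (f (Inr None) * g (Inl None) + (\<Sum>a\<in>UNIV. f (Inr (Some a)) * g (Inl (Some a))))" for f g :: "'n fidx \<Rightarrow> complex"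
    unfolding sum_fidx[of "\<lambda>\<Gamma>. f \<Gamma> * _ \<Gamma>"] sum_C_low by (simp add: sum_negf)
  have "(\<Sum>i\<in>UNIV. \<Sum>j\<in>UNIV. Bf i j * fr q i u * fr q j v) =
     1 / 2 * (\<Sum>\<Gamma>\<in>UNIV. E1 q \<Gamma> u * (\<Sum>\<Delta>\<in>UNIV. C_low \<Gamma> \<Delta> * E2 q \<Delta> v))
     - 1 / 2 * (\<Sum>\<Gamma>\<in>UNIV. E2 q \<Gamma> u * (\<Sum>\<Delta>\<in>UNIV. C_low \<Gamma> \<Delta> * E1 q \<Delta> v))"
    unfolding sum_pair by (simp add: Bf_def eps_def fr_def sum_distrib_left sum_negf mult_ac)
  then show ?thesis unfolding 1 by (simp add: dot_def sum_negf mult_ac add_divide_distrib diff_divide_distrib)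
qed

end

context rqmap
begin

lemma change_mv: "up v = mv (Mf p) v" "dn v = mv (tp (Rf p)) v" "bk v = mv (Rf p) v"
  by (simp_all add: fun_eq_iff up_def dn_def bk_def mv_def)

definition Gf :: "'n qpoint \<Rightarrow> 'n \<Rightarrow> 'n \<Rightarrow> real" where "Gf q a b = (\<Sum>m\<in>UNIV. Mf p a m * Rf q m b)"
definition Qmf :: "'n qpoint \<Rightarrow> 'n \<Rightarrow> 'n \<Rightarrow> complex" where "Qmf q a b = of_real (\<Sum>d\<in>UNIV. Gf q a d * Gf q b d)"

lemma Qmf_apply: "dot (Qmf q a) z = mv (Mf p) (mv (Rf q) (mv (tp (Rf q)) (mv (tp (Mf p)) z))) a"
proof -
  have 1: "mv (Mf p) (mv (Rf q) y) = mv (Gf q) y" for y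
    unfolding mv_mv Gf_def[abs_def] ..
  have 2: "mv (tp (Rf q)) (mv (tp (Mf p)) y) = mv (tp (Gf q)) y" for y
    unfolding mv_mv Gf_def[abs_def] by (simp only: mult.commute)
  show ?thesis unfolding 1 2 unfolding mv_mv by (simp add: dot_def mv_def Qmf_def)
qed

lemma C_Kv: "q \<in> Sdom \<Longrightarrow> C.Kv q z = mv (tp (Rf p)) (mv (tp (Mf q)) (mv (Mf q) (mv (Rf p) z)))"
proof -
  assume q: "q \<in> Sdom"
  have "z = up (bk z)" unfolding change_mv mv_cancel[OF p_Sdom] ..
  then have "C.Kv q z = C.Kv q (up (bk z))" by (rule arg_cong)
  then show ?thesis unfolding Kv_change Kv_frame[OF q] unfolding change_mv .
qed

lemma Kv_Qmf: "q \<in> Sdom \<Longrightarrow> C.Kv q (\<lambda>a. dot (Qmf q a) z) = z"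
  unfolding Qmf_apply C_Kv by (simp only: mv_cancel p_Sdom)

lemma Qmf_Kv: "q \<in> Sdom \<Longrightarrow> dot (Qmf q a) (C.Kv q z) = z a"
  unfolding Qmf_apply C_Kv by (simp only: mv_cancel p_Sdom)

lemma Sdom_open: "open Sdom"
proof -
  have "open {q :: 'n qpoint. fst q \<in> V \<and> fst (snd q) > 0}"
    by (intro open_Collect_conj open_Collect_less continuous_intros) (rule open_vimage[OF V_open, unfolded vimage_def], intro continuous_intros)
  then show ?thesis by (simp add: Sdom_def base_def rho_def)
qed

lemma Qmf_differentiable:
  assumes q: "q \<in> Sdom"
  shows "(\<lambda>q. Qmf q a b) differentiable (at q)"
proof -
  have "(\<lambda>q. \<chi> a. Qmf q a b) differentiable (at q)"
  proof (rule differentiable_linear_solution[where A="\<lambda>q z. \<chi> a. C.Kv q (($) z) a" and y="\<lambda>q. \<chi> a. of_bool (a = b)"])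
    show "linear (\<lambda>z. \<chi> a. C.Kv q (($) z) a)" for q
    proof (intro linearI)
      show "(\<chi> a. C.Kv q (($) (y + z)) a) = (\<chi> a. C.Kv q (($) y) a) + (\<chi> a. C.Kv q (($) z) a)" for y z
      proof -
        have "($) (y + z) = (\<lambda>a. y $ a + z $ a)" by (simp add: fun_eq_iff)
        then show ?thesis by (simp add: vec_eq_iff C.Kv_linear(1))
      qed
      show "(\<chi> a. C.Kv q (($) (r *\<^sub>R z)) a) = r *\<^sub>R (\<chi> a. C.Kv q (($) z) a)" for r z
      proof -
        have "($) (r *\<^sub>R z) = (\<lambda>a. of_real r * z $ a)" by (rule ext) (simp only: vector_scaleR_component, rule scaleR_conv_of_real)
        moreover have "r *\<^sub>R y = of_real r * y" for y :: complex by (rule scaleR_conv_of_real)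
        ultimately show ?thesis by (simp only: vec_eq_iff C.Kv_linear(4)) simp
      qed
    qed
    have h: "C.hc q \<noteq> 0" unfolding hc_change by (rule h_pos(2)[OF q])
    show "(\<lambda>q. \<chi> a. C.Kv q (($) z) a) differentiable (at q)" for z
      by (rule differentiable_vec_lambda, rule differentiableI, rule C.has_derivative_Kv[OF h], rule has_derivative_const)
    show "z = 0" if "(\<chi> a. C.Kv q (($) z) a) = 0" for z
    proof -
      have "C.Kv q (($) z) = (\<lambda>a. 0)" using that by (simp add: vec_eq_iff fun_eq_iff)
      then have "z $ a = 0" for a using Qmf_Kv[OF q, of a "($) z"] by (simp add: dot_def)
      then show ?thesis by (simp add: vec_eq_iff)
    qed
    have "(\<chi> a. C.Kv q' (($) (\<chi> a. Qmf q' a b)) a) = (\<chi> a. of_bool (a = b))" if "q' \<in> Sdom" for q'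
      using Kv_Qmf[OF that, of "\<lambda>a. of_bool (a = b)"] by (simp add: dot_delta vec_lambda_beta[abs_def])
    then show "\<forall>\<^sub>F q' in nhds q. (\<chi> a. C.Kv q' (($) (\<chi> a. Qmf q' a b)) a) = (\<chi> a. of_bool (a = b))"
      using Sdom_open q unfolding eventually_nhds by blast
  qed (rule differentiable_const)
  then obtain D where "((\<lambda>q. \<chi> a. Qmf q a b) has_derivative D) (at q)" by (auto simp: differentiable_def)
  from bounded_linear.has_derivative[OF bounded_linear_vec_nth this, of a] show ?thesis
    by (auto intro: differentiableI)
qed

lemma coords_injective:
  assumes "\<And>a. X' a v = 0" "rho v = 0" "phit v = 0" "zetat v None = 0" "zeta v None = 0" "\<And>a. Zt' a v = 0" "\<And>a. Z' a v = 0"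
  shows "v = 0"
proof -
  have 0: "mv M (\<lambda>_. 0) = (\<lambda>_. 0)" for M :: "'n \<Rightarrow> 'n \<Rightarrow> real" by (simp add: mv_def fun_eq_iff)
  have "up (S.XX v) = (\<lambda>_. 0)" "up (S.Zc v) = (\<lambda>_. 0)" "dn (S.Ztc v) = (\<lambda>_. 0)"
    unfolding coords_change[symmetric] using assms by (simp_all add: C.XX_def C.Zc_def C.Ztc_def fun_eq_iff)
  then have "bk (up (S.XX v)) = bk (\<lambda>_. 0)" "bk (up (S.Zc v)) = bk (\<lambda>_. 0)" "mv (tp (Mf p)) (dn (S.Ztc v)) = mv (tp (Mf p)) (\<lambda>_. 0)"
    by (simp_all only:)
  then have "S.XX v = (\<lambda>_. 0)" "S.Zc v = (\<lambda>_. 0)" "S.Ztc v = (\<lambda>_. 0)"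
    unfolding change_mv mv_cancel[OF p_Sdom] by (simp_all only: 0)
  then have "base v $ a = 0" "zeta v (Some a) = 0" "zetat v (Some a) = 0" for a
    by (simp_all add: S.XX_def S.Zc_def S.Ztc_def fun_eq_iff)
  then have "fst v = 0" "snd (snd (snd (snd v))) = 0" "fst (snd (snd (snd v))) = 0"
    using assms(4,5) by (simp_all add: base_def zeta_def zetat_def vec_eq_iff) (metis option.exhaust)+
  then show "v = 0" using assms(2,3) by (simp add: rho_def phit_def prod_eq_iff)
qed

end

sublocale rqmap \<subseteq> qmap_frame T' X' rho phit "\<lambda>q. zetat q None" "\<lambda>q. zeta q None" Zt' Z' Sdom Qmf
proof (rule qmap_frame.intro)
  show "qmap_chart T' X' rho phit (\<lambda>q. zetat q None) (\<lambda>q. zeta q None) Zt' Z' Sdom Qmf"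
  proof (rule qmap_chart.intro)
    show "cubic_chart T' X' rho phit (\<lambda>q. zetat q None) (\<lambda>q. zeta q None) Zt' Z'" by (rule C.cubic_chart_axioms)
    show "qmap_chart_axioms T' X' rho Sdom Qmf"
    proof (rule qmap_chart_axioms.intro)
      show "open Sdom" by (rule Sdom_open)
      show "C.vol q > 0" if "q \<in> Sdom" for q unfolding hc_change by (rule h_pos(1)[OF that])
      show "rho q > 0" if "q \<in> Sdom" for q using that by (simp add: Sdom_def)
      show "cnj (Qmf q a b) = Qmf q a b" for q a b by (simp add: Qmf_def)
      show "C.Kv q (\<lambda>a. dot (Qmf q a) z) a = z a" if "q \<in> Sdom" for q z a by (simp only: Kv_Qmf[OF that])
      show "dot (Qmf q a) (C.Kv q z) = z a" if "q \<in> Sdom" for q z a by (rule Qmf_Kv[OF that])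
      show "(\<lambda>q. Qmf q a b) differentiable (at q)" if "q \<in> Sdom" for q a b by (rule Qmf_differentiable[OF that])
    qed
  qed
  show "qmap_frame_axioms X' rho phit (\<lambda>q. zetat q None) (\<lambda>q. zeta q None) Zt' Z'"
  proof (rule qmap_frame_axioms.intro)
    show "v = 0" if "\<And>a. X' a v = 0" "rho v = 0" "phit v = 0" "zetat v None = 0" "zeta v None = 0" "\<And>a. Zt' a v = 0" "\<And>a. Z' a v = 0" for v
      by (rule coords_injective) (rule that)+
    show "DIM('n qpoint) = DIM(complex ^ 'n fidx)" by simp
  qed
qed

context rqmap
begin

lemma alpha_None: "alpha c e q None v = a0 q v"
proof -
  have "Ps q v = of_real (phit v + (\<Sum>I\<in>UNIV. zeta q I * zetat v I - zetat q I * zeta v I))"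
    unfolding Ps_def coords_change dot_dn_up sum_option
    by (simp add: S.Zc_def S.Ztc_def dot_def sum_subtractf)
  moreover have "complex_of_real (1 / (2 * rho q)) = inverse (2 * of_real (rho q))"
    by (simp add: inverse_eq_divide)
  ultimately show ?thesis
    unfolding alpha_def option.case a0_def C.rr_def by (simp only: mult_minus_left)
qed

lemma aub_mv: "q \<in> Sdom \<Longrightarrow> aub q v = up (mv (Rf q) (mv (tp (Rf q)) (\<lambda>a. cnj (S.af q v a))))"
proof -
  assume q: "q \<in> Sdom"
  have "aup q v a = mv (Mf p) (mv (Rf q) (mv (tp (Rf q)) (S.af q v))) a" for a
    unfolding aup_def Qv_def Qmf_apply af_change change_mv mv_cancel[OF p_Sdom] ..
  then have aub: "aub q v a = mv (Mf p) (mv (Rf q) (mv (tp (Rf q)) (\<lambda>a. cnj (S.af q v a)))) a" for a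
    unfolding aub_def by (simp only: cnj_mv)
  show ?thesis unfolding change_mv by (rule ext) (rule aub)
qed

lemma metric_g_FS:
  assumes q: "q \<in> Sdom"
  shows "of_real (g_FS c e q u v) = (\<Sum>i\<in>UNIV. \<Sum>j\<in>UNIV. Bf i j * fr q i u * fr q j v)"
proof -
  define W where "W u v = C.bf q u * cnj (C.bf q v) + dot (C.XX u) (C.Kv q (C.XB v)) + a0 q u * cnj (a0 q v) + dot (C.af q u) (aub q v)" for u v
  have b: "(\<Sum>a\<in>UNIV. beta c e q (Some a) u * cnj (beta c e q (Some a) v)) = dot (C.XX u) (C.Kv q (C.XB v))" for u v
  proof -
    have "dot (C.XX u) (C.Kv q (C.XB v)) = dot (S.XX u) (mv (tp (Mf q)) (mv (Mf q) (S.XB v)))"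
      unfolding coords_change Kv_change dot_dn_up Kv_frame[OF q] ..
    also have "\<dots> = dot (mv (Mf q) (S.XX u)) (mv (Mf q) (S.XB v))" by (rule dot_mv[symmetric])
    finally show ?thesis by (simp add: beta_Some cnj_mv dot_def)
  qed
  have a: "(\<Sum>a\<in>UNIV. alpha c e q (Some a) u * cnj (alpha c e q (Some a) v)) = dot (C.af q u) (aub q v)" for u v
  proof -
    have "dot (C.af q u) (aub q v) = dot (S.af q u) (mv (Rf q) (mv (tp (Rf q)) (\<lambda>a. cnj (S.af q v a))))"
      unfolding aub_mv[OF q] af_change dot_dn_up ..
    also have "\<dots> = dot (mv (tp (Rf q)) (S.af q u)) (mv (tp (Rf q)) (\<lambda>a. cnj (S.af q v a)))"
      using dot_mv[of "tp (Rf q)" "S.af q u"] by simp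
    finally show ?thesis by (simp add: alpha_Some[OF q] cnj_mv dot_def)
  qed
  have W: "W u v = (\<Sum>A\<in>UNIV. beta c e q A u * cnj (beta c e q A v)) + (\<Sum>A\<in>UNIV. alpha c e q A u * cnj (alpha c e q A v))" for u v
    unfolding sum_option b a W_def by (simp add: beta_None[OF q] alpha_None bf_change)
  have cW: "cnj (W u v) = W v u" for u v
    unfolding W by (simp add: mult.commute)
  have "(\<Sum>A\<in>UNIV. sym_prod (beta c e q A) (\<lambda>y. cnj (beta c e q A y)) u v + sym_prod (alpha c e q A) (\<lambda>y. cnj (alpha c e q A y)) u v)
     = (W u v + W v u) / 2"
    unfolding W sym_prod_def sum_divide_distrib[symmetric] sum.distrib[symmetric] add_divide_distrib[symmetric]
    by (simp only: add_ac mult.commute[of "cnj _"])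
  moreover have "of_real (Re ((W u v + W v u) / 2)) = (W u v + W v u) / 2"
    by (rule of_real_Re) (simp add: Reals_cnj_iff cW add.commute)
  ultimately show ?thesis
    unfolding g_FS_def frame_metric by (simp only: W_def)
qed

lemma Kv_identity: "C.Kv p z a = z a"
  unfolding C_Kv[OF p_Sdom] by (simp only: mv_cancel p_Sdom)

end

sublocale rqmap \<subseteq> qmap_point T' X' rho phit "\<lambda>q. zetat q None" "\<lambda>q. zeta q None" Zt' Z' Sdom Qmf "g_FS c e" p
proof (rule qmap_point.intro, rule qmap_frame_axioms, rule qmap_point_axioms.intro)
  show "p \<in> Sdom" by (rule p_Sdom)
  show "C.Kv p z a = z a" for z a by (rule Kv_identity)
  show "of_real (g_FS c e q u v) = (\<Sum>i\<in>UNIV. \<Sum>j\<in>UNIV. Bf i j * fr q i u * fr q j v)" if "q \<in> Sdom" for q u v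
    by (rule metric_g_FS[OF that])
qed

context rqmap
begin

lemma coframe_fr: "coframe c e p \<alpha> \<Gamma> = fr p (\<alpha>, \<Gamma>)"
proof
  fix v
  have b: "beta c e p (Some a) v = C.XX v a" for a unfolding beta_Some coords_change change_mv ..
  have a: "alpha c e p (Some a) v = C.af p v a" for a unfolding alpha_Some[OF p_Sdom] af_change change_mv ..
  have 1: "coframe c e p 1 \<Gamma> v = E1 p \<Gamma> v" for \<Gamma>
    by (cases \<Gamma>; rename_tac A; case_tac A) (simp_all add: coframe_def b a beta_None[OF p_Sdom] alpha_None bf_change)
  have 2: "coframe c e p 2 \<Gamma> v = E2 p \<Gamma> v" for \<Gamma>
    by (cases \<Gamma>; rename_tac A; case_tac A) (simp_all add: coframe_def b a beta_None[OF p_Sdom] alpha_None bf_change aup_p Kv_p del: cnj_aub)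
  show "coframe c e p \<alpha> \<Gamma> v = fr p (\<alpha>, \<Gamma>) v"
    using two_cases[of \<alpha>] 1 2 by (auto simp: fr_def)
qed

lemma is_quartic_tensor_iff: "is_quartic_tensor c e p W \<longleftrightarrow> W = Om"
proof -
  have d: "dual_frame c e p \<beta> \<Delta> = The (duals \<beta> \<Delta>)" for \<beta> \<Delta>
    unfolding dual_frame_def duals_def[abs_def] coframe_fr ..
  show ?thesis
    unfolding is_quartic_tensor_def d coframe_fr FE_formula quartic_iff[symmetric] quartic_def ..
qed

text \<open>Evaluation of the listed components.\<close>

lemma T'_h3: "T' a b d = h3 c e (base p) a b d"
proof -
  have "csym c s l m = csym c m l s" for m l s
    by (rule trans[OF csym_sym(1) trans[OF csym_sym(2) csym_sym(1)]])
  then show ?thesis unfolding T'_def h3_def partial3_cubic Rf_def by simp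
qed

lemma exp_h3: "of_real (exp (kahler_pot c (base p)) * h3 c e (base p) a b d) = te (delta b) (delta d) a"
proof -
  have "TT T' (delta b) (delta d) a = (\<Sum>x\<in>UNIV. of_bool (x = b) * (\<Sum>y\<in>UNIV. of_bool (y = d) * of_real (T' a x y)))"
    unfolding TT_def sum_distrib_left by (simp only: mult_ac)
  then have "TT T' (delta b) (delta d) a = of_real (T' a b d)" by simp
  then show ?thesis
    unfolding te_def T'_h3 exp_kahler_pot(1)[OF p_Sdom] hc_change S.hc_vol by simp
qed

lemma exp_h3_last: "of_real (exp (kahler_pot c (base p)) * h3 c e (base p) a b d) = te (delta a) (delta b) d"
  unfolding exp_h3 te_sym[of "delta b" "delta d"] by (rule te_delta)

lemma exp_h1: "of_real (exp (kahler_pot c (base p)) * h1 c e (base p) a) = C.xc p a / 2"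
proof -
  have "of_real (h1 c e (base p) a) = C.hd p a"
    unfolding hc_change(4) by (simp add: h1_def dn_def Rf_def S.hd_partial)
  then have "of_real (h1 c e (base p) a) = 4 * C.hc p * C.xc p a"
    unfolding hd_p .
  then show ?thesis
    using h_pos(1)[OF p_Sdom] unfolding of_real_mult exp_kahler_pot(1)[OF p_Sdom] hc_change S.hc_vol by simp
qed

lemma exp_h2: "of_real (exp (kahler_pot c (base p)) * h2 c e (base p) a b) = mm (delta a) (delta b)"
proof -
  have bk: "bk (delta b) = (\<lambda>m. of_real (Rf p m b))" by (simp add: bk_def fun_eq_iff)
  have "TT T' (C.xc p) (delta b) a = of_real (h2 c e (base p) a b)"
    unfolding TT_change coords_change bk_up bk dn_def S.tt_x_partial2
    by (simp add: h2_def Rf_def sum_distrib_left mult_ac)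
  then have "of_real (exp (kahler_pot c (base p)) * h2 c e (base p) a b) = te (C.xc p) (delta b) a"
    unfolding te_def exp_kahler_pot(1)[OF p_Sdom] hc_change S.hc_vol by simp
  also have "\<dots> = dot (delta a) (te (C.xc p) (delta b))" by (simp add: dot_delta)
  finally show ?thesis unfolding dot_te_x mm_def .
qed

lemma exp_square: "exp (2 * kahler_pot c (base p)) * (x * y) = (exp (kahler_pot c (base p)) * x) * (exp (kahler_pot c (base p)) * y)"
  by (simp add: exp_double power2_eq_square)

lemma exp_h3_h3: "of_real (exp (2 * kahler_pot c (base p)) * (\<Sum>f\<in>UNIV. h3 c e (base p) a b f * h3 c e (base p) f k d))
   = dot (te (delta a) (delta b)) (te (delta k) (delta d))"
  unfolding sum_distrib_left exp_square of_real_sum dot_def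
  by (simp only: of_real_mult[of "exp _ * _" "exp _ * _"] exp_h3_last[of a b] exp_h3[of _ k d])

lemma S_tensor_SS: "of_real (S_tensor c e (base p) a b k d) = SS (delta a) (delta b) (delta k) (delta d)"
proof -
  let ?k = "exp (kahler_pot c (base p))"
  let ?h1 = "h1 c e (base p)" and ?h2 = "h2 c e (base p)" and ?h3 = "h3 c e (base p)"
  have k2: "exp (2 * kahler_pot c (base p)) = ?k * ?k" by (simp add: exp_double power2_eq_square)
  define F where "F b k a d = exp (2 * kahler_pot c (base p)) * (\<Sum>f\<in>UNIV. ?h3 b k f * ?h3 f a d)" for b k a d
  have "S_tensor c e (base p) a b k d = - (1 / 2) * (
       (F b k a d - 4 * (?k * ?h2 b k) * (?k * ?h2 a d)) + (F a k b d - 4 * (?k * ?h2 a k) * (?k * ?h2 b d))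
     + (F a b k d - 4 * (?k * ?h2 a b) * (?k * ?h2 k d))
     + 4 * ((?k * ?h1 a) * (?k * ?h3 b k d)) + 4 * ((?k * ?h1 b) * (?k * ?h3 k d a))
     + 4 * ((?k * ?h1 k) * (?k * ?h3 d a b)) + 4 * ((?k * ?h1 d) * (?k * ?h3 a b k)))"
    unfolding S_tensor_def F_def k2 by (simp add: algebra_simps)
  moreover have "of_real (F b k a d) = dot (te (delta b) (delta k)) (te (delta a) (delta d))" for b k a d
    unfolding F_def by (rule exp_h3_h3)
  moreover have "complex_of_real (- (1 / 2) * (
       (f1 - 4 * m1 * m2) + (f2 - 4 * m3 * m4) + (f3 - 4 * m5 * m6) + 4 * (x1 * t1) + 4 * (x2 * t2) + 4 * (x3 * t3) + 4 * (x4 * t4)))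
     = - (1 / 2) * ((of_real f1 - 4 * of_real m1 * of_real m2) + (of_real f2 - 4 * of_real m3 * of_real m4) + (of_real f3 - 4 * of_real m5 * of_real m6)
       + 4 * (of_real x1 * of_real t1) + 4 * (of_real x2 * of_real t2) + 4 * (of_real x3 * of_real t3) + 4 * (of_real x4 * of_real t4))"
    for f1 f2 f3 m1 m2 m3 m4 m5 m6 x1 x2 x3 x4 t1 t2 t3 t4 by simp
  ultimately have "of_real (S_tensor c e (base p) a b k d) = - (1 / 2) * (
       (dot (te (delta b) (delta k)) (te (delta a) (delta d)) - 4 * mm (delta b) (delta k) * mm (delta a) (delta d))
     + (dot (te (delta a) (delta k)) (te (delta b) (delta d)) - 4 * mm (delta a) (delta k) * mm (delta b) (delta d))
     + (dot (te (delta a) (delta b)) (te (delta k) (delta d)) - 4 * mm (delta a) (delta b) * mm (delta k) (delta d))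
     + 4 * (C.xc p a / 2 * te (delta k) (delta d) b) + 4 * (C.xc p b / 2 * te (delta d) (delta a) k)
     + 4 * (C.xc p k / 2 * te (delta a) (delta b) d) + 4 * (C.xc p d / 2 * te (delta b) (delta k) a))"
    by (simp only: exp_h1 exp_h2 exp_h3)
  then show ?thesis
    unfolding SS_def by (simp add: dot_delta)
qed

lemma Om_listed: "{#\<Gamma>, \<Delta>, \<Lambda>, \<Xi>#} \<notin> listed_indices \<Longrightarrow> Om \<Gamma> \<Delta> \<Lambda> \<Xi> = 0"
proof -
  have L: "{#Inl None, Inl None, Inr None, Inr None#} \<in> listed_indices" "{#Inl None, Inl (Some b), Inr None, Inr (Some d)#} \<in> listed_indices"
    "{#Inl (Some a), Inl (Some b), Inr (Some k), Inr (Some d)#} \<in> listed_indices"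
    "{#Inr None, Inl (Some b), Inl (Some k), Inl (Some d)#} \<in> listed_indices"
    "{#Inl None, Inr (Some b), Inr (Some k), Inr (Some d)#} \<in> listed_indices"
    "{#Inl (Some a), Inl (Some b), Inl (Some k), Inl (Some d)#} \<in> listed_indices"
    "{#Inr (Some a), Inr (Some b), Inr (Some k), Inr (Some d)#} \<in> listed_indices" for a b k d
    unfolding listed_indices_def by blast+
  have S1: "{#Inl A, Inl B, Inl C, Inl D#} \<notin> listed_indices \<Longrightarrow> oS A B C D = 0" for A B C D
    by (cases A; cases B; cases C; cases D) (simp_all add: L)
  have S2: "{#Inr A, Inr B, Inr C, Inr D#} \<notin> listed_indices \<Longrightarrow> oS A B C D = 0" for A B C D
    by (cases A; cases B; cases C; cases D) (simp_all add: L)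
  have T1: "{#Inr D, Inl A, Inl B, Inl C#} \<notin> listed_indices \<Longrightarrow> oT A B C D = 0" for A B C D
    by (cases A; cases B; cases C; cases D) (simp_all add: L)
  have T2: "{#Inl D, Inr A, Inr B, Inr C#} \<notin> listed_indices \<Longrightarrow> oT A B C D = 0" for A B C D
    by (cases A; cases B; cases C; cases D) (simp_all add: L)
  have L': "{#Inl (Some b), Inl None, Inr None, Inr (Some d)#} \<in> listed_indices" "{#Inl None, Inl (Some b), Inr (Some d), Inr None#} \<in> listed_indices"
    "{#Inl (Some b), Inl None, Inr (Some d), Inr None#} \<in> listed_indices" for b d
    using L(2)[of b d] by (simp_all only: add_mset_commute[of "Inl (Some b)" "Inl None"] add_mset_commute[of "Inr (Some d)" "Inr None"])
  have U: "{#Inl A, Inl B, Inr C, Inr D#} \<notin> listed_indices \<Longrightarrow> oU A B C D = 0" for A B C D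
    by (cases A; cases B; cases C; cases D) (simp_all add: oU_def L L')
  have S: "{#Inl A, Inl B, Inl C, Inl D#} \<notin> listed_indices \<or> {#Inr A, Inr B, Inr C, Inr D#} \<notin> listed_indices \<Longrightarrow> oS A B C D = 0"
    and T: "{#Inr D, Inl A, Inl B, Inl C#} \<notin> listed_indices \<or> {#Inl D, Inr A, Inr B, Inr C#} \<notin> listed_indices \<Longrightarrow> oT A B C D = 0" for A B C D
    using S1 S2 T1 T2 by blast+
  assume notin: "{#\<Gamma>, \<Delta>, \<Lambda>, \<Xi>#} \<notin> listed_indices"
  show ?thesis
    apply (insert notin)
    apply (cases \<Gamma>; cases \<Delta>; cases \<Lambda>; cases \<Xi>; hypsubst; unfold Om.simps)
    apply (rule S T U; simp only: add_mset_commute simp_thms)+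
    done
qed

end

theorem theorem20:
  fixes c :: "'n::finite \<Rightarrow> 'n \<Rightarrow> 'n \<Rightarrow> real"
    and H :: "(real ^ 'n) set"
    and V :: "(complex ^ 'n) set"
    and e :: "complex ^ 'n \<Rightarrow> real ^ 'n ^ 'n"
    and p :: "'n qpoint"
  assumes "projective_special_real c H"
    and "local_frame c H V e"
    and "p \<in> qmap_domain H" and "base p \<in> V"
  shows "(\<exists>!\<Omega>. is_quartic_tensor c e p \<Omega>) \<and>
    (\<forall>\<Omega>. is_quartic_tensor c e p \<Omega> \<longrightarrow>
       symmetric4 \<Omega> \<and>
       \<Omega> un0 un0 ti0 ti0 = 1 / 2 \<and>
       (\<forall>b d. \<Omega> un0 (un b) ti0 (ti d) = 1 / 4 * of_bool (b = d)) \<and>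
       (\<forall>a b k d. \<Omega> (un a) (un b) (ti k) (ti d) =
          1 / 4 * (of_bool (a = k) * of_bool (b = d) + of_bool (a = d) * of_bool (b = k))
          - 1 / 2 * of_real (exp (2 * kahler_pot c (base p)) *
              (\<Sum>f\<in>UNIV. h3 c e (base p) a b f * h3 c e (base p) f k d))) \<and>
       (\<forall>b k d. \<Omega> ti0 (un b) (un k) (un d) =
          - (\<i> / 2) * of_real (exp (kahler_pot c (base p)) * h3 c e (base p) b k d)) \<and>
       (\<forall>b k d. \<Omega> un0 (ti b) (ti k) (ti d) =
          - (\<i> / 2) * of_real (exp (kahler_pot c (base p)) * h3 c e (base p) b k d)) \<and>
       (\<forall>a b k d. \<Omega> (un a) (un b) (un k) (un d) = of_real (S_tensor c e (base p) a b k d)) \<and>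
       (\<forall>a b k d. \<Omega> (ti a) (ti b) (ti k) (ti d) = of_real (S_tensor c e (base p) a b k d)) \<and>
       (\<forall>\<Gamma> \<Delta> \<Lambda> \<Xi>. {#\<Gamma>, \<Delta>, \<Lambda>, \<Xi>#} \<notin> listed_indices \<longrightarrow> \<Omega> \<Gamma> \<Delta> \<Lambda> \<Xi> = 0))"
proof -
  have "open V" "V \<subseteq> rmap_domain H" and frame: "\<And>X. X \<in> V \<Longrightarrow> invertible (e X) \<and>
      (\<forall>l m. of_real (\<Sum>a\<in>UNIV. e X $ a $ l * e X $ a $ m) = kahler_metric c l m X)"
    using assms(2) unfolding local_frame_def by blast+
  interpret rqmap c V e p
  proof
    show "open V" "base p \<in> V" by fact+
    show "cubic c (im_vec X) > 0" if "X \<in> V" for X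
      using that \<open>V \<subseteq> rmap_domain H\<close> cubic_cone_pos[OF assms(1)] by (auto simp: rmap_domain_def)
    show "invertible (e X)" if "X \<in> V" for X using frame[OF that] by blast
    show "of_real (\<Sum>a\<in>UNIV. e X $ a $ l * e X $ a $ m) = kahler_metric c l m X" if "X \<in> V" for X l m
      using frame[OF that] by blast
    show "rho p > 0" using assms(3) by (simp add: qmap_domain_def)
  qed
  have le: "- (\<i> / 2) * of_real (exp (kahler_pot c (base p)) * h3 c e (base p) b k d)
      = - \<i> / 2 * dot (delta b) (te (delta k) (delta d))" for b k d
    unfolding exp_h3 dot_delta by simp
  have components: "symmetric4 Om" "Om un0 un0 ti0 ti0 = 1 / 2"
    "Om un0 (un b) ti0 (ti d) = 1 / 4 * of_bool (b = d)"
    "Om (un a) (un b) (ti k) (ti d) =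
          1 / 4 * (of_bool (a = k) * of_bool (b = d) + of_bool (a = d) * of_bool (b = k))
          - 1 / 2 * of_real (exp (2 * kahler_pot c (base p)) *
              (\<Sum>f\<in>UNIV. h3 c e (base p) a b f * h3 c e (base p) f k d))"
    "Om ti0 (un b) (un k) (un d) = - (\<i> / 2) * of_real (exp (kahler_pot c (base p)) * h3 c e (base p) b k d)"
    "Om un0 (ti b) (ti k) (ti d) = - (\<i> / 2) * of_real (exp (kahler_pot c (base p)) * h3 c e (base p) b k d)"
    "Om (un a) (un b) (un k) (un d) = of_real (S_tensor c e (base p) a b k d)"
    "Om (ti a) (ti b) (ti k) (ti d) = of_real (S_tensor c e (base p) a b k d)"
    for a b k d
    unfolding exp_h3_h3 S_tensor_SS le by (rule Om_symmetric4) (simp_all add: oU_def)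
  show ?thesis
    unfolding is_quartic_tensor_iff
  proof (rule conjI, blast, intro allI impI, elim ssubst, intro conjI allI impI)
  qed (rule components Om_listed, assumption?)+
qed

end
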